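(* Assume that the Cauchy problem for $u_t+(f(u))_x-(\mathcal{M}u)_x=0$ is globally well-posed in $H^s_{per}([0,L])$ for some $s\ge\frac m2$. Suppose: $(H_3)$ there is an open set $\mathcal{O}\subset\mathbb{R}^2$ such that $(\omega,A)\in\mathcal{O}\mapsto\phi_{(\omega,A)}\in C^\infty_{per}([0,L])$ is a smooth surface of $L$-periodic functions, with fixed period $L>0$, solving $\mathcal{M}\phi+\omega\phi-f(\phi)+A=0$, and for every $(\omega,A)\in\mathcal{O}$, with $\phi=\phi_{(\omega,A)}$, the operator $\mathcal{L}=\mathcal{M}+\omega-f'(\phi)$ has only one negative eigenvalue, which is simple, and zero is a simple eigenvalue with eigenfunction $\phi'$; $(H_1)$ for $\phi=\phi_{(\omega,A)}$ there are constants $c_1,c_2>0$ such that $(\mathcal{L}v,v)\ge c_1\|v\|_{\frac m2}^2-c_2\|v\|^2$ for all $v\in C^\infty_{per}([0,L])$. Let $$\Delta(x,y)=x^2M_A(\phi)+xy\,(M_\omega(\phi)+F_A(\phi))+y^2F_\omega(\phi),\qquad (x,y)\in\mathbb{R}^2.$$ Then the periodic wave $\phi=\phi_{(\omega,A)}$ is orbitally stable in $H^{\frac m2}_{per}([0,L])$ provided that there is $(a,b)\in\mathbb{R}^2$ with $\Delta(a,b)>0$. In particular, $\phi$ is orbitally stable if at least one of the following holds: (i) $M_A(\phi)=-(\mathcal{L}^{-1}1,1)>0$; (ii) $F_\omega(\phi)=-(\mathcal{L}^{-1}\phi,\phi)>0$; (iii) $M_\omega(\phi)^2-F_\omega(\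phi)M_A(\phi)=(\mathcal{L}^{-1}\phi,1)^2-(\mathcal{L}^{-1}\phi,\phi)(\mathcal{L}^{-1}1,1)>0$.
   Context: All functions are real-valued and $L$-periodic, $L>0$. $H^s_{per}([0,L])$ is the usual periodic Sobolev space with norm $\|\cdot\|_s$; $\|\cdot\|=\|\cdot\|_0$ and $(\cdot,\cdot)$ are the norm and inner product of $L^2_{per}([0,L])$. $f:\mathbb{R}\to\mathbb{R}$ is smooth. $\mathcal{M}$ is the Fourier multiplier $\widehat{\mathcal{M}g}(\kappa)=\theta(\kappa)\widehat g(\kappa)$, $\kappa\in\mathbb{Z}$, where $\theta:\mathbb{R}\to\mathbb{R}$ is even and continuous and there are $m>0$, $\upsilon_1,\upsilon_2>0$ and $\kappa_0$ with $\upsilon_1|\kappa|^m\le\theta(\kappa)\le\upsilon_2|\kappa|^m$ for $|\kappa|\ge\kappa_0$. $\mathcal{L}$ is regarded as a self-adjoint operator on $L^2_{per}([0,L])$ with domain $H^m_{per}([0,L])$. Since $\ker\mathcal{L}=[\phi']$, $\mathcal{L}$ is invertible on $[\phi']^\perp$ (the $L^2$-orthogonal complement), which contains $1$ and $\phi$; $\mathcal{L}^{-1}$ denotes this inverse. Notation, for $\phi=\phi_{(\omega,A)}$: $M_\omega(\phi)=\int_0^L\frac{\partial}{\partial\omega}\phi_{(\omega,A)}\,dx$, $M_A(\phi)=\int_0^L\frac{\partial}{\partial A}\phi_{(\omega,A)}\,dx$, $F_\omega(\phi)=\frac12\int_0^L\frac{\partial}{\partial\omega}(\phi_{(\omega,A)}^2)\,dx$,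 $F_A(\phi)=\frac12\int_0^L\frac{\partial}{\partial A}(\phi_{(\omega,A)}^2)\,dx$. Standing assumption: the functionals $P(u)=\frac12\int_0^L u\mathcal{M}u\,dx-\int_0^L W(u)\,dx$ (with $W'=f$), $F(u)=\frac12\int_0^L u^2dx$ and $M(u)=\int_0^L u\,dx$ are well defined and smooth on $H^{\frac m2}_{per}([0,L])$ and are conserved by the solutions of the equation. Global well-posedness in $H^s_{per}$ means in particular that each initial datum $u_0\in H^s_{per}([0,L])$ yields a unique solution $u(t)$ defined for all $t\ge0$ and continuous in time with values in $H^s_{per}([0,L])$. Orbital stability. Let $\Omega_\phi=\{\phi(\cdot+r): r\in\mathbb{R}\}$ and $d(v,\Omega_\phi)=\inf_{r\in\mathbb{R}}\|v-\phi(\cdot+r)\|_{\frac m2}$. The wave $\phi$ is orbitally stable in $H^{\frac m2}_{per}([0,L])$ if for every $\varepsilon>0$ there is $\delta>0$ such that whenever $u_0\in H^s_{per}([0,L])$ (with $s\ge\frac m2$ the index for which global well-posedness is assumed) satisfies $\|u_0-\phi\|_{\frac m2}<\delta$, the solution $u(t)$ with initial condition $u_0$ exists for all $t\ge0$ and satisfies $d(u(t),\Omega_\phi)<\varepsilon$ for all $t\ge0$. *)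

theory Defs
  imports "HOL-Analysis.Analysis"
begin

section \<open>Smooth functions\<close>

text \<open>Only used for open \<open>S\<close>; on a finite-dimensional domain this is the usual notion of \<open>C^k\<close>.\<close>

primrec Ck_on :: "nat \<Rightarrow> 'a::real_normed_vector set \<Rightarrow> ('a \<Rightarrow> 'b::real_normed_vector) \<Rightarrow> bool" where
  "Ck_on 0 S f \<longleftrightarrow> continuous_on S f"
| "Ck_on (Suc k) S f \<longleftrightarrow>
     (\<forall>x\<in>S. f differentiable (at x)) \<and> (\<forall>v. Ck_on k S (\<lambda>x. frechet_derivative f (at x) v))"

definition smooth_on :: "'a::real_normed_vector set \<Rightarrow> ('a \<Rightarrow> 'b::real_normed_vector) \<Rightarrow> bool" where
  "smooth_on S f \<longleftrightarrow> (\<forall>k. Ck_on k S f)"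

definition periodic :: "real \<Rightarrow> (real \<Rightarrow> real) \<Rightarrow> bool" where
  "periodic L g \<longleftrightarrow> (\<forall>x. g (x + L) = g x)"

definition smooth_per :: "real \<Rightarrow> (real \<Rightarrow> real) set" where
  "smooth_per L = {g. smooth_on UNIV g \<and> periodic L g}"


section \<open>Periodic Sobolev spaces\<close>

text \<open>Elements of the spaces below are Borel functions and not equivalence classes, so equality
  of two elements is always stated as equality almost everywhere.\<close>

definition L2_per :: "real \<Rightarrow> (real \<Rightarrow> real) set" where
  "L2_per L = {g. g \<in> borel_measurable borel \<and> periodic L g \<and>
                  set_integrable lborel {0..L} (\<lambda>x. (g x)\<^sup>2)}"

definition inner_per :: "real \<Rightarrow> (real \<Rightarrow> real) \<Rightarrow> (real \<Rightarrow> real) \<Rightarrow> real" where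
  "inner_per L g h = (LINT x:{0..L}|lborel. g x * h x)"

definition fourier_coeff :: "real \<Rightarrow> (real \<Rightarrow> real) \<Rightarrow> int \<Rightarrow> complex" where
  "fourier_coeff L g \<kappa> =
     (1 / complex_of_real L) *
     (LINT x:{0..L}|lborel. complex_of_real (g x) * cis (- 2 * pi * of_int \<kappa> * x / L))"

text \<open>Used for \<open>s \<ge> 0\<close> only, where \<open>H\<^sup>s\<close> is a subspace of \<open>L\<^sup>2\<close>. With the factor \<open>L\<close>, the norm
  with index 0 is the \<open>L\<^sup>2\<close> norm (Parseval).\<close>

definition sobolev_per :: "real \<Rightarrow> real \<Rightarrow> (real \<Rightarrow> real) set" where
  "sobolev_per L s = {g \<in> L2_per L.
     (\<lambda>\<kappa>::int. (1 + (of_int \<kappa>)\<^sup>2) powr s * (cmod (fourier_coeff L g \<kappa>))\<^sup>2) summable_on UNIV}"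

definition sobolev_norm :: "real \<Rightarrow> real \<Rightarrow> (real \<Rightarrow> real) \<Rightarrow> real" where
  "sobolev_norm L s g =
     sqrt (L * (\<Sum>\<^sub>\<infinity>\<kappa>::int. (1 + (of_int \<kappa>)\<^sup>2) powr s * (cmod (fourier_coeff L g \<kappa>))\<^sup>2))"


section \<open>The Fourier multiplier and the linearized operator\<close>

definition symbol_cond :: "(real \<Rightarrow> real) \<Rightarrow> real \<Rightarrow> bool" where
  "symbol_cond \<theta> m \<longleftrightarrow>
     (\<forall>\<kappa>. \<theta> (- \<kappa>) = \<theta> \<kappa>) \<and> continuous_on UNIV \<theta> \<and> m > 0 \<and>
     (\<exists>\<upsilon>\<^sub>1 \<upsilon>\<^sub>2 \<kappa>\<^sub>0. \<upsilon>\<^sub>1 > 0 \<and> \<upsilon>\<^sub>2 > 0 \<and>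
        (\<forall>\<kappa>. \<bar>\<kappa>\<bar> \<ge> \<kappa>\<^sub>0 \<longrightarrow> \<upsilon>\<^sub>1 * \<bar>\<kappa>\<bar> powr m \<le> \<theta> \<kappa> \<and> \<theta> \<kappa> \<le> \<upsilon>\<^sub>2 * \<bar>\<kappa>\<bar> powr m))"

text \<open>The multiplier on its \<open>L\<^sup>2\<close> domain \<open>H\<^sup>m\<close>. There the chosen function exists and is unique
  up to a null set; outside that domain the value is meaningless.\<close>

definition mult_op :: "real \<Rightarrow> (real \<Rightarrow> real) \<Rightarrow> (real \<Rightarrow> real) \<Rightarrow> (real \<Rightarrow> real)" where
  "mult_op L \<theta> g = (SOME w. w \<in> L2_per L \<and>
     (\<forall>\<kappa>::int. fourier_coeff L w \<kappa> = complex_of_real (\<theta> (of_int \<kappa>)) * fourier_coeff L g \<kappa>))"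

text \<open>For \<open>u\<close> in the form domain \<open>H\<^bsup>m/2\<^esup>\<close> the integral of \<open>u M u\<close> is the duality pairing between
  \<open>H\<^bsup>m/2\<^esup>\<close> and \<open>H\<^bsup>-m/2\<^esup>\<close>; for \<open>u\<close> in \<open>H\<^sup>m\<close> it is \<open>inner_per L u (mult_op L \<theta> u)\<close>.\<close>

definition mult_form :: "real \<Rightarrow> (real \<Rightarrow> real) \<Rightarrow> (real \<Rightarrow> real) \<Rightarrow> real" where
  "mult_form L \<theta> u =
     L * (\<Sum>\<^sub>\<infinity>\<kappa>::int. \<theta> (of_int \<kappa>) * (cmod (fourier_coeff L u \<kappa>))\<^sup>2)"

definition lin_op ::
  "real \<Rightarrow> (real \<Rightarrow> real) \<Rightarrow> (real \<Rightarrow> real) \<Rightarrow> real \<Rightarrow> (real \<Rightarrow> real) \<Rightarrow> (real \<Rightarrow> real) \<Rightarrow> (real \<Rightarrow> real)" where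
  "lin_op L \<theta> f \<omega> \<phi> v = (\<lambda>x. mult_op L \<theta> v x + \<omega> * v x - deriv f (\<phi> x) * v x)"

definition wave_eq ::
  "real \<Rightarrow> (real \<Rightarrow> real) \<Rightarrow> (real \<Rightarrow> real) \<Rightarrow> real \<Rightarrow> real \<Rightarrow> (real \<Rightarrow> real) \<Rightarrow> bool" where
  "wave_eq L \<theta> f \<omega> A \<phi> \<longleftrightarrow>
     (AE x in lborel. mult_op L \<theta> \<phi> x + \<omega> * \<phi> x - f (\<phi> x) + A = 0)"

text \<open>Eigenvalues of an operator \<open>T\<close> on \<open>L\<^sup>2\<close> with domain \<open>H\<^sup>m\<close>. Simplicity is stated
  geometrically; for self-adjoint \<open>T\<close> geometric and algebraic multiplicity agree.\<close>

definition eigenspace ::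
  "real \<Rightarrow> real \<Rightarrow> ((real \<Rightarrow> real) \<Rightarrow> (real \<Rightarrow> real)) \<Rightarrow> real \<Rightarrow> (real \<Rightarrow> real) set" where
  "eigenspace L m T l = {v \<in> sobolev_per L m. AE x in lborel. T v x = l * v x}"

definition eigenfunction ::
  "real \<Rightarrow> real \<Rightarrow> ((real \<Rightarrow> real) \<Rightarrow> (real \<Rightarrow> real)) \<Rightarrow> real \<Rightarrow> (real \<Rightarrow> real) \<Rightarrow> bool" where
  "eigenfunction L m T l v \<longleftrightarrow> v \<in> eigenspace L m T l \<and> \<not> (AE x in lborel. v x = 0)"

definition eigenvalue ::
  "real \<Rightarrow> real \<Rightarrow> ((real \<Rightarrow> real) \<Rightarrow> (real \<Rightarrow> real)) \<Rightarrow> real \<Rightarrow> bool" where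
  "eigenvalue L m T l \<longleftrightarrow> (\<exists>v. eigenfunction L m T l v)"

definition simple_eigenvalue ::
  "real \<Rightarrow> real \<Rightarrow> ((real \<Rightarrow> real) \<Rightarrow> (real \<Rightarrow> real)) \<Rightarrow> real \<Rightarrow> bool" where
  "simple_eigenvalue L m T l \<longleftrightarrow>
     (\<exists>v. eigenfunction L m T l v \<and>
          (\<forall>w\<in>eigenspace L m T l. \<exists>c. AE x in lborel. w x = c * v x))"

definition spectral_cond ::
  "real \<Rightarrow> real \<Rightarrow> ((real \<Rightarrow> real) \<Rightarrow> (real \<Rightarrow> real)) \<Rightarrow> (real \<Rightarrow> real) \<Rightarrow> bool" where
  "spectral_cond L m T \<phi> \<longleftrightarrow>
     (\<exists>!l. l < 0 \<and> eigenvalue L m T l) \<and>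
     (\<forall>l<0. eigenvalue L m T l \<longrightarrow> simple_eigenvalue L m T l) \<and>
     simple_eigenvalue L m T 0 \<and> eigenfunction L m T 0 (deriv \<phi>)"

text \<open>The inverse of \<open>T\<close> on the orthogonal complement of its kernel \<open>[\<phi>']\<close>; the value is unique
  up to a null set.\<close>

definition inv_op ::
  "real \<Rightarrow> real \<Rightarrow> ((real \<Rightarrow> real) \<Rightarrow> (real \<Rightarrow> real)) \<Rightarrow> (real \<Rightarrow> real) \<Rightarrow> (real \<Rightarrow> real) \<Rightarrow> (real \<Rightarrow> real)" where
  "inv_op L m T \<phi> g = (SOME v. v \<in> sobolev_per L m \<and> inner_per L v (deriv \<phi>) = 0 \<and>
     (AE x in lborel. T v x = g x))"


section \<open>The Cauchy problem\<close>

text \<open>\<open>u\<close> is continuous from \<open>[0,\<infinity>)\<close> to \<open>H\<^sup>s\<close> and satisfies \<open>u\<^sub>t + (f(u))\<^sub>x - (M u)\<^sub>x = 0\<close> at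
  every time \<open>t \<ge> 0\<close> in the sense of periodic distributions. In the pairing with a test function
  \<open>\<psi>\<close>, the derivative in \<open>x\<close> and the symmetric operator \<open>M\<close> have been moved to \<open>\<psi>\<close>.\<close>

definition global_solution ::
  "real \<Rightarrow> (real \<Rightarrow> real) \<Rightarrow> (real \<Rightarrow> real) \<Rightarrow> real \<Rightarrow> (real \<Rightarrow> real) \<Rightarrow> (real \<Rightarrow> real \<Rightarrow> real) \<Rightarrow> bool" where
  "global_solution L \<theta> f s u0 u \<longleftrightarrow>
     (AE x in lborel. u 0 x = u0 x) \<and>
     (\<forall>t\<ge>0. u t \<in> sobolev_per L s \<and>
        ((\<lambda>\<tau>. sobolev_norm L s (\<lambda>x. u \<tau> x - u t x)) \<longlongrightarrow> 0) (at t within {0..}) \<and>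
        set_integrable lborel {0..L} (\<lambda>x. f (u t x)) \<and>
        (\<forall>\<psi>\<in>smooth_per L.
           ((\<lambda>\<tau>. inner_per L (u \<tau>) \<psi>) has_real_derivative
              (inner_per L (\<lambda>x. f (u t x)) (deriv \<psi>)
                - inner_per L (u t) (mult_op L \<theta> (deriv \<psi>))))
           (at t within {0..})))"

definition globally_well_posed ::
  "real \<Rightarrow> (real \<Rightarrow> real) \<Rightarrow> (real \<Rightarrow> real) \<Rightarrow> real \<Rightarrow> bool" where
  "globally_well_posed L \<theta> f s \<longleftrightarrow>
     (\<forall>u0\<in>sobolev_per L s.
        (\<exists>u. global_solution L \<theta> f s u0 u) \<and>
        (\<forall>u v. global_solution L \<theta> f s u0 u \<longrightarrow> global_solution L \<theta> f s u0 v \<longrightarrow>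
           (\<forall>t\<ge>0. AE x in lborel. u t x = v t x)))"


section \<open>Conserved functionals\<close>

definition P_fun :: "real \<Rightarrow> (real \<Rightarrow> real) \<Rightarrow> (real \<Rightarrow> real) \<Rightarrow> (real \<Rightarrow> real) \<Rightarrow> real" where
  "P_fun L \<theta> W u = mult_form L \<theta> u / 2 - (LINT x:{0..L}|lborel. W (u x))"

definition F_fun :: "real \<Rightarrow> (real \<Rightarrow> real) \<Rightarrow> real" where
  "F_fun L u = (LINT x:{0..L}|lborel. (u x)\<^sup>2) / 2"

definition M_fun :: "real \<Rightarrow> (real \<Rightarrow> real) \<Rightarrow> real" where
  "M_fun L u = (LINT x:{0..L}|lborel. u x)"

text \<open>Infinite Frechet differentiability of \<open>G\<close> on the space \<open>V\<close> with the (semi)norm \<open>N\<close>. For a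
  list \<open>vs\<close> of length \<open>n\<close>, \<open>D u vs\<close> is the \<open>n\<close>-th derivative at \<open>u\<close>, a bounded multilinear form,
  applied to \<open>vs\<close>; the last clause says that the derivative of \<open>u \<mapsto> D u vs\<close> in the direction \<open>h\<close>
  is \<open>D u (h # vs)\<close>, uniformly in \<open>vs\<close>.\<close>

definition smooth_functional ::
  "(real \<Rightarrow> real) set \<Rightarrow> ((real \<Rightarrow> real) \<Rightarrow> real) \<Rightarrow> ((real \<Rightarrow> real) \<Rightarrow> real) \<Rightarrow> bool" where
  "smooth_functional V N G \<longleftrightarrow>
     (\<exists>D :: (real \<Rightarrow> real) \<Rightarrow> (real \<Rightarrow> real) list \<Rightarrow> real.
        \<forall>u\<in>V.
          D u [] = G u \<and>
          (\<forall>xs\<in>lists V. \<forall>ys\<in>lists V. \<forall>v\<in>V. \<forall>w\<in>V. \<forall>c.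
             D u (xs @ (\<lambda>x. v x + w x) # ys) = D u (xs @ v # ys) + D u (xs @ w # ys) \<and>
             D u (xs @ (\<lambda>x. c * v x) # ys) = c * D u (xs @ v # ys)) \<and>
          (\<forall>n. \<exists>C. \<forall>vs\<in>lists V. length vs = n \<longrightarrow> \<bar>D u vs\<bar> \<le> C * prod_list (map N vs)) \<and>
          (\<forall>n. \<forall>\<epsilon>>0. \<exists>\<delta>>0. \<forall>h\<in>V. N h < \<delta> \<longrightarrow>
             (\<forall>vs\<in>lists V. length vs = n \<longrightarrow>
                \<bar>D (\<lambda>x. u x + h x) vs - D u vs - D u (h # vs)\<bar> \<le> \<epsilon> * N h * prod_list (map N vs))))"

definition conserved ::
  "real \<Rightarrow> (real \<Rightarrow> real) \<Rightarrow> (real \<Rightarrow> real) \<Rightarrow> real \<Rightarrow> ((real \<Rightarrow> real) \<Rightarrow> real) \<Rightarrow> bool" where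
  "conserved L \<theta> f s G \<longleftrightarrow>
     (\<forall>u0\<in>sobolev_per L s. \<forall>u. global_solution L \<theta> f s u0 u \<longrightarrow> (\<forall>t\<ge>0. G (u t) = G u0))"

text \<open>Well-definedness of \<open>P\<close> has to be required separately, because the integral of a
  non-integrable function is 0; for \<open>F\<close> and \<open>M\<close> it is automatic.\<close>

definition functionals_cond ::
  "real \<Rightarrow> (real \<Rightarrow> real) \<Rightarrow> (real \<Rightarrow> real) \<Rightarrow> (real \<Rightarrow> real) \<Rightarrow> real \<Rightarrow> real \<Rightarrow> bool" where
  "functionals_cond L \<theta> f W m s \<longleftrightarrow>
     (\<forall>u\<in>sobolev_per L (m/2). set_integrable lborel {0..L} (\<lambda>x. W (u x))) \<and>
     (\<forall>G\<in>{P_fun L \<theta> W, F_fun L, M_fun L}.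
        smooth_functional (sobolev_per L (m/2)) (sobolev_norm L (m/2)) G \<and> conserved L \<theta> f s G)"


section \<open>The family of waves and orbital stability\<close>

text \<open>Smoothness of \<open>p \<mapsto> \<phi>\<^sub>p\<close> as a map into \<open>C\<^sup>\<infinity>\<close> is rendered as joint smoothness in \<open>(p, x)\<close>.\<close>

definition smooth_surface :: "real \<Rightarrow> (real \<times> real) set \<Rightarrow> (real \<times> real \<Rightarrow> real \<Rightarrow> real) \<Rightarrow> bool" where
  "smooth_surface L S \<phi> \<longleftrightarrow>
     (\<forall>p\<in>S. \<phi> p \<in> smooth_per L) \<and> smooth_on (S \<times> UNIV) (\<lambda>(p, x). \<phi> p x)"

definition M_omega :: "real \<Rightarrow> (real \<times> real \<Rightarrow> real \<Rightarrow> real) \<Rightarrow> real \<Rightarrow> real \<Rightarrow> real" where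
  "M_omega L \<phi> \<omega> A = (LINT x:{0..L}|lborel. deriv (\<lambda>w. \<phi> (w, A) x) \<omega>)"

definition M_A :: "real \<Rightarrow> (real \<times> real \<Rightarrow> real \<Rightarrow> real) \<Rightarrow> real \<Rightarrow> real \<Rightarrow> real" where
  "M_A L \<phi> \<omega> A = (LINT x:{0..L}|lborel. deriv (\<lambda>a. \<phi> (\<omega>, a) x) A)"

definition F_omega :: "real \<Rightarrow> (real \<times> real \<Rightarrow> real \<Rightarrow> real) \<Rightarrow> real \<Rightarrow> real \<Rightarrow> real" where
  "F_omega L \<phi> \<omega> A = (LINT x:{0..L}|lborel. deriv (\<lambda>w. (\<phi> (w, A) x)\<^sup>2) \<omega>) / 2"

definition F_A :: "real \<Rightarrow> (real \<times> real \<Rightarrow> real \<Rightarrow> real) \<Rightarrow> real \<Rightarrow> real \<Rightarrow> real" where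
  "F_A L \<phi> \<omega> A = (LINT x:{0..L}|lborel. deriv (\<lambda>a. (\<phi> (\<omega>, a) x)\<^sup>2) A) / 2"

definition Delta ::
  "real \<Rightarrow> (real \<times> real \<Rightarrow> real \<Rightarrow> real) \<Rightarrow> real \<Rightarrow> real \<Rightarrow> real \<Rightarrow> real \<Rightarrow> real" where
  "Delta L \<phi> \<omega> A x y =
     x\<^sup>2 * M_A L \<phi> \<omega> A + x * y * (M_omega L \<phi> \<omega> A + F_A L \<phi> \<omega> A) + y\<^sup>2 * F_omega L \<phi> \<omega> A"

definition orbit_dist :: "real \<Rightarrow> real \<Rightarrow> (real \<Rightarrow> real) \<Rightarrow> (real \<Rightarrow> real) \<Rightarrow> real" where
  "orbit_dist L m \<phi> v = (INF r::real. sobolev_norm L (m/2) (\<lambda>x. v x - \<phi> (x + r)))"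

definition orbitally_stable ::
  "real \<Rightarrow> (real \<Rightarrow> real) \<Rightarrow> (real \<Rightarrow> real) \<Rightarrow> real \<Rightarrow> real \<Rightarrow> (real \<Rightarrow> real) \<Rightarrow> bool" where
  "orbitally_stable L \<theta> f m s \<phi> \<longleftrightarrow>
     (\<forall>\<epsilon>>0. \<exists>\<delta>>0. \<forall>u0\<in>sobolev_per L s. sobolev_norm L (m/2) (\<lambda>x. u0 x - \<phi> x) < \<delta> \<longrightarrow>
        (\<exists>u. global_solution L \<theta> f s u0 u) \<and>
        (\<forall>u. global_solution L \<theta> f s u0 u \<longrightarrow> (\<forall>t\<ge>0. orbit_dist L m \<phi> (u t) < \<epsilon>)))"

end

theory Submission
  imports Defs
begin

text \<open>Write \<open>E = P + \<omega> F + A M\<close> and \<open>N = a M + b F\<close>. The functional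
  \<open>2 (E(u) - E(\<phi>)) + K (N(u) - N(\<phi>))\<^sup>2\<close> is conserved and invariant under translations. The wave is a
  critical point of \<open>E\<close> with Hessian \<open>\<L>\<close>, so for \<open>h\<close> orthogonal to \<open>\<phi>'\<close> everything rests on the
  coercivity of \<open>(\<L>h, h) + K (a + b \<phi>, h)\<^sup>2\<close> in \<open>H\<^bsup>m/2\<^esup>\<close>. Differentiating the wave equation in the
  parameters gives \<open>\<L> \<Upsilon> = - (a + b \<phi>)\<close> for \<open>\<Upsilon> = a \<partial>\<^sub>A \<phi> + b \<partial>\<^sub>\<omega> \<phi>\<close>, hence
  \<open>(\<L> \<Upsilon>, \<Upsilon>) = - \<Delta>(a, b) < 0\<close>: as \<open>\<L>\<close> has a single negative direction, its form is positive on the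
  vectors \<open>h\<close> with \<open>(\<L> \<Upsilon>, h) = 0\<close> that are orthogonal to \<open>\<phi>'\<close>. The spectral theorem is replaced by
  minimising the form over orthogonal complements, where compactness of \<open>H\<^bsup>m/2\<^esup>\<close> in \<open>L\<^sup>2\<close> yields
  minimisers, and these are eigenfunctions in the operator domain.\<close>

section \<open>Square-integrable periodic functions\<close>

text \<open>The multiplier, the Sobolev norms and the form of \<open>M\<close> are all given through
  Fourier coefficients of representatives, hence the need for uniqueness and completeness of these
  coefficients. The nonlinearity has no growth bound and elements of H^(m/2) may be unbounded, so
  the Hessian of \<open>P\<close> cannot be computed under the integral there; only the abstract
  smoothness of \<open>P\<close> is available, and its derivatives have to be compared with the
  explicit ones on bounded functions. \<open>N\<close> enters as a squared penalty and not as a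
  constraint: perturbations that change \<open>N\<close> are then covered without moving the
  parameters of the wave. Two norms compete in the choice of the translate, since orthogonality to
  \<phi>' is an L2 condition while the distance to the orbit is measured in H^(m/2). The translate
  is chosen in L2, and its H^(m/2) closeness is recovered by interpolation between L2 and H^m;
  \<phi> lies in H^m because \<phi>' is in the domain of \<L>. Stability is a barrier argument: at a
  fixed small distance the conserved functional would exceed its initial value, and the distance is
  continuous in time.\<close>

lemma set_integrable_mult_bounded:
  fixes h p :: "real \<Rightarrow> 'b::{real_normed_algebra,banach,second_countable_topology}"
  assumes h: "set_integrable lborel {a..b} h" and p: "p \<in> borel_measurable borel"
    and C: "\<And>x. norm (p x) \<le> C"
  shows "set_integrable lborel {a..b} (\<lambda>x. h x * p x)"
proof (rule set_integrable_bound)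
  show "set_integrable lborel {a..b} (\<lambda>x. C *\<^sub>R h x)" using h by simp
  have "(\<lambda>x. indicat_real {a..b} x *\<^sub>R h x) \<in> borel_measurable lborel"
    using h unfolding set_integrable_def by auto
  then have "(\<lambda>x. (indicat_real {a..b} x *\<^sub>R h x) * p x) \<in> borel_measurable lborel"
    using p by (intro borel_measurable_times) auto
  then show "set_borel_measurable lborel {a..b} (\<lambda>x. h x * p x)"
    unfolding set_borel_measurable_def by simp
  show "AE x in lborel. x \<in> {a..b} \<longrightarrow> norm (h x * p x) \<le> norm (C *\<^sub>R h x)"
  proof (intro AE_I2 impI)
    fix x
    have "norm (h x * p x) \<le> norm (h x) * norm (p x)" by (rule norm_mult_ineq)
    also have "\<dots> \<le> norm (h x) * \<bar>C\<bar>" using C[of x] by (intro mult_left_mono) auto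
    finally show "norm (h x * p x) \<le> norm (C *\<^sub>R h x)" by (simp add: mult.commute)
  qed
qed

lemma set_integrable_complex_of_real:
  "set_integrable M A h \<Longrightarrow> set_integrable M A (\<lambda>x. complex_of_real (h x))"
  unfolding set_integrable_def
  by (drule integrable_of_real[where 'a=complex]) (simp add: scaleR_conv_of_real)

locale period =
  fixes L :: real
  assumes L_pos: "L > 0"
begin

lemma periodic_of_int:
  assumes "periodic L g" shows "g (x + of_int k * L) = g x"
proof -
  have nat: "g (y + of_nat n * L) = g y" for n y
  proof (induction n arbitrary: y)
    case (Suc n)
    have "g (y + of_nat (Suc n) * L) = g ((y + of_nat n * L) + L)" by (simp add: algebra_simps)
    then show ?case using Suc assms by (simp add: periodic_def)
  qed simp
  show ?thesis
  proof (cases "k \<ge> 0")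
    case True then show ?thesis using nat[of x "nat k"] by simp
  next
    case False then show ?thesis using nat[of "x + of_int k * L" "nat (- k)"] by simp
  qed
qed

lemma period_reduce:
  obtains k :: int where "x + of_int k * L \<in> {0..<L}"
proof
  have "frac (x / L) * L = x + of_int (- \<lfloor>x / L\<rfloor>) * L" using L_pos by (simp add: frac_def algebra_simps)
  moreover have "0 \<le> frac (x / L) * L" "frac (x / L) * L < L"
    using L_pos frac_lt_1[of "x/L"] by auto
  ultimately show "x + of_int (- \<lfloor>x / L\<rfloor>) * L \<in> {0..<L}" by auto
qed

lemma periodic_bounded:
  assumes "continuous_on UNIV g" "periodic L g"
  obtains C where "\<And>x. \<bar>g x\<bar> \<le> C"
proof -
  have "compact (g ` {0..L})" using assms(1) by (intro compact_continuous_image continuous_on_subset[OF assms(1)]) auto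
  then obtain C where C: "\<forall>x\<in>{0..L}. \<bar>g x\<bar> \<le> C"
    using compact_imp_bounded[of "g ` {0..L}"] unfolding bounded_iff by auto
  have "\<bar>g x\<bar> \<le> C" for x
  proof -
    obtain k where "x + of_int k * L \<in> {0..<L}" by (rule period_reduce)
    then show ?thesis using C[rule_format, of "x + of_int k * L"] periodic_of_int[OF assms(2), of x k] by auto
  qed
  then show ?thesis using that by blast
qed

section \<open>The space \<open>L2_per\<close> and its inner product\<close>

lemma L2_perD:
  assumes "g \<in> L2_per L"
  shows "g \<in> borel_measurable borel" "periodic L g" "set_integrable lborel {0..L} (\<lambda>x. (g x)\<^sup>2)"
  using assms unfolding L2_per_def by auto

lemma L2_mult_integrable:
  assumes g: "g \<in> L2_per L" and h: "h \<in> L2_per L"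
  shows "set_integrable lborel {0..L} (\<lambda>x. g x * h x)"
proof (rule set_integrable_bound)
  show "set_integrable lborel {0..L} (\<lambda>x. (g x)\<^sup>2 + (h x)\<^sup>2)"
    using L2_perD(3)[OF g] L2_perD(3)[OF h] by (rule set_integral_add)
  show "set_borel_measurable lborel {0..L} (\<lambda>x. g x * h x)"
    using L2_perD(1)[OF g] L2_perD(1)[OF h] unfolding set_borel_measurable_def by measurable
  have "\<bar>g x * h x\<bar> \<le> \<bar>(g x)\<^sup>2 + (h x)\<^sup>2\<bar>" for x
    using sum_squares_bound[of "g x" "h x"] sum_squares_bound[of "g x" "- h x"]
    by (simp add: abs_le_iff)
  then show "AE x in lborel. x \<in> {0..L} \<longrightarrow> norm (g x * h x) \<le> norm ((g x)\<^sup>2 + (h x)\<^sup>2)" by simp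
qed

lemma L2_bounded:
  assumes "g \<in> borel_measurable borel" "periodic L g" "\<And>x. \<bar>g x\<bar> \<le> C"
  shows "g \<in> L2_per L"
proof -
  have "set_integrable lborel {0..L} (\<lambda>x. (g x)\<^sup>2)"
  proof (rule set_integrable_bound)
    show "set_integrable lborel {0..L} (\<lambda>x. C\<^sup>2)" by (intro borel_integrable_atLeastAtMost') auto
    show "set_borel_measurable lborel {0..L} (\<lambda>x. (g x)\<^sup>2)"
      using assms(1) unfolding set_borel_measurable_def by measurable
    show "AE x in lborel. x \<in> {0..L} \<longrightarrow> norm ((g x)\<^sup>2) \<le> norm (C\<^sup>2)"
      using assms(3) by (auto intro!: AE_I2 simp: abs_le_square_iff[symmetric] intro: order_trans[OF assms(3)])
  qed
  then show ?thesis using assms unfolding L2_per_def by auto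
qed

lemma L2_continuous:
  assumes "continuous_on UNIV g" "periodic L g" shows "g \<in> L2_per L"
  using L2_bounded periodic_bounded[OF assms] assms borel_measurable_continuous_onI by metis

lemma L2_const [simp]: "(\<lambda>x. c) \<in> L2_per L"
  by (rule L2_continuous) (auto simp: periodic_def)

lemma L2_add:
  assumes g: "g \<in> L2_per L" and h: "h \<in> L2_per L"
  shows "(\<lambda>x. g x + h x) \<in> L2_per L"
proof -
  have "set_integrable lborel {0..L} (\<lambda>x. ((g x)\<^sup>2 + (h x)\<^sup>2) + 2 * (g x * h x))"
    using L2_perD(3)[OF g] L2_perD(3)[OF h] L2_mult_integrable[OF g h] by (intro set_integral_add) auto
  then have "set_integrable lborel {0..L} (\<lambda>x. (g x + h x)\<^sup>2)"
    by (simp add: power2_sum algebra_simps)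
  then show ?thesis using L2_perD[OF g] L2_perD[OF h] unfolding L2_per_def periodic_def by auto
qed

lemma L2_scale:
  assumes g: "g \<in> L2_per L" shows "(\<lambda>x. c * g x) \<in> L2_per L"
  using L2_perD[OF g] unfolding L2_per_def periodic_def by (auto simp: power_mult_distrib)

lemma L2_diff:
  assumes g: "g \<in> L2_per L" and h: "h \<in> L2_per L"
  shows "(\<lambda>x. g x - h x) \<in> L2_per L"
  using L2_add[OF g L2_scale[OF h, of "-1"]] by simp

lemma L2_mult_bounded:
  assumes g: "g \<in> L2_per L" and b: "b \<in> borel_measurable borel" "periodic L b" "\<And>x. \<bar>b x\<bar> \<le> C"
  shows "(\<lambda>x. b x * g x) \<in> L2_per L"
proof -
  have "norm ((b x)\<^sup>2) \<le> C\<^sup>2" for x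
    using b(3)[of x] by (simp add: abs_le_square_iff[symmetric])
  then have "set_integrable lborel {0..L} (\<lambda>x. (g x)\<^sup>2 * (b x)\<^sup>2)"
    using set_integrable_mult_bounded[OF L2_perD(3)[OF g], of "\<lambda>x. (b x)\<^sup>2" "C\<^sup>2"] b(1) by auto
  then show ?thesis using L2_perD[OF g] b unfolding L2_per_def periodic_def
    by (auto simp: power_mult_distrib mult.commute)
qed

lemma L2_integrable:
  assumes g: "g \<in> L2_per L" shows "set_integrable lborel {0..L} g"
  using L2_mult_integrable[OF g L2_const[of 1]] by simp

lemma inner_per_commute: "inner_per L g h = inner_per L h g"
  unfolding inner_per_def by (simp add: mult.commute)

lemma inner_per_add_left:
  assumes "g \<in> L2_per L" "h \<in> L2_per L" "k \<in> L2_per L"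
  shows "inner_per L (\<lambda>x. g x + h x) k = inner_per L g k + inner_per L h k"
  unfolding inner_per_def using L2_mult_integrable assms by (simp add: distrib_right set_integral_add)

lemma inner_per_scale_left: "inner_per L (\<lambda>x. c * g x) k = c * inner_per L g k"
  unfolding inner_per_def by (simp add: mult.assoc)

lemma inner_per_diff_left:
  assumes "g \<in> L2_per L" "h \<in> L2_per L" "k \<in> L2_per L"
  shows "inner_per L (\<lambda>x. g x - h x) k = inner_per L g k - inner_per L h k"
  using inner_per_add_left[OF assms(1) L2_scale[OF assms(2), of "-1"] assms(3)]
    inner_per_scale_left[of "-1" h k] by simp

lemma inner_per_nonneg: "inner_per L g g \<ge> 0"
  unfolding inner_per_def set_lebesgue_integral_def by (intro integral_nonneg_AE) auto

lemma inner_per_cong_AE: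
  assumes "AE x in lborel. g x = g' x" "AE x in lborel. h x = h' x"
    "g \<in> borel_measurable borel" "g' \<in> borel_measurable borel" "h \<in> borel_measurable borel" "h' \<in> borel_measurable borel"
  shows "inner_per L g h = inner_per L g' h'"
  unfolding inner_per_def
proof (rule set_lebesgue_integral_cong_AE)
  show "AE x\<in>{0..L} in lborel. g x * h x = g' x * h' x" using assms(1,2) by eventually_elim simp
qed (use assms in measurable)

lemma fourier_coeff_cong_AE:
  assumes "AE x in lborel. g x = g' x" "g \<in> borel_measurable borel" "g' \<in> borel_measurable borel"
  shows "fourier_coeff L g = fourier_coeff L g'"
proof
  fix \<kappa>
  have [measurable]: "(\<lambda>x. cis (- 2 * pi * of_int \<kappa> * x / L)) \<in> borel_measurable borel"
    by (intro borel_measurable_continuous_onI continuous_intros) (use L_pos in auto)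
  have "set_lebesgue_integral lborel {0..L} (\<lambda>x. complex_of_real (g x) * cis (- 2 * pi * of_int \<kappa> * x / L))
    = set_lebesgue_integral lborel {0..L} (\<lambda>x. complex_of_real (g' x) * cis (- 2 * pi * of_int \<kappa> * x / L))"
  proof (rule set_lebesgue_integral_cong_AE)
    show "AE x\<in>{0..L} in lborel. complex_of_real (g x) * cis (- 2 * pi * of_int \<kappa> * x / L) = complex_of_real (g' x) * cis (- 2 * pi * of_int \<kappa> * x / L)"
      using assms(1) by eventually_elim simp
  qed (use assms(2,3) in measurable)
  then show "fourier_coeff L g \<kappa> = fourier_coeff L g' \<kappa>" unfolding fourier_coeff_def by simp
qed

text \<open>A null set in one period spreads over countably many translates, each null by
  translation invariance of Lebesgue measure. This is what passes from statements on
  \<open>{0..L}\<close> to statements on the whole line.\<close>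

lemma AE_periodic:
  assumes "AE x in lborel. x \<in> {0..L} \<longrightarrow> g x = h x" "periodic L g" "periodic L h"
    and [measurable]: "g \<in> borel_measurable borel" "h \<in> borel_measurable borel"
  shows "AE x in lborel. g x = h x"
proof -
  have "AE x in lborel. \<forall>k::int. of_int k * L + x \<in> {0..L} \<longrightarrow> g (of_int k * L + x) = h (of_int k * L + x)"
  proof (subst AE_all_countable, intro allI)
    fix k :: int
    have "AE x in distr lborel borel ((+) (of_int k * L)). x \<in> {0..L} \<longrightarrow> g x = h x"
      unfolding lborel_distr_plus by (rule assms(1))
    then show "AE x in lborel. of_int k * L + x \<in> {0..L} \<longrightarrow> g (of_int k * L + x) = h (of_int k * L + x)"
      by (subst (asm) AE_distr_iff) auto
  qed
  then show ?thesis
  proof eventually_elim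
    case (elim x)
    obtain k where "x + of_int k * L \<in> {0..<L}" by (rule period_reduce)
    with elim have "g (of_int k * L + x) = h (of_int k * L + x)" by (auto simp: add.commute)
    then show ?case using periodic_of_int[OF assms(2)] periodic_of_int[OF assms(3)] by (metis add.commute)
  qed
qed

lemma inner_per_zero_AE:
  assumes g: "g \<in> L2_per L" and "inner_per L g g = 0"
  shows "AE x in lborel. g x = 0"
proof -
  have "AE x in lborel. indicator {0..L} x *\<^sub>R (g x * g x) = 0"
    using assms(2) L2_mult_integrable[OF g g]
    unfolding inner_per_def set_lebesgue_integral_def set_integrable_def
    by (subst (asm) integral_nonneg_eq_0_iff_AE) auto
  then have "AE x in lborel. x \<in> {0..L} \<longrightarrow> g x = 0" by eventually_elim auto
  then show ?thesis using L2_perD[OF g] by (intro AE_periodic) (auto simp: periodic_def)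
qed

end

section \<open>Fourier coefficients\<close>

context period
begin

abbreviation E :: "int \<Rightarrow> real \<Rightarrow> complex" where
  "E \<kappa> x \<equiv> cis (- 2 * pi * of_int \<kappa> * x / L)"

lemma continuous_E: "continuous_on S (E \<kappa>)"
  by (intro continuous_intros) (use L_pos in auto)

lemma E_measurable [measurable]: "E \<kappa> \<in> borel_measurable borel"
  by (intro borel_measurable_continuous_onI continuous_E)

lemma E_integrable:
  "set_integrable lborel {0..L} h \<Longrightarrow> set_integrable lborel {0..L} (\<lambda>x. complex_of_real (h x) * E \<kappa> x)"
  by (rule set_integrable_mult_bounded[OF set_integrable_complex_of_real E_measurable, where C=1]) auto

section \<open>Algebra of Fourier coefficients and their uniqueness\<close>

lemma fourier_coeff_add:
  assumes "set_integrable lborel {0..L} g" "set_integrable lborel {0..L} h"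
  shows "fourier_coeff L (\<lambda>x. g x + h x) \<kappa> = fourier_coeff L g \<kappa> + fourier_coeff L h \<kappa>"
  using E_integrable[OF assms(1)] E_integrable[OF assms(2)] unfolding fourier_coeff_def
  by (simp add: ring_distribs set_integral_add add_divide_distrib)

lemma fourier_coeff_scale: "fourier_coeff L (\<lambda>x. c * g x) \<kappa> = complex_of_real c * fourier_coeff L g \<kappa>"
  unfolding fourier_coeff_def by (simp add: mult.assoc)

lemma fourier_coeff_diff:
  assumes "set_integrable lborel {0..L} g" "set_integrable lborel {0..L} h"
  shows "fourier_coeff L (\<lambda>x. g x - h x) \<kappa> = fourier_coeff L g \<kappa> - fourier_coeff L h \<kappa>"
proof -
  have "set_integrable lborel {0..L} (\<lambda>x. (-1) * h x)" using assms(2) by (rule set_integrable_mult_right)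
  then show ?thesis using fourier_coeff_add[OF assms(1), of "\<lambda>x. (-1) * h x" \<kappa>] fourier_coeff_scale[of "-1" h \<kappa>] by simp
qed

lemma fourier_coeff_uminus: "fourier_coeff L g (- \<kappa>) = cnj (fourier_coeff L g \<kappa>)"
proof -
  let ?F = "\<lambda>x. complex_of_real (g x) * E \<kappa> x"
  have eq: "(\<lambda>x. indicat_real {0..L} x *\<^sub>R cnj (?F x)) = (\<lambda>x. cnj (indicat_real {0..L} x *\<^sub>R ?F x))"
    by (simp add: scaleR_conv_of_real fun_eq_iff)
  have "set_lebesgue_integral lborel {0..L} (\<lambda>x. cnj (?F x)) = cnj (set_lebesgue_integral lborel {0..L} ?F)"
    unfolding set_lebesgue_integral_def eq by (rule Bochner_Integration.integral_cnj)
  then show ?thesis unfolding fourier_coeff_def by (simp add: cis_cnj)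
qed

text \<open>Cosine and sine are combinations of two exponentials, each of which shifts the index by
  one. Hence the vanishing of all coefficients survives multiplication by the two coordinates of the
  unit circle.\<close>

lemma fourier_coeff_trig_mult:
  assumes h: "set_integrable lborel {0..L} h"
  shows "fourier_coeff L (\<lambda>x. h x * cos (2 * pi * x / L)) \<kappa> =
           (fourier_coeff L h (\<kappa> - 1) + fourier_coeff L h (\<kappa> + 1)) / 2"
    and "fourier_coeff L (\<lambda>x. h x * sin (2 * pi * x / L)) \<kappa> =
           (fourier_coeff L h (\<kappa> - 1) - fourier_coeff L h (\<kappa> + 1)) / (2 * \<i>)"
proof -
  have E1: "E (\<kappa> - 1) x = E \<kappa> x * cis (2 * pi * x / L)" for x
    by (simp add: cis_mult add_divide_distrib diff_divide_distrib algebra_simps)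
  have E2: "E (\<kappa> + 1) x = E \<kappa> x * cis (- (2 * pi * x / L))" for x
    by (simp add: cis_mult add_divide_distrib diff_divide_distrib algebra_simps)
  have c: "complex_of_real (cos t) = (cis t + cis (- t)) / 2" for t by (simp add: complex_eq_iff)
  have s: "complex_of_real (sin t) = (cis t - cis (- t)) / (2 * \<i>)" for t
  proof -
    have "2 * \<i> * complex_of_real (sin t) = cis t - cis (- t)" by (simp add: complex_eq_iff)
    then show ?thesis by (simp add: nonzero_eq_divide_eq mult.commute)
  qed
  have "complex_of_real (h x * cos (2 * pi * x / L)) * E \<kappa> x
      = (1/2) * (complex_of_real (h x) * E (\<kappa> - 1) x + complex_of_real (h x) * E (\<kappa> + 1) x)" for x
    unfolding E1 E2 of_real_mult c by (simp add: algebra_simps)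
  then show "fourier_coeff L (\<lambda>x. h x * cos (2 * pi * x / L)) \<kappa> =
           (fourier_coeff L h (\<kappa> - 1) + fourier_coeff L h (\<kappa> + 1)) / 2"
    unfolding fourier_coeff_def
    using E_integrable[OF h, of "\<kappa> - 1"] E_integrable[OF h, of "\<kappa> + 1"]
    by (simp only: set_integral_mult_right set_integral_add) (simp add: ring_distribs add_divide_distrib)
  have "complex_of_real (h x * sin (2 * pi * x / L)) * E \<kappa> x
      = (1/(2*\<i>)) * (complex_of_real (h x) * E (\<kappa> - 1) x - complex_of_real (h x) * E (\<kappa> + 1) x)" for x
    unfolding E1 E2 of_real_mult s by (simp add: algebra_simps add_divide_distrib diff_divide_distrib)
  then show "fourier_coeff L (\<lambda>x. h x * sin (2 * pi * x / L)) \<kappa> =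
           (fourier_coeff L h (\<kappa> - 1) - fourier_coeff L h (\<kappa> + 1)) / (2 * \<i>)"
    unfolding fourier_coeff_def
    using E_integrable[OF h, of "\<kappa> - 1"] E_integrable[OF h, of "\<kappa> + 1"]
    by (simp only: set_integral_mult_right set_integral_diff) (simp add: ring_distribs diff_divide_distrib)
qed

text \<open>The induction hypothesis quantifies over \<open>h\<close>, so that products of polynomials need no
  convolution of coefficients.\<close>

lemma fourier_coeff_polynomial_mult:
  assumes "real_polynomial_function p"
  shows "set_integrable lborel {0..L} h \<Longrightarrow> (\<And>\<kappa>. fourier_coeff L h \<kappa> = 0) \<Longrightarrow>
    set_integrable lborel {0..L} (\<lambda>x. h x * p (cis (2 * pi * x / L))) \<and>
    (\<forall>\<kappa>. fourier_coeff L (\<lambda>x. h x * p (cis (2 * pi * x / L))) \<kappa> = 0)"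
  using assms
proof (induction p arbitrary: h rule: real_polynomial_function.induct)
  case (linear p)
  note h = linear.prems
  interpret bounded_linear p by fact
  \<comment> \<open>A real-linear functional on the plane, restricted to the circle, is a
    combination of cosine and sine.\<close>
  have p: "p (cis t) = cos t * p 1 + sin t * p \<i>" for t
  proof -
    have "cis t = cos t *\<^sub>R 1 + sin t *\<^sub>R \<i>" by (simp add: complex_eq_iff)
    then show ?thesis by (simp only: add scaleR real_scaleR_def)
  qed
  have c: "set_integrable lborel {0..L} (\<lambda>x. h x * cos (2 * pi * x / L))"
    by (rule set_integrable_mult_bounded[OF h(1), where C=1]) auto
  have s: "set_integrable lborel {0..L} (\<lambda>x. h x * sin (2 * pi * x / L))"
    by (rule set_integrable_mult_bounded[OF h(1), where C=1]) auto
  have eq: "(\<lambda>x. h x * p (cis (2 * pi * x / L))) =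
      (\<lambda>x. p 1 * (h x * cos (2 * pi * x / L)) + p \<i> * (h x * sin (2 * pi * x / L)))"
    by (simp add: p fun_eq_iff algebra_simps)
  show ?case unfolding eq
    using c s h(2) fourier_coeff_trig_mult[OF h(1)]
    by (auto simp: fourier_coeff_add fourier_coeff_scale intro!: set_integral_add)
next
  case (const c)
  then show ?case by (simp add: fourier_coeff_scale mult.commute[of _ c])
next
  case (add f g)
  then show ?case by (simp add: distrib_left fourier_coeff_add set_integral_add)
next
  case (mult f g)
  then show ?case by (simp add: mult.assoc[symmetric])
qed

text \<open>Stone-Weierstrass on the unit circle: polynomials are uniformly dense, and
  \<open>h\<close> times a polynomial has vanishing zeroth coefficient, that is, integral 0. Writing
  test functions as functions of \<open>cis (2 * pi * x / L)\<close> builds periodicity into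
  them.\<close>

lemma zero_coeff_integral_continuous:
  fixes F :: "complex \<Rightarrow> real"
  assumes h: "set_integrable lborel {0..L} h" and z: "\<And>\<kappa>. fourier_coeff L h \<kappa> = 0"
    and F: "continuous_on UNIV F"
  shows "(LINT x:{0..L}|lborel. h x * F (cis (2 * pi * x / L))) = 0"
proof -
  define J where "J = (LINT x:{0..L}|lborel. \<bar>h x\<bar>)"
  have J0: "J \<ge> 0" unfolding J_def set_lebesgue_integral_def by (intro integral_nonneg_AE) auto
  let ?c = "\<lambda>x. cis (2 * pi * x / L)"
  have cm [measurable]: "?c \<in> borel_measurable borel"
    by (intro borel_measurable_continuous_onI continuous_intros) (use L_pos in auto)
  have Fm [measurable]: "F \<in> borel_measurable borel" using F by (rule borel_measurable_continuous_onI)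
  have Fc: "(\<lambda>x. F (?c x)) \<in> borel_measurable borel" by measurable
  have "compact (F ` sphere 0 1)" by (intro compact_continuous_image continuous_on_subset[OF F]) auto
  then obtain C where C: "\<forall>z\<in>sphere 0 1. \<bar>F z\<bar> \<le> C"
    using compact_imp_bounded[of "F ` sphere 0 1"] unfolding bounded_iff by auto
  have hF: "set_integrable lborel {0..L} (\<lambda>x. h x * F (?c x))"
    by (rule set_integrable_mult_bounded[OF h, where C=C]) (use C Fc in auto)
  have "\<bar>LINT x:{0..L}|lborel. h x * F (?c x)\<bar> \<le> e * J" if "e > 0" for e
  proof -
    obtain p where p: "real_polynomial_function p" "\<And>z. z \<in> sphere 0 1 \<Longrightarrow> \<bar>F z - p z\<bar> < e"
      by (rule Stone_Weierstrass_real_polynomial_function[of "sphere (0::complex) 1" F e])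
        (use continuous_on_subset[OF F] \<open>e > 0\<close> in auto)
    have hp: "set_integrable lborel {0..L} (\<lambda>x. h x * p (?c x))"
      and "fourier_coeff L (\<lambda>x. h x * p (?c x)) 0 = 0"
      using fourier_coeff_polynomial_mult[OF p(1) h z] by auto
    then have p0: "(LINT x:{0..L}|lborel. h x * p (?c x)) = 0"
      using L_pos set_integral_complex_of_real[of lborel "{0..L}" "\<lambda>x. h x * p (?c x)"] unfolding fourier_coeff_def by simp
    have hd: "set_integrable lborel {0..L} (\<lambda>x. h x * F (?c x) - h x * p (?c x))"
      by (rule set_integral_diff(1)[OF hF hp])
    have n1: "set_integrable lborel {0..L} (\<lambda>x. norm (h x * F (?c x) - h x * p (?c x)))"
      using integrable_norm[OF hd[unfolded set_integrable_def]] unfolding set_integrable_def by (simp add: abs_mult)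
    have n2: "set_integrable lborel {0..L} (\<lambda>x. e * \<bar>h x\<bar>)"
      using integrable_norm[OF h[unfolded set_integrable_def]] unfolding set_integrable_def by (simp add: abs_mult algebra_simps)
    have le: "norm (h x * F (?c x) - h x * p (?c x)) \<le> e * \<bar>h x\<bar>" for x
    proof -
      have "norm (h x * F (?c x) - h x * p (?c x)) = \<bar>h x\<bar> * \<bar>F (?c x) - p (?c x)\<bar>"
        by (simp only: right_diff_distrib[symmetric] real_norm_def abs_mult)
      also have "\<dots> \<le> \<bar>h x\<bar> * e" using p(2)[of "?c x"] by (intro mult_left_mono) auto
      finally show ?thesis by (simp only: mult.commute)
    qed
    have "\<bar>LINT x:{0..L}|lborel. h x * F (?c x) - h x * p (?c x)\<bar>
        \<le> (LINT x:{0..L}|lborel. norm (h x * F (?c x) - h x * p (?c x)))"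
      using set_integral_norm_bound[OF hd] by (simp only: real_norm_def)
    moreover have "(LINT x:{0..L}|lborel. norm (h x * F (?c x) - h x * p (?c x))) \<le> (LINT x:{0..L}|lborel. e * \<bar>h x\<bar>)"
      using n1 n2 le by (rule set_integral_mono)
    moreover have "(LINT x:{0..L}|lborel. e * \<bar>h x\<bar>) = e * J" unfolding J_def by (rule set_integral_mult_right)
    ultimately show ?thesis unfolding set_integral_diff(2)[OF hF hp] p0 by linarith
  qed
  note b = this
  have "\<bar>LINT x:{0..L}|lborel. h x * F (?c x)\<bar> \<le> 0 + d" if "d > 0" for d
  proof -
    \<comment> \<open>\<open>J\<close> may be 0, hence \<open>J + 1\<close> in the
      denominator.\<close>
    have "\<bar>LINT x:{0..L}|lborel. h x * F (?c x)\<bar> \<le> d / (J + 1) * J" using that J0 by (intro b) auto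
    also have "\<dots> \<le> d" using that J0 by (simp add: field_simps)
    finally show ?thesis by simp
  qed
  then have "\<bar>LINT x:{0..L}|lborel. h x * F (?c x)\<bar> \<le> 0" by (rule field_le_epsilon)
  then show ?thesis by simp
qed

text \<open>The indicator of an open set is the pointwise limit of truncated multiples of the
  distance to the complement, which are continuous with values in [0,1]; dominated convergence
  applies with bound \<open>\<bar>h\<bar>\<close>.\<close>

lemma zero_coeff_integral_open:
  assumes h: "set_integrable lborel {0..L} h" and z: "\<And>\<kappa>. fourier_coeff L h \<kappa> = 0"
    and U: "open U" "U \<noteq> UNIV"
  shows "(LINT x:{0..L}|lborel. h x * indicator U (cis (2 * pi * x / L))) = 0"
proof -
  define F where "F n z = min 1 (real n * infdist z (- U))" for n and z :: complex
  have Fc: "continuous_on UNIV (F n)" for n unfolding F_def by (intro continuous_intros)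
  have lim: "(\<lambda>n. F n z) \<longlonglongrightarrow> indicator U z" for z
  proof (cases "z \<in> U")
    case True
    \<comment> \<open>\<open>infdist\<close> to the empty set is 0 by convention, so
      \<open>U = UNIV\<close> has to be excluded.\<close>
    then have "infdist z (- U) > 0" using U by (intro infdist_pos_not_in_closed) auto
    then obtain N where N: "real N * infdist z (- U) > 1"
      using reals_Archimedean3 by blast
    have "F n z = 1" if "n \<ge> N" for n
    proof -
      have "real N * infdist z (- U) \<le> real n * infdist z (- U)"
        using that by (intro mult_right_mono) (auto simp: infdist_nonneg)
      then show ?thesis using N unfolding F_def by simp
    qed
    then have "eventually (\<lambda>n. F n z = indicator U z) sequentially"
      using True by (auto simp: eventually_sequentially)
    then show ?thesis by (rule tendsto_eventually)
  next
    case False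
    then show ?thesis by (simp add: F_def)
  qed
  have Fb: "\<bar>F n z\<bar> \<le> 1" for n z unfolding F_def by (simp add: infdist_nonneg)
  have cm [measurable]: "(\<lambda>x. cis (2 * pi * x / L)) \<in> borel_measurable borel"
    by (intro borel_measurable_continuous_onI continuous_intros) (use L_pos in auto)
  have [measurable]: "F n \<in> borel_measurable borel" for n
    using Fc by (rule borel_measurable_continuous_onI)
  have [measurable]: "U \<in> sets borel" using U by simp
  let ?h = "\<lambda>x. indicat_real {0..L} x * h x"
  have [measurable]: "?h \<in> borel_measurable lborel"
    using h unfolding set_integrable_def by auto
  have "(\<lambda>n. LINT x|lborel. ?h x * F n (cis (2 * pi * x / L)))
     \<longlonglongrightarrow> (LINT x|lborel. ?h x * indicator U (cis (2 * pi * x / L)))"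
  proof (rule integral_dominated_convergence)
    show "integrable lborel (\<lambda>x. \<bar>?h x\<bar>)" using h unfolding set_integrable_def by auto
    show "AE x in lborel. (\<lambda>n. ?h x * F n (cis (2 * pi * x / L))) \<longlonglongrightarrow> ?h x * indicator U (cis (2 * pi * x / L))"
      by (intro AE_I2 tendsto_intros lim)
    show "AE x in lborel. norm (?h x * F n (cis (2 * pi * x / L))) \<le> \<bar>?h x\<bar>" for n
      using Fb by (intro AE_I2) (simp add: abs_mult mult_left_le)
  qed measurable
  moreover have "(LINT x|lborel. ?h x * F n (cis (2 * pi * x / L))) = 0" for n
    using zero_coeff_integral_continuous[OF h z Fc[of n]] unfolding set_lebesgue_integral_def
    by (simp add: mult.assoc)
  ultimately show ?thesis unfolding set_lebesgue_integral_def by (simp add: mult.assoc LIMSEQ_const_iff)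
qed

text \<open>For \<open>a\<close> inside the period, the half-line is seen on the circle as the
  complement of the compact arc over \<open>{0..a}\<close>, an open set. Half-lines suffice because
  they determine finite measures.\<close>

lemma zero_coeff_integral_greaterThan:
  assumes h: "set_integrable lborel {0..L} h" and z: "\<And>\<kappa>. fourier_coeff L h \<kappa> = 0"
  shows "(LINT x:{0..L}|lborel. h x * indicator {a<..} x) = 0"
proof -
  have full: "(LINT x:{0..L}|lborel. h x) = 0"
    using z[of 0] L_pos set_integral_complex_of_real[of lborel "{0..L}" h] unfolding fourier_coeff_def by simp
  consider "a < 0" | "a \<ge> L" | "0 \<le> a" "a < L" by linarith
  then show ?thesis
  proof cases
    case 1
    have "(LINT x:{0..L}|lborel. h x * indicator {a<..} x) = (LINT x:{0..L}|lborel. h x)"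
      using 1 by (intro set_lebesgue_integral_cong) (auto simp: indicator_def)
    then show ?thesis using full by simp
  next
    case 2
    have "(LINT x:{0..L}|lborel. h x * indicator {a<..} x) = (LINT x:{0..L}|lborel. 0)"
      using 2 by (intro set_lebesgue_integral_cong) (auto simp: indicator_def)
    then show ?thesis by simp
  next
    case 3
    let ?c = "\<lambda>x. cis (2 * pi * x / L)"
    define U where "U = - (?c ` {0..a})"
    have "compact (?c ` {0..a})"
      by (intro compact_continuous_image continuous_intros) (use L_pos in auto)
    then have "open U" unfolding U_def by (simp add: compact_imp_closed open_Compl)
    have "?c 0 \<in> ?c ` {0..a}" using 3 by (intro imageI) auto
    then have "U \<noteq> UNIV" unfolding U_def by (metis ComplD UNIV_I)
    with \<open>open U\<close> have 0: "(LINT x:{0..L}|lborel. h x * indicator U (?c x)) = 0"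
      by (rule zero_coeff_integral_open[OF h z])
    \<comment> \<open>The endpoint \<open>L\<close> has the same image as 0, which lies on the arc,
      so the equivalence fails there; a single point is a null set.\<close>
    have iff: "?c x \<in> U \<longleftrightarrow> a < x" if "x \<in> {0..L}" "x \<noteq> L" for x
    proof
      assume "?c x \<in> U"
      then show "a < x" using that unfolding U_def by (metis Compl_iff atLeastAtMost_iff imageI not_le)
    next
      assume "a < x"
      show "?c x \<in> U"
      proof (rule ccontr)
        assume "?c x \<notin> U"
        then obtain y where y: "0 \<le> y" "y \<le> a" "?c x = ?c y" unfolding U_def by auto
        then obtain n :: int where n: "2 * pi * x / L = 2 * pi * y / L + 2 * pi * n"
          using sin_cos_eq_iff[of "2 * pi * x / L" "2 * pi * y / L"] by (auto simp: complex_eq_iff)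
        then have "(2 * pi) * x = (2 * pi) * (y + n * L)" using L_pos by (simp add: field_simps)
        then have "x = y + n * L" by (simp only: mult_cancel_left) simp
        moreover have "0 < x - y" "x - y < L" using that y \<open>a < x\<close> 3 by auto
        ultimately have "0 < n * L" "n * L < 1 * L" by auto
        then have "0 < n" "n < 1" using L_pos by (auto simp: zero_less_mult_iff) 
        then show False by simp
      qed
    qed
    have [measurable]: "U \<in> sets borel" using \<open>open U\<close> by simp
    have [measurable]: "?c \<in> borel_measurable borel"
      by (intro borel_measurable_continuous_onI continuous_intros) (use L_pos in auto)
    have hm [measurable]: "(\<lambda>x. indicat_real {0..L} x * h x) \<in> borel_measurable lborel"
      using h unfolding set_integrable_def by auto
    have "(LINT x:{0..L}|lborel. h x * indicator {a<..} x) = (LINT x:{0..L}|lborel. h x * indicator U (?c x))"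
      unfolding set_lebesgue_integral_def real_scaleR_def mult.assoc[symmetric]
    proof (rule integral_cong_AE)
      have "AE x in lborel. x \<noteq> L" by (rule AE_lborel_singleton)
      then show "AE x in lborel. indicat_real {0..L} x * h x * indicat_real {a<..} x =
         indicat_real {0..L} x * h x * indicat_real U (?c x)"
        by eventually_elim (use iff in \<open>auto simp: indicator_def\<close>)
    qed measurable
    then show ?thesis using 0 by simp
  qed
qed

text \<open>The positive and the negative part of \<open>h\<close> on the period are densities of
  two finite measures that agree on all half-lines, so the measures agree and the two parts coincide
  almost everywhere. Where the two parts of one number coincide, both are 0.\<close>

theorem fourier_uniqueness:
  assumes h: "set_integrable lborel {0..L} h" and z: "\<And>\<kappa>. fourier_coeff L h \<kappa> = 0"
  shows "AE x in lborel. x \<in> {0..L} \<longrightarrow> h x = 0"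
proof -
  define k where "k x = indicat_real {0..L} x * h x" for x
  have ki: "integrable lborel k" using h unfolding set_integrable_def k_def by simp
  then have [measurable]: "k \<in> borel_measurable borel" by auto
  let ?p = "\<lambda>x. max 0 (k x)" and ?n = "\<lambda>x. max 0 (- k x)"
  have pi: "integrable lborel (\<lambda>x. ?p x * indicator {a<..} x)" for a
    by (rule Bochner_Integration.integrable_bound[OF ki]) (auto simp: indicator_def)
  have ni: "integrable lborel (\<lambda>x. ?n x * indicator {a<..} x)" for a
    by (rule Bochner_Integration.integrable_bound[OF ki]) (auto simp: indicator_def)
  have eq: "(LINT x|lborel. ?p x * indicator {a<..} x) = (LINT x|lborel. ?n x * indicator {a<..} x)" for a
  proof -
    have "(LINT x|lborel. ?p x * indicator {a<..} x) - (LINT x|lborel. ?n x * indicator {a<..} x)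
      = (LINT x|lborel. ?p x * indicator {a<..} x - ?n x * indicator {a<..} x)"
      using pi ni by simp
    also have "\<dots> = (LINT x|lborel. k x * indicator {a<..} x)"
      by (intro Bochner_Integration.integral_cong) (auto simp: indicator_def max_def)
    also have "\<dots> = 0"
      using zero_coeff_integral_greaterThan[OF h z, of a] unfolding set_lebesgue_integral_def k_def
      by (simp add: mult.assoc)
    finally show ?thesis by simp
  qed
  have em: "emeasure (density lborel (\<lambda>x. ennreal (q x))) {a<..} = ennreal (LINT x|lborel. q x * indicator {a<..} x)"
    if "integrable lborel (\<lambda>x. q x * indicator {a<..} x)" "\<And>x. q x \<ge> 0" and [measurable]: "q \<in> borel_measurable borel" for q :: "real \<Rightarrow> real" and a
  proof -
    have "emeasure (density lborel (\<lambda>x. ennreal (q x))) {a<..} = (\<integral>\<^sup>+x. ennreal (q x) * indicator {a<..} x \<partial>lborel)"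
      by (rule emeasure_density) auto
    also have "\<dots> = (\<integral>\<^sup>+x. ennreal (q x * indicator {a<..} x) \<partial>lborel)"
      by (intro nn_integral_cong) (auto simp: indicator_def)
    also have "\<dots> = ennreal (LINT x|lborel. q x * indicator {a<..} x)"
      using that by (intro nn_integral_eq_integral) auto
    finally show ?thesis .
  qed
  have "density lborel (\<lambda>x. ennreal (?p x)) = density lborel (\<lambda>x. ennreal (?n x))"
  proof (rule measure_eqI_lessThan)
    fix a
    show "emeasure (density lborel (\<lambda>x. ennreal (?p x))) {a<..} < \<infinity>"
      by (subst em[OF pi]) auto
    show "emeasure (density lborel (\<lambda>x. ennreal (?p x))) {a<..} = emeasure (density lborel (\<lambda>x. ennreal (?n x))) {a<..}"
      by (subst em[OF pi], simp, simp, subst em[OF ni], simp, simp, subst eq) (rule refl)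
  qed auto
  then have "AE x in lborel. ennreal (?p x) = ennreal (?n x)"
    by (intro sigma_finite_measure.density_unique[OF lborel.sigma_finite_measure_axioms]) auto
  then show ?thesis
  proof eventually_elim
    case (elim x)
    then have "?p x = ?n x" by (subst (asm) ennreal_inj) auto
    then have "k x = 0" by (auto simp: max_def split: if_splits)
    then show ?case by (auto simp: k_def)
  qed
qed

corollary fourier_coeff_inject:
  assumes g: "g \<in> L2_per L" and h: "h \<in> L2_per L" and "\<And>\<kappa>. fourier_coeff L g \<kappa> = fourier_coeff L h \<kappa>"
  shows "AE x in lborel. g x = h x"
proof -
  have "AE x in lborel. x \<in> {0..L} \<longrightarrow> g x - h x = 0"
    using assms by (intro fourier_uniqueness set_integral_diff L2_integrable)
       (auto simp: fourier_coeff_diff L2_integrable)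
  then have "AE x in lborel. x \<in> {0..L} \<longrightarrow> g x = h x" by eventually_elim simp
  then show ?thesis using L2_perD[OF g] L2_perD[OF h] by (intro AE_periodic)
qed

section \<open>Orthogonality of exponentials and trigonometric polynomials\<close>

lemma integral_E: "(LINT x:{0..L}|lborel. E \<kappa> x) = (if \<kappa> = 0 then complex_of_real L else 0)"
proof (cases "\<kappa> = 0")
  case True
  then show ?thesis using L_pos by (simp add: set_integral_const scaleR_conv_of_real set_lebesgue_integral_def)
next
  case False
  define a where "a = - 2 * pi * of_int \<kappa> / L"
  have a: "a \<noteq> 0" using False L_pos by (simp add: a_def)
  have "((\<lambda>x. cis (a * x) / (\<i> * a)) has_vector_derivative E \<kappa> x) (at x within {0..L})" for x
  proof -
    have "((\<lambda>x. exp (\<i> * a * of_real x) / (\<i> * a)) has_vector_derivative (exp (\<i> * a * of_real x))) (at x within {0..L})"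
      using a by (auto intro!: derivative_eq_intros has_vector_derivative_real_field)
    moreover have "exp (\<i> * a * of_real y) = cis (a * y)" for y by (simp add: cis_conv_exp mult.assoc)
    moreover have "a * x = - 2 * pi * of_int \<kappa> * x / L" by (simp add: a_def)
    ultimately show ?thesis by simp
  qed
  then have "(LINT x|lborel. indicator {0..L} x *\<^sub>R E \<kappa> x) = cis (a * L) / (\<i> * a) - cis (a * 0) / (\<i> * a)"
    using L_pos continuous_E by (intro integral_FTC_Icc) auto
  moreover have "a * L = 2 * pi * of_int (- \<kappa>)" using L_pos by (simp add: a_def)
  ultimately show ?thesis using False unfolding set_lebesgue_integral_def
    by (simp only:) (simp add: cis_multiple_2pi[of "of_int (- \<kappa>)", simplified])
qed

lemma Re_mult_cnj_self: "Re (z * cnj z) = (cmod z)\<^sup>2"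
  by (simp add: complex_mult_cnj cmod_power2)

lemma L_integrable_one: "set_integrable lborel {0..L} (\<lambda>x. 1::real)"
  by (intro borel_integrable_atLeastAtMost') auto

lemma set_integral_sum_fin:
  fixes f :: "'i \<Rightarrow> real \<Rightarrow> 'b::{banach, second_countable_topology}"
  assumes "\<And>j. set_integrable lborel {0..L} (f j)"
  shows "(LINT x:{0..L}|lborel. (\<Sum>j\<in>K. f j x)) = (\<Sum>j\<in>K. LINT x:{0..L}|lborel. f j x)"
  unfolding set_lebesgue_integral_def scaleR_sum_right
  by (rule Bochner_Integration.integral_sum) (rule assms[unfolded set_integrable_def])

lemma set_integrable_Re: "set_integrable M A f \<Longrightarrow> set_integrable M A (\<lambda>x. Re (f x))"
  unfolding set_integrable_def by (drule Bochner_Integration.integrable_Re) simp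

lemma set_integral_Re: "set_integrable M A f \<Longrightarrow> (LINT x:A|M. Re (f x)) = Re (LINT x:A|M. f x)"
  unfolding set_integrable_def set_lebesgue_integral_def
  by (drule Bochner_Integration.integral_Re) simp

text \<open>\<open>E \<kappa>\<close> carries a negative frequency, so its conjugate is the
  exponential that belongs to the coefficient of index \<kappa>. The real part makes the value real
  for any \<open>c\<close>; the coefficients are the intended ones only for conjugate-symmetric
  \<open>c\<close> on a symmetric index set.\<close>

definition trig :: "(int \<Rightarrow> complex) \<Rightarrow> int set \<Rightarrow> real \<Rightarrow> real" where
  "trig c K x = (\<Sum>\<kappa>\<in>K. Re (c \<kappa> * cnj (E \<kappa> x)))"

lemma trig_continuous: "continuous_on S (trig c K)"
  unfolding trig_def by (intro continuous_intros) (use L_pos in auto)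

lemma E_periodic: "E \<kappa> (x + L) = E \<kappa> x"
proof -
  have "- 2 * pi * of_int \<kappa> * (x + L) / L = - 2 * pi * of_int \<kappa> * x / L + 2 * pi * of_int (- \<kappa>)"
    using L_pos by (simp add: field_simps)
  then have "E \<kappa> (x + L) = E \<kappa> x * cis (2 * pi * of_int (- \<kappa>))" by (simp only: cis_mult)
  then show ?thesis by (simp only: cis_multiple_2pi Ints_of_int mult_1_right)
qed

lemma trig_periodic: "periodic L (trig c K)"
  unfolding periodic_def trig_def E_periodic by (intro allI refl)

lemma trig_L2: "trig c K \<in> L2_per L"
  by (intro L2_continuous trig_continuous trig_periodic)

text \<open>A real part is half the sum with the conjugate, so the term of index \<open>j\<close>
  feeds the frequencies \<open>j\<close> and \<open>- j\<close> with weight one half each. By the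
  symmetry of \<open>c\<close> and \<open>K\<close> the two halves arriving at \<kappa> are
  equal.\<close>

lemma fourier_coeff_trig:
  assumes c: "\<And>\<kappa>. c (- \<kappa>) = cnj (c \<kappa>)" and K: "finite K" "\<And>\<kappa>. \<kappa> \<in> K \<longleftrightarrow> - \<kappa> \<in> K"
  shows "fourier_coeff L (trig c K) \<kappa> = (if \<kappa> \<in> K then c \<kappa> else 0)"
proof -
  have Ei: "set_integrable lborel {0..L} (E j)" for j
    using E_integrable[of "\<lambda>x. 1" j] L_integrable_one by simp
  have re: "complex_of_real (Re (z * cnj (E j x))) * E \<kappa> x = (z / 2) * E (\<kappa> - j) x + (cnj z / 2) * E (\<kappa> + j) x" for z j x
  proof -
    have e: "E (\<kappa> - j) x = E \<kappa> x * cnj (E j x)" "E (\<kappa> + j) x = E \<kappa> x * E j x"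
      by (simp_all add: cis_cnj cis_mult add_divide_distrib diff_divide_distrib algebra_simps)
    have "complex_of_real (Re (z * cnj b)) * a = (z / 2) * (a * cnj b) + (cnj z / 2) * (a * b)" for a b
    proof -
      have "complex_of_real (Re (z * cnj b)) = (z * cnj b + cnj (z * cnj b)) / 2" by (simp add: complex_eq_iff)
      then show ?thesis by (simp add: algebra_simps add_divide_distrib)
    qed
    then show ?thesis unfolding e by this
  qed
  have "complex_of_real (trig c K x) * E \<kappa> x = (\<Sum>j\<in>K. (c j / 2) * E (\<kappa> - j) x + (cnj (c j) / 2) * E (\<kappa> + j) x)" for x
    unfolding trig_def of_real_sum sum_distrib_right re by simp
  then have "(LINT x:{0..L}|lborel. complex_of_real (trig c K x) * E \<kappa> x)
    = (LINT x:{0..L}|lborel. (\<Sum>j\<in>K. (c j / 2) * E (\<kappa> - j) x + (cnj (c j) / 2) * E (\<kappa> + j) x))" by simp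
  also have "\<dots> = (\<Sum>j\<in>K. (LINT x:{0..L}|lborel. (c j / 2) * E (\<kappa> - j) x + (cnj (c j) / 2) * E (\<kappa> + j) x))"
    by (rule set_integral_sum_fin) (intro set_integral_add set_integrable_mult_right Ei)
  also have "\<dots> = (\<Sum>j\<in>K. (if \<kappa> = j then c j / 2 * L else 0) + (if j = - \<kappa> then cnj (c j) / 2 * L else 0))"
    using Ei by (intro sum.cong refl)
      (simp only: set_integral_add set_integrable_mult_right set_integral_mult_right integral_E, auto)
  also have "\<dots> = (if \<kappa> \<in> K then c \<kappa> * L else 0)"
    using K(1) K(2)[of \<kappa>] c[of \<kappa>] by (simp add: sum.distrib)
  finally show ?thesis using L_pos unfolding fourier_coeff_def by simp
qed

lemma inner_trig:
  assumes g: "set_integrable lborel {0..L} g"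
  shows "inner_per L g (trig c K) = L * (\<Sum>\<kappa>\<in>K. Re (c \<kappa> * cnj (fourier_coeff L g \<kappa>)))"
proof -
  have int: "set_integrable lborel {0..L} (\<lambda>x. c j * cnj (complex_of_real (g x) * E j x))" for j
  proof -
    have eq: "cnj (complex_of_real (g x) * E j x) = complex_of_real (g x) * E (- j) x" for x by (simp add: cis_cnj)
    show ?thesis unfolding eq by (intro set_integrable_mult_right E_integrable g)
  qed
  have cnjint: "(LINT x:{0..L}|lborel. cnj (complex_of_real (g x) * E j x)) = L * cnj (fourier_coeff L g j)" for j
  proof -
    have eq: "cnj (complex_of_real (g x) * E j x) = complex_of_real (g x) * E (- j) x" for x by (simp add: cis_cnj)
    show ?thesis unfolding eq using L_pos fourier_coeff_uminus[of g j] by (simp add: fourier_coeff_def)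
  qed
  have "complex_of_real (inner_per L g (trig c K)) = (LINT x:{0..L}|lborel. complex_of_real (g x * trig c K x))"
    unfolding inner_per_def by (simp only: set_integral_complex_of_real)
  have "inner_per L g (trig c K) = (LINT x:{0..L}|lborel. (\<Sum>j\<in>K. Re (c j * cnj (complex_of_real (g x) * E j x))))"
    unfolding inner_per_def trig_def by (intro set_lebesgue_integral_cong) (auto simp: sum_distrib_left algebra_simps)
  also have "\<dots> = (\<Sum>j\<in>K. LINT x:{0..L}|lborel. Re (c j * cnj (complex_of_real (g x) * E j x)))"
    by (rule set_integral_sum_fin) (rule set_integrable_Re[OF int])
  also have "\<dots> = (\<Sum>j\<in>K. Re (LINT x:{0..L}|lborel. c j * cnj (complex_of_real (g x) * E j x)))"
    by (simp only: set_integral_Re[OF int])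
  also have "\<dots> = (\<Sum>j\<in>K. Re (c j * (L * cnj (fourier_coeff L g j))))"
    by (simp only: set_integral_mult_right cnjint)
  also have "\<dots> = L * (\<Sum>\<kappa>\<in>K. Re (c \<kappa> * cnj (fourier_coeff L g \<kappa>)))"
    by (simp add: sum_distrib_left algebra_simps)
  finally show ?thesis .
qed

lemma inner_trig_self:
  assumes c: "\<And>\<kappa>. c (- \<kappa>) = cnj (c \<kappa>)" and K: "finite K" "\<And>\<kappa>. \<kappa> \<in> K \<longleftrightarrow> - \<kappa> \<in> K"
  shows "inner_per L (trig c K) (trig c K) = L * (\<Sum>\<kappa>\<in>K. (cmod (c \<kappa>))\<^sup>2)"
  unfolding inner_trig[OF L2_integrable[OF trig_L2]]
  by (simp add: fourier_coeff_trig[where c=c and K=K, OF c K] Re_mult_cnj_self del: complex_mult_cnj times_complex.simps cong: sum.cong)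

lemma bessel:
  assumes g: "g \<in> L2_per L" and K: "finite K"
  shows "L * (\<Sum>\<kappa>\<in>K. (cmod (fourier_coeff L g \<kappa>))\<^sup>2) \<le> inner_per L g g"
proof -
  \<comment> \<open>Real partial sums have the expected coefficients only on symmetric index sets.
    Symmetrising \<open>K\<close> can only increase the sum to be bounded.\<close>
  define K' where "K' = K \<union> uminus ` K"
  have K': "finite K'" "\<And>\<kappa>. \<kappa> \<in> K' \<longleftrightarrow> - \<kappa> \<in> K'" using K by (force simp: K'_def image_iff)+
  let ?T = "trig (fourier_coeff L g) K'" and ?S = "L * (\<Sum>\<kappa>\<in>K'. (cmod (fourier_coeff L g \<kappa>))\<^sup>2)"
  have gT: "inner_per L g ?T = ?S"
    unfolding inner_trig[OF L2_integrable[OF g]] by (simp only: Re_mult_cnj_self)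
  have TT: "inner_per L ?T ?T = ?S" using inner_trig_self[where c="fourier_coeff L g" and K=K', OF fourier_coeff_uminus K'] .
  have "0 \<le> inner_per L (\<lambda>x. g x - ?T x) (\<lambda>x. g x - ?T x)" by (rule inner_per_nonneg)
  also have "\<dots> = inner_per L g g - ?S"
  proof -
    have T: "?T \<in> L2_per L" by (rule trig_L2)
    have "inner_per L (\<lambda>x. g x - ?T x) (\<lambda>x. g x - ?T x) = inner_per L g (\<lambda>x. g x - ?T x) - inner_per L ?T (\<lambda>x. g x - ?T x)"
      by (rule inner_per_diff_left[OF g T L2_diff[OF g T]])
    also have "\<dots> = (inner_per L g g - inner_per L ?T g) - (inner_per L g ?T - inner_per L ?T ?T)"
      unfolding inner_per_commute[of g "\<lambda>x. g x - ?T x"] inner_per_commute[of ?T "\<lambda>x. g x - ?T x"]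
        inner_per_diff_left[OF g T g] inner_per_diff_left[OF g T T] by (rule refl)
    also have "\<dots> = inner_per L g g - ?S" unfolding inner_per_commute[of ?T g] gT TT by simp
    finally show ?thesis .
  qed
  finally have "?S \<le> inner_per L g g" by simp
  moreover have "(\<Sum>\<kappa>\<in>K. (cmod (fourier_coeff L g \<kappa>))\<^sup>2) \<le> (\<Sum>\<kappa>\<in>K'. (cmod (fourier_coeff L g \<kappa>))\<^sup>2)"
    using K' by (intro sum_mono2) (auto simp: K'_def)
  ultimately show ?thesis using L_pos by (smt (verit) mult_left_mono)
qed

end

section \<open>Completeness and Parseval's identity\<close>

lemma finite_int_subset_interval:
  assumes "finite (F :: int set)" obtains N :: nat where "F \<subseteq> {- int N..int N}"
proof
  show "F \<subseteq> {- int (nat (Max (insert 0 (abs ` F))))..int (nat (Max (insert 0 (abs ` F))))}"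
  proof
    fix x assume "x \<in> F"
    then have "\<bar>x\<bar> \<le> Max (insert 0 (abs ` F))" using assms by (intro Max_ge) auto
    then show "x \<in> {- int (nat (Max (insert 0 (abs ` F))))..int (nat (Max (insert 0 (abs ` F))))}" by auto
  qed
qed

lemma summable_on_tail:
  fixes f :: "int \<Rightarrow> real"
  assumes f: "f summable_on UNIV" and nn: "\<And>x. f x \<ge> 0" and e: "e > 0"
  obtains N :: nat where "\<And>A. finite A \<Longrightarrow> A \<inter> {- int N..int N} = {} \<Longrightarrow> sum f A < e"
proof -
  have "(sum f \<longlongrightarrow> infsum f UNIV) (finite_subsets_at_top UNIV)"
    using has_sum_infsum[OF f] by (simp add: has_sum_def)
  then have "eventually (\<lambda>F. sum f F > infsum f UNIV - e) (finite_subsets_at_top UNIV)"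
    using e by (intro order_tendstoD) auto
  then obtain F where F: "finite F" "\<And>Y. finite Y \<Longrightarrow> F \<subseteq> Y \<Longrightarrow> sum f Y > infsum f UNIV - e"
    unfolding eventually_finite_subsets_at_top by auto
  obtain N where N: "F \<subseteq> {- int N..int N}" using finite_int_subset_interval[OF F(1)] .
  have "sum f A < e" if A: "finite A" "A \<inter> {- int N..int N} = {}" for A
  proof -
    have "sum f A + sum f {- int N..int N} = sum f (A \<union> {- int N..int N})"
      using A by (subst sum.union_disjoint) auto
    also have "\<dots> \<le> infsum f UNIV" using f nn A by (intro finite_sum_le_infsum) auto
    finally show ?thesis using F(2)[of "{- int N..int N}"] N by simp
  qed
  then show ?thesis using that by blast
qed

context period
begin

section \<open>Construction of functions from their coefficients\<close>

lemma trig_diff: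
  assumes "finite A" "B \<subseteq> A" shows "trig c A x - trig c B x = trig c (A - B) x"
  unfolding trig_def by (rule sum_diff[OF assms, symmetric])

text \<open>Partial sums along a fast subsequence converge almost everywhere and are dominated by an
  integrable function; the bound on the norm of the limit is Fatou's lemma.\<close>

theorem riesz_fischer:
  assumes c: "\<And>\<kappa>. c (- \<kappa>) = cnj (c \<kappa>)" and s: "(\<lambda>\<kappa>. (cmod (c \<kappa>))\<^sup>2) summable_on UNIV"
  obtains g where "g \<in> L2_per L" "\<And>\<kappa>. fourier_coeff L g \<kappa> = c \<kappa>"
    "inner_per L g g \<le> L * (\<Sum>\<^sub>\<infinity>\<kappa>. (cmod (c \<kappa>))\<^sup>2)"
proof -
  let ?f = "\<lambda>\<kappa>. (cmod (c \<kappa>))\<^sup>2"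
  have "\<exists>N::nat. \<forall>A. finite A \<longrightarrow> A \<inter> {- int N..int N} = {} \<longrightarrow> sum ?f A < (1/4)^k" for k
    using summable_on_tail[OF s, of "(1/4)^k"] by (metis zero_le_power2 zero_less_divide_1_iff zero_less_numeral zero_less_power)
  then obtain N where N: "\<And>k A. finite A \<Longrightarrow> A \<inter> {- int (N k)..int (N k)} = {} \<Longrightarrow> sum ?f A < (1/4)^k" by metis
  define r where "r k = (\<Sum>j\<le>k. N j)" for k
  have rN: "N k \<le> r k" for k unfolding r_def by (rule member_le_sum) auto
  have rk: "k < j \<Longrightarrow> r k \<le> r j" for k j unfolding r_def by (rule sum_mono2) auto
  \<comment> \<open>The cumulative radii make the index sets nested; the additional \<open>k\<close>
    makes them exhaust the integers even if the \<open>N k\<close> stay bounded.\<close>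
  define K where "K k = {- (int (r k) + int k)..int (r k) + int k}" for k
  have Kf: "finite (K k)" "\<And>\<kappa>. \<kappa> \<in> K k \<longleftrightarrow> - \<kappa> \<in> K k" for k unfolding K_def by auto
  have Km: "K k \<subseteq> K (Suc k)" for k unfolding K_def using rk[of k "Suc k"] by auto
  define S where "S k = trig c (K k)" for k
  define D where "D k = trig c (K (Suc k) - K k)" for k
  have DS: "S (Suc k) x - S k x = D k x" for k x
    unfolding S_def D_def using trig_diff[OF Kf(1) Km] .
  have Dc: "continuous_on UNIV (D k)" for k unfolding D_def by (rule trig_continuous)
  have Sc: "continuous_on UNIV (S k)" for k unfolding S_def by (rule trig_continuous)
  have [measurable]: "D k \<in> borel_measurable borel" for k using Dc by (rule borel_measurable_continuous_onI)
  have [measurable]: "S k \<in> borel_measurable borel" for k using Sc by (rule borel_measurable_continuous_onI)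
  have DL2: "D k \<in> L2_per L" for k unfolding D_def by (rule trig_L2)
  have SL2: "S k \<in> L2_per L" for k unfolding S_def by (rule trig_L2)
  have D2: "inner_per L (D k) (D k) \<le> L * (1/4)^k" for k
  proof -
    have "inner_per L (D k) (D k) = L * sum ?f (K (Suc k) - K k)"
      unfolding D_def using Kf by (intro inner_trig_self c) auto
    moreover have "sum ?f (K (Suc k) - K k) < (1/4)^k"
      using rN[of k] Kf by (intro N) (auto simp: K_def)
    ultimately show ?thesis using L_pos by simp
  qed
  have D1i: "set_integrable lborel {0..L} (\<lambda>x. \<bar>D k x\<bar>)" for k
    by (rule set_integrable_abs[OF L2_integrable[OF DL2]])
  have D1: "(LINT x:{0..L}|lborel. \<bar>D k x\<bar>) \<le> L * (1/2)^k" for k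
  proof -
    \<comment> \<open>Weighted arithmetic-geometric mean:
      \<open>2 * \<bar>D\<bar> \<le> (1/2)^k + 2^k * D * D\<close>. It turns the L2 bound
      \<open>L * (1/4)^k\<close> into an L1 bound that is summable over \<open>k\<close>.\<close>
    have "(LINT x:{0..L}|lborel. \<bar>D k x\<bar>) \<le> (LINT x:{0..L}|lborel. (1/2) * ((1/2)^k) + (2^k / 2) * (D k x * D k x))"
    proof (rule set_integral_mono[OF D1i])
      show "set_integrable lborel {0..L} (\<lambda>x. (1/2) * ((1/2)^k) + (2^k / 2) * (D k x * D k x))"
        by (intro set_integral_add set_integrable_mult_right L2_mult_integrable DL2 borel_integrable_atLeastAtMost') auto
      fix x
      have "0 \<le> ((1/2)^k - \<bar>D k x\<bar>)\<^sup>2 * 2^k" by simp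
      also have "\<dots> = (1/2)^k - 2 * \<bar>D k x\<bar> + 2^k * (D k x * D k x)"
        by (simp add: power2_eq_square algebra_simps power_one_over) 
      finally show "\<bar>D k x\<bar> \<le> (1/2) * ((1/2)^k) + (2^k / 2) * (D k x * D k x)" by simp
    qed
    also have "\<dots> = L * ((1/2) * (1/2)^k) + (2^k / 2) * inner_per L (D k) (D k)"
    proof -
      have "set_integrable lborel {0..L} (\<lambda>x. (1/2) * ((1/2)^k) :: real)" by (intro borel_integrable_atLeastAtMost') auto
      moreover have "set_integrable lborel {0..L} (\<lambda>x. (2^k / 2) * (D k x * D k x))"
        by (intro set_integrable_mult_right L2_mult_integrable DL2)
      moreover have "(LINT x:{0..L}|lborel. (1/2) * ((1/2)^k)) = L * ((1/2) * (1/2)^k)"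
        using L_pos by (simp add: set_lebesgue_integral_def)
      ultimately show ?thesis by (simp only: set_integral_add set_integral_mult_right inner_per_def)
    qed
    also have "\<dots> \<le> L * ((1/2) * (1/2)^k) + (2^k / 2) * (L * (1/4)^k)"
      using D2[of k] by (intro add_left_mono mult_left_mono) auto
    also have "\<dots> = L * (1/2)^k"
    proof -
      have "(2::real)^k * (1/4)^k = (1/2)^k" by (simp add: power_mult_distrib[symmetric])
      then show ?thesis by (simp add: algebra_simps)
    qed
    finally show ?thesis .
  qed
  let ?i = "\<lambda>x. indicat_real {0..L} x"
  have iD: "integrable lborel (\<lambda>x. ?i x * \<bar>D k x\<bar>)" for k using D1i[of k] unfolding set_integrable_def by simp
  have sumD: "summable (\<lambda>k. LINT x|lborel. norm (?i x * \<bar>D k x\<bar>))"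
  proof (rule summable_comparison_test')
    show "summable (\<lambda>k. L * (1/2)^k)" by (intro summable_mult summable_geometric) simp
    show "norm (LINT x|lborel. norm (?i x * \<bar>D k x\<bar>)) \<le> L * (1/2)^k" if "k \<ge> 0" for k
      using D1[of k] unfolding set_lebesgue_integral_def by (simp add: abs_mult)
  qed
  have AEs: "AE x in lborel. summable (\<lambda>k. norm (?i x * \<bar>D k x\<bar>))"
  proof -
    have "(\<integral>\<^sup>+x. (\<Sum>k. ennreal (norm (?i x * \<bar>D k x\<bar>))) \<partial>lborel) = (\<Sum>k. \<integral>\<^sup>+x. ennreal (norm (?i x * \<bar>D k x\<bar>)) \<partial>lborel)"
      by (rule nn_integral_suminf) measurable
    also have "\<dots> = (\<Sum>k. ennreal (LINT x|lborel. norm (?i x * \<bar>D k x\<bar>)))"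
      using iD by (intro suminf_cong nn_integral_eq_integral integrable_norm) auto
    also have "\<dots> \<noteq> \<infinity>"
      using sumD by (subst suminf_ennreal2) auto
    finally have "AE x in lborel. (\<Sum>k. ennreal (norm (?i x * \<bar>D k x\<bar>))) \<noteq> \<infinity>"
      by (intro nn_integral_PInf_AE) auto
    then show ?thesis by eventually_elim (rule summable_suminf_not_top, auto simp del: real_norm_def)
  qed
  have iG: "integrable lborel (\<lambda>x. \<Sum>k. ?i x * \<bar>D k x\<bar>)"
    using iD AEs sumD by (intro integrable_suminf) auto
  have Stel: "S k x = S 0 x + (\<Sum>j<k. D j x)" for k x
    by (induction k) (auto simp: DS[symmetric])
  \<comment> \<open>\<open>lim\<close> has some value even where the partial sums diverge. Since
    these are periodic at every point, \<open>g\<close> is exactly periodic, not merely almost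
    everywhere.\<close>
  define g where "g x = lim (\<lambda>k. S k x)" for x
  have gm [measurable]: "g \<in> borel_measurable borel"
    unfolding g_def by (rule borel_measurable_lim_metric) measurable
  have gper: "periodic L g"
    using trig_periodic unfolding periodic_def g_def S_def by simp
  have lim: "AE x in lborel. x \<in> {0..L} \<longrightarrow> (\<lambda>k. S k x) \<longlonglongrightarrow> g x"
    using AEs
  proof eventually_elim
    case (elim x)
    show ?case
    proof
      assume x: "x \<in> {0..L}"
      then have "summable (\<lambda>k. D k x)" using elim by (intro summable_rabs_cancel[of "\<lambda>k. D k x"]) simp
      then have "(\<lambda>k. \<Sum>j<k. D j x) \<longlonglongrightarrow> (\<Sum>j. D j x)" by (rule summable_LIMSEQ)
      then have "(\<lambda>k. S 0 x + (\<Sum>j<k. D j x)) \<longlonglongrightarrow> S 0 x + (\<Sum>j. D j x)" by (intro tendsto_intros)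
      then have "convergent (\<lambda>k. S k x)" unfolding convergent_def Stel[symmetric] by blast
      then show "(\<lambda>k. S k x) \<longlonglongrightarrow> g x" unfolding g_def by (simp add: convergent_LIMSEQ_iff)
    qed
  qed
  have dom: "AE x in lborel. norm (?i x * S k x) \<le> ?i x * \<bar>S 0 x\<bar> + (\<Sum>k. ?i x * \<bar>D k x\<bar>)" for k
    using AEs
  proof eventually_elim
    case (elim x)
    have "\<bar>S k x\<bar> \<le> \<bar>S 0 x\<bar> + (\<Sum>j<k. \<bar>D j x\<bar>)"
      unfolding Stel[of k] using sum_abs[of "\<lambda>j. D j x" "{..<k}"] by linarith
    then have "?i x * \<bar>S k x\<bar> \<le> ?i x * \<bar>S 0 x\<bar> + (\<Sum>j<k. ?i x * \<bar>D j x\<bar>)"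
      by (auto simp: indicator_def sum_distrib_left)
    moreover have "(\<Sum>j<k. ?i x * \<bar>D j x\<bar>) \<le> (\<Sum>k. ?i x * \<bar>D k x\<bar>)"
      using elim by (intro sum_le_suminf) (auto simp: abs_mult)
    ultimately show ?case by (simp add: abs_mult)
  qed
  have coeff: "fourier_coeff L g \<kappa> = c \<kappa>" for \<kappa>
  proof -
    have "(\<lambda>k. LINT x|lborel. ?i x *\<^sub>R (complex_of_real (S k x) * E \<kappa> x)) \<longlonglongrightarrow> (LINT x|lborel. ?i x *\<^sub>R (complex_of_real (g x) * E \<kappa> x))"
    proof (rule integral_dominated_convergence)
      show "integrable lborel (\<lambda>x. ?i x * \<bar>S 0 x\<bar> + (\<Sum>k. ?i x * \<bar>D k x\<bar>))"
        using iG set_integrable_abs[OF L2_integrable[OF SL2[of 0]]] unfolding set_integrable_def by (intro Bochner_Integration.integrable_add) auto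
      show "AE x in lborel. (\<lambda>k. ?i x *\<^sub>R (complex_of_real (S k x) * E \<kappa> x)) \<longlonglongrightarrow> ?i x *\<^sub>R (complex_of_real (g x) * E \<kappa> x)"
        using lim
      proof eventually_elim
        case (elim x)
        then show ?case by (cases "x \<in> {0..L}") (auto intro!: tendsto_intros)
      qed
      show "AE x in lborel. norm (?i x *\<^sub>R (complex_of_real (S k x) * E \<kappa> x)) \<le> ?i x * \<bar>S 0 x\<bar> + (\<Sum>k. ?i x * \<bar>D k x\<bar>)" for k
        using dom[of k] by eventually_elim (simp add: norm_mult abs_mult)
    qed measurable
    then have "(\<lambda>k. (1 / complex_of_real L) * (LINT x|lborel. ?i x *\<^sub>R (complex_of_real (S k x) * E \<kappa> x)))
       \<longlonglongrightarrow> (1 / complex_of_real L) * (LINT x|lborel. ?i x *\<^sub>R (complex_of_real (g x) * E \<kappa> x))" by (intro tendsto_intros)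
    then have l: "(\<lambda>k. fourier_coeff L (S k) \<kappa>) \<longlonglongrightarrow> fourier_coeff L g \<kappa>"
      unfolding fourier_coeff_def set_lebesgue_integral_def .
    have "eventually (\<lambda>k. fourier_coeff L (S k) \<kappa> = c \<kappa>) sequentially"
    proof (rule eventually_sequentiallyI[of "nat \<bar>\<kappa>\<bar>"])
      fix k assume "nat \<bar>\<kappa>\<bar> \<le> k"
      then have "\<kappa> \<in> K k" unfolding K_def by auto
      then show "fourier_coeff L (S k) \<kappa> = c \<kappa>"
        unfolding S_def using fourier_coeff_trig[where c=c and K="K k" and \<kappa>=\<kappa>, OF c Kf] by simp
    qed
    then show ?thesis using tendsto_unique[OF _ l tendsto_eventually] by auto
  qed
  let ?B = "L * (\<Sum>\<^sub>\<infinity>\<kappa>. (cmod (c \<kappa>))\<^sup>2)"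
  have "(\<integral>\<^sup>+x. ennreal (?i x * (g x)\<^sup>2) \<partial>lborel) = (\<integral>\<^sup>+x. liminf (\<lambda>k. ennreal (?i x * (S k x)\<^sup>2)) \<partial>lborel)"
  proof (rule nn_integral_cong_AE)
    show "AE x in lborel. ennreal (?i x * (g x)\<^sup>2) = liminf (\<lambda>k. ennreal (?i x * (S k x)\<^sup>2))"
      using lim
    proof eventually_elim
      case (elim x)
      then have "(\<lambda>k. ennreal (?i x * (S k x)\<^sup>2)) \<longlonglongrightarrow> ennreal (?i x * (g x)\<^sup>2)"
        by (cases "x \<in> {0..L}") (auto intro!: tendsto_intros)
      then show ?case by (metis lim_imp_Liminf trivial_limit_sequentially)
    qed
  qed
  also have "\<dots> \<le> liminf (\<lambda>k. \<integral>\<^sup>+x. ennreal (?i x * (S k x)\<^sup>2) \<partial>lborel)"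
    by (rule nn_integral_liminf) measurable
  also have "\<dots> \<le> liminf (\<lambda>k::nat. ennreal ?B)"
  proof (intro Liminf_mono always_eventually allI)
    fix k
    have "(\<integral>\<^sup>+x. ennreal (?i x * (S k x)\<^sup>2) \<partial>lborel) = ennreal (LINT x|lborel. ?i x * (S k x)\<^sup>2)"
      using L2_perD(3)[OF SL2[of k]] unfolding set_integrable_def by (intro nn_integral_eq_integral) auto
    also have "(LINT x|lborel. ?i x * (S k x)\<^sup>2) = inner_per L (S k) (S k)"
      unfolding inner_per_def set_lebesgue_integral_def by (simp add: power2_eq_square)
    also have "\<dots> = L * sum ?f (K k)" unfolding S_def by (intro inner_trig_self c Kf)
    also have "ennreal \<dots> \<le> ennreal ?B"
      using L_pos Kf s by (intro ennreal_leI mult_left_mono finite_sum_le_infsum) auto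
    finally show "(\<integral>\<^sup>+x. ennreal (?i x * (S k x)\<^sup>2) \<partial>lborel) \<le> ennreal ?B" .
  qed
  also have "\<dots> = ennreal ?B" by (simp add: Liminf_const)
  finally have fatou: "(\<integral>\<^sup>+x. ennreal (?i x * (g x)\<^sup>2) \<partial>lborel) \<le> ennreal ?B" .
  have gi: "integrable lborel (\<lambda>x. ?i x * (g x)\<^sup>2)"
  proof (rule integrableI_nonneg)
    show "(\<integral>\<^sup>+x. ennreal (?i x * (g x)\<^sup>2) \<partial>lborel) < \<infinity>" 
      by (rule order_le_less_trans[OF fatou]) simp
  qed (auto simp: indicator_def)
  have "ennreal (LINT x|lborel. ?i x * (g x)\<^sup>2) \<le> ennreal ?B"
    using fatou nn_integral_eq_integral[OF gi] by (simp add: indicator_def)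
  moreover have "?B \<ge> 0" using L_pos by (intro mult_nonneg_nonneg infsum_nonneg) auto
  ultimately have "(LINT x|lborel. ?i x * (g x)\<^sup>2) \<le> ?B" by (simp add: ennreal_le_iff)
  then have "inner_per L g g \<le> ?B"
    unfolding inner_per_def set_lebesgue_integral_def by (simp add: power2_eq_square)
  moreover have "g \<in> L2_per L"
    using gi gper unfolding L2_per_def set_integrable_def by simp
  ultimately show ?thesis using that coeff by blast
qed

section \<open>Parseval's identity\<close>

lemma fourier_coeff_summable:
  assumes g: "g \<in> L2_per L" shows "(\<lambda>\<kappa>. (cmod (fourier_coeff L g \<kappa>))\<^sup>2) summable_on UNIV"
proof (rule nonneg_bdd_above_summable_on)
  show "bdd_above (sum (\<lambda>\<kappa>. (cmod (fourier_coeff L g \<kappa>))\<^sup>2) ` {F. F \<subseteq> UNIV \<and> finite F})"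
  proof (rule bdd_aboveI2)
    fix F :: "int set" assume "F \<in> {F. F \<subseteq> UNIV \<and> finite F}"
    then have "L * (\<Sum>\<kappa>\<in>F. (cmod (fourier_coeff L g \<kappa>))\<^sup>2) \<le> inner_per L g g" by (intro bessel g) auto
    then show "(\<Sum>\<kappa>\<in>F. (cmod (fourier_coeff L g \<kappa>))\<^sup>2) \<le> inner_per L g g / L"
      using L_pos by (simp add: field_simps)
  qed
qed simp

text \<open>Bessel's inequality gives one direction. For the other, the function that
  \<open>riesz_fischer\<close> builds from the coefficients of \<open>g\<close> equals
  \<open>g\<close> almost everywhere by uniqueness and comes with the upper bound on its
  norm.\<close>

theorem parseval_norm:
  assumes g: "g \<in> L2_per L"
  shows "inner_per L g g = L * (\<Sum>\<^sub>\<infinity>\<kappa>. (cmod (fourier_coeff L g \<kappa>))\<^sup>2)"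
proof (rule antisym)
  obtain g' where g': "g' \<in> L2_per L" "\<And>\<kappa>. fourier_coeff L g' \<kappa> = fourier_coeff L g \<kappa>"
    "inner_per L g' g' \<le> L * (\<Sum>\<^sub>\<infinity>\<kappa>. (cmod (fourier_coeff L g \<kappa>))\<^sup>2)"
    by (rule riesz_fischer[of "fourier_coeff L g", OF fourier_coeff_uminus fourier_coeff_summable[OF g]]) blast
  have "AE x in lborel. g x = g' x" using g'(2) by (intro fourier_coeff_inject g g'(1)) auto
  then have "inner_per L g g = inner_per L g' g'"
    using L2_perD(1)[OF g] L2_perD(1)[OF g'(1)] by (intro inner_per_cong_AE)
  then show "inner_per L g g \<le> L * (\<Sum>\<^sub>\<infinity>\<kappa>. (cmod (fourier_coeff L g \<kappa>))\<^sup>2)" using g'(3) by simp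
  have "(\<Sum>\<^sub>\<infinity>\<kappa>. (cmod (fourier_coeff L g \<kappa>))\<^sup>2) \<le> inner_per L g g / L"
  proof (rule infsum_le_finite_sums[OF fourier_coeff_summable[OF g]])
    fix F :: "int set" assume "finite F"
    from bessel[OF g this] show "(\<Sum>\<kappa>\<in>F. (cmod (fourier_coeff L g \<kappa>))\<^sup>2) \<le> inner_per L g g / L"
      using L_pos by (simp add: field_simps)
  qed
  then show "L * (\<Sum>\<^sub>\<infinity>\<kappa>. (cmod (fourier_coeff L g \<kappa>))\<^sup>2) \<le> inner_per L g g"
    using L_pos by (simp add: field_simps)
qed

end

section \<open>Symmetric bilinear forms on spaces of functions\<close>

text \<open>The degenerate case \<open>c = 0\<close> is included so that Cauchy-Schwarz holds for
  forms that are only semidefinite; it is used below at vectors on which the form vanishes.\<close>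

lemma quadratic_nonneg_discriminant:
  fixes a b c :: real
  assumes "\<And>t. 0 \<le> a + 2 * t * b + t\<^sup>2 * c"
  shows "b\<^sup>2 \<le> a * c"
proof (cases "c = 0")
  case True
  have "b = 0"
  proof (rule ccontr)
    assume "b \<noteq> 0"
    \<comment> \<open>At this argument the affine function has the value -1.\<close>
    then show False using assms[of "- (a + 1) / (2 * b)"] True by (simp add: field_simps)
  qed
  then show ?thesis using True by simp
next
  case False
  have "c > 0"
  proof (rule ccontr)
    assume "\<not> c > 0"
    then have c: "c < 0" using False by simp
    \<comment> \<open>For such \<open>t\<close> the leading term is at most
      \<open>- t * (\<bar>a\<bar> + 2 * \<bar>b\<bar> + 1)\<close> and outweighs the other
      two.\<close>
    define t where "t = max 1 ((\<bar>a\<bar> + 2 * \<bar>b\<bar> + 1) / (- c))"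
    have t: "t \<ge> 1" "t * (- c) \<ge> \<bar>a\<bar> + 2 * \<bar>b\<bar> + 1"
      using c unfolding t_def by (auto simp: field_simps max_def)
    have "t * (t * (- c)) \<ge> t * (\<bar>a\<bar> + 2 * \<bar>b\<bar> + 1)" using t by (intro mult_left_mono) auto
    moreover have "t * \<bar>a\<bar> \<ge> \<bar>a\<bar>" using t mult_right_mono[of 1 t "\<bar>a\<bar>"] by simp
    moreover have "t * b \<le> t * \<bar>b\<bar>" using t by (intro mult_left_mono) auto
    moreover have "t * (\<bar>a\<bar> + 2 * \<bar>b\<bar> + 1) = t * \<bar>a\<bar> + 2 * (t * \<bar>b\<bar>) + t" by (simp add: algebra_simps)
    moreover have "t\<^sup>2 * c = - (t * (t * (- c)))" "2 * t * b = 2 * (t * b)" by (simp_all add: power2_eq_square)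
    ultimately show False using assms[of t] t(1) abs_ge_self[of a] by linarith
  qed
  then show ?thesis using assms[of "- b / c"] by (simp add: field_simps power2_eq_square)
qed

text \<open>One interface for the L2 product, the Sobolev products and the indefinite form
  \<open>Q\<close>: no sign is built in, and lemmas that need positivity take it as a premise. The
  carrier can be cut down to a subspace on which the form is nonnegative.\<close>

locale sym_form =
  fixes V :: "(real \<Rightarrow> real) set" and B :: "(real \<Rightarrow> real) \<Rightarrow> (real \<Rightarrow> real) \<Rightarrow> real"
  assumes add_closed: "u \<in> V \<Longrightarrow> v \<in> V \<Longrightarrow> (\<lambda>x. u x + v x) \<in> V"
    and scale_closed: "u \<in> V \<Longrightarrow> (\<lambda>x. c * u x) \<in> V"
    and commute: "u \<in> V \<Longrightarrow> v \<in> V \<Longrightarrow> B u v = B v u"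
    and add_left: "u \<in> V \<Longrightarrow> v \<in> V \<Longrightarrow> w \<in> V \<Longrightarrow> B (\<lambda>x. u x + v x) w = B u w + B v w"
    and scale_left: "u \<in> V \<Longrightarrow> w \<in> V \<Longrightarrow> B (\<lambda>x. c * u x) w = c * B u w"
begin

lemma add_right: "u \<in> V \<Longrightarrow> v \<in> V \<Longrightarrow> w \<in> V \<Longrightarrow> B w (\<lambda>x. u x + v x) = B w u + B w v"
  by (simp add: commute[of w] add_left add_closed)

lemma scale_right: "u \<in> V \<Longrightarrow> w \<in> V \<Longrightarrow> B w (\<lambda>x. c * u x) = c * B w u"
  by (simp add: commute[of w] scale_left scale_closed)

lemma diff_closed: "u \<in> V \<Longrightarrow> v \<in> V \<Longrightarrow> (\<lambda>x. u x - v x) \<in> V"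
  using add_closed[OF _ scale_closed[of v "-1"], of u] by simp

lemma diff_left: "u \<in> V \<Longrightarrow> v \<in> V \<Longrightarrow> w \<in> V \<Longrightarrow> B (\<lambda>x. u x - v x) w = B u w - B v w"
  using add_left[OF _ scale_closed[of v "-1"], of u w] scale_left[of v w "-1"] by simp

lemma diff_right: "u \<in> V \<Longrightarrow> v \<in> V \<Longrightarrow> w \<in> V \<Longrightarrow> B w (\<lambda>x. u x - v x) = B w u - B w v"
  by (simp add: commute[of w] diff_left diff_closed)

lemma lincomb_closed: "u \<in> V \<Longrightarrow> v \<in> V \<Longrightarrow> (\<lambda>x. u x + t * v x) \<in> V"
  by (intro add_closed scale_closed)

lemma lincomb_left: "u \<in> V \<Longrightarrow> v \<in> V \<Longrightarrow> w \<in> V \<Longrightarrow> B (\<lambda>x. u x + t * v x) w = B u w + t * B v w"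
  by (simp add: add_left scale_closed scale_left)

lemma lincomb_right: "u \<in> V \<Longrightarrow> v \<in> V \<Longrightarrow> w \<in> V \<Longrightarrow> B w (\<lambda>x. u x + t * v x) = B w u + t * B w v"
  by (simp add: add_right scale_closed scale_right)

lemma expand: "u \<in> V \<Longrightarrow> v \<in> V \<Longrightarrow>
    B (\<lambda>x. u x + t * v x) (\<lambda>x. u x + t * v x) = B u u + 2 * t * B u v + t\<^sup>2 * B v v"
  using commute[of u v] by (simp add: lincomb_left lincomb_right lincomb_closed power2_eq_square algebra_simps)

lemma Cauchy_Schwarz:
  assumes "u \<in> V" "v \<in> V" and "\<And>u. u \<in> V \<Longrightarrow> 0 \<le> B u u"
  shows "(B u v)\<^sup>2 \<le> B u u * B v v"
  using assms by (intro quadratic_nonneg_discriminant) (simp add: expand[symmetric] lincomb_closed)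

lemma Cauchy_Schwarz_abs:
  assumes "u \<in> V" "v \<in> V" and "\<And>u. u \<in> V \<Longrightarrow> 0 \<le> B u u"
  shows "\<bar>B u v\<bar> \<le> sqrt (B u u) * sqrt (B v v)"
  using Cauchy_Schwarz[OF assms] by (metis real_sqrt_abs real_sqrt_le_iff real_sqrt_mult)

lemma triangle:
  assumes "u \<in> V" "v \<in> V" and nn: "\<And>u. u \<in> V \<Longrightarrow> 0 \<le> B u u"
  shows "sqrt (B (\<lambda>x. u x + v x) (\<lambda>x. u x + v x)) \<le> sqrt (B u u) + sqrt (B v v)"
proof (rule real_le_lsqrt)
  have "B (\<lambda>x. u x + v x) (\<lambda>x. u x + v x) = B u u + 2 * B u v + B v v"
    using expand[of u v 1] assms by simp
  also have "\<dots> \<le> B u u + 2 * (sqrt (B u u) * sqrt (B v v)) + B v v"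
    using Cauchy_Schwarz_abs[OF assms] by linarith
  also have "\<dots> = (sqrt (B u u) + sqrt (B v v))\<^sup>2"
    using assms by (simp add: power2_sum)
  finally show "B (\<lambda>x. u x + v x) (\<lambda>x. u x + v x) \<le> (sqrt (B u u) + sqrt (B v v))\<^sup>2" .
qed (use assms in simp)

lemma polarization:
  assumes "u \<in> V" "v \<in> V"
  shows "B u v = (B (\<lambda>x. u x + v x) (\<lambda>x. u x + v x) - B u u - B v v) / 2"
  using expand[of u v 1] assms by simp

end

section \<open>Fourier multiplier forms and Sobolev spaces\<close>

definition wt :: "real \<Rightarrow> int \<Rightarrow> real" where
  "wt s \<kappa> = (1 + (of_int \<kappa>)\<^sup>2) powr s"

lemma wt_pos: "wt s \<kappa> > 0"
  unfolding wt_def by (smt (verit) powr_gt_zero zero_le_power2)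

lemma wt_0 [simp]: "wt 0 \<kappa> = 1"
  unfolding wt_def by (smt (verit) powr_zero_eq_one zero_le_power2)

lemma wt_mono: "s \<le> t \<Longrightarrow> wt s \<kappa> \<le> wt t \<kappa>"
  unfolding wt_def by (intro powr_mono) auto

lemma wt_ge_1: "0 \<le> s \<Longrightarrow> 1 \<le> wt s \<kappa>"
  using wt_mono[of 0 s \<kappa>] by simp

lemma wt_add: "wt (s + t) \<kappa> = wt s \<kappa> * wt t \<kappa>"
  unfolding wt_def by (rule powr_add)

lemma wt_half: "wt m \<kappa> = (wt (m/2) \<kappa>)\<^sup>2"
  using wt_add[of "m/2" "m/2" \<kappa>] by (simp add: power2_eq_square)

text \<open>The growth condition controls large frequencies only; on the remaining compact interval
  continuity bounds the symbol, and the lower estimate absorbs this range into the additive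
  constant.\<close>

lemma symbol_cond_bounds:
  assumes "symbol_cond \<theta> m"
  obtains c C where "c > 0" "C > 0" "\<And>\<kappa>::int. \<bar>\<theta> (of_int \<kappa>)\<bar> \<le> C * wt (m/2) \<kappa>"
    "\<And>\<kappa>::int. c * wt (m/2) \<kappa> - C \<le> \<theta> (of_int \<kappa>)"
proof -
  obtain v1 v2 k0 where v: "v1 > 0" "v2 > 0" "m > 0" "continuous_on UNIV \<theta>" and
    b: "\<And>\<kappa>. \<bar>\<kappa>\<bar> \<ge> k0 \<Longrightarrow> v1 * \<bar>\<kappa>\<bar> powr m \<le> \<theta> \<kappa> \<and> \<theta> \<kappa> \<le> v2 * \<bar>\<kappa>\<bar> powr m"
    using assms unfolding symbol_cond_def by blast
  \<comment> \<open>The cut-off is at least 1 so that beyond it \<kappa>^2 dominates (1 +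
    \<kappa>^2)/2; this comparison is the origin of the factor \<open>(1/2) powr (m/2)\<close> in
    \<open>c\<close>.\<close>
  define k1 where "k1 = max k0 1"
  have "compact (\<theta> ` {-k1..k1})" by (intro compact_continuous_image continuous_on_subset[OF v(4)]) auto
  then obtain C0 where C0: "\<forall>x\<in>{-k1..k1}. \<bar>\<theta> x\<bar> \<le> C0"
    using compact_imp_bounded[of "\<theta> ` {-k1..k1}"] unfolding bounded_iff by auto
  have "k1 \<ge> 1" unfolding k1_def by simp
  then have C0': "C0 \<ge> 0" using C0[rule_format, of 0] by auto
  define c where "c = v1 * (1/2) powr (m/2)"
  \<comment> \<open>The bound on low frequencies, the upper growth constant, and the largest value
    of \<open>c * wt (m/2) \<kappa>\<close> below the cut-off.\<close>
  define C where "C = C0 + v2 + c * (1 + k1\<^sup>2) powr (m/2)"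
  have c: "c > 0" unfolding c_def using v by simp
  have k2: "(1 + k1\<^sup>2) powr (m/2) \<ge> 1" using v by (intro ge_one_powr_ge_zero) auto
  then have cC: "c * (1 + k1\<^sup>2) powr (m/2) > 0" using c by (intro mult_pos_pos) linarith+
  have C: "C > 0" "C0 \<le> C" "v2 \<le> C" unfolding C_def using C0' v cC by auto
  have "\<bar>\<theta> (of_int \<kappa>)\<bar> \<le> C * wt (m/2) \<kappa> \<and> c * wt (m/2) \<kappa> - C \<le> \<theta> (of_int \<kappa>)" for \<kappa> :: int
  proof (cases "\<bar>real_of_int \<kappa>\<bar> \<le> k1")
    case True
    then have 1: "\<bar>\<theta> (of_int \<kappa>)\<bar> \<le> C0" by (intro C0[rule_format]) auto
    have "C0 * 1 \<le> C * wt (m/2) \<kappa>" using C C0' wt_ge_1[of "m/2" \<kappa>] v by (intro mult_mono) auto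
    moreover have "c * wt (m/2) \<kappa> \<le> c * (1 + k1\<^sup>2) powr (m/2)"
      using c True v unfolding wt_def by (intro mult_left_mono powr_mono2 add_left_mono) (auto simp: abs_le_square_iff[symmetric] k1_def)
    ultimately show ?thesis using 1 v unfolding C_def by auto
  next
    case False
    then have k: "\<bar>real_of_int \<kappa>\<bar> \<ge> k0" "\<bar>real_of_int \<kappa>\<bar> \<ge> 1" unfolding k1_def by auto
    have pm: "\<bar>real_of_int \<kappa>\<bar> powr m = ((of_int \<kappa>)\<^sup>2) powr (m/2)"
    proof -
      have "((of_int \<kappa>)\<^sup>2) powr (m/2) = (\<bar>real_of_int \<kappa>\<bar> powr 2) powr (m/2)" using k by (simp add: powr_numeral)
      also have "\<dots> = \<bar>real_of_int \<kappa>\<bar> powr m" by (simp only: powr_powr) simp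
      finally show ?thesis by simp
    qed
    have up: "\<bar>real_of_int \<kappa>\<bar> powr m \<le> wt (m/2) \<kappa>"
      unfolding pm wt_def using v by (intro powr_mono2) auto
    have "(1/2) powr (m/2) * wt (m/2) \<kappa> = ((1 + (of_int \<kappa>)\<^sup>2) / 2) powr (m/2)"
      unfolding wt_def by (simp add: powr_mult[symmetric])
    also have "\<dots> \<le> ((of_int \<kappa>)\<^sup>2) powr (m/2)"
    proof (intro powr_mono2)
      have "1 \<le> (real_of_int \<kappa>)\<^sup>2" using k(2) by (metis one_le_power power2_abs)
      then show "(1 + (real_of_int \<kappa>)\<^sup>2) / 2 \<le> (real_of_int \<kappa>)\<^sup>2" by simp
    qed (use v in auto)
    finally have lo: "(1/2) powr (m/2) * wt (m/2) \<kappa> \<le> \<bar>real_of_int \<kappa>\<bar> powr m" unfolding pm .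
    have "c * wt (m/2) \<kappa> \<le> v1 * \<bar>real_of_int \<kappa>\<bar> powr m"
      unfolding c_def using mult_left_mono[OF lo, of v1] v by (simp add: mult.assoc)
    then have l: "c * wt (m/2) \<kappa> \<le> \<theta> (of_int \<kappa>)" using b[OF k(1)] by linarith
    have "v2 * \<bar>real_of_int \<kappa>\<bar> powr m \<le> C * wt (m/2) \<kappa>" using up v C by (intro mult_mono) auto
    then have u: "\<theta> (of_int \<kappa>) \<le> C * wt (m/2) \<kappa>" using b[OF k(1)] by linarith
    have "0 < c * wt (m/2) \<kappa>" using c wt_pos by simp
    then show ?thesis using l u C by linarith
  qed
  then show ?thesis using that[OF c C(1)] by blast
qed

section \<open>Bilinear forms that are diagonal in the Fourier basis\<close>

context period
begin

text \<open>For \<open>a = wt s\<close> this is the inner product of H^s, for \<open>a = 1\<close>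
  that of L2, and for the symbol \<theta> on the integers the form of \<open>M\<close> on its form
  domain.\<close>

definition mform :: "(int \<Rightarrow> real) \<Rightarrow> (real \<Rightarrow> real) \<Rightarrow> (real \<Rightarrow> real) \<Rightarrow> real" where
  "mform a u v = L * (\<Sum>\<^sub>\<infinity>\<kappa>. a \<kappa> * Re (fourier_coeff L u \<kappa> * cnj (fourier_coeff L v \<kappa>)))"

lemma mform_self: "mform a u u = L * (\<Sum>\<^sub>\<infinity>\<kappa>. a \<kappa> * (cmod (fourier_coeff L u \<kappa>))\<^sup>2)"
  unfolding mform_def Re_mult_cnj_self ..

lemma sobolev_L2: "u \<in> sobolev_per L s \<Longrightarrow> u \<in> L2_per L"
  unfolding sobolev_per_def by auto

lemma sobolev_iff:
  "u \<in> sobolev_per L s \<longleftrightarrow> u \<in> L2_per L \<and> (\<lambda>\<kappa>. wt s \<kappa> * (cmod (fourier_coeff L u \<kappa>))\<^sup>2) summable_on UNIV"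
  unfolding sobolev_per_def wt_def by auto

lemma sobolev_summable:
  "u \<in> sobolev_per L s \<Longrightarrow> (\<lambda>\<kappa>. wt s \<kappa> * (cmod (fourier_coeff L u \<kappa>))\<^sup>2) summable_on UNIV"
  unfolding sobolev_iff by auto

lemma summable_on_dominated:
  fixes f g :: "int \<Rightarrow> real"
  assumes "g summable_on UNIV" "\<And>x. \<bar>f x\<bar> \<le> g x"
  shows "f summable_on UNIV"
proof -
  have "(\<lambda>x. norm (g x)) summable_on UNIV"
    using assms(1) order_trans[OF abs_ge_zero assms(2)] by simp
  then have "(\<lambda>x. norm (f x)) summable_on UNIV"
    by (rule Infinite_Sum.abs_summable_on_comparison_test) (use order_trans[OF assms(2) abs_ge_self] in auto)
  then show ?thesis by (rule abs_summable_summable)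
qed

lemma mform_summable:
  assumes u: "u \<in> sobolev_per L s" and v: "v \<in> sobolev_per L s" and a: "\<And>\<kappa>. \<bar>a \<kappa>\<bar> \<le> C * wt s \<kappa>"
  shows "(\<lambda>\<kappa>. a \<kappa> * Re (fourier_coeff L u \<kappa> * cnj (fourier_coeff L v \<kappa>))) summable_on UNIV"
proof (rule summable_on_dominated)
  let ?U = "\<lambda>\<kappa>. cmod (fourier_coeff L u \<kappa>)" and ?V = "\<lambda>\<kappa>. cmod (fourier_coeff L v \<kappa>)"
  show "(\<lambda>\<kappa>. C * (wt s \<kappa> * (?U \<kappa>)\<^sup>2 + wt s \<kappa> * (?V \<kappa>)\<^sup>2)) summable_on UNIV"
    by (intro summable_on_cmult_right summable_on_add sobolev_summable u v)
  fix \<kappa>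
  have "\<bar>Re (fourier_coeff L u \<kappa> * cnj (fourier_coeff L v \<kappa>))\<bar> \<le> ?U \<kappa> * ?V \<kappa>"
    using abs_Re_le_cmod[of "fourier_coeff L u \<kappa> * cnj (fourier_coeff L v \<kappa>)"] by (simp only: norm_mult complex_mod_cnj)
  also have "\<dots> \<le> (?U \<kappa>)\<^sup>2 + (?V \<kappa>)\<^sup>2"
    using sum_squares_bound[of "?U \<kappa>" "?V \<kappa>"] mult_nonneg_nonneg[OF norm_ge_zero norm_ge_zero, of "fourier_coeff L u \<kappa>" "fourier_coeff L v \<kappa>"] by linarith
  finally have 1: "\<bar>Re (fourier_coeff L u \<kappa> * cnj (fourier_coeff L v \<kappa>))\<bar> \<le> (?U \<kappa>)\<^sup>2 + (?V \<kappa>)\<^sup>2" .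
  have "0 \<le> C * wt s \<kappa>" using a[of \<kappa>] abs_ge_zero order_trans by blast
  then have "\<bar>a \<kappa>\<bar> * \<bar>Re (fourier_coeff L u \<kappa> * cnj (fourier_coeff L v \<kappa>))\<bar> \<le> (C * wt s \<kappa>) * ((?U \<kappa>)\<^sup>2 + (?V \<kappa>)\<^sup>2)"
    using 1 a by (intro mult_mono) auto
  then show "\<bar>a \<kappa> * Re (fourier_coeff L u \<kappa> * cnj (fourier_coeff L v \<kappa>))\<bar> \<le> C * (wt s \<kappa> * (?U \<kappa>)\<^sup>2 + wt s \<kappa> * (?V \<kappa>)\<^sup>2)"
    unfolding abs_mult by (simp only: ring_distribs mult.assoc)
qed

lemma mform_self_summable:
  assumes u: "u \<in> sobolev_per L s" and a: "\<And>\<kappa>. \<bar>a \<kappa>\<bar> \<le> C * wt s \<kappa>"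
  shows "(\<lambda>\<kappa>. a \<kappa> * (cmod (fourier_coeff L u \<kappa>))\<^sup>2) summable_on UNIV"
  using mform_summable[OF u u a] unfolding Re_mult_cnj_self .

lemma Re_of_real_mult: "Re (complex_of_real c * z) = c * Re z"
  by simp

lemma L2_coeff_add:
  "u \<in> L2_per L \<Longrightarrow> v \<in> L2_per L \<Longrightarrow> fourier_coeff L (\<lambda>x. u x + v x) \<kappa> = fourier_coeff L u \<kappa> + fourier_coeff L v \<kappa>"
  by (intro fourier_coeff_add L2_integrable)

lemma L2_coeff_diff:
  "u \<in> L2_per L \<Longrightarrow> v \<in> L2_per L \<Longrightarrow> fourier_coeff L (\<lambda>x. u x - v x) \<kappa> = fourier_coeff L u \<kappa> - fourier_coeff L v \<kappa>"
  by (intro fourier_coeff_diff L2_integrable)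

lemma cmod_add_sq_le: "(cmod (x + y))\<^sup>2 \<le> 2 * (cmod x)\<^sup>2 + 2 * (cmod y)\<^sup>2"
proof -
  have "(cmod (x + y))\<^sup>2 \<le> (cmod x + cmod y)\<^sup>2" by (intro power_mono norm_triangle_ineq) auto
  also have "\<dots> \<le> 2 * (cmod x)\<^sup>2 + 2 * (cmod y)\<^sup>2" using sum_squares_bound[of "cmod x" "cmod y"] by (simp add: power2_sum)
  finally show ?thesis .
qed

lemma sobolev_add:
  assumes u: "u \<in> sobolev_per L s" and v: "v \<in> sobolev_per L s"
  shows "(\<lambda>x. u x + v x) \<in> sobolev_per L s"
proof -
  have "(\<lambda>\<kappa>. wt s \<kappa> * (cmod (fourier_coeff L (\<lambda>x. u x + v x) \<kappa>))\<^sup>2) summable_on UNIV"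
  proof (rule summable_on_dominated)
    let ?U = "\<lambda>\<kappa>. wt s \<kappa> * (cmod (fourier_coeff L u \<kappa>))\<^sup>2" and ?V = "\<lambda>\<kappa>. wt s \<kappa> * (cmod (fourier_coeff L v \<kappa>))\<^sup>2"
    show "(\<lambda>\<kappa>. 2 * ?U \<kappa> + 2 * ?V \<kappa>) summable_on UNIV"
      by (intro summable_on_cmult_right summable_on_add sobolev_summable u v)
    fix \<kappa>
    have "wt s \<kappa> * (cmod (fourier_coeff L u \<kappa> + fourier_coeff L v \<kappa>))\<^sup>2 \<le>
      wt s \<kappa> * (2 * (cmod (fourier_coeff L u \<kappa>))\<^sup>2 + 2 * (cmod (fourier_coeff L v \<kappa>))\<^sup>2)"
      by (intro mult_left_mono cmod_add_sq_le less_imp_le wt_pos)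
    then show "\<bar>wt s \<kappa> * (cmod (fourier_coeff L (\<lambda>x. u x + v x) \<kappa>))\<^sup>2\<bar> \<le> 2 * ?U \<kappa> + 2 * ?V \<kappa>"
      using wt_pos[of s \<kappa>] by (simp add: L2_coeff_add sobolev_L2[OF u] sobolev_L2[OF v] abs_mult algebra_simps)
  qed
  then show ?thesis unfolding sobolev_iff using L2_add u v sobolev_L2 by blast
qed

lemma sobolev_scale:
  assumes u: "u \<in> sobolev_per L s" shows "(\<lambda>x. c * u x) \<in> sobolev_per L s"
proof -
  have "(\<lambda>\<kappa>. c\<^sup>2 * (wt s \<kappa> * (cmod (fourier_coeff L u \<kappa>))\<^sup>2)) summable_on UNIV"
    by (intro summable_on_cmult_right sobolev_summable u)
  then show ?thesis unfolding sobolev_iff using L2_scale[OF sobolev_L2[OF u]]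
    by (simp add: fourier_coeff_scale norm_mult power_mult_distrib algebra_simps)
qed

lemma mform_sym_form:
  assumes a: "\<And>\<kappa>. \<bar>a \<kappa>\<bar> \<le> C * wt s \<kappa>"
  shows "sym_form (sobolev_per L s) (mform a)"
proof
  fix u v w c
  assume u: "u \<in> sobolev_per L s"
  show "(\<lambda>x. c * u x) \<in> sobolev_per L s" using u by (rule sobolev_scale)
  show "mform a (\<lambda>x. c * u x) w = c * mform a u w"
  proof -
    have "mform a (\<lambda>x. c * u x) w = L * (\<Sum>\<^sub>\<infinity>\<kappa>. c * (a \<kappa> * Re (fourier_coeff L u \<kappa> * cnj (fourier_coeff L w \<kappa>))))"
      unfolding mform_def fourier_coeff_scale by (simp only: mult.assoc Re_of_real_mult mult.left_commute)
    also have "\<dots> = c * mform a u w" unfolding infsum_cmult_right' mform_def by simp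
    finally show ?thesis .
  qed
  assume v: "v \<in> sobolev_per L s"
  show "(\<lambda>x. u x + v x) \<in> sobolev_per L s" using u v by (rule sobolev_add)
  have "Re (fourier_coeff L u \<kappa> * cnj (fourier_coeff L v \<kappa>)) = Re (fourier_coeff L v \<kappa> * cnj (fourier_coeff L u \<kappa>))" for \<kappa>
    by simp
  then show "mform a u v = mform a v u" unfolding mform_def by presburger
  assume w: "w \<in> sobolev_per L s"
  have "mform a (\<lambda>x. u x + v x) w = L * (\<Sum>\<^sub>\<infinity>\<kappa>. a \<kappa> * Re (fourier_coeff L u \<kappa> * cnj (fourier_coeff L w \<kappa>))
       + a \<kappa> * Re (fourier_coeff L v \<kappa> * cnj (fourier_coeff L w \<kappa>)))"
    unfolding mform_def L2_coeff_add[OF sobolev_L2[OF u] sobolev_L2[OF v]]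
    by (simp only: distrib_right plus_complex.sel distrib_left)
  also have "\<dots> = mform a u w + mform a v w"
    unfolding infsum_add[OF mform_summable[OF u w a] mform_summable[OF v w a]] mform_def by (rule distrib_left)
  finally show "mform a (\<lambda>x. u x + v x) w = mform a u w + mform a v w" .
qed

lemma mform_mono:
  assumes u: "u \<in> sobolev_per L s" and a: "\<And>\<kappa>. \<bar>a \<kappa>\<bar> \<le> C * wt s \<kappa>" and b: "\<And>\<kappa>. \<bar>b \<kappa>\<bar> \<le> C' * wt s \<kappa>"
    and le: "\<And>\<kappa>. a \<kappa> \<le> b \<kappa>"
  shows "mform a u u \<le> mform b u u"
  unfolding mform_self using L_pos le
  by (intro mult_left_mono infsum_mono mform_self_summable[OF u a] mform_self_summable[OF u b] mult_right_mono) auto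

lemma mform_lincomb:
  assumes u: "u \<in> sobolev_per L s" and a: "\<And>\<kappa>. \<bar>a \<kappa>\<bar> \<le> C * wt s \<kappa>" and b: "\<And>\<kappa>. \<bar>b \<kappa>\<bar> \<le> C' * wt s \<kappa>"
  shows "mform (\<lambda>\<kappa>. x * a \<kappa> + y * b \<kappa>) u u = x * mform a u u + y * mform b u u"
proof -
  have "mform (\<lambda>\<kappa>. x * a \<kappa> + y * b \<kappa>) u u =
     L * (\<Sum>\<^sub>\<infinity>\<kappa>. x * (a \<kappa> * (cmod (fourier_coeff L u \<kappa>))\<^sup>2) + y * (b \<kappa> * (cmod (fourier_coeff L u \<kappa>))\<^sup>2))"
    unfolding mform_self by (simp only: distrib_right mult.assoc)
  also have "\<dots> = x * mform a u u + y * mform b u u"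
    unfolding mform_self infsum_add[OF summable_on_cmult_right[OF mform_self_summable[OF u a]]
      summable_on_cmult_right[OF mform_self_summable[OF u b]]] infsum_cmult_right' by (simp add: algebra_simps)
  finally show ?thesis .
qed

lemma mform_nonneg: "(\<And>\<kappa>. a \<kappa> \<ge> 0) \<Longrightarrow> mform a u u \<ge> 0"
  unfolding mform_self using L_pos by (intro mult_nonneg_nonneg infsum_nonneg) auto

lemma sobolev_norm_mform: "sobolev_norm L s u = sqrt (mform (wt s) u u)"
  unfolding sobolev_norm_def mform_self wt_def ..

lemma sobolev_norm_sq: "(sobolev_norm L s u)\<^sup>2 = mform (wt s) u u"
  unfolding sobolev_norm_mform using mform_nonneg[of "wt s" u] wt_pos by (simp add: less_imp_le)

lemma sobolev_norm_nonneg: "0 \<le> sobolev_norm L s u"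
  unfolding sobolev_norm_mform using mform_nonneg[of "wt s" u] wt_pos by (simp add: less_imp_le)

lemma wt_abs: "\<bar>wt s \<kappa>\<bar> \<le> 1 * wt s \<kappa>"
  using wt_pos[of s \<kappa>] by simp

lemma sobolev_sym_form: "sym_form (sobolev_per L s) (mform (wt s))"
  by (rule mform_sym_form[OF wt_abs])

lemma sobolev_norm_triangle:
  assumes "u \<in> sobolev_per L s" "v \<in> sobolev_per L s"
  shows "sobolev_norm L s (\<lambda>x. u x + v x) \<le> sobolev_norm L s u + sobolev_norm L s v"
  unfolding sobolev_norm_mform
  by (intro sym_form.triangle[OF sobolev_sym_form] assms mform_nonneg less_imp_le wt_pos)

lemma sobolev_norm_scale: "sobolev_norm L s (\<lambda>x. c * u x) = \<bar>c\<bar> * sobolev_norm L s u"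
proof -
  have "mform (wt s) (\<lambda>x. c * u x) (\<lambda>x. c * u x) = c\<^sup>2 * mform (wt s) u u"
    unfolding mform_self fourier_coeff_scale norm_mult power_mult_distrib
    by (simp add: mult.left_commute[of _ "c\<^sup>2"] infsum_cmult_right')
  then show ?thesis unfolding sobolev_norm_mform by (simp add: real_sqrt_mult)
qed

lemma sobolev_norm_minus_commute: "sobolev_norm L s (\<lambda>x. u x - v x) = sobolev_norm L s (\<lambda>x. v x - u x)"
  using sobolev_norm_scale[of s "-1" "\<lambda>x. v x - u x"] by simp

lemma sobolev_diff:
  "u \<in> sobolev_per L s \<Longrightarrow> v \<in> sobolev_per L s \<Longrightarrow> (\<lambda>x. u x - v x) \<in> sobolev_per L s"
  by (rule sym_form.diff_closed[OF sobolev_sym_form])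

lemma sobolev_mono:
  assumes "s \<le> t" and u: "u \<in> sobolev_per L t"
  shows "u \<in> sobolev_per L s" "sobolev_norm L s u \<le> sobolev_norm L t u"
proof -
  have b: "\<bar>wt s \<kappa>\<bar> \<le> 1 * wt t \<kappa>" for \<kappa> using wt_mono[OF assms(1), of \<kappa>] wt_pos[of s \<kappa>] by simp
  show "u \<in> sobolev_per L s"
    unfolding sobolev_iff using mform_self_summable[OF u b] sobolev_L2[OF u] by simp
  show "sobolev_norm L s u \<le> sobolev_norm L t u"
    unfolding sobolev_norm_mform using wt_mono[OF assms(1)]
    by (intro real_sqrt_le_mono mform_mono[OF u b wt_abs])
qed

lemma sobolev_0: "sobolev_per L 0 = L2_per L"
  using fourier_coeff_summable unfolding set_eq_iff sobolev_iff by auto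

lemma inner_sym_form: "sym_form (L2_per L) (inner_per L)"
  by unfold_locales (auto simp: L2_add L2_scale inner_per_add_left inner_per_scale_left intro: inner_per_commute)

text \<open>Both sides are symmetric forms with the same diagonal by \<open>parseval_norm\<close>,
  so polarization identifies them.\<close>

theorem parseval:
  assumes u: "u \<in> L2_per L" and v: "v \<in> L2_per L"
  shows "inner_per L u v = mform (\<lambda>\<kappa>. 1) u v"
proof -
  have "sym_form (L2_per L) (mform (\<lambda>\<kappa>. 1))"
    using mform_sym_form[of "\<lambda>\<kappa>. 1" 1 0] sobolev_0 by simp
  from sym_form.polarization[OF this u v] sym_form.polarization[OF inner_sym_form u v]
  show ?thesis using u v L2_add[OF u v] by (simp add: parseval_norm mform_self)
qed

lemma inner_le_sobolev:
  assumes "0 \<le> s" "u \<in> sobolev_per L s" shows "inner_per L u u \<le> (sobolev_norm L s u)\<^sup>2"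
proof -
  have "inner_per L u u = (sobolev_norm L 0 u)\<^sup>2"
    using parseval[OF sobolev_L2 sobolev_L2, OF assms(2) assms(2)] unfolding sobolev_norm_sq by (simp add: mform_self)
  also have "\<dots> \<le> (sobolev_norm L s u)\<^sup>2"
    using sobolev_mono(2)[OF assms] sobolev_norm_nonneg by (intro power_mono)
  finally show ?thesis .
qed

end

locale symbol = period +
  fixes \<theta> :: "real \<Rightarrow> real" and m :: real
  assumes symbol: "symbol_cond \<theta> m"
begin

abbreviation tw :: "int \<Rightarrow> real" where "tw \<kappa> \<equiv> \<theta> (of_int \<kappa>)"

lemma m_pos: "m > 0" using symbol unfolding symbol_cond_def by auto

lemma mult_form_mform: "mult_form L \<theta> u = mform tw u u"
  unfolding mult_form_def mform_self ..

text \<open>On H^m the multiplied coefficients are square summable, because the square of the symbol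
  is at most a multiple of \<open>wt m\<close>, and evenness of \<theta> preserves their conjugate
  symmetry. \<open>riesz_fischer\<close> then supplies a witness for the choice in
  \<open>mult_op\<close>.\<close>

lemma mult_op_exists:
  assumes u: "u \<in> sobolev_per L m"
  shows "mult_op L \<theta> u \<in> L2_per L" "fourier_coeff L (mult_op L \<theta> u) \<kappa> = complex_of_real (tw \<kappa>) * fourier_coeff L u \<kappa>"
proof -
  obtain c C where cC: "C > 0" "\<And>\<kappa>. \<bar>tw \<kappa>\<bar> \<le> C * wt (m/2) \<kappa>" by (rule symbol_cond_bounds[OF symbol]) blast
  have sq: "(tw \<kappa>)\<^sup>2 \<le> C\<^sup>2 * wt m \<kappa>" for \<kappa>
    using power_mono[OF cC(2)[of \<kappa>], of 2] unfolding wt_half[of m] by (simp add: power_mult_distrib)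
  define a where "a \<kappa> = complex_of_real (tw \<kappa>) * fourier_coeff L u \<kappa>" for \<kappa>
  have "\<theta> (- x) = \<theta> x" for x using symbol unfolding symbol_cond_def by auto
  then have 1: "a (- \<kappa>) = cnj (a \<kappa>)" for \<kappa> unfolding a_def by (simp add: fourier_coeff_uminus)
  have "(\<lambda>\<kappa>. (tw \<kappa>)\<^sup>2 * (cmod (fourier_coeff L u \<kappa>))\<^sup>2) summable_on UNIV"
    by (rule mform_self_summable[OF u, where C="C\<^sup>2"]) (use sq in simp)
  then have 2: "(\<lambda>\<kappa>. (cmod (a \<kappa>))\<^sup>2) summable_on UNIV"
    unfolding a_def norm_mult power_mult_distrib by simp
  obtain w where "w \<in> L2_per L" "\<And>\<kappa>. fourier_coeff L w \<kappa> = a \<kappa>"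
    by (rule riesz_fischer[OF 1 2]) blast
  then have "\<exists>w. w \<in> L2_per L \<and> (\<forall>\<kappa>. fourier_coeff L w \<kappa> = complex_of_real (tw \<kappa>) * fourier_coeff L u \<kappa>)"
    unfolding a_def by blast
  from someI_ex[OF this] show "mult_op L \<theta> u \<in> L2_per L"
    "fourier_coeff L (mult_op L \<theta> u) \<kappa> = complex_of_real (tw \<kappa>) * fourier_coeff L u \<kappa>"
    unfolding mult_op_def by auto
qed

text \<open>Elliptic regularity at the level of coefficients: if the multiplied coefficients belong
  to an L2 function, the lower bound on the symbol already places \<open>g\<close> in H^m, where
  \<open>mult_op\<close> is meaningful.\<close>

lemma mult_op_eqI:
  assumes g: "g \<in> L2_per L" and w: "w \<in> L2_per L"
    and eq: "\<And>\<kappa>. fourier_coeff L w \<kappa> = complex_of_real (tw \<kappa>) * fourier_coeff L g \<kappa>"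
  shows "g \<in> sobolev_per L m" "AE x in lborel. mult_op L \<theta> g x = w x"
proof -
  obtain c C where cC: "c > 0" "C > 0" "\<And>\<kappa>. c * wt (m/2) \<kappa> - C \<le> tw \<kappa>" by (rule symbol_cond_bounds[OF symbol]) blast
  have sq: "wt m \<kappa> \<le> (2 / c\<^sup>2) * (tw \<kappa>)\<^sup>2 + (2 * C\<^sup>2 / c\<^sup>2)" for \<kappa>
  proof -
    have "0 \<le> c * wt (m/2) \<kappa>" using cC wt_pos[of "m/2" \<kappa>] by simp
    moreover have "c * wt (m/2) \<kappa> \<le> tw \<kappa> + C" using cC(3)[of \<kappa>] by simp
    ultimately have "(c * wt (m/2) \<kappa>)\<^sup>2 \<le> (tw \<kappa> + C)\<^sup>2" by (intro power_mono) auto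
    also have "\<dots> \<le> 2 * (tw \<kappa>)\<^sup>2 + 2 * C\<^sup>2" using sum_squares_bound[of "tw \<kappa>" C] by (simp add: power2_sum)
    finally have "c\<^sup>2 * wt m \<kappa> \<le> 2 * (tw \<kappa>)\<^sup>2 + 2 * C\<^sup>2" unfolding wt_half[of m] by (simp add: power_mult_distrib)
    then show ?thesis using cC by (simp add: field_simps)
  qed
  have "(\<lambda>\<kappa>. wt m \<kappa> * (cmod (fourier_coeff L g \<kappa>))\<^sup>2) summable_on UNIV"
  proof (rule summable_on_dominated)
    show "(\<lambda>\<kappa>. (2 / c\<^sup>2) * (cmod (fourier_coeff L w \<kappa>))\<^sup>2 + (2 * C\<^sup>2 / c\<^sup>2) * (cmod (fourier_coeff L g \<kappa>))\<^sup>2) summable_on UNIV"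
      by (intro summable_on_cmult_right summable_on_add fourier_coeff_summable g w)
    fix \<kappa>
    have "wt m \<kappa> * (cmod (fourier_coeff L g \<kappa>))\<^sup>2 \<le> ((2 / c\<^sup>2) * (tw \<kappa>)\<^sup>2 + (2 * C\<^sup>2 / c\<^sup>2)) * (cmod (fourier_coeff L g \<kappa>))\<^sup>2"
      by (intro mult_right_mono sq) simp
    then show "\<bar>wt m \<kappa> * (cmod (fourier_coeff L g \<kappa>))\<^sup>2\<bar> \<le>
       (2 / c\<^sup>2) * (cmod (fourier_coeff L w \<kappa>))\<^sup>2 + (2 * C\<^sup>2 / c\<^sup>2) * (cmod (fourier_coeff L g \<kappa>))\<^sup>2"
      using wt_pos[of m \<kappa>] unfolding eq norm_mult power_mult_distrib by (simp add: abs_mult distrib_right)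
  qed
  then show g': "g \<in> sobolev_per L m" unfolding sobolev_iff using g by blast
  show "AE x in lborel. mult_op L \<theta> g x = w x"
    by (rule fourier_coeff_inject[OF mult_op_exists(1)[OF g'] w]) (simp add: mult_op_exists(2)[OF g'] eq)
qed

lemma mform_mult_op:
  assumes u: "u \<in> sobolev_per L m" and v: "v \<in> L2_per L"
  shows "mform tw u v = inner_per L (mult_op L \<theta> u) v"
  unfolding parseval[OF mult_op_exists(1)[OF u] v] mform_def mult_op_exists(2)[OF u]
  by (simp only: mult.assoc Re_of_real_mult mult_1)

end

section \<open>Compactness of the Sobolev embedding\<close>

context period
begin

lemma infsum_finite_support:
  fixes f :: "int \<Rightarrow> real"
  assumes "finite K" "\<And>x. x \<notin> K \<Longrightarrow> f x = 0" shows "infsum f UNIV = sum f K"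
proof -
  have "infsum f UNIV = infsum f K" by (rule infsum_cong_neutral) (use assms in auto)
  then show ?thesis using assms(1) by simp
qed

lemma summable_finite_support:
  fixes f :: "int \<Rightarrow> real"
  assumes "finite K" "\<And>x. x \<notin> K \<Longrightarrow> f x = 0" shows "f summable_on UNIV"
proof -
  have "f summable_on K" using assms(1) by simp
  then show ?thesis by (rule summable_on_cong_neutral[THEN iffD1, rotated -1]) (use assms in auto)
qed

lemma trig_sobolev:
  assumes c: "\<And>\<kappa>. c (- \<kappa>) = cnj (c \<kappa>)" and K: "finite K" "\<And>\<kappa>. \<kappa> \<in> K \<longleftrightarrow> - \<kappa> \<in> K"
  shows "trig c K \<in> sobolev_per L s"
  unfolding sobolev_iff using trig_L2 K(1)
  by (auto intro!: summable_finite_support[of K] simp: fourier_coeff_trig[where c=c and K=K, OF c K])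

lemma mform_trig:
  assumes c: "\<And>\<kappa>. c (- \<kappa>) = cnj (c \<kappa>)" and K: "finite K" "\<And>\<kappa>. \<kappa> \<in> K \<longleftrightarrow> - \<kappa> \<in> K"
  shows "mform a u (trig c K) = L * (\<Sum>\<kappa>\<in>K. a \<kappa> * Re (fourier_coeff L u \<kappa> * cnj (c \<kappa>)))"
proof -
  have "(\<Sum>\<^sub>\<infinity>\<kappa>. a \<kappa> * Re (fourier_coeff L u \<kappa> * cnj (fourier_coeff L (trig c K) \<kappa>)))
     = (\<Sum>\<kappa>\<in>K. a \<kappa> * Re (fourier_coeff L u \<kappa> * cnj (fourier_coeff L (trig c K) \<kappa>)))"
    by (rule infsum_finite_support) (simp_all add: fourier_coeff_trig[where c=c and K=K, OF c K] K(1))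
  then show ?thesis unfolding mform_def
    by (simp add: fourier_coeff_trig[where c=c and K=K, OF c K] del: complex_cnj_mult times_complex.simps cong: sum.cong)
qed

lemma mform_finite_le:
  assumes u: "u \<in> sobolev_per L s" and a: "\<And>\<kappa>. \<bar>a \<kappa>\<bar> \<le> C * wt s \<kappa>" "\<And>\<kappa>. a \<kappa> \<ge> 0" and K: "finite K"
  shows "L * (\<Sum>\<kappa>\<in>K. a \<kappa> * (cmod (fourier_coeff L u \<kappa>))\<^sup>2) \<le> mform a u u"
  unfolding mform_self using L_pos a K
  by (intro mult_left_mono finite_sum_le_infsum mform_self_summable[OF u a(1)]) auto

text \<open>Tychonoff gives compactness of a product of closed discs, and countability of the index
  set makes it sequential; this takes the place of a diagonal argument.\<close>

lemma bounded_sequences_convergent_subseq: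
  fixes x :: "nat \<Rightarrow> int \<Rightarrow> complex"
  assumes "\<And>n \<kappa>. cmod (x n \<kappa>) \<le> \<rho>"
  obtains c r where "strict_mono (r :: nat \<Rightarrow> nat)" "\<And>\<kappa>. (\<lambda>n. x (r n) \<kappa>) \<longlonglongrightarrow> c \<kappa>"
proof -
  have "compactin (product_topology (\<lambda>i::int. euclidean) UNIV) (PiE UNIV (\<lambda>i. cball (0::complex) \<rho>))"
    by (subst compactin_PiE) auto
  then have "compact (PiE (UNIV::int set) (\<lambda>i. cball (0::complex) \<rho>))"
    by (simp add: euclidean_product_topology)
  then have "seq_compact (PiE (UNIV::int set) (\<lambda>i. cball (0::complex) \<rho>))"
    by (rule compact_imp_seq_compact)
  moreover have "\<forall>n. x n \<in> PiE UNIV (\<lambda>i. cball (0::complex) \<rho>)" using assms by auto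
  ultimately obtain c r where r: "strict_mono (r :: nat \<Rightarrow> nat)" "(x \<circ> r) \<longlonglongrightarrow> c"
    unfolding seq_compact_def by blast
  have "(\<lambda>n. x (r n) \<kappa>) \<longlonglongrightarrow> c \<kappa>" for \<kappa>
  proof -
    have c0: "continuous_on UNIV (\<lambda>f :: int \<Rightarrow> complex. f \<kappa>)" by (rule continuous_on_product_coordinates)
    have "isCont (\<lambda>f :: int \<Rightarrow> complex. f \<kappa>) c"
      using c0 by (metis UNIV_I continuous_on_eq_continuous_at open_UNIV)
    from isCont_tendsto_compose[OF this r(2)] show ?thesis by (simp add: o_def)
  qed
  then show ?thesis using that r(1) by blast
qed

lemma wt_filterlim: assumes "s > 0" shows "filterlim (\<lambda>N::nat. wt s (int N)) at_top sequentially"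
proof -
  have "filterlim (\<lambda>N::nat. (1 + (real N)\<^sup>2) powr s) at_top sequentially"
  proof (rule filterlim_at_top_mono)
    show "filterlim (\<lambda>N::nat. exp (s * ln (real N))) at_top sequentially"
      by (intro filterlim_compose[OF exp_at_top] filterlim_tendsto_pos_mult_at_top[OF tendsto_const assms]
        filterlim_compose[OF ln_at_top] filterlim_real_sequentially)
    show "\<forall>\<^sub>F N in sequentially. exp (s * ln (real N)) \<le> (1 + (real N)\<^sup>2) powr s"
    proof (rule eventually_sequentiallyI[of 1])
      fix N :: nat assume "1 \<le> N"
      then have "exp (s * ln (real N)) = real N powr s" by (simp add: powr_def)
      also have "\<dots> \<le> (1 + (real N)\<^sup>2) powr s"
        using sum_squares_bound[of "real N" 1] assms by (intro powr_mono2) auto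
      finally show "exp (s * ln (real N)) \<le> (1 + (real N)\<^sup>2) powr s" .
    qed
  qed
  then show ?thesis unfolding wt_def by simp
qed

text \<open>A subsequence converges in every single coefficient. Low frequencies are finitely many,
  and high ones are uniformly small because the weight tends to infinity. Convergence of the
  coefficients is kept in the conclusion since lower semicontinuity of the form rests on it.\<close>

theorem sobolev_compact_embedding:
  assumes s: "s > 0" and v: "\<And>n. v n \<in> sobolev_per L s" and R: "\<And>n. (sobolev_norm L s (v n))\<^sup>2 \<le> R"
  obtains w r where "strict_mono (r :: nat \<Rightarrow> nat)" "w \<in> sobolev_per L s"
    "\<And>\<kappa>. (\<lambda>n. fourier_coeff L (v (r n)) \<kappa>) \<longlonglongrightarrow> fourier_coeff L w \<kappa>"
    "(\<lambda>n. inner_per L (\<lambda>x. v (r n) x - w x) (\<lambda>x. v (r n) x - w x)) \<longlonglongrightarrow> 0"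
proof -
  let ?x = "\<lambda>n. fourier_coeff L (v n)"
  have fin: "L * (\<Sum>\<kappa>\<in>K. wt s \<kappa> * (cmod (?x n \<kappa>))\<^sup>2) \<le> R" if "finite K" for K n
    using mform_finite_le[OF v[of n] wt_abs less_imp_le[OF wt_pos] that] R[of n] unfolding sobolev_norm_sq by linarith
  have bd: "cmod (?x n \<kappa>) \<le> sqrt (R / L)" for n \<kappa>
  proof (rule real_le_rsqrt)
    have "1 * (cmod (?x n \<kappa>))\<^sup>2 \<le> wt s \<kappa> * (cmod (?x n \<kappa>))\<^sup>2" using wt_ge_1[of s \<kappa>] s by (intro mult_right_mono) auto
    then have "L * (cmod (?x n \<kappa>))\<^sup>2 \<le> L * (wt s \<kappa> * (cmod (?x n \<kappa>))\<^sup>2)" using L_pos by (intro mult_left_mono) auto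
    also have "\<dots> \<le> R" using fin[of "{\<kappa>}" n] by simp
    finally show "(cmod (?x n \<kappa>))\<^sup>2 \<le> R / L" using L_pos by (simp add: field_simps)
  qed
  obtain c r where r: "strict_mono (r :: nat \<Rightarrow> nat)" and c: "\<And>\<kappa>. (\<lambda>n. ?x (r n) \<kappa>) \<longlonglongrightarrow> c \<kappa>"
    by (rule bounded_sequences_convergent_subseq[of ?x, OF bd]) blast
  have sym: "c (- \<kappa>) = cnj (c \<kappa>)" for \<kappa>
  proof -
    have "(\<lambda>n. cnj (?x (r n) \<kappa>)) \<longlonglongrightarrow> cnj (c \<kappa>)" using c by (rule tendsto_cnj)
    then show ?thesis using c[of "- \<kappa>"] unfolding fourier_coeff_uminus by (simp add: LIMSEQ_unique)
  qed
  have finc: "L * (\<Sum>\<kappa>\<in>K. wt s \<kappa> * (cmod (c \<kappa>))\<^sup>2) \<le> R" if "finite K" for K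
  proof (rule LIMSEQ_le_const2)
    show "(\<lambda>n. L * (\<Sum>\<kappa>\<in>K. wt s \<kappa> * (cmod (?x (r n) \<kappa>))\<^sup>2)) \<longlonglongrightarrow> L * (\<Sum>\<kappa>\<in>K. wt s \<kappa> * (cmod (c \<kappa>))\<^sup>2)"
      by (intro tendsto_intros c)
    show "\<exists>N. \<forall>n\<ge>N. L * (\<Sum>\<kappa>\<in>K. wt s \<kappa> * (cmod (?x (r n) \<kappa>))\<^sup>2) \<le> R" using fin[OF that] by blast
  qed
  have csum: "(\<lambda>\<kappa>. wt s \<kappa> * (cmod (c \<kappa>))\<^sup>2) summable_on UNIV"
  proof (rule nonneg_bdd_above_summable_on)
    show "bdd_above (sum (\<lambda>\<kappa>. wt s \<kappa> * (cmod (c \<kappa>))\<^sup>2) ` {F. F \<subseteq> UNIV \<and> finite F})"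
    proof (rule bdd_aboveI2)
      fix F :: "int set" assume "F \<in> {F. F \<subseteq> UNIV \<and> finite F}"
      then show "(\<Sum>\<kappa>\<in>F. wt s \<kappa> * (cmod (c \<kappa>))\<^sup>2) \<le> R / L"
        using finc[of F] L_pos by (simp add: field_simps)
    qed
  qed (use wt_pos[of s] in \<open>simp add: less_imp_le\<close>)
  have "(\<lambda>\<kappa>. (cmod (c \<kappa>))\<^sup>2) summable_on UNIV"
    by (rule summable_on_dominated[OF csum]) (use wt_ge_1[of s] s in \<open>simp add: mult_le_cancel_right1\<close>)
  then obtain w where w: "w \<in> L2_per L" "\<And>\<kappa>. fourier_coeff L w \<kappa> = c \<kappa>"
    using riesz_fischer[of c, OF sym] by metis
  have wS: "w \<in> sobolev_per L s" unfolding sobolev_iff w(2) using w(1) csum by blast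
  define d where "d n = (\<lambda>x. v (r n) x - w x)" for n
  have dS: "d n \<in> sobolev_per L s" for n unfolding d_def by (intro sobolev_diff v wS)
  have wR: "(sobolev_norm L s w)\<^sup>2 \<le> R"
  proof -
    have "(\<Sum>\<^sub>\<infinity>\<kappa>. wt s \<kappa> * (cmod (c \<kappa>))\<^sup>2) \<le> R / L"
      by (rule infsum_le_finite_sums[OF csum]) (use finc L_pos in \<open>simp add: field_simps\<close>)
    then show ?thesis unfolding sobolev_norm_sq mform_self w(2) using L_pos by (simp add: field_simps)
  qed
  have R0: "R \<ge> 0" using wR zero_le_power2 order_trans by blast
  have dR: "(sobolev_norm L s (d n))\<^sup>2 \<le> 4 * R" for n
  proof -
    have "sobolev_norm L s (d n) \<le> sobolev_norm L s (v (r n)) + sobolev_norm L s w"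
      using sobolev_norm_triangle[OF v[of "r n"] sobolev_scale[OF wS, of "-1"]] sobolev_norm_scale[of s "-1" w]
      unfolding d_def by simp
    also have "\<dots> \<le> sqrt R + sqrt R" using R[of "r n"] wR by (intro add_mono real_le_rsqrt)
    finally have "(sobolev_norm L s (d n))\<^sup>2 \<le> (2 * sqrt R)\<^sup>2" using sobolev_norm_nonneg by (intro power_mono) auto
    then show ?thesis using R0 by (simp add: power_mult_distrib)
  qed
  have dc: "fourier_coeff L (d n) \<kappa> = ?x (r n) \<kappa> - c \<kappa>" for n \<kappa>
    unfolding d_def using L2_coeff_diff[OF sobolev_L2[OF v] w(1)] w(2) by simp
  \<comment> \<open>The L2 symbol 1 is at most the indicator of the low frequencies plus
    \<open>wt s \<kappa> / wt s N\<close>. The constant \<open>4 * R\<close> bounds the squared norm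
    of a difference of two elements of norm at most \<open>sqrt R\<close>.\<close>
  have split: "inner_per L (d n) (d n) \<le> L * (\<Sum>\<kappa>\<in>{-int N..int N}. (cmod (?x (r n) \<kappa> - c \<kappa>))\<^sup>2) + 4 * R / wt s (int N)" for n N
  proof -
    define a where "a \<kappa> = (if \<kappa> \<in> {-int N..int N} then 1 else 0 :: real)" for \<kappa>
    have ab: "\<bar>a \<kappa>\<bar> \<le> 1 * wt s \<kappa>" for \<kappa> using wt_ge_1[of s \<kappa>] s unfolding a_def by auto
    have 1: "\<bar>1\<bar> \<le> 1 * wt s \<kappa>" for \<kappa> using wt_ge_1[of s \<kappa>] s by auto
    have le: "1 \<le> 1 * a \<kappa> + (1 / wt s (int N)) * wt s \<kappa>" for \<kappa>
    proof (cases "\<kappa> \<in> {-int N..int N}")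
      case True then show ?thesis using wt_pos[of s \<kappa>] wt_pos[of s "int N"] unfolding a_def by simp
    next
      case False
      then have "\<bar>real_of_int (int N)\<bar> \<le> \<bar>real_of_int \<kappa>\<bar>" by auto
      then have "(real_of_int (int N))\<^sup>2 \<le> (real_of_int \<kappa>)\<^sup>2" by (simp only: abs_le_square_iff)
      then have "wt s (int N) \<le> wt s \<kappa>" unfolding wt_def using s by (intro powr_mono2) auto
      then show ?thesis using wt_pos[of s "int N"] False unfolding a_def by (simp add: field_simps)
    qed
    have bb: "\<bar>1 * a \<kappa> + (1 / wt s (int N)) * wt s \<kappa>\<bar> \<le> (1 + 1 / wt s (int N)) * wt s \<kappa>" for \<kappa>
      using ab[of \<kappa>] wt_pos[of s \<kappa>] wt_pos[of s "int N"] by (simp add: distrib_right a_def)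
    have "inner_per L (d n) (d n) = mform (\<lambda>\<kappa>. 1) (d n) (d n)"
      using sobolev_L2[OF dS] by (intro parseval)
    also have "\<dots> \<le> mform (\<lambda>\<kappa>. 1 * a \<kappa> + (1 / wt s (int N)) * wt s \<kappa>) (d n) (d n)"
      by (rule mform_mono[OF dS 1 bb le])
    also have "\<dots> = 1 * mform a (d n) (d n) + (1 / wt s (int N)) * mform (wt s) (d n) (d n)"
      by (rule mform_lincomb[OF dS ab wt_abs])
    also have "mform a (d n) (d n) = L * (\<Sum>\<kappa>\<in>{-int N..int N}. (cmod (?x (r n) \<kappa> - c \<kappa>))\<^sup>2)"
      unfolding mform_self dc by (subst infsum_finite_support[of "{-int N..int N}"]) (auto simp: a_def)
    also have "(1 / wt s (int N)) * mform (wt s) (d n) (d n) \<le> (1 / wt s (int N)) * (4 * R)"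
      using dR[of n] wt_pos[of s "int N"] unfolding sobolev_norm_sq by (intro mult_left_mono) auto
    finally show ?thesis by simp
  qed
  have "(\<lambda>n. inner_per L (d n) (d n)) \<longlonglongrightarrow> 0"
  proof (rule LIMSEQ_I)
    fix e :: real assume e: "e > 0"
    have "((\<lambda>N. 4 * R / wt s (int N)) \<longlongrightarrow> 0) sequentially"
      by (rule real_tendsto_divide_at_top[OF tendsto_const wt_filterlim[OF s]])
    then have "\<forall>\<^sub>F N in sequentially. 4 * R / wt s (int N) < e / 2" using e by (intro order_tendstoD) auto
    then obtain N where N: "4 * R / wt s (int N) < e / 2" unfolding eventually_sequentially by blast
    have "(\<lambda>n. L * (\<Sum>\<kappa>\<in>{-int N..int N}. (cmod (?x (r n) \<kappa> - c \<kappa>))\<^sup>2)) \<longlonglongrightarrow> L * (\<Sum>\<kappa>\<in>{-int N..int N}. (cmod (c \<kappa> - c \<kappa>))\<^sup>2)"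
      by (intro tendsto_intros c)
    then have "\<forall>\<^sub>F n in sequentially. L * (\<Sum>\<kappa>\<in>{-int N..int N}. (cmod (?x (r n) \<kappa> - c \<kappa>))\<^sup>2) < e / 2"
      using e by (intro order_tendstoD) auto
    then obtain n0 where "\<And>n. n \<ge> n0 \<Longrightarrow> L * (\<Sum>\<kappa>\<in>{-int N..int N}. (cmod (?x (r n) \<kappa> - c \<kappa>))\<^sup>2) < e / 2"
      unfolding eventually_sequentially by blast
    then have "norm (inner_per L (d n) (d n) - 0) < e" if "n \<ge> n0" for n
      using split[of n N] N inner_per_nonneg[of "d n"] that by (force simp only: real_norm_def diff_zero abs_of_nonneg)
    then show "\<exists>n0. \<forall>n\<ge>n0. norm (inner_per L (d n) (d n) - 0) < e" by blast
  qed
  then have "(\<lambda>n. inner_per L (\<lambda>x. v (r n) x - w x) (\<lambda>x. v (r n) x - w x)) \<longlonglongrightarrow> 0" unfolding d_def .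
  moreover have "(\<lambda>n. ?x (r n) \<kappa>) \<longlonglongrightarrow> fourier_coeff L w \<kappa>" for \<kappa> using c w(2) by simp
  ultimately show ?thesis using that r wS by blast
qed

end

section \<open>The linearized operator\<close>

lemma sym_form_subset:
  assumes "sym_form V B" "U \<subseteq> V" "\<And>u v. u \<in> U \<Longrightarrow> v \<in> U \<Longrightarrow> (\<lambda>x. u x + v x) \<in> U"
    "\<And>c u. u \<in> U \<Longrightarrow> (\<lambda>x. c * u x) \<in> U"
  shows "sym_form U B"
proof (rule sym_form.intro)
  fix u v w c
  assume u: "u \<in> U"
  then have uV: "u \<in> V" using assms(2) by auto
  show "(\<lambda>x. c * u x) \<in> U" using u by (rule assms(4))
  { assume w: "w \<in> U"
    then show "B (\<lambda>x. c * u x) w = c * B u w" using sym_form.scale_left[OF assms(1) uV] assms(2) by auto }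
  assume v: "v \<in> U"
  then have vV: "v \<in> V" using assms(2) by auto
  show "(\<lambda>x. u x + v x) \<in> U" using u v by (rule assms(3))
  show "B u v = B v u" by (rule sym_form.commute[OF assms(1) uV vV])
  assume w: "w \<in> U"
  then show "B (\<lambda>x. u x + v x) w = B u w + B v w" using sym_form.add_left[OF assms(1) uV vV] assms(2) by auto
qed

lemma sym_form_lincomb:
  assumes "sym_form V B" "sym_form V B'"
  shows "sym_form V (\<lambda>u v. B u v + c * B' u v)"
proof -
  interpret B: sym_form V B by fact
  interpret B': sym_form V B' by fact
  show ?thesis
  proof (rule sym_form.intro)
    fix u v w a
    assume u: "u \<in> V"
    show "(\<lambda>x. a * u x) \<in> V" using u by (rule B.scale_closed)
    { assume w: "w \<in> V"
      show "B (\<lambda>x. a * u x) w + c * B' (\<lambda>x. a * u x) w = a * (B u w + c * B' u w)"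
        using u w by (simp add: B.scale_left B'.scale_left algebra_simps) }
    assume v: "v \<in> V"
    show "(\<lambda>x. u x + v x) \<in> V" using u v by (rule B.add_closed)
    show "B u v + c * B' u v = B v u + c * B' v u" unfolding B.commute[OF u v] B'.commute[OF u v] ..
    assume w: "w \<in> V"
    show "B (\<lambda>x. u x + v x) w + c * B' (\<lambda>x. u x + v x) w = B u w + c * B' u w + (B v w + c * B' v w)"
      using u v w by (simp add: B.add_left B'.add_left algebra_simps)
  qed
qed

text \<open>The potential \<omega> - f'(\<phi>) is abstracted to a continuous periodic
  \<open>q\<close>, which separates the spectral argument from the wave.\<close>

locale lin_operator = symbol +
  fixes q :: "real \<Rightarrow> real"
  assumes q_cont: "continuous_on UNIV q" and q_per: "periodic L q"
begin

abbreviation V :: "(real \<Rightarrow> real) set" where "V \<equiv> sobolev_per L (m/2)"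

definition Lop :: "(real \<Rightarrow> real) \<Rightarrow> real \<Rightarrow> real" where
  "Lop v x = mult_op L \<theta> v x + q x * v x"

text \<open>The form of \<open>Lop\<close> extended from the operator domain H^m to the form domain
  H^(m/2), where \<open>Lop u\<close> itself need not exist as a function; \<open>Q_Lop\<close>
  connects the two.\<close>

definition Q :: "(real \<Rightarrow> real) \<Rightarrow> (real \<Rightarrow> real) \<Rightarrow> real" where
  "Q u v = mform tw u v + inner_per L (\<lambda>x. q x * u x) v"

lemma q_bound: obtains Cq where "Cq > 0" "\<And>x. \<bar>q x\<bar> \<le> Cq"
proof -
  obtain C where "\<And>x. \<bar>q x\<bar> \<le> C" using periodic_bounded[OF q_cont q_per] by blast
  then show ?thesis using that[of "max C 1"] by (meson less_max_iff_disj max.coboundedI1 zero_less_one)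
qed

lemma q_L2: "u \<in> L2_per L \<Longrightarrow> (\<lambda>x. q x * u x) \<in> L2_per L"
  using q_bound L2_mult_bounded[OF _ borel_measurable_continuous_onI[OF q_cont] q_per] by metis

lemma pot_sym_form: "sym_form (L2_per L) (\<lambda>u v. inner_per L (\<lambda>x. q x * u x) v)"
proof
  fix u v w c
  assume u: "u \<in> L2_per L"
  show "(\<lambda>x. c * u x) \<in> L2_per L" using u by (rule L2_scale)
  show "inner_per L (\<lambda>x. q x * (c * u x)) w = c * inner_per L (\<lambda>x. q x * u x) w"
    using inner_per_scale_left[of c "\<lambda>x. q x * u x" w] by (simp add: mult.left_commute)
  show "inner_per L (\<lambda>x. q x * u x) v = inner_per L (\<lambda>x. q x * v x) u"
    unfolding inner_per_def by (simp add: mult_ac)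
  assume v: "v \<in> L2_per L"
  show "(\<lambda>x. u x + v x) \<in> L2_per L" using u v by (rule L2_add)
  assume w: "w \<in> L2_per L"
  show "inner_per L (\<lambda>x. q x * (u x + v x)) w = inner_per L (\<lambda>x. q x * u x) w + inner_per L (\<lambda>x. q x * v x) w"
    using inner_per_add_left[OF q_L2[OF u] q_L2[OF v] w] by (simp add: distrib_left)
qed

lemma V_L2: "V \<subseteq> L2_per L"
  using sobolev_L2 by blast

lemma Hm_V: "u \<in> sobolev_per L m \<Longrightarrow> u \<in> V"
  using sobolev_mono(1)[of "m/2" m] m_pos by simp

lemma inner_V: "sym_form V (inner_per L)"
  by (rule sym_form_subset[OF inner_sym_form V_L2 sobolev_add sobolev_scale])

lemma Q_sym_form: "sym_form V Q"
proof -
  obtain c C where C: "\<And>\<kappa>. \<bar>tw \<kappa>\<bar> \<le> C * wt (m/2) \<kappa>" by (rule symbol_cond_bounds[OF symbol]) blast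
  have "sym_form V (\<lambda>u v. mform tw u v + 1 * inner_per L (\<lambda>x. q x * u x) v)"
    by (intro sym_form_lincomb mform_sym_form[OF C] sym_form_subset[OF pot_sym_form V_L2 sobolev_add sobolev_scale])
  then show ?thesis unfolding Q_def[abs_def] by simp
qed

lemma pot_bound:
  assumes "\<And>x. \<bar>q x\<bar> \<le> Cq" and u: "u \<in> L2_per L"
  shows "\<bar>inner_per L (\<lambda>x. q x * u x) u\<bar> \<le> Cq * inner_per L u u"
proof -
  have i: "set_integrable lborel {0..L} (\<lambda>x. q x * u x * u x)" by (rule L2_mult_integrable[OF q_L2[OF u] u])
  have "\<bar>inner_per L (\<lambda>x. q x * u x) u\<bar> \<le> (LINT x:{0..L}|lborel. norm (q x * u x * u x))"
    unfolding inner_per_def using set_integral_norm_bound[OF i] by (simp only: real_norm_def)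
  also have "\<dots> \<le> (LINT x:{0..L}|lborel. Cq * (u x * u x))"
  proof (rule set_integral_mono)
    show "set_integrable lborel {0..L} (\<lambda>x. norm (q x * u x * u x))"
      using set_integrable_abs[OF i] by (simp only: real_norm_def)
    show "set_integrable lborel {0..L} (\<lambda>x. Cq * (u x * u x))"
      by (intro set_integrable_mult_right L2_mult_integrable u)
    fix x
    show "norm (q x * u x * u x) \<le> Cq * (u x * u x)"
      using mult_right_mono[OF assms(1)[of x], of "u x * u x"] by (simp add: abs_mult mult.assoc)
  qed
  finally show ?thesis unfolding inner_per_def by simp
qed

lemma Lop_L2: "u \<in> sobolev_per L m \<Longrightarrow> Lop u \<in> L2_per L"
  unfolding Lop_def[abs_def] by (intro L2_add mult_op_exists(1) q_L2 sobolev_L2)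

lemma Q_Lop:
  assumes u: "u \<in> sobolev_per L m" and v: "v \<in> L2_per L"
  shows "Q u v = inner_per L (Lop u) v"
  unfolding Q_def mform_mult_op[OF u v] Lop_def[abs_def]
  by (rule inner_per_add_left[symmetric, OF mult_op_exists(1)[OF u] q_L2[OF sobolev_L2[OF u]] v])

lemma Q_AE:
  assumes u: "u \<in> sobolev_per L m" and g: "g \<in> L2_per L" and eq: "AE x in lborel. Lop u x = g x" and v: "v \<in> L2_per L"
  shows "Q u v = inner_per L g v"
  unfolding Q_Lop[OF u v]
  by (rule inner_per_cong_AE[OF eq]) (use Lop_L2[OF u] g v L2_perD(1) in auto)

text \<open>All estimates follow by comparing symbols and bounding the potential by its supremum
  \<open>Cq\<close>. Adding \<open>Cq\<close> to the symbol constant yields one \<open>C\<close>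
  that serves every clause.\<close>

lemma Garding:
  obtains c C where "c > 0" "C > 0" "\<And>u. u \<in> V \<Longrightarrow> Q u u \<ge> c * (sobolev_norm L (m/2) u)\<^sup>2 - C * inner_per L u u"
    "\<And>u. u \<in> V \<Longrightarrow> \<bar>Q u u\<bar> \<le> C * (sobolev_norm L (m/2) u)\<^sup>2"
    "\<And>\<kappa>. \<bar>tw \<kappa>\<bar> \<le> C * wt (m/2) \<kappa>" "\<And>\<kappa>. 0 \<le> tw \<kappa> + C"
proof -
  obtain c C where cC: "c > 0" "C > 0" "\<And>\<kappa>. \<bar>tw \<kappa>\<bar> \<le> C * wt (m/2) \<kappa>" "\<And>\<kappa>. c * wt (m/2) \<kappa> - C \<le> tw \<kappa>"
    by (rule symbol_cond_bounds[OF symbol]) blast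
  obtain Cq where Cq: "Cq > 0" "\<And>x. \<bar>q x\<bar> \<le> Cq" by (rule q_bound) blast
  have 1: "\<bar>1\<bar> \<le> 1 * wt (m/2) \<kappa>" for \<kappa> using wt_ge_1[of "m/2" \<kappa>] m_pos by auto
  have b: "\<bar>c * wt (m/2) \<kappa> + (- C) * 1\<bar> \<le> (c + C) * wt (m/2) \<kappa>" for \<kappa>
  proof -
    have "C * 1 \<le> C * wt (m/2) \<kappa>" using wt_ge_1[of "m/2" \<kappa>] m_pos cC by (intro mult_left_mono) auto
    moreover have "0 \<le> c * wt (m/2) \<kappa>" using cC wt_pos[of "m/2" \<kappa>] by simp
    ultimately show ?thesis using cC(2) unfolding distrib_right by (intro abs_leI) linarith+
  qed
  have b2: "\<bar>C * wt (m/2) \<kappa>\<bar> \<le> C * wt (m/2) \<kappa>" for \<kappa> using wt_pos[of "m/2" \<kappa>] cC by simp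
  have inner_eq: "inner_per L u u = mform (\<lambda>\<kappa>. 1) u u" if "u \<in> V" for u using parseval that sobolev_L2 by blast
  show ?thesis
  proof (rule that[of c "C + Cq"])
    fix u assume u: "u \<in> V"
    have "mform (\<lambda>\<kappa>. c * wt (m/2) \<kappa> + (- C) * 1) u u \<le> mform tw u u"
      by (rule mform_mono[OF u b cC(3)]) (use cC(4) in simp)
    moreover have "mform (\<lambda>\<kappa>. c * wt (m/2) \<kappa> + (- C) * 1) u u = c * (sobolev_norm L (m/2) u)\<^sup>2 + (- C) * inner_per L u u"
      unfolding sobolev_norm_sq inner_eq[OF u] by (rule mform_lincomb[OF u wt_abs 1])
    ultimately show "Q u u \<ge> c * (sobolev_norm L (m/2) u)\<^sup>2 - (C + Cq) * inner_per L u u"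
      using pot_bound[OF Cq(2) sobolev_L2[OF u]] unfolding Q_def by (simp add: distrib_right abs_le_iff)
    have "mform tw u u \<le> mform (\<lambda>\<kappa>. C * wt (m/2) \<kappa> + 0 * 1) u u"
    proof (rule mform_mono[OF u cC(3), where C'=C])
      fix \<kappa>
      show "\<bar>C * wt (m/2) \<kappa> + 0 * 1\<bar> \<le> C * wt (m/2) \<kappa>" using b2[of \<kappa>] by simp
      show "tw \<kappa> \<le> C * wt (m/2) \<kappa> + 0 * 1" using cC(3)[of \<kappa>] by (simp add: abs_le_iff)
    qed
    moreover have "mform (\<lambda>\<kappa>. (- C) * wt (m/2) \<kappa> + 0 * 1) u u \<le> mform tw u u"
    proof (rule mform_mono[OF u _ cC(3), where C=C])
      fix \<kappa>
      show "\<bar>(- C) * wt (m/2) \<kappa> + 0 * 1\<bar> \<le> C * wt (m/2) \<kappa>" using b2[of \<kappa>] by simp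
      show "(- C) * wt (m/2) \<kappa> + 0 * 1 \<le> tw \<kappa>" using cC(3)[of \<kappa>] by (simp add: abs_le_iff)
    qed
    ultimately have "\<bar>mform tw u u\<bar> \<le> C * (sobolev_norm L (m/2) u)\<^sup>2"
      unfolding mform_lincomb[OF u wt_abs 1] sobolev_norm_sq by (simp add: abs_le_iff)
    moreover have "Cq * inner_per L u u \<le> Cq * (sobolev_norm L (m/2) u)\<^sup>2"
      using inner_le_sobolev[OF _ u] m_pos Cq by (intro mult_left_mono) auto
    ultimately show "\<bar>Q u u\<bar> \<le> (C + Cq) * (sobolev_norm L (m/2) u)\<^sup>2"
      using pot_bound[OF Cq(2) sobolev_L2[OF u]] unfolding Q_def by (simp add: distrib_right)
  next
    fix \<kappa>
    show "\<bar>tw \<kappa>\<bar> \<le> (C + Cq) * wt (m/2) \<kappa>" using cC(3)[of \<kappa>] mult_pos_pos[OF Cq(1) wt_pos[of "m/2" \<kappa>]]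
      unfolding distrib_right by linarith
    have "0 \<le> c * wt (m/2) \<kappa>" using cC wt_pos[of "m/2" \<kappa>] by simp
    then show "0 \<le> tw \<kappa> + (C + Cq)" using cC(4)[of \<kappa>] Cq by linarith
  qed (use cC Cq in auto)
qed

text \<open>Testing the weak equation with trigonometric polynomials identifies every Fourier coefficient
  of \<open>M v\<close>, so weak solutions lie in the operator domain.\<close>

lemma weak_solution_regular:
  assumes v: "v \<in> V" and g: "g \<in> L2_per L" and weak: "\<And>w. w \<in> V \<Longrightarrow> Q v w = inner_per L g w"
  shows "v \<in> sobolev_per L m" "AE x in lborel. Lop v x = g x"
proof -
  let ?h = "\<lambda>x. g x - q x * v x"
  have v2: "v \<in> L2_per L" using v by (rule sobolev_L2)
  have h: "?h \<in> L2_per L" by (intro L2_diff g q_L2 v2)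
  have eq: "fourier_coeff L ?h \<kappa> = complex_of_real (tw \<kappa>) * fourier_coeff L v \<kappa>" for \<kappa>
  proof -
    define K where "K = {\<kappa>, - \<kappa>}"
    have K: "finite K" "\<And>j. j \<in> K \<longleftrightarrow> - j \<in> K" by (auto simp: K_def)
    \<comment> \<open>The test function has the defect itself as coefficients, so the tested
      identity becomes a vanishing sum of squares. The index set is a pair, as a real test function
      always involves \<kappa> and - \<kappa> together.\<close>
    define d where "d j = complex_of_real (tw j) * fourier_coeff L v j - fourier_coeff L ?h j" for j
    have "\<theta> (- x) = \<theta> x" for x using symbol unfolding symbol_cond_def by auto
    then have d: "d (- j) = cnj (d j)" for j unfolding d_def by (simp add: fourier_coeff_uminus)
    let ?w = "trig d K"
    have wV: "?w \<in> V" by (rule trig_sobolev[where c=d and K=K, OF d K])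
    have "mform tw v ?w = inner_per L g ?w - inner_per L (\<lambda>x. q x * v x) ?w"
      using weak[OF wV] unfolding Q_def by simp
    also have "\<dots> = inner_per L ?h ?w"
      by (rule inner_per_diff_left[symmetric, OF g q_L2[OF v2] trig_L2])
    also have "\<dots> = mform (\<lambda>\<kappa>. 1) ?h ?w" by (rule parseval[OF h trig_L2])
    finally have "(\<Sum>j\<in>K. tw j * Re (fourier_coeff L v j * cnj (d j))) = (\<Sum>j\<in>K. 1 * Re (fourier_coeff L ?h j * cnj (d j)))"
      unfolding mform_trig[where c=d and K=K, OF d K] using L_pos by simp
    then have "0 = (\<Sum>j\<in>K. tw j * Re (fourier_coeff L v j * cnj (d j)) - 1 * Re (fourier_coeff L ?h j * cnj (d j)))"
      unfolding sum_subtractf by simp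
    also have "\<dots> = (\<Sum>j\<in>K. Re (d j * cnj (d j)))"
      by (intro sum.cong refl) (simp only: d_def left_diff_distrib minus_complex.sel mult.assoc Re_of_real_mult mult_1)
    finally have "(\<Sum>j\<in>K. (cmod (d j))\<^sup>2) = 0" unfolding Re_mult_cnj_self by simp
    then have "d \<kappa> = 0" using K(1) by (subst (asm) sum_nonneg_eq_0_iff) (auto simp: K_def)
    then show ?thesis unfolding d_def by simp
  qed
  show "v \<in> sobolev_per L m" by (rule mult_op_eqI(1)[OF v2 h eq])
  have "AE x in lborel. mult_op L \<theta> v x = ?h x" by (rule mult_op_eqI(2)[OF v2 h eq])
  then show "AE x in lborel. Lop v x = g x" by eventually_elim (simp add: Lop_def)
qed

section \<open>The direct method for the form \<open>Q\<close>\<close>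

lemma inner_tendsto:
  assumes d: "(\<lambda>n. inner_per L (\<lambda>x. v n x - w x) (\<lambda>x. v n x - w x)) \<longlonglongrightarrow> 0"
    and v: "\<And>n. v n \<in> L2_per L" and w: "w \<in> L2_per L" and z: "z \<in> L2_per L"
  shows "(\<lambda>n. inner_per L (v n) z) \<longlonglongrightarrow> inner_per L w z"
proof (rule LIM_zero_cancel, rule Lim_null_comparison)
  interpret I: sym_form "L2_per L" "inner_per L" by (rule inner_sym_form)
  have "\<bar>inner_per L (v n) z - inner_per L w z\<bar> \<le>
      sqrt (inner_per L (\<lambda>x. v n x - w x) (\<lambda>x. v n x - w x)) * sqrt (inner_per L z z)" for n
    unfolding I.diff_left[OF v w z, symmetric]
    by (intro I.Cauchy_Schwarz_abs I.diff_closed v w z inner_per_nonneg)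
  then show "\<forall>\<^sub>F n in sequentially. norm (inner_per L (v n) z - inner_per L w z) \<le>
      sqrt (inner_per L (\<lambda>x. v n x - w x) (\<lambda>x. v n x - w x)) * sqrt (inner_per L z z)" by simp
  have "(\<lambda>n. sqrt (inner_per L (\<lambda>x. v n x - w x) (\<lambda>x. v n x - w x)) * sqrt (inner_per L z z)) \<longlonglongrightarrow> sqrt 0 * sqrt (inner_per L z z)"
    by (intro tendsto_intros d)
  then show "(\<lambda>n. sqrt (inner_per L (\<lambda>x. v n x - w x) (\<lambda>x. v n x - w x)) * sqrt (inner_per L z z)) \<longlonglongrightarrow> 0" by simp
qed

text \<open>Garding bounds a minimising sequence in H^(m/2); a subsequence converges in L2, so its
  limit keeps the norm 1 and the orthogonality conditions. Only lower semicontinuity of the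
  multiplier part is left, as the potential part converges.\<close>

lemma Q_minimizer:
  assumes Z: "Z \<subseteq> L2_per L" and C_def: "C = {v \<in> V. \<forall>z\<in>Z. inner_per L v z = 0}"
    and nontriv: "u0 \<in> C" "inner_per L u0 u0 \<noteq> 0"
  obtains v where "v \<in> C" "inner_per L v v = 1" "\<And>w. w \<in> C \<Longrightarrow> Q v v * inner_per L w w \<le> Q w w"
proof -
  interpret B: sym_form V Q by (rule Q_sym_form)
  interpret I: sym_form V "inner_per L" by (rule inner_V)
  obtain c K where G: "c > 0" "K > 0" "\<And>u. u \<in> V \<Longrightarrow> Q u u \<ge> c * (sobolev_norm L (m/2) u)\<^sup>2 - K * inner_per L u u"
    "\<And>\<kappa>. \<bar>tw \<kappa>\<bar> \<le> K * wt (m/2) \<kappa>" "\<And>\<kappa>. 0 \<le> tw \<kappa> + K"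
    by (rule Garding) blast
  obtain Cq where Cq: "Cq > 0" "\<And>x. \<bar>q x\<bar> \<le> Cq" by (rule q_bound) blast
  have CV: "C \<subseteq> V" unfolding C_def by auto
  have ZV: "inner_per L (\<lambda>x. a * v x) z = 0" if "v \<in> C" "z \<in> Z" for a v z
    using that unfolding C_def by (simp add: inner_per_scale_left)
  have Cscale: "(\<lambda>x. a * v x) \<in> C" if "v \<in> C" for a v
    using that ZV[OF that] sobolev_scale unfolding C_def by auto
  define A where "A = {Q w w | w. w \<in> C \<and> inner_per L w w = 1}"
  have norm1: "\<exists>a. a\<^sup>2 * inner_per L w w = 1 \<and> (\<lambda>x. a * w x) \<in> C \<and> inner_per L (\<lambda>x. a * w x) (\<lambda>x. a * w x) = 1
      \<and> Q (\<lambda>x. a * w x) (\<lambda>x. a * w x) = a\<^sup>2 * Q w w"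
    if w: "w \<in> C" "inner_per L w w \<noteq> 0" for w
  proof -
    define a where "a = 1 / sqrt (inner_per L w w)"
    have "inner_per L w w > 0" using w inner_per_nonneg[of w] by simp
    then have a: "a\<^sup>2 * inner_per L w w = 1" unfolding a_def by (simp add: power_divide)
    have wV: "w \<in> V" using w CV by auto
    have "inner_per L (\<lambda>x. a * w x) (\<lambda>x. a * w x) = a\<^sup>2 * inner_per L w w"
      using wV by (simp add: I.scale_left I.scale_right I.scale_closed power2_eq_square)
    moreover have "Q (\<lambda>x. a * w x) (\<lambda>x. a * w x) = a\<^sup>2 * Q w w"
      using wV by (simp add: B.scale_left B.scale_right B.scale_closed power2_eq_square)
    ultimately show ?thesis using a Cscale[OF w(1)] by auto
  qed
  have Ane: "A \<noteq> {}" using norm1[OF nontriv] unfolding A_def by blast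
  have Abd: "- K \<le> y" if yA: "y \<in> A" for y
  proof -
    obtain w where w: "w \<in> C" "inner_per L w w = 1" "y = Q w w" using yA unfolding A_def by blast
    have "0 \<le> c * (sobolev_norm L (m/2) w)\<^sup>2" using G(1) by simp
    then show ?thesis using G(3)[of w] w CV by auto
  qed
  then have Abb: "bdd_below A" by (meson bdd_below.I)
  define \<mu> where "\<mu> = Inf A"
  have "\<exists>w. w \<in> C \<and> inner_per L w w = 1 \<and> Q w w < \<mu> + 1 / real (Suc n)" for n
  proof -
    have "Inf A < \<mu> + 1 / real (Suc n)" unfolding \<mu>_def by simp
    then obtain y where "y \<in> A" "y < \<mu> + 1 / real (Suc n)" using cInf_lessD[OF Ane] by blast
    then show ?thesis unfolding A_def by auto
  qed
  then obtain v where v: "\<And>n. v n \<in> C" "\<And>n. inner_per L (v n) (v n) = 1" "\<And>n. Q (v n) (v n) < \<mu> + 1 / real (Suc n)" by metis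
  have vV: "v n \<in> V" for n using v(1) CV by auto
  have "c * (sobolev_norm L (m/2) (v n))\<^sup>2 \<le> \<mu> + 1 + K" for n
  proof -
    have "1 / real (Suc n) \<le> 1" by simp
    moreover have "c * (sobolev_norm L (m/2) (v n))\<^sup>2 - K * 1 \<le> Q (v n) (v n)"
      using G(3)[OF vV[of n]] unfolding v(2) .
    ultimately show ?thesis using v(3)[of n] by linarith
  qed
  then have R: "(sobolev_norm L (m/2) (v n))\<^sup>2 \<le> (\<mu> + 1 + K) / c" for n using G(1) by (simp add: field_simps)
  obtain w r where w: "strict_mono (r :: nat \<Rightarrow> nat)" "w \<in> V"
    "\<And>\<kappa>. (\<lambda>n. fourier_coeff L (v (r n)) \<kappa>) \<longlonglongrightarrow> fourier_coeff L w \<kappa>"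
    "(\<lambda>n. inner_per L (\<lambda>x. v (r n) x - w x) (\<lambda>x. v (r n) x - w x)) \<longlonglongrightarrow> 0"
    by (rule sobolev_compact_embedding[where v=v, OF half_gt_zero[OF m_pos] vV R]) blast
  let ?d = "\<lambda>n x. v (r n) x - w x"
  have dV: "?d n \<in> V" for n by (intro sobolev_diff vV w)
  have wL: "w \<in> L2_per L" using w(2) by (rule sobolev_L2)
  have vL: "v n \<in> L2_per L" for n using vV by (rule sobolev_L2)
  note it = inner_tendsto[OF w(4) vL wL]
  have wC: "w \<in> C"
  proof -
    have "inner_per L w z = 0" if z: "z \<in> Z" for z
    proof -
      have "(\<lambda>n. inner_per L (v (r n)) z) \<longlonglongrightarrow> inner_per L w z" using it z Z by blast
      moreover have "inner_per L (v (r n)) z = 0" for n using v(1)[of "r n"] z unfolding C_def by auto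
      ultimately show ?thesis by (simp add: LIMSEQ_const_iff)
    qed
    then show ?thesis using w(2) unfolding C_def by auto
  qed
  \<comment> \<open>Each quadratic term is written through the difference to the limit and a mixed
    term, whose limits are known; used for the L2 product and for the potential.\<close>
  have exp: "B' (v (r n)) (v (r n)) = B' (?d n) (?d n) + 2 * (B' (v (r n)) w) - B' w w" if "sym_form V B'" for B' n
  proof -
    interpret S: sym_form V B' by fact
    show ?thesis using vV[of "r n"] w(2) dV[of n] S.commute[of w "v (r n)"]
      by (simp add: S.diff_left S.diff_right)
  qed
  have w1: "inner_per L w w = 1"
  proof -
    have "(\<lambda>n. inner_per L (?d n) (?d n) + 2 * inner_per L (v (r n)) w - inner_per L w w) \<longlonglongrightarrow> 0 + 2 * inner_per L w w - inner_per L w w"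
      by (intro tendsto_intros w(4) it wL)
    then have "(\<lambda>n. 1) \<longlonglongrightarrow> inner_per L w w" unfolding exp[OF inner_V, symmetric] v(2) by simp
    then show ?thesis by (simp add: LIMSEQ_const_iff)
  qed
  let ?p = "\<lambda>u v. inner_per L (\<lambda>x. q x * u x) v"
  have pV: "sym_form V ?p" by (rule sym_form_subset[OF pot_sym_form V_L2 sobolev_add sobolev_scale])
  have pot: "(\<lambda>n. ?p (v (r n)) (v (r n))) \<longlonglongrightarrow> ?p w w"
  proof -
    have 1: "(\<lambda>n. ?p (?d n) (?d n)) \<longlonglongrightarrow> 0"
    proof (rule Lim_null_comparison)
      show "\<forall>\<^sub>F n in sequentially. norm (?p (?d n) (?d n)) \<le> Cq * inner_per L (?d n) (?d n)"
        using pot_bound[OF Cq(2) sobolev_L2[OF dV]] by simp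
      show "(\<lambda>n. Cq * inner_per L (?d n) (?d n)) \<longlonglongrightarrow> 0" using tendsto_mult[OF tendsto_const w(4)] by simp
    qed
    have 2: "?p (v (r n)) w = inner_per L (v (r n)) (\<lambda>x. q x * w x)" for n
      unfolding inner_per_def by (simp add: mult_ac)
    have "(\<lambda>n. ?p (?d n) (?d n) + 2 * inner_per L (v (r n)) (\<lambda>x. q x * w x) - ?p w w) \<longlonglongrightarrow> 0 + 2 * inner_per L w (\<lambda>x. q x * w x) - ?p w w"
      by (intro tendsto_intros 1 it q_L2 wL)
    moreover have "inner_per L w (\<lambda>x. q x * w x) = ?p w w" by (rule inner_per_commute)
    ultimately show ?thesis unfolding exp[OF pV] 2 by simp
  qed
  have 1: "\<bar>1\<bar> \<le> 1 * wt (m/2) \<kappa>" for \<kappa> using wt_ge_1[of "m/2" \<kappa>] m_pos by auto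
  have tb: "\<bar>1 * tw \<kappa> + K * 1\<bar> \<le> (2 * K) * wt (m/2) \<kappa>" for \<kappa>
  proof -
    have "K * 1 \<le> K * wt (m/2) \<kappa>" using G(2) 1[of \<kappa>] by (intro mult_left_mono) auto
    moreover have "(2 * K) * wt (m/2) \<kappa> = K * wt (m/2) \<kappa> + K * wt (m/2) \<kappa>" by simp
    ultimately show ?thesis using G(2) G(4)[of \<kappa>] unfolding abs_le_iff by linarith
  qed
  have Qe: "mform (\<lambda>\<kappa>. 1 * tw \<kappa> + K * 1) u u = Q u u - ?p u u + K * inner_per L u u" if "u \<in> V" for u
    unfolding mform_lincomb[OF that G(4) 1] Q_def parseval[OF sobolev_L2[OF that] sobolev_L2[OF that]] by simp
  \<comment> \<open>The shift by \<open>K\<close> makes every symbol value nonnegative, so finite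
    partial sums bound the form from below; these pass to the limit coefficient by
    coefficient.\<close>
  have lower: "L * (\<Sum>\<kappa>\<in>F. (1 * tw \<kappa> + K * 1) * (cmod (fourier_coeff L w \<kappa>))\<^sup>2) \<le> \<mu> - ?p w w + K" if F: "finite F" for F
  proof (rule LIMSEQ_le)
    show "(\<lambda>n. L * (\<Sum>\<kappa>\<in>F. (1 * tw \<kappa> + K * 1) * (cmod (fourier_coeff L (v (r n)) \<kappa>))\<^sup>2)) \<longlonglongrightarrow>
       L * (\<Sum>\<kappa>\<in>F. (1 * tw \<kappa> + K * 1) * (cmod (fourier_coeff L w \<kappa>))\<^sup>2)" by (intro tendsto_intros w(3))
    have "(\<lambda>n. 1 / real (Suc n)) \<longlonglongrightarrow> 0" using LIMSEQ_inverse_real_of_nat by (simp add: inverse_eq_divide)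
    from LIMSEQ_subseq_LIMSEQ[OF this w(1)]
    have "(\<lambda>n. \<mu> + 1 / real (Suc (r n)) - ?p (v (r n)) (v (r n)) + K) \<longlonglongrightarrow> \<mu> + 0 - ?p w w + K"
      by (intro tendsto_intros pot) (simp add: o_def)
    then show "(\<lambda>n. \<mu> + 1 / real (Suc (r n)) - ?p (v (r n)) (v (r n)) + K) \<longlonglongrightarrow> \<mu> - ?p w w + K" by simp
    have "L * (\<Sum>\<kappa>\<in>F. (1 * tw \<kappa> + K * 1) * (cmod (fourier_coeff L (v (r n)) \<kappa>))\<^sup>2) \<le> \<mu> + 1 / real (Suc (r n)) - ?p (v (r n)) (v (r n)) + K" for n
    proof -
      have "L * (\<Sum>\<kappa>\<in>F. (1 * tw \<kappa> + K * 1) * (cmod (fourier_coeff L (v (r n)) \<kappa>))\<^sup>2) \<le> mform (\<lambda>\<kappa>. 1 * tw \<kappa> + K * 1) (v (r n)) (v (r n))"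
        by (rule mform_finite_le[OF vV tb _ F]) (use G(5) in simp)
      then show ?thesis unfolding Qe[OF vV] using v(2,3)[of "r n"] by simp
    qed
    then show "\<exists>N. \<forall>n\<ge>N. L * (\<Sum>\<kappa>\<in>F. (1 * tw \<kappa> + K * 1) * (cmod (fourier_coeff L (v (r n)) \<kappa>))\<^sup>2) \<le> \<mu> + 1 / real (Suc (r n)) - ?p (v (r n)) (v (r n)) + K" by blast
  qed
  have "(\<Sum>\<^sub>\<infinity>\<kappa>. (1 * tw \<kappa> + K * 1) * (cmod (fourier_coeff L w \<kappa>))\<^sup>2) \<le> (\<mu> - ?p w w + K) / L"
  proof (rule infsum_le_finite_sums[OF mform_self_summable[OF w(2) tb]])
    fix F :: "int set" assume "finite F"
    from lower[OF this] show "(\<Sum>\<kappa>\<in>F. (1 * tw \<kappa> + K * 1) * (cmod (fourier_coeff L w \<kappa>))\<^sup>2) \<le> (\<mu> - ?p w w + K) / L"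
      using L_pos by (simp add: pos_le_divide_eq mult.commute)
  qed
  then have "mform (\<lambda>\<kappa>. 1 * tw \<kappa> + K * 1) w w \<le> \<mu> - ?p w w + K"
    unfolding mform_self using L_pos by (simp add: pos_le_divide_eq mult.commute)
  then have Qw: "Q w w \<le> \<mu>" unfolding Qe[OF w(2)] w1 by simp
  show ?thesis
  proof (rule that[OF wC w1])
    fix u assume u: "u \<in> C"
    show "Q w w * inner_per L u u \<le> Q u u"
    proof (cases "inner_per L u u = 0")
      case True
      \<comment> \<open>Zero L2 norm gives a null function, not the zero function; its coefficients
        all vanish nevertheless.\<close>
      have "AE x in lborel. u x = 0" using True u CV by (intro inner_per_zero_AE) (auto intro: sobolev_L2)
      then have "fourier_coeff L u = fourier_coeff L (\<lambda>x. 0)"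
        using u CV L2_perD(1)[OF sobolev_L2] by (intro fourier_coeff_cong_AE) auto
      then have "mform tw u u = 0" unfolding mform_self by (simp add: fourier_coeff_def)
      moreover have "?p u u = 0" using pot_bound[OF Cq(2), of u] True u CV sobolev_L2 by fastforce
      ultimately show ?thesis using True unfolding Q_def by simp
    next
      case False
      then obtain a where a: "a\<^sup>2 * inner_per L u u = 1" "(\<lambda>x. a * u x) \<in> C" "inner_per L (\<lambda>x. a * u x) (\<lambda>x. a * u x) = 1"
        "Q (\<lambda>x. a * u x) (\<lambda>x. a * u x) = a\<^sup>2 * Q u u" using norm1[OF u] by blast
      then have "a\<^sup>2 * Q u u \<in> A" unfolding A_def by force
      then have "\<mu> \<le> a\<^sup>2 * Q u u" unfolding \<mu>_def by (rule cInf_lower[OF _ Abb])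
      then have "Q w w \<le> a\<^sup>2 * Q u u" using Qw by simp
      then have "Q w w * inner_per L u u \<le> (a\<^sup>2 * Q u u) * inner_per L u u" by (intro mult_right_mono inner_per_nonneg)
      also have "\<dots> = Q u u * (a\<^sup>2 * inner_per L u u)" by simp
      finally show ?thesis using a(1) by simp
    qed
  qed
qed

section \<open>Coercivity from the spectral hypothesis\<close>

lemma project_out:
  assumes x: "x \<in> V" and e: "e \<in> V" and ne: "inner_per L e e \<noteq> 0"
  shows "inner_per L (\<lambda>t. x t + (- (inner_per L x e / inner_per L e e)) * e t) e = 0"
  unfolding sym_form.lincomb_left[OF inner_V x e e] using ne by simp

text \<open>If the minimum of \<open>Q\<close> over unit vectors orthogonal to \<xi> and \<psi> were
  not positive, the minimiser would be an eigenfunction with eigenvalue at most 0 in that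
  complement, which \<open>no_ev\<close> excludes.\<close>

lemma spectral_gap:
  assumes \<xi>: "\<xi> \<in> sobolev_per L m" "AE x in lborel. Lop \<xi> x = \<Lambda> * \<xi> x" "inner_per L \<xi> \<xi> \<noteq> 0"
    and \<psi>: "\<psi> \<in> sobolev_per L m" "AE x in lborel. Lop \<psi> x = 0" "inner_per L \<psi> \<psi> \<noteq> 0"
    and \<Lambda>: "\<Lambda> < 0"
    and no_ev: "\<And>l v. l \<le> 0 \<Longrightarrow> v \<in> sobolev_per L m \<Longrightarrow> (AE x in lborel. Lop v x = l * v x) \<Longrightarrow>
        inner_per L v \<xi> = 0 \<Longrightarrow> inner_per L v \<psi> = 0 \<Longrightarrow> inner_per L v v = 0"
  obtains c where "c > 0" "\<And>v. v \<in> V \<Longrightarrow> inner_per L v \<xi> = 0 \<Longrightarrow> inner_per L v \<psi> = 0 \<Longrightarrow> c * inner_per L v v \<le> Q v v"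
proof -
  interpret B: sym_form V Q by (rule Q_sym_form)
  interpret I: sym_form V "inner_per L" by (rule inner_V)
  have \<xi>V: "\<xi> \<in> V" and \<psi>V: "\<psi> \<in> V" using \<xi>(1) \<psi>(1) Hm_V by auto
  have Q\<xi>: "Q \<xi> v = \<Lambda> * inner_per L \<xi> v" if "v \<in> L2_per L" for v
    using Q_AE[OF \<xi>(1) L2_scale[OF sobolev_L2[OF \<xi>(1)]] \<xi>(2) that] by (simp add: inner_per_scale_left)
  have Q\<psi>: "Q \<psi> v = 0" if "v \<in> L2_per L" for v
    using Q_AE[OF \<psi>(1) L2_const \<psi>(2) that] by (simp add: inner_per_def)
  have \<xi>\<psi>: "inner_per L \<xi> \<psi> = 0"
    using Q\<xi>[OF sobolev_L2[OF \<psi>V]] Q\<psi>[OF sobolev_L2[OF \<xi>V]] B.commute[OF \<xi>V \<psi>V] \<Lambda> by simp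
  then have \<psi>\<xi>: "inner_per L \<psi> \<xi> = 0" by (subst inner_per_commute)
  define C where "C = {v \<in> V. \<forall>z\<in>{\<xi>, \<psi>}. inner_per L v z = 0}"
  show ?thesis
  proof (cases "\<exists>u0\<in>C. inner_per L u0 u0 \<noteq> 0")
    case False
    have "1 * inner_per L v v \<le> Q v v" if v: "v \<in> V" "inner_per L v \<xi> = 0" "inner_per L v \<psi> = 0" for v
    proof -
      obtain c K where "c > 0" "\<And>u. u \<in> V \<Longrightarrow> Q u u \<ge> c * (sobolev_norm L (m/2) u)\<^sup>2 - K * inner_per L u u"
        by (rule Garding) blast
      moreover have "inner_per L v v = 0" using False v unfolding C_def by auto
      ultimately show ?thesis using v(1) zero_le_power2[of "sobolev_norm L (m/2) v"]
        by (smt (verit) mult_cancel_right1 mult_nonneg_nonneg mult_zero_right)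
    qed
    then show ?thesis using that[of 1] by simp
  next
    case True
    then obtain u0 where u0: "u0 \<in> C" "inner_per L u0 u0 \<noteq> 0" by blast
    have Z: "{\<xi>, \<psi>} \<subseteq> L2_per L" using \<xi>V \<psi>V sobolev_L2 by auto
    obtain v where v: "v \<in> C" "inner_per L v v = 1" "\<And>w. w \<in> C \<Longrightarrow> Q v v * inner_per L w w \<le> Q w w"
      by (rule Q_minimizer[OF Z C_def u0]) blast
    define \<mu> where "\<mu> = Q v v"
    have vV: "v \<in> V" and v\<xi>: "inner_per L v \<xi> = 0" and v\<psi>: "inner_per L v \<psi> = 0" using v(1) unfolding C_def by auto
    have "\<mu> > 0"
    proof (rule ccontr)
      assume "\<not> \<mu> > 0"
      then have \<mu>: "\<mu> \<le> 0" by simp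
      let ?B = "\<lambda>u w. Q u w + (- \<mu>) * inner_per L u w"
      have CV: "C \<subseteq> V" unfolding C_def by auto
      have Cadd: "(\<lambda>x. u x + w x) \<in> C" if "u \<in> C" "w \<in> C" for u w
        using that \<xi>V \<psi>V unfolding C_def by (simp add: I.add_left I.add_closed)
      have Cscale: "(\<lambda>x. a * u x) \<in> C" if "u \<in> C" for a u
        using that \<xi>V \<psi>V unfolding C_def by (simp add: I.scale_left I.scale_closed)
      have BV: "sym_form V ?B" by (rule sym_form_lincomb[OF Q_sym_form inner_V])
      have BC: "sym_form C ?B" by (rule sym_form_subset[OF BV CV Cadd Cscale])
      \<comment> \<open>The Euler-Lagrange equation without differentiation: \<open>?B\<close> is
        nonnegative on \<open>C\<close> and vanishes at \<open>v\<close>, so Cauchy-Schwarz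
        annihilates all its pairings with \<open>v\<close>.\<close>
      have EL: "?B v w = 0" if "w \<in> C" for w
      proof -
        have "(?B v w)\<^sup>2 \<le> ?B v v * ?B w w"
          by (rule sym_form.Cauchy_Schwarz[OF BC v(1) that]) (use v(3) in \<open>simp add: \<mu>_def\<close>)
        also have "?B v v = 0" using v(2) by (simp add: \<mu>_def)
        finally show ?thesis by simp
      qed
      \<comment> \<open>So far the equation is tested on \<open>C\<close> only. Since
        \<open>?B v\<close> also vanishes on \<xi> and \<psi>, the components of a general test
        function along them may be removed.\<close>
      have weak: "Q v w = inner_per L (\<lambda>x. \<mu> * v x) w" if w: "w \<in> V" for w
      proof -
        define w1 where "w1 = (\<lambda>t. w t + (- (inner_per L w \<xi> / inner_per L \<xi> \<xi>)) * \<xi> t)"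
        define w2 where "w2 = (\<lambda>t. w1 t + (- (inner_per L w1 \<psi> / inner_per L \<psi> \<psi>)) * \<psi> t)"
        have w1V: "w1 \<in> V" unfolding w1_def by (rule I.lincomb_closed[OF w \<xi>V])
        have w2V: "w2 \<in> V" unfolding w2_def by (rule I.lincomb_closed[OF w1V \<psi>V])
        have "inner_per L w1 \<xi> = 0" unfolding w1_def by (rule project_out[OF w \<xi>V \<xi>(3)])
        moreover have "inner_per L w2 \<xi> = inner_per L w1 \<xi> + (- (inner_per L w1 \<psi> / inner_per L \<psi> \<psi>)) * inner_per L \<psi> \<xi>"
          unfolding w2_def by (rule I.lincomb_left[OF w1V \<psi>V \<xi>V])
        ultimately have "inner_per L w2 \<xi> = 0" using \<psi>\<xi> by simp
        moreover have "inner_per L w2 \<psi> = 0" unfolding w2_def by (rule project_out[OF w1V \<psi>V \<psi>(3)])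
        ultimately have "w2 \<in> C" using w2V unfolding C_def by auto
        then have 0: "?B v w2 = 0" by (rule EL)
        have "Q v \<xi> = 0" using B.commute[OF vV \<xi>V] Q\<xi>[OF sobolev_L2[OF vV]] v\<xi> inner_per_commute[of v \<xi>] by simp
        then have B\<xi>: "?B v \<xi> = 0" using v\<xi> by simp
        have B\<psi>: "?B v \<psi> = 0" using B.commute[OF vV \<psi>V] Q\<psi>[OF sobolev_L2[OF vV]] v\<psi> by simp
        have "?B v w1 = 0" using 0 B\<psi> unfolding w2_def sym_form.lincomb_right[OF BV w1V \<psi>V vV] by (simp only:)
        then have "?B v w = 0" using B\<xi> unfolding w1_def sym_form.lincomb_right[OF BV w \<xi>V vV] by (simp only:)
        then show ?thesis by (simp add: inner_per_scale_left)
      qed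
      have g: "(\<lambda>x. \<mu> * v x) \<in> L2_per L" using L2_scale sobolev_L2[OF vV] by blast
      show False
        using no_ev[OF \<mu> weak_solution_regular(1)[OF vV g weak] weak_solution_regular(2)[OF vV g weak] v\<xi> v\<psi>] v(2) by simp
    qed
    moreover have "\<mu> * inner_per L w w \<le> Q w w" if "w \<in> V" "inner_per L w \<xi> = 0" "inner_per L w \<psi> = 0" for w
      using v(3)[of w] that unfolding C_def \<mu>_def by simp
    ultimately show ?thesis using that by blast
  qed
qed

text \<open>The constraint \<open>(h, g) = 0\<close> means \<open>Q \<Upsilon> h = 0\<close> for a direction with \<open>Q \<Upsilon> \<Upsilon> < 0\<close>; such a \<open>\<Upsilon>\<close> uses up
  the only negative direction of \<open>Q\<close>.\<close>

lemma coercive_on_constraint: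
  assumes \<xi>: "\<xi> \<in> sobolev_per L m" "AE x in lborel. Lop \<xi> x = \<Lambda> * \<xi> x" "inner_per L \<xi> \<xi> \<noteq> 0"
    and \<psi>: "\<psi> \<in> sobolev_per L m" "AE x in lborel. Lop \<psi> x = 0" "inner_per L \<psi> \<psi> \<noteq> 0"
    and \<Lambda>: "\<Lambda> < 0"
    and gap: "c0 > 0" "\<And>v. v \<in> V \<Longrightarrow> inner_per L v \<xi> = 0 \<Longrightarrow> inner_per L v \<psi> = 0 \<Longrightarrow> c0 * inner_per L v v \<le> Q v v"
    and \<Upsilon>: "\<Upsilon> \<in> V" "Q \<Upsilon> \<Upsilon> < 0"
  obtains c where "c > 0" "\<And>h. h \<in> V \<Longrightarrow> inner_per L h \<psi> = 0 \<Longrightarrow> Q \<Upsilon> h = 0 \<Longrightarrow> c * inner_per L h h \<le> Q h h"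
proof -
  interpret B: sym_form V Q by (rule Q_sym_form)
  interpret I: sym_form V "inner_per L" by (rule inner_V)
  have \<xi>V: "\<xi> \<in> V" and \<psi>V: "\<psi> \<in> V" using \<xi>(1) \<psi>(1) Hm_V by auto
  have Q\<xi>: "Q \<xi> v = \<Lambda> * inner_per L \<xi> v" if "v \<in> L2_per L" for v
    using Q_AE[OF \<xi>(1) L2_scale[OF sobolev_L2[OF \<xi>(1)]] \<xi>(2) that] by (simp add: inner_per_scale_left)
  have Q\<psi>: "Q \<psi> v = 0" if "v \<in> L2_per L" for v
    using Q_AE[OF \<psi>(1) L2_const \<psi>(2) that] by (simp add: inner_per_def)
  have \<xi>\<psi>: "inner_per L \<xi> \<psi> = 0"
    using Q\<xi>[OF sobolev_L2[OF \<psi>V]] Q\<psi>[OF sobolev_L2[OF \<xi>V]] B.commute[OF \<xi>V \<psi>V] \<Lambda> by simp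
  then have \<psi>\<xi>: "inner_per L \<psi> \<xi> = 0" by (subst inner_per_commute)
  define N where "N = inner_per L \<xi> \<xi>"
  have N: "N > 0" using \<xi>(3) inner_per_nonneg[of \<xi>] unfolding N_def by simp
  define C where "C = {v \<in> V. inner_per L v \<xi> = 0 \<and> inner_per L v \<psi> = 0}"
  have CV: "C \<subseteq> V" unfolding C_def by auto
  have Cadd: "(\<lambda>x. u x + w x) \<in> C" if "u \<in> C" "w \<in> C" for u w
    using that \<xi>V \<psi>V unfolding C_def by (simp add: I.add_left I.add_closed)
  have Cscale: "(\<lambda>x. a * u x) \<in> C" if "u \<in> C" for a u
    using that \<xi>V \<psi>V unfolding C_def by (simp add: I.scale_left I.scale_closed)
  have QC: "sym_form C Q" by (rule sym_form_subset[OF Q_sym_form CV Cadd Cscale])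
  have Cpos: "0 \<le> Q u u" if "u \<in> C" for u
    using gap(2)[of u] gap(1) that inner_per_nonneg[of u] unfolding C_def
    by (smt (verit) mem_Collect_eq mult_nonneg_nonneg)
  \<comment> \<open>The components along \<xi>, \<psi> and \<open>C\<close> are orthogonal for
    \<open>Q\<close>, and for L2 as well once \<open>u\<close> is orthogonal to \<psi>. The
    elimination form allows it to be applied to both \<Upsilon> and \<open>h\<close>.\<close>
  have dec: thesis
    if u: "u \<in> V" and k: "\<And>\<alpha> p \<gamma>. p \<in> C \<Longrightarrow> Q u u = \<Lambda> * N * \<alpha>\<^sup>2 + Q p p \<Longrightarrow>
        inner_per L u \<psi> = 0 \<longrightarrow> inner_per L u u = N * \<alpha>\<^sup>2 + inner_per L p p \<Longrightarrow>
        \<forall>w\<in>C. Q u w = Q p w \<Longrightarrow> Q u \<xi> = \<Lambda> * N * \<alpha> \<Longrightarrow> u = (\<lambda>t. p t + \<alpha> * \<xi> t + \<gamma> * \<psi> t) \<Longrightarrow> thesis"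
    for u thesis
  proof -
    define \<alpha> where "\<alpha> = inner_per L u \<xi> / N"
    define p1 where "p1 = (\<lambda>t. u t + (- \<alpha>) * \<xi> t)"
    define \<gamma> where "\<gamma> = inner_per L p1 \<psi> / inner_per L \<psi> \<psi>"
    define p where "p = (\<lambda>t. p1 t + (- \<gamma>) * \<psi> t)"
    have p1V: "p1 \<in> V" unfolding p1_def by (rule I.lincomb_closed[OF u \<xi>V])
    have pV: "p \<in> V" unfolding p_def by (rule I.lincomb_closed[OF p1V \<psi>V])
    have p1\<xi>: "inner_per L p1 \<xi> = 0" unfolding p1_def \<alpha>_def N_def by (rule project_out[OF u \<xi>V \<xi>(3)])
    moreover have "inner_per L p \<xi> = inner_per L p1 \<xi> + (- \<gamma>) * inner_per L \<psi> \<xi>"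
      unfolding p_def by (rule I.lincomb_left[OF p1V \<psi>V \<xi>V])
    ultimately have p\<xi>: "inner_per L p \<xi> = 0" using \<psi>\<xi> by simp
    have p\<psi>: "inner_per L p \<psi> = 0" unfolding p_def \<gamma>_def by (rule project_out[OF p1V \<psi>V \<psi>(3)])
    have pC: "p \<in> C" using pV p\<xi> p\<psi> unfolding C_def by auto
    define s where "s = (\<lambda>t. p t + \<alpha> * \<xi> t)"
    have sV: "s \<in> V" unfolding s_def by (rule I.lincomb_closed[OF pV \<xi>V])
    have us: "u = (\<lambda>t. s t + \<gamma> * \<psi> t)" unfolding s_def p_def p1_def by simp
    have Qp\<xi>: "Q p \<xi> = 0" using B.commute[OF pV \<xi>V] Q\<xi>[OF sobolev_L2[OF pV]] p\<xi> inner_per_commute[of p \<xi>] by simp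
    have Qr\<psi>: "Q v \<psi> = 0" if "v \<in> V" for v using B.commute[OF that \<psi>V] Q\<psi>[OF sobolev_L2[OF that]] by simp
    have Q\<xi>\<xi>: "Q \<xi> \<xi> = \<Lambda> * N" unfolding N_def by (rule Q\<xi>[OF sobolev_L2[OF \<xi>V]])
    have "Q u u = Q s s" unfolding us B.expand[OF sV \<psi>V] Qr\<psi>[OF sV] Qr\<psi>[OF \<psi>V] by simp
    also have "\<dots> = Q p p + \<alpha>\<^sup>2 * (\<Lambda> * N)" unfolding s_def B.expand[OF pV \<xi>V] Qp\<xi> Q\<xi>\<xi> by simp
    finally have 1: "Q u u = \<Lambda> * N * \<alpha>\<^sup>2 + Q p p" by simp
    have 2: "inner_per L u u = N * \<alpha>\<^sup>2 + inner_per L p p" if "inner_per L u \<psi> = 0"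
    proof -
      have "inner_per L p1 \<psi> = 0" unfolding p1_def I.lincomb_left[OF u \<xi>V \<psi>V] using \<xi>\<psi> that by simp
      then have "\<gamma> = 0" unfolding \<gamma>_def by simp
      then have "u = s" using us by simp
      then show ?thesis unfolding s_def using I.expand[OF pV \<xi>V, of \<alpha>] p\<xi> by (simp add: N_def)
    qed
    have 3: "Q u w = Q p w" if w: "w \<in> C" for w
    proof -
      have wV: "w \<in> V" and "inner_per L w \<xi> = 0" using w unfolding C_def by auto
      then have "Q \<xi> w = 0" using Q\<xi>[OF sobolev_L2[OF wV]] inner_per_commute[of w \<xi>] by simp
      then show ?thesis unfolding us B.lincomb_left[OF sV \<psi>V wV] Q\<psi>[OF sobolev_L2[OF wV]]
        unfolding s_def B.lincomb_left[OF pV \<xi>V wV] by simp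
    qed
    have 4: "Q u \<xi> = \<Lambda> * N * \<alpha>"
      unfolding us B.lincomb_left[OF sV \<psi>V \<xi>V] Q\<psi>[OF sobolev_L2[OF \<xi>V]]
      unfolding s_def B.lincomb_left[OF pV \<xi>V \<xi>V] Qp\<xi> Q\<xi>\<xi> by simp
    show thesis
      by (rule k[of p \<alpha> \<gamma>]) (use pC 1 2 3 4 us in \<open>simp_all add: s_def\<close>)
  qed
  obtain \<beta> p0 \<gamma>0 where u: "p0 \<in> C" "Q \<Upsilon> \<Upsilon> = \<Lambda> * N * \<beta>\<^sup>2 + Q p0 p0"
      "inner_per L \<Upsilon> \<psi> = 0 \<longrightarrow> inner_per L \<Upsilon> \<Upsilon> = N * \<beta>\<^sup>2 + inner_per L p0 p0"
      "\<forall>w\<in>C. Q \<Upsilon> w = Q p0 w" "Q \<Upsilon> \<xi> = \<Lambda> * N * \<beta>" "\<Upsilon> = (\<lambda>t. p0 t + \<beta> * \<xi> t + \<gamma>0 * \<psi> t)"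
    by (rule dec[OF \<Upsilon>(1)])
  define G where "G = - \<Lambda> * N"
  have G: "G > 0" unfolding G_def using \<Lambda> N by (simp add: mult_neg_pos)
  define S where "S = Q p0 p0"
  have S: "0 \<le> S" "S < G * \<beta>\<^sup>2" using Cpos[OF u(1)] u(2) \<Upsilon>(2) unfolding S_def G_def by auto
  have \<beta>: "\<beta>\<^sup>2 > 0" using S by (cases "\<beta> = 0") auto
  \<comment> \<open>\<open>Q \<Upsilon> \<Upsilon> < 0\<close> means that \<open>S\<close> stays
    strictly below \<open>G * \<beta>\<^sup>2\<close>, and \<delta> is the relative margin. The
    negative part of \<open>Q h h\<close> will consume at most the fraction
    \<open>1 - \<delta>\<close> of \<open>Q p p\<close>.\<close>
  define \<delta> where "\<delta> = 1 - S / (G * \<beta>\<^sup>2)"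
  have \<delta>: "\<delta> > 0" "\<delta> \<le> 1" unfolding \<delta>_def using S G \<beta> by (auto simp: divide_simps)
  \<comment> \<open>The denominator is the factor by which \<open>Q p p\<close> controls
    \<open>N * \<alpha>\<^sup>2 + inner_per L p p\<close>, the squared L2 norm of
    \<open>h\<close>.\<close>
  define c where "c = \<delta> / (N / G + 1 / c0)"
  have den: "N / G + 1 / c0 > 0" using N G gap(1) by (simp add: add_pos_pos)
  have c: "c > 0" unfolding c_def using \<delta> den by simp
  show ?thesis
  proof (rule that[OF c])
    fix h assume h: "h \<in> V" "inner_per L h \<psi> = 0" "Q \<Upsilon> h = 0"
    obtain \<alpha> p \<gamma> where p: "p \<in> C" "Q h h = \<Lambda> * N * \<alpha>\<^sup>2 + Q p p"
      and p3: "inner_per L h \<psi> = 0 \<longrightarrow> inner_per L h h = N * \<alpha>\<^sup>2 + inner_per L p p"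
      and "\<forall>w\<in>C. Q h w = Q p w" "Q h \<xi> = \<Lambda> * N * \<alpha>" and h_eq: "h = (\<lambda>t. p t + \<alpha> * \<xi> t + \<gamma> * \<psi> t)"
      by (rule dec[OF h(1)])
    have pV: "p \<in> V" using p(1) CV by auto
    have "Q \<Upsilon> h = Q \<Upsilon> p + \<alpha> * Q \<Upsilon> \<xi> + \<gamma> * Q \<Upsilon> \<psi>"
      unfolding h_eq using B.lincomb_right[OF I.lincomb_closed[OF pV \<xi>V] \<psi>V \<Upsilon>(1)] B.lincomb_right[OF pV \<xi>V \<Upsilon>(1)] by simp
    moreover have "Q \<Upsilon> \<psi> = 0" using B.commute[OF \<Upsilon>(1) \<psi>V] Q\<psi>[OF sobolev_L2[OF \<Upsilon>(1)]] by simp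
    ultimately have "Q p0 p = G * \<alpha> * \<beta>" using h(3) bspec[OF u(4) p(1)] u(5) unfolding G_def
      by (simp add: eq_neg_iff_add_eq_0 mult_ac)
    \<comment> \<open>The constraint expresses \<alpha> through the pairing of the two components in
      \<open>C\<close>, where \<open>Q\<close> is nonnegative; Cauchy-Schwarz there bounds the
      negative direction by the positive one.\<close>
    then have cs: "(G * \<alpha> * \<beta>)\<^sup>2 \<le> S * Q p p"
      using sym_form.Cauchy_Schwarz[OF QC u(1) p(1) Cpos] unfolding S_def by simp
    have "G * \<alpha>\<^sup>2 * (G * \<beta>\<^sup>2) \<le> S * Q p p" using cs by (simp add: power2_eq_square mult_ac)
    then have 1: "G * \<alpha>\<^sup>2 \<le> (1 - \<delta>) * Q p p" unfolding \<delta>_def using G \<beta> by (simp add: pos_le_divide_eq)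
    have Qp: "0 \<le> Q p p" by (rule Cpos[OF p(1)])
    have low: "\<delta> * Q p p \<le> Q h h" using 1 p(2) unfolding G_def by (simp add: algebra_simps)
    have "(1 - \<delta>) * Q p p \<le> 1 * Q p p" using \<delta> Qp by (intro mult_right_mono) auto
    then have "G * \<alpha>\<^sup>2 \<le> Q p p" using 1 by simp
    then have "N * \<alpha>\<^sup>2 \<le> N / G * Q p p" using G N by (simp add: field_simps)
    moreover have "inner_per L p p \<le> 1 / c0 * Q p p"
      using gap(2)[of p] gap(1) p(1) unfolding C_def by (simp add: field_simps)
    ultimately have "inner_per L h h \<le> (N / G + 1 / c0) * Q p p" using p3 h(2) by (simp add: distrib_right)
    then have "c * inner_per L h h \<le> c * ((N / G + 1 / c0) * Q p p)" using c by (intro mult_left_mono) auto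
    also have "\<dots> = \<delta> * Q p p" unfolding c_def using den by simp
    finally show "c * inner_per L h h \<le> Q h h" using low by linarith
  qed
qed

text \<open>Subtracting the right multiple of \<Upsilon> from \<open>h\<close> restores the
  constraint at a cost proportional to the square of \<open>(g, h)\<close>, which the penalty
  outweighs. The L2 bound obtained in this way is upgraded to H^(m/2) by Garding.\<close>

theorem coercive_augmented:
  assumes \<xi>: "\<xi> \<in> sobolev_per L m" "AE x in lborel. Lop \<xi> x = \<Lambda> * \<xi> x" "inner_per L \<xi> \<xi> \<noteq> 0"
    and \<psi>: "\<psi> \<in> sobolev_per L m" "AE x in lborel. Lop \<psi> x = 0" "inner_per L \<psi> \<psi> \<noteq> 0"
    and \<Lambda>: "\<Lambda> < 0"
    and no_ev: "\<And>l v. l \<le> 0 \<Longrightarrow> v \<in> sobolev_per L m \<Longrightarrow> (AE x in lborel. Lop v x = l * v x) \<Longrightarrow>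
        inner_per L v \<xi> = 0 \<Longrightarrow> inner_per L v \<psi> = 0 \<Longrightarrow> inner_per L v v = 0"
    and \<Upsilon>: "\<Upsilon> \<in> V" "Q \<Upsilon> \<Upsilon> < 0" and g: "\<And>w. w \<in> V \<Longrightarrow> Q \<Upsilon> w = - inner_per L g w"
  obtains c K where "c > 0" "K > 0"
    "\<And>h. h \<in> V \<Longrightarrow> inner_per L h \<psi> = 0 \<Longrightarrow> c * (sobolev_norm L (m/2) h)\<^sup>2 \<le> Q h h + K * (inner_per L g h)\<^sup>2"
proof -
  interpret B: sym_form V Q by (rule Q_sym_form)
  interpret I: sym_form V "inner_per L" by (rule inner_V)
  obtain c0 where gap: "c0 > 0" "\<And>v. v \<in> V \<Longrightarrow> inner_per L v \<xi> = 0 \<Longrightarrow> inner_per L v \<psi> = 0 \<Longrightarrow> c0 * inner_per L v v \<le> Q v v"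
    by (rule spectral_gap[OF \<xi> \<psi> \<Lambda> no_ev]) blast+
  obtain c1 where c1: "c1 > 0" "\<And>h. h \<in> V \<Longrightarrow> inner_per L h \<psi> = 0 \<Longrightarrow> Q \<Upsilon> h = 0 \<Longrightarrow> c1 * inner_per L h h \<le> Q h h"
    by (rule coercive_on_constraint[OF \<xi> \<psi> \<Lambda> gap \<Upsilon>]) blast+
  have \<psi>V: "\<psi> \<in> V" using \<psi>(1) Hm_V by auto
  have Q\<psi>: "Q \<psi> v = 0" if "v \<in> L2_per L" for v
    using Q_AE[OF \<psi>(1) L2_const \<psi>(2) that] by (simp add: inner_per_def)
  have Qr\<psi>: "Q v \<psi> = 0" if "v \<in> V" for v using B.commute[OF that \<psi>V] Q\<psi>[OF sobolev_L2[OF that]] by simp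
  \<comment> \<open>The component along \<psi> is removed from \<Upsilon> so that corrections of
    \<open>h\<close> stay orthogonal to \<psi>; \<open>Q\<close> does not notice, as \<psi> spans
    its kernel.\<close>
  define y where "y = (\<lambda>t. \<Upsilon> t + (- (inner_per L \<Upsilon> \<psi> / inner_per L \<psi> \<psi>)) * \<psi> t)"
  have yV: "y \<in> V" unfolding y_def by (rule I.lincomb_closed[OF \<Upsilon>(1) \<psi>V])
  have y\<psi>: "inner_per L y \<psi> = 0" unfolding y_def by (rule project_out[OF \<Upsilon>(1) \<psi>V \<psi>(3)])
  have Qy: "Q y w = Q \<Upsilon> w" if "w \<in> V" for w
    unfolding y_def B.lincomb_left[OF \<Upsilon>(1) \<psi>V that] Q\<psi>[OF sobolev_L2[OF that]] by simp
  define D where "D = - Q \<Upsilon> \<Upsilon>"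
  have D: "D > 0" using \<Upsilon>(2) unfolding D_def by simp
  have Qyy: "Q y y = - D" using Qy[OF yV] B.commute[OF \<Upsilon>(1) yV] Qy[OF \<Upsilon>(1)] unfolding D_def by simp
  define Y where "Y = inner_per L y y"
  have Y: "Y \<ge> 0" unfolding Y_def by (rule inner_per_nonneg)
  obtain cg Cg where Gd: "cg > 0" "Cg > 0" "\<And>u. u \<in> V \<Longrightarrow> Q u u \<ge> cg * (sobolev_norm L (m/2) u)\<^sup>2 - Cg * inner_per L u u"
    by (rule Garding) blast
  define c2 where "c2 = 1 / (2 / c1 + 2 * Y / D)"
  have den: "2 / c1 + 2 * Y / D > 0" using c1 D Y by (intro add_pos_nonneg) auto
  have c2: "c2 > 0" unfolding c2_def using den by simp
  define c where "c = cg / (1 + Cg / c2)"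
  have den2: "1 + Cg / c2 > 0" using Gd c2 by (intro add_pos_nonneg) auto
  have c: "c > 0" unfolding c_def using Gd den2 by simp
  show ?thesis
  \<comment> \<open>Restoring the constraint costs \<open>t\<^sup>2 * D\<close>; the weight
    \<open>2 / D\<close> makes the penalty equal to twice that, so \<open>t\<^sup>2 * D\<close> is
    left over to control the correction.\<close>
  proof (rule that[OF c, of "2 / D"])
    show "2 / D > 0" using D by simp
    fix h assume h: "h \<in> V" "inner_per L h \<psi> = 0"
    define t where "t = inner_per L g h / D"
    define k where "k = (\<lambda>x. h x + (- t) * y x)"
    have kV: "k \<in> V" unfolding k_def by (rule I.lincomb_closed[OF h(1) yV])
    have hk: "h = (\<lambda>x. k x + t * y x)" unfolding k_def by simp
    have k\<psi>: "inner_per L k \<psi> = 0" unfolding k_def I.lincomb_left[OF h(1) yV \<psi>V] using h(2) y\<psi> by simp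
    have "Q \<Upsilon> y = - D" using Qy[OF yV] Qyy by simp
    then have Qk: "Q \<Upsilon> k = 0"
      unfolding k_def B.lincomb_right[OF h(1) yV \<Upsilon>(1)] g[OF h(1)] t_def using D by simp
    have ck: "c1 * inner_per L k k \<le> Q k k" by (rule c1(2)[OF kV k\<psi> Qk])
    have "Q k y = 0" using B.commute[OF kV yV] Qy[OF kV] Qk by simp
    then have Qh: "Q h h = Q k k - t\<^sup>2 * D" unfolding hk B.expand[OF kV yV] Qyy by simp
    define T where "T = Q h h + 2 / D * (inner_per L g h)\<^sup>2"
    have "inner_per L g h = t * D" unfolding t_def using D by simp
    then have "2 / D * (inner_per L g h)\<^sup>2 = 2 * (t\<^sup>2 * D)" using D by (simp add: power2_eq_square)
    then have T: "T = Q k k + t\<^sup>2 * D" unfolding T_def Qh by simp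
    have kk: "inner_per L k k \<ge> 0" by (rule inner_per_nonneg)
    have t2: "0 \<le> t\<^sup>2 * D" using D by simp
    have Qkk: "0 \<le> Q k k" using ck mult_nonneg_nonneg[OF less_imp_le[OF c1(1)] kk] by linarith
    have "inner_per L h h = inner_per L k k + 2 * t * inner_per L k y + t\<^sup>2 * Y"
      unfolding hk I.expand[OF kV yV] Y_def ..
    \<comment> \<open>Nonnegativity of the norm of \<open>k - t * y\<close> bounds the mixed term,
      which gives the parallelogram estimate with factor 2.\<close>
    moreover have "0 \<le> inner_per L k k + 2 * (- t) * inner_per L k y + (- t)\<^sup>2 * Y"
      using I.expand[OF kV yV, of "- t"] inner_per_nonneg unfolding Y_def by metis
    ultimately have "inner_per L h h \<le> 2 * inner_per L k k + 2 * (t\<^sup>2 * Y)"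
      by (simp only: power2_minus mult_minus_right mult_minus_left)
    also have "inner_per L k k \<le> (1 / c1) * Q k k" using ck c1(1) by (simp add: field_simps)
    also have "(1 / c1) * Q k k \<le> (1 / c1) * T" unfolding T using t2 c1 by (intro mult_left_mono) auto
    also have "t\<^sup>2 * Y = (Y / D) * (t\<^sup>2 * D)" using D by simp
    also have "(Y / D) * (t\<^sup>2 * D) \<le> (Y / D) * T" unfolding T using Qkk Y D by (intro mult_left_mono) auto
    finally have "inner_per L h h \<le> (2 / c1 + 2 * Y / D) * T" by (simp add: algebra_simps)
    then have i: "inner_per L h h \<le> T / c2" unfolding c2_def by (simp add: mult.commute)
    have "cg * (sobolev_norm L (m/2) h)\<^sup>2 \<le> Q h h + Cg * inner_per L h h" using Gd(3)[OF h(1)] by simp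
    also have "Q h h \<le> T" unfolding T Qh using t2 by linarith
    also have "Cg * inner_per L h h \<le> Cg * (T / c2)" using i Gd(2) by (intro mult_left_mono) auto
    finally have "cg * (sobolev_norm L (m/2) h)\<^sup>2 \<le> (1 + Cg / c2) * T" by (simp add: distrib_right)
    then show "c * (sobolev_norm L (m/2) h)\<^sup>2 \<le> Q h h + 2 / D * (inner_per L g h)\<^sup>2"
      unfolding c_def T_def[symmetric] using den2 by (simp add: pos_divide_le_eq mult.commute)
  qed
qed

end

section \<open>Smooth families of waves\<close>

lemma smooth_on_differentiable: "smooth_on S f \<Longrightarrow> x \<in> S \<Longrightarrow> f differentiable (at x)"
  unfolding smooth_on_def by (metis Ck_on.simps(2))

lemma smooth_on_continuous: "smooth_on S f \<Longrightarrow> continuous_on S f"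
  unfolding smooth_on_def by (metis Ck_on.simps(1))

lemma smooth_on_frechet_derivative:
  "smooth_on S f \<Longrightarrow> smooth_on S (\<lambda>x. frechet_derivative f (at x) v)"
  unfolding smooth_on_def by (metis Ck_on.simps(2))

lemma smooth_real_deriv:
  fixes f :: "real \<Rightarrow> real"
  assumes "smooth_on UNIV f"
  shows "(f has_real_derivative deriv f x) (at x)" "smooth_on UNIV (deriv f)"
proof -
  have d: "(f has_real_derivative deriv f x) (at x)" for x
    using smooth_on_differentiable[OF assms, of x] by (simp add: DERIV_deriv_iff_real_differentiable)
  then show "(f has_real_derivative deriv f x) (at x)" .
  have "frechet_derivative f (at x) 1 = deriv f x" for x
    using frechet_derivative_at[OF d[of x, unfolded has_field_derivative_def]] by (metis mult_1_right)
  then show "smooth_on UNIV (deriv f)"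
    using smooth_on_frechet_derivative[OF assms, of 1] by simp
qed

lemma smooth_real_continuous_deriv: "smooth_on UNIV (f :: real \<Rightarrow> real) \<Longrightarrow> continuous_on UNIV (deriv f)"
  by (intro smooth_on_continuous smooth_real_deriv)

section \<open>Fourier coefficients of derivatives\<close>

context period
begin

lemma periodic_deriv:
  assumes "periodic L g" shows "periodic L (deriv g)"
  unfolding periodic_def
proof
  fix x
  have "g = (\<lambda>y. g (y + L))" using assms unfolding periodic_def by simp
  then have "deriv g x = deriv (\<lambda>y. g (y + L)) x" by simp
  also have "\<dots> = deriv g (x + L)"
    unfolding deriv_def using DERIV_shift[of g _ x L] by (simp add: add.commute)
  finally show "deriv g (x + L) = deriv g x" ..
qed

text \<open>Integration by parts, written as the fundamental theorem for the product with
  \<open>E \<kappa>\<close>; periodicity cancels the boundary values.\<close>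

lemma fourier_coeff_deriv:
  assumes d: "\<And>x. (g has_real_derivative g' x) (at x)" and c: "continuous_on UNIV g'" and p: "periodic L g"
  shows "fourier_coeff L g' \<kappa> = (2 * pi * \<kappa> / L) * \<i> * fourier_coeff L g \<kappa>"
proof -
  define a where "a = - 2 * pi * of_int \<kappa> / L"
  have ax: "a * x = - 2 * pi * of_int \<kappa> * x / L" for x by (simp add: a_def)
  have gc: "continuous_on UNIV g" using d by (meson DERIV_isCont continuous_at_imp_continuous_on)
  have cI: "continuous_on {0..L} g'" and gI: "continuous_on {0..L} g"
    using continuous_on_subset[OF c] continuous_on_subset[OF gc] by auto
  have dE: "(E \<kappa> has_vector_derivative (\<i> * a * E \<kappa> x)) (at x within {0..L})" for x
  proof -
    have "((\<lambda>x. exp (\<i> * a * of_real x)) has_vector_derivative (\<i> * a * exp (\<i> * a * of_real x))) (at x within {0..L})"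
      by (auto intro!: derivative_eq_intros has_vector_derivative_real_field)
    moreover have "exp (\<i> * a * of_real y) = cis (a * y)" for y by (simp add: cis_conv_exp mult.assoc)
    ultimately show ?thesis unfolding ax[symmetric] by simp
  qed
  have dg: "((\<lambda>x. complex_of_real (g x)) has_vector_derivative complex_of_real (g' x)) (at x within {0..L})" for x
    using has_vector_derivative_of_real[OF d[of x]]
    by (rule has_vector_derivative_at_within)
  let ?F = "\<lambda>x. complex_of_real (g' x) * E \<kappa> x + (\<i> * a) * (complex_of_real (g x) * E \<kappa> x)"
  have "((\<lambda>x. complex_of_real (g x) * E \<kappa> x) has_vector_derivative ?F x) (at x within {0..L})" for x
    using has_vector_derivative_mult[OF dg dE, of x] by (simp add: algebra_simps)
  moreover have "continuous_on {0..L} ?F"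
    by (intro continuous_on_add continuous_on_mult continuous_on_of_real continuous_on_const cI gI continuous_E)
  ultimately have "(LINT x|lborel. indicator {0..L} x *\<^sub>R ?F x) = complex_of_real (g L) * E \<kappa> L - complex_of_real (g 0) * E \<kappa> 0"
    using L_pos by (intro integral_FTC_Icc) auto
  also have "\<dots> = 0"
  proof -
    have "g L = g 0" using p unfolding periodic_def by (metis add_0)
    moreover have "E \<kappa> L = E \<kappa> 0" using E_periodic[of \<kappa> 0] by (simp only: add_0)
    ultimately show ?thesis by (simp only: diff_self)
  qed
  finally have 0: "(LINT x:{0..L}|lborel. ?F x) = 0" unfolding set_lebesgue_integral_def .
  have i: "set_integrable lborel {0..L} (\<lambda>x. complex_of_real (g' x) * E \<kappa> x)" "set_integrable lborel {0..L} (\<lambda>x. complex_of_real (g x) * E \<kappa> x)"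
    by (intro E_integrable borel_integrable_atLeastAtMost' cI gI)+
  have "(LINT x:{0..L}|lborel. complex_of_real (g' x) * E \<kappa> x) + (\<i> * a) * (LINT x:{0..L}|lborel. complex_of_real (g x) * E \<kappa> x) = 0"
    using 0 i by (simp only: set_integral_add set_integrable_mult_right set_integral_mult_right)
  then have "(LINT x:{0..L}|lborel. complex_of_real (g' x) * E \<kappa> x) = - (\<i> * a) * (LINT x:{0..L}|lborel. complex_of_real (g x) * E \<kappa> x)"
    by (simp only: eq_neg_iff_add_eq_0 mult_minus_left)
  then have "fourier_coeff L g' \<kappa> = - (\<i> * a) * fourier_coeff L g \<kappa>"
    unfolding fourier_coeff_def by (simp only: mult.left_commute)
  then show ?thesis by (simp add: a_def mult_ac)
qed

lemma integral_deriv_periodic: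
  assumes d: "\<And>x. (g has_real_derivative g' x) (at x)" and c: "continuous_on UNIV g'" and p: "periodic L g"
  shows "(LINT x:{0..L}|lborel. g' x) = 0"
  using fourier_coeff_deriv[OF assms, of 0] L_pos set_integral_complex_of_real[of lborel "{0..L}" g']
  unfolding fourier_coeff_def by simp

text \<open>Off the zero mode the coefficients of \<open>g\<close> are at most a constant times
  those of the derivative; the zero mode is added separately. It transfers membership in H^m from
  \<phi>' to \<phi>, since the wave equation says nothing about the domain.\<close>

lemma sobolev_of_deriv:
  assumes d: "\<And>x. (g has_real_derivative g' x) (at x)" and c: "continuous_on UNIV g'" and p: "periodic L g"
    and s: "g' \<in> sobolev_per L s"
  shows "g \<in> sobolev_per L s"
proof -
  have gc: "continuous_on UNIV g" using d by (meson DERIV_isCont continuous_at_imp_continuous_on)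
  have g: "g \<in> L2_per L" by (rule L2_continuous[OF gc p])
  define b where "b = (L / (2 * pi))\<^sup>2"
  have "(\<lambda>\<kappa>. wt s \<kappa> * (cmod (fourier_coeff L g \<kappa>))\<^sup>2) summable_on UNIV"
  proof (rule summable_on_dominated)
    show "(\<lambda>\<kappa>. b * (wt s \<kappa> * (cmod (fourier_coeff L g' \<kappa>))\<^sup>2) + (cmod (fourier_coeff L g \<kappa>))\<^sup>2) summable_on UNIV"
      by (intro summable_on_add summable_on_cmult_right sobolev_summable[OF s] fourier_coeff_summable[OF g])
    fix \<kappa>
    have "wt s \<kappa> * (cmod (fourier_coeff L g \<kappa>))\<^sup>2 \<le> b * (wt s \<kappa> * (cmod (fourier_coeff L g' \<kappa>))\<^sup>2) + (cmod (fourier_coeff L g \<kappa>))\<^sup>2"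
    proof (cases "\<kappa> = 0")
      case True
      then show ?thesis by (simp add: wt_def b_def)
    next
      case False
      then have k1: "1 \<le> (real_of_int \<kappa>)\<^sup>2" by (metis abs_ge_zero int_one_le_iff_zero_less le_less of_int_1 of_int_le_iff of_int_power one_le_power power2_abs zero_less_abs_iff)
      have "(cmod (fourier_coeff L g' \<kappa>))\<^sup>2 = (2 * pi / L)\<^sup>2 * (real_of_int \<kappa>)\<^sup>2 * (cmod (fourier_coeff L g \<kappa>))\<^sup>2"
        unfolding fourier_coeff_deriv[OF d c p] by (simp add: norm_mult norm_divide power_mult_distrib power_divide)
      then have "b * (cmod (fourier_coeff L g' \<kappa>))\<^sup>2 = (real_of_int \<kappa>)\<^sup>2 * (cmod (fourier_coeff L g \<kappa>))\<^sup>2"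
        unfolding b_def using L_pos by (simp add: power_divide power_mult_distrib)
      moreover have "1 * (cmod (fourier_coeff L g \<kappa>))\<^sup>2 \<le> (real_of_int \<kappa>)\<^sup>2 * (cmod (fourier_coeff L g \<kappa>))\<^sup>2"
        using k1 by (intro mult_right_mono) auto
      ultimately have "wt s \<kappa> * (cmod (fourier_coeff L g \<kappa>))\<^sup>2 \<le> wt s \<kappa> * (b * (cmod (fourier_coeff L g' \<kappa>))\<^sup>2)"
        using wt_pos[of s \<kappa>] by (intro mult_left_mono) auto
      then show ?thesis using zero_le_power2[of "cmod (fourier_coeff L g \<kappa>)"] by (simp only: mult.left_commute[of b])
    qed
    then show "\<bar>wt s \<kappa> * (cmod (fourier_coeff L g \<kappa>))\<^sup>2\<bar> \<le> b * (wt s \<kappa> * (cmod (fourier_coeff L g' \<kappa>))\<^sup>2) + (cmod (fourier_coeff L g \<kappa>))\<^sup>2"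
      using wt_pos[of s \<kappa>] by (simp add: abs_mult)
  qed
  then show ?thesis unfolding sobolev_iff using g by blast
qed

lemma fourier_coeff_has_derivative:
  assumes U: "convex U" "t0 \<in> U"
    and d: "\<And>t x. t \<in> U \<Longrightarrow> x \<in> {0..L} \<Longrightarrow> ((\<lambda>t. g t x) has_real_derivative g' t x) (at t within U)"
    and c': "continuous_on (U \<times> {0..L}) (\<lambda>(t, x). g' t x)"
    and c: "\<And>t. t \<in> U \<Longrightarrow> continuous_on {0..L} (g t)"
  shows "((\<lambda>t. fourier_coeff L (g t) \<kappa>) has_vector_derivative fourier_coeff L (g' t0) \<kappa>) (at t0 within U)"
proof -
  have conv: "fourier_coeff L h \<kappa> = (1 / complex_of_real L) * integral (cbox 0 L) (\<lambda>x. complex_of_real (h x) * E \<kappa> x)"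
    if "continuous_on {0..L} h" for h
  proof -
    have "set_integrable lborel {0..L} (\<lambda>x. complex_of_real (h x) * E \<kappa> x)"
      by (intro E_integrable borel_integrable_atLeastAtMost' that)
    from set_borel_integral_eq_integral(2)[OF this] show ?thesis unfolding fourier_coeff_def by (simp add: cbox_interval)
  qed
  have c0: "continuous_on {0..L} (g' t0)"
  proof -
    have "continuous_on {0..L} (\<lambda>x. (\<lambda>(t, x). g' t x) (t0, x))"
      by (rule continuous_on_compose2[OF c']) (use U in \<open>auto intro!: continuous_intros\<close>)
    then show ?thesis by simp
  qed
  have "((\<lambda>t. integral (cbox 0 L) (\<lambda>x. complex_of_real (g t x) * E \<kappa> x)) has_vector_derivative
      integral (cbox 0 L) (\<lambda>x. complex_of_real (g' t0 x) * E \<kappa> x)) (at t0 within U)"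
  proof (rule leibniz_rule_vector_derivative[where U=U])
    show "((\<lambda>t. complex_of_real (g t x) * E \<kappa> x) has_vector_derivative complex_of_real (g' t x) * E \<kappa> x) (at t within U)"
      if "t \<in> U" "x \<in> cbox 0 L" for t x
      using that by (intro has_vector_derivative_mult_left has_vector_derivative_of_real)
        (use d[of t x] in \<open>simp add: cbox_interval has_real_derivative_iff_has_vector_derivative\<close>)
    show "(\<lambda>x. complex_of_real (g t x) * E \<kappa> x) integrable_on cbox 0 L" if "t \<in> U" for t
      using c[OF that] by (intro integrable_continuous continuous_intros continuous_E) (auto simp: cbox_interval)
    have "continuous_on (U \<times> cbox 0 L) (\<lambda>p. complex_of_real (g' (fst p) (snd p)) * cis (- 2 * pi * of_int \<kappa> * snd p / L))"
      using c' L_pos by (intro continuous_intros) (auto simp: cbox_interval case_prod_beta')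
    then show "continuous_on (U \<times> cbox 0 L) (\<lambda>(t, x). complex_of_real (g' t x) * E \<kappa> x)"
      by (simp add: case_prod_beta')
  qed (use U in auto)
  then have "((\<lambda>t. (1 / complex_of_real L) * integral (cbox 0 L) (\<lambda>x. complex_of_real (g t x) * E \<kappa> x)) has_vector_derivative
      (1 / complex_of_real L) * integral (cbox 0 L) (\<lambda>x. complex_of_real (g' t0 x) * E \<kappa> x)) (at t0 within U)"
    by (rule has_vector_derivative_mult_right)
  then show ?thesis unfolding conv[OF c0]
    by (rule has_vector_derivative_transform[rotated -1]) (use U conv[OF c] in auto)
qed

end

text \<open>\<open>deriv_Hm\<close> is what the spectral hypothesis contributes at every parameter,
  not only at the wave under study: it puts each \<phi> in the domain on which
  \<open>mult_op\<close> has a meaning.\<close>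

locale wave_family = symbol +
  fixes f :: "real \<Rightarrow> real" and S :: "(real \<times> real) set" and \<phi> :: "real \<times> real \<Rightarrow> real \<Rightarrow> real"
  assumes f_smooth: "smooth_on UNIV f" and S_open: "open S" and surface: "smooth_surface L S \<phi>"
    and wave: "\<And>w a. (w, a) \<in> S \<Longrightarrow> wave_eq L \<theta> f w a (\<phi> (w, a))"
    and deriv_Hm: "\<And>p. p \<in> S \<Longrightarrow> deriv (\<phi> p) \<in> sobolev_per L m"
begin

lemma f_cont: "continuous_on A f"
  using smooth_on_continuous[OF f_smooth] by (rule continuous_on_subset) auto

lemma f'_cont: "continuous_on A (deriv f)"
  using smooth_real_continuous_deriv[OF f_smooth] by (rule continuous_on_subset) auto

lemma phi_facts:
  assumes p: "p \<in> S"
  shows "smooth_on UNIV (\<phi> p)" "periodic L (\<phi> p)" "continuous_on A (\<phi> p)" "\<phi> p \<in> sobolev_per L m"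
    "\<phi> p \<in> L2_per L" "(\<phi> p has_real_derivative deriv (\<phi> p) x) (at x)" "continuous_on A (deriv (\<phi> p))"
proof -
  show s: "smooth_on UNIV (\<phi> p)" and per: "periodic L (\<phi> p)"
    using surface p unfolding smooth_surface_def smooth_per_def by auto
  show "continuous_on A (\<phi> p)" using smooth_on_continuous[OF s] by (rule continuous_on_subset) auto
  show "(\<phi> p has_real_derivative deriv (\<phi> p) x) (at x)" by (rule smooth_real_deriv[OF s])
  have c: "continuous_on UNIV (deriv (\<phi> p))" by (rule smooth_real_continuous_deriv[OF s])
  then show "continuous_on A (deriv (\<phi> p))" by (rule continuous_on_subset) auto
  show "\<phi> p \<in> sobolev_per L m"
    by (rule sobolev_of_deriv[OF smooth_real_deriv(1)[OF s] c per deriv_Hm[OF p]])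
  then show "\<phi> p \<in> L2_per L" by (rule sobolev_L2)
qed

text \<open>\<open>mult_op\<close> is a choice up to null sets, whereas coefficients are numbers and
  can be differentiated in the parameters.\<close>

lemma wave_coeff:
  assumes p: "(w, a) \<in> S"
  shows "complex_of_real (tw \<kappa>) * fourier_coeff L (\<phi> (w, a)) \<kappa> =
    fourier_coeff L (\<lambda>x. f (\<phi> (w, a) x) - w * \<phi> (w, a) x - a) \<kappa>"
proof -
  note F = phi_facts[OF p]
  let ?g = "\<lambda>x. f (\<phi> (w, a) x) - w * \<phi> (w, a) x - a"
  have g: "?g \<in> L2_per L"
  proof (rule L2_continuous)
    show "continuous_on UNIV ?g" by (intro continuous_intros F continuous_on_compose2[OF f_cont[of UNIV] F(3)]) auto
    show "periodic L ?g" using F(2) unfolding periodic_def by simp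
  qed
  have "AE x in lborel. mult_op L \<theta> (\<phi> (w, a)) x = ?g x"
    using wave[OF p] unfolding wave_eq_def by eventually_elim simp
  then have "fourier_coeff L (mult_op L \<theta> (\<phi> (w, a))) = fourier_coeff L ?g"
    using L2_perD(1)[OF mult_op_exists(1)[OF F(4)]] L2_perD(1)[OF g] by (rule fourier_coeff_cong_AE)
  then show ?thesis using mult_op_exists(2)[OF F(4), of \<kappa>] by simp
qed

text \<open>The derivative of the wave equation along the line \<open>t \<mapsto> (w0 + t e1, a0 + t e2)\<close>, taken in each
  Fourier coefficient.\<close>

lemma linearized_equation:
  assumes p: "(w0 + t0 * e1, a0 + t0 * e2) \<in> S"
  defines "w \<equiv> w0 + t0 * e1" and "a \<equiv> a0 + t0 * e2"
  defines "v \<equiv> \<lambda>x. deriv (\<lambda>t. \<phi> (w0 + t * e1, a0 + t * e2) x) t0"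
  shows "((\<lambda>t. \<phi> (w0 + t * e1, a0 + t * e2) x) has_real_derivative v x) (at t0)"
    "v \<in> sobolev_per L m"
    "AE x in lborel. mult_op L \<theta> v x + w * v x - deriv f (\<phi> (w, a) x) * v x = - (e1 * \<phi> (w, a) x + e2)"
proof -
  define c where "c t = (w0 + t * e1, a0 + t * e2)" for t
  define \<Phi> where "\<Phi> = (\<lambda>(p, x). \<phi> p x)"
  have \<Phi>: "smooth_on (S \<times> UNIV) \<Phi>" using surface unfolding smooth_surface_def \<Phi>_def by auto
  define g' where "g' t x = frechet_derivative \<Phi> (at (c t, x)) ((e1, e2), 0)" for t x
  have cc: "continuous_on A c" for A unfolding c_def by (intro continuous_intros)
  have "open (c -` S)" using S_open cc[of UNIV] by (simp add: open_vimage)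
  moreover have "t0 \<in> c -` S" using p by (simp add: c_def)
  ultimately obtain r where r: "r > 0" "ball t0 r \<subseteq> c -` S" using openE by blast
  \<comment> \<open>A ball is convex, as needed for differentiating under the integral, and open, so
    that derivatives within it are ordinary ones.\<close>
  define U where "U = ball t0 r"
  have U: "convex U" "open U" "t0 \<in> U" using r(1) unfolding U_def by auto
  have US: "c t \<in> S" if "t \<in> U" for t using r(2) that unfolding U_def by auto
  have d: "((\<lambda>t. \<phi> (c t) x) has_real_derivative g' t x) (at t)" if t: "t \<in> U" for t x
  proof -
    have "\<Phi> differentiable (at (c t, x))" using smooth_on_differentiable[OF \<Phi>] US[OF t] by auto
    then have 1: "(\<Phi> has_derivative frechet_derivative \<Phi> (at (c t, x))) (at (c t, x))" by (rule frechet_derivative_works[THEN iffD1])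
    have 2: "((\<lambda>t. (c t, x)) has_derivative (\<lambda>h. ((h * e1, h * e2), 0))) (at t)"
      unfolding c_def by (auto intro!: derivative_eq_intros)
    have "((\<lambda>t. \<Phi> (c t, x)) has_derivative (\<lambda>h. frechet_derivative \<Phi> (at (c t, x)) ((h * e1, h * e2), 0))) (at t)"
      using diff_chain_at[OF 2 1] by (simp add: o_def)
    moreover have "frechet_derivative \<Phi> (at (c t, x)) ((h * e1, h * e2), 0) = g' t x * h" for h
    proof -
      have "linear (frechet_derivative \<Phi> (at (c t, x)))" using 1 has_derivative_linear by blast
      from linear_scale[OF this, of h "((e1, e2), 0)"] show ?thesis unfolding g'_def by (simp add: mult.commute)
    qed
    ultimately show ?thesis unfolding has_field_derivative_def \<Phi>_def by (simp add: mult_commute_abs)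
  qed
  have "(\<lambda>t. \<phi> (w0 + t * e1, a0 + t * e2) x) = (\<lambda>t. \<phi> (c t) x)" for x unfolding c_def ..
  then have v: "v = g' t0" unfolding v_def using DERIV_imp_deriv[OF d[OF U(3)]] by auto
  show dv: "((\<lambda>t. \<phi> (w0 + t * e1, a0 + t * e2) x) has_real_derivative v x) (at t0)"
    using d[OF U(3)] unfolding v c_def .
  have g'c: "continuous_on (U \<times> UNIV) (\<lambda>(t, x). g' t x)"
  proof -
    have "continuous_on (S \<times> UNIV) (\<lambda>z. frechet_derivative \<Phi> (at z) ((e1, e2), 0))"
      by (intro smooth_on_continuous smooth_on_frechet_derivative \<Phi>)
    then have "continuous_on (U \<times> UNIV) (\<lambda>y. frechet_derivative \<Phi> (at ((\<lambda>(t, x). (c t, x)) y)) ((e1, e2), 0))"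
      by (rule continuous_on_compose2) (use US in \<open>auto intro!: continuous_intros continuous_on_compose2[OF cc[of UNIV]] simp: case_prod_beta'\<close>)
    then show ?thesis unfolding g'_def by (simp add: case_prod_beta')
  qed
  have vc: "continuous_on UNIV v"
  proof -
    have "continuous_on UNIV (\<lambda>x. (\<lambda>(t, x). g' t x) (t0, x))"
      by (rule continuous_on_compose2[OF g'c]) (use U in \<open>auto intro!: continuous_intros\<close>)
    then show ?thesis unfolding v by simp
  qed
  have vp: "periodic L v"
    unfolding periodic_def
  proof
    fix x
    have "((\<lambda>t. \<phi> (c t) x) has_real_derivative g' t0 (x + L)) (at t0)"
    proof (rule has_field_derivative_transform_within_open[OF d[OF U(3)] U(2,3)])
      fix t assume "t \<in> U"
      then show "\<phi> (c t) (x + L) = \<phi> (c t) x" using phi_facts(2)[OF US] unfolding periodic_def by auto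
    qed
    then show "v (x + L) = v x" unfolding v using d[OF U(3), of x] by (rule DERIV_unique)
  qed
  have c0: "c t0 = (w, a)" unfolding c_def w_def a_def ..
  note F = phi_facts[OF p, folded w_def a_def]
  have \<Phi>c: "continuous_on (U \<times> {0..L}) (\<lambda>(t, x). \<phi> (c t) x)"
  proof -
    have "continuous_on (U \<times> {0..L}) (\<lambda>y. \<Phi> ((\<lambda>(t, x). (c t, x)) y))"
      by (rule continuous_on_compose2[OF smooth_on_continuous[OF \<Phi>]]) (use US in \<open>auto intro!: continuous_intros continuous_on_compose2[OF cc[of UNIV]] simp: case_prod_beta'\<close>)
    then show ?thesis unfolding \<Phi>_def by (simp add: case_prod_beta')
  qed
  have g'cL: "continuous_on (U \<times> {0..L}) (\<lambda>(t, x). g' t x)"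
    by (rule continuous_on_subset[OF g'c]) auto
  have D1: "((\<lambda>t. fourier_coeff L (\<phi> (c t)) \<kappa>) has_vector_derivative fourier_coeff L (g' t0) \<kappa>) (at t0)" for \<kappa>
  proof -
    have "((\<lambda>t. fourier_coeff L (\<phi> (c t)) \<kappa>) has_vector_derivative fourier_coeff L (g' t0) \<kappa>) (at t0 within U)"
      by (rule fourier_coeff_has_derivative[OF U(1,3) _ g'cL]) (use d phi_facts(3)[OF US] in \<open>auto intro: has_field_derivative_at_within\<close>)
    then show ?thesis using at_within_open[OF U(3,2)] by simp
  qed
  define G where "G t x = f (\<phi> (c t) x) - (w0 + t * e1) * \<phi> (c t) x - (a0 + t * e2)" for t x
  define G' where "G' t x = deriv f (\<phi> (c t) x) * g' t x - (e1 * \<phi> (c t) x + (w0 + t * e1) * g' t x) - e2" for t x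
  have D2: "((\<lambda>t. fourier_coeff L (G t) \<kappa>) has_vector_derivative fourier_coeff L (G' t0) \<kappa>) (at t0)" for \<kappa>
  proof -
    have "((\<lambda>t. fourier_coeff L (G t) \<kappa>) has_vector_derivative fourier_coeff L (G' t0) \<kappa>) (at t0 within U)"
    proof (rule fourier_coeff_has_derivative[OF U(1,3)])
      fix t x assume t: "t \<in> U"
      have "((\<lambda>t. G t x) has_real_derivative G' t x) (at t)"
        unfolding G_def G'_def
        by (rule derivative_eq_intros DERIV_chain2[OF smooth_real_deriv(1)[OF f_smooth] d[OF t]] d[OF t] refl | simp)+
      then show "((\<lambda>t. G t x) has_real_derivative G' t x) (at t within U)" by (rule has_field_derivative_at_within)
    next
      fix t assume "t \<in> U"
      then show "continuous_on {0..L} (G t)" unfolding G_def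
        by (intro continuous_intros continuous_on_compose2[OF f_cont[of UNIV]] phi_facts(3)[OF US]) auto
    next
      have "continuous_on (U \<times> {0..L}) (\<lambda>y. deriv f ((\<lambda>(t, x). \<phi> (c t) x) y) * (\<lambda>(t, x). g' t x) y - (e1 * (\<lambda>(t, x). \<phi> (c t) x) y + (w0 + fst y * e1) * (\<lambda>(t, x). g' t x) y) - e2)"
        by (intro continuous_intros continuous_on_compose2[OF f'_cont[of UNIV] \<Phi>c] \<Phi>c g'cL) auto
      then show "continuous_on (U \<times> {0..L}) (\<lambda>(t, x). G' t x)" unfolding G'_def by (simp add: case_prod_beta')
    qed
    then show ?thesis using at_within_open[OF U(3,2)] by simp
  qed
  have Gcoeff: "fourier_coeff L (G t) \<kappa> = complex_of_real (tw \<kappa>) * fourier_coeff L (\<phi> (c t)) \<kappa>" if "t \<in> U" for t \<kappa>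
    using wave_coeff[of "w0 + t * e1" "a0 + t * e2"] US[OF that] unfolding G_def c_def by simp
  \<comment> \<open>Near \<open>t0\<close> the two sides of the wave equation have the same
    coefficients, and uniqueness of derivatives equates their rates of change. The operator
    \<open>M\<close> only ever acts as a constant factor, so no derivative has to be moved through
    it.\<close>
  have coeff: "fourier_coeff L (G' t0) \<kappa> = complex_of_real (tw \<kappa>) * fourier_coeff L v \<kappa>" for \<kappa>
  proof -
    have "((\<lambda>t. complex_of_real (tw \<kappa>) * fourier_coeff L (\<phi> (c t)) \<kappa>) has_vector_derivative complex_of_real (tw \<kappa>) * fourier_coeff L (g' t0) \<kappa>) (at t0)"
      by (rule has_vector_derivative_mult_right[OF D1])
    then have "((\<lambda>t. fourier_coeff L (G t) \<kappa>) has_vector_derivative complex_of_real (tw \<kappa>) * fourier_coeff L (g' t0) \<kappa>) (at t0)"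
      by (rule has_vector_derivative_transform_within_open[OF _ U(2,3)]) (simp add: Gcoeff)
    then show ?thesis unfolding v using D2[of \<kappa>] vector_derivative_unique_at by blast
  qed
  have G't0: "G' t0 = (\<lambda>x. deriv f (\<phi> (w, a) x) * v x - (e1 * \<phi> (w, a) x + w * v x) - e2)"
    unfolding G'_def c0 v w_def by simp
  have G'L2: "G' t0 \<in> L2_per L"
  proof (rule L2_continuous)
    show "continuous_on UNIV (G' t0)" unfolding G't0
      by (intro continuous_intros vc F(3) continuous_on_compose2[OF f'_cont[of UNIV] F(3)]) auto
    show "periodic L (G' t0)" unfolding G't0 using vp F(2) unfolding periodic_def by simp
  qed
  have vL2: "v \<in> L2_per L" by (rule L2_continuous[OF vc vp])
  show "v \<in> sobolev_per L m" by (rule mult_op_eqI(1)[OF vL2 G'L2 coeff])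
  have "AE x in lborel. mult_op L \<theta> v x = G' t0 x" by (rule mult_op_eqI(2)[OF vL2 G'L2 coeff])
  then show "AE x in lborel. mult_op L \<theta> v x + w * v x - deriv f (\<phi> (w, a) x) * v x = - (e1 * \<phi> (w, a) x + e2)"
    by eventually_elim (simp add: G't0)
qed

end

section \<open>Consequences of the spectral hypothesis\<close>

context period
begin

section \<open>Eigenfunctions modulo null sets\<close>

lemma inner_per_1: "inner_per L g (\<lambda>x. 1) = (LINT x:{0..L}|lborel. g x)"
  unfolding inner_per_def by simp

lemma eigenfunction_nonzero:
  assumes "eigenfunction L m T l v" shows "v \<in> sobolev_per L m" "AE x in lborel. T v x = l * v x" "inner_per L v v \<noteq> 0"
  using assms inner_per_zero_AE[OF sobolev_L2] unfolding eigenfunction_def eigenspace_def by auto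

text \<open>Both functions are multiples of one eigenfunction, and \<xi> is a nonzero multiple;
  orthogonality forces the factor of \<open>v\<close> to be 0.\<close>

lemma simple_eigenvalue_orthogonal:
  assumes s: "simple_eigenvalue L m T l" and \<xi>: "eigenfunction L m T l \<xi>"
    and v: "v \<in> eigenspace L m T l" and o: "inner_per L v \<xi> = 0"
  shows "inner_per L v v = 0"
proof -
  obtain v0 where v0: "eigenfunction L m T l v0" and mult: "\<forall>w\<in>eigenspace L m T l. \<exists>c. AE x in lborel. w x = c * v0 x"
    using s unfolding simple_eigenvalue_def by blast
  note n0 = eigenfunction_nonzero[OF v0] and n1 = eigenfunction_nonzero[OF \<xi>]
  have [measurable]: "v0 \<in> borel_measurable borel" "\<xi> \<in> borel_measurable borel" "v \<in> borel_measurable borel"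
    using n0(1) n1(1) v L2_perD(1)[OF sobolev_L2] unfolding eigenspace_def by auto
  obtain c where c: "AE x in lborel. v x = c * v0 x" using mult v by blast
  obtain d where d: "AE x in lborel. \<xi> x = d * v0 x" using mult \<xi> unfolding eigenfunction_def by blast
  have "inner_per L \<xi> \<xi> = inner_per L (\<lambda>x. d * v0 x) (\<lambda>x. d * v0 x)"
    by (rule inner_per_cong_AE[OF d d]) measurable
  then have dn: "d \<noteq> 0" using n1(3) by (auto simp: inner_per_def)
  have "inner_per L v \<xi> = inner_per L (\<lambda>x. c * v0 x) (\<lambda>x. d * v0 x)"
    by (rule inner_per_cong_AE[OF c d]) measurable
  also have "\<dots> = c * (d * inner_per L v0 v0)"
    unfolding inner_per_scale_left inner_per_commute[of v0 "\<lambda>x. d * v0 x"] ..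
  finally have "c = 0" using o dn n0(3) by simp
  have "inner_per L v v = inner_per L (\<lambda>x. c * v0 x) (\<lambda>x. c * v0 x)"
    by (rule inner_per_cong_AE[OF c c]) measurable
  then show ?thesis using \<open>c = 0\<close> by (simp add: inner_per_def)
qed

text \<open>Below or at 0 there are only the eigenvalues \<Lambda> and 0, both simple, so
  orthogonality to one eigenfunction of each leaves null functions. This is the premise
  \<open>no_ev\<close> of the coercivity results.\<close>

lemma spectral_cond_cases:
  assumes "spectral_cond L m T \<phi>"
  obtains \<Lambda> \<xi> where "\<Lambda> < 0" "eigenfunction L m T \<Lambda> \<xi>" "eigenfunction L m T 0 (deriv \<phi>)"
    "\<And>l v. l \<le> 0 \<Longrightarrow> v \<in> sobolev_per L m \<Longrightarrow> (AE x in lborel. T v x = l * v x) \<Longrightarrow>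
       inner_per L v \<xi> = 0 \<Longrightarrow> inner_per L v (deriv \<phi>) = 0 \<Longrightarrow> inner_per L v v = 0"
proof -
  obtain \<Lambda> where \<Lambda>: "\<Lambda> < 0" "eigenvalue L m T \<Lambda>" and uniq: "\<And>l. l < 0 \<Longrightarrow> eigenvalue L m T l \<Longrightarrow> l = \<Lambda>"
    using assms unfolding spectral_cond_def by blast
  have sL: "simple_eigenvalue L m T \<Lambda>" and s0: "simple_eigenvalue L m T 0" and e0: "eigenfunction L m T 0 (deriv \<phi>)"
    using assms \<Lambda> unfolding spectral_cond_def by auto
  obtain \<xi> where \<xi>: "eigenfunction L m T \<Lambda> \<xi>" using \<Lambda>(2) unfolding eigenvalue_def by blast
  show ?thesis
  proof (rule that[OF \<Lambda>(1) \<xi> e0])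
    fix l v assume l: "l \<le> 0" and v: "v \<in> sobolev_per L m" "AE x in lborel. T v x = l * v x"
      and o: "inner_per L v \<xi> = 0" "inner_per L v (deriv \<phi>) = 0"
    have ve: "v \<in> eigenspace L m T l" using v unfolding eigenspace_def by auto
    consider "l = 0" | "l = \<Lambda>" | "\<not> eigenvalue L m T l" using uniq[of l] l by linarith
    then show "inner_per L v v = 0"
    proof cases
      case 1
      then show ?thesis using simple_eigenvalue_orthogonal[OF s0 e0 _ o(2)] ve by simp
    next
      case 2
      then show ?thesis using simple_eigenvalue_orthogonal[OF sL \<xi> _ o(1)] ve by simp
    next
      case 3
      then have z: "AE x in lborel. v x = 0" using ve unfolding eigenvalue_def eigenfunction_def by blast
      have "inner_per L v v = inner_per L (\<lambda>x. 0) (\<lambda>x. 0)"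
        by (rule inner_per_cong_AE[OF z z]) (use L2_perD(1)[OF sobolev_L2[OF v(1)]] in auto)
      then show ?thesis by (simp add: inner_per_def)
    qed
  qed
qed

end

locale wave_point = wave_family +
  fixes \<omega> A :: real
  assumes param: "(\<omega>, A) \<in> S"
    and spectral: "spectral_cond L m (lin_op L \<theta> f \<omega> (\<phi> (\<omega>, A))) (\<phi> (\<omega>, A))"
begin

abbreviation \<phi>0 :: "real \<Rightarrow> real" where "\<phi>0 \<equiv> \<phi> (\<omega>, A)"

section \<open>The linearization at a fixed wave and its parameter derivatives\<close>

lemmas phi0 = phi_facts[OF param]

definition pot :: "real \<Rightarrow> real" where "pot x = \<omega> - deriv f (\<phi>0 x)"

sublocale lin_operator L \<theta> m pot
proof
  show "continuous_on UNIV pot" unfolding pot_def[abs_def]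
    by (intro continuous_intros continuous_on_compose2[OF f'_cont[of UNIV] phi0(3)]) auto
  show "periodic L pot" using phi0(2) unfolding pot_def periodic_def by simp
qed

lemma Lop_lin_op: "Lop = lin_op L \<theta> f \<omega> \<phi>0"
  unfolding Lop_def[abs_def] lin_op_def[abs_def] pot_def by (simp add: algebra_simps)

definition pA :: "real \<Rightarrow> real" where "pA x = deriv (\<lambda>a. \<phi> (\<omega>, a) x) A"
definition pw :: "real \<Rightarrow> real" where "pw x = deriv (\<lambda>w. \<phi> (w, A) x) \<omega>"

lemma pA_facts: "((\<lambda>a. \<phi> (\<omega>, a) x) has_real_derivative pA x) (at A)" "pA \<in> sobolev_per L m"
    "AE x in lborel. Lop pA x = - 1"
  using linearized_equation[of \<omega> A 0 0 1] param
  by (simp_all add: pA_def[abs_def] Lop_lin_op lin_op_def)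

lemma pw_facts: "((\<lambda>w. \<phi> (w, A) x) has_real_derivative pw x) (at \<omega>)" "pw \<in> sobolev_per L m"
    "AE x in lborel. Lop pw x = - \<phi>0 x"
  using linearized_equation[of 0 \<omega> 1 A 0] param
  by (simp_all add: pw_def[abs_def] Lop_lin_op lin_op_def)

lemma M_A_inner: "M_A L \<phi> \<omega> A = inner_per L pA (\<lambda>x. 1)"
  unfolding M_A_def inner_per_1 pA_def ..

lemma M_omega_inner: "M_omega L \<phi> \<omega> A = inner_per L pw (\<lambda>x. 1)"
  unfolding M_omega_def inner_per_1 pw_def ..

lemma F_A_inner: "F_A L \<phi> \<omega> A = inner_per L pA \<phi>0"
proof -
  have "deriv (\<lambda>a. (\<phi> (\<omega>, a) x)\<^sup>2) A = 2 * (pA x * \<phi>0 x)" for x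
    using DERIV_power[OF pA_facts(1)[of x], of 2] by (intro DERIV_imp_deriv) (simp add: mult_ac)
  then show ?thesis unfolding F_A_def inner_per_def by (simp only: set_integral_mult_right)
qed

lemma F_omega_inner: "F_omega L \<phi> \<omega> A = inner_per L pw \<phi>0"
proof -
  have "deriv (\<lambda>w. (\<phi> (w, A) x)\<^sup>2) \<omega> = 2 * (pw x * \<phi>0 x)" for x
    using DERIV_power[OF pw_facts(1)[of x], of 2] by (intro DERIV_imp_deriv) (simp add: mult_ac)
  then show ?thesis unfolding F_omega_def inner_per_def by (simp only: set_integral_mult_right)
qed

lemma Q_pA: "v \<in> L2_per L \<Longrightarrow> Q pA v = - inner_per L (\<lambda>x. 1) v"
  using Q_AE[OF pA_facts(2) L2_const pA_facts(3)] inner_per_scale_left[of "-1" "\<lambda>x. 1" v] by simp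

lemma Q_pw: "v \<in> L2_per L \<Longrightarrow> Q pw v = - inner_per L \<phi>0 v"
  using Q_AE[OF pw_facts(2) L2_scale[OF phi0(5), of "-1"], of v] pw_facts(3) inner_per_scale_left[of "-1" \<phi>0 v] by simp

text \<open>Symmetry of \<open>Q\<close> on the two parameter derivatives: \<open>Q pA pw\<close>
  equals both - (1, \<open>pw\<close>) and - (\<phi>, \<open>pA\<close>). It makes the mixed
  coefficient of \<open>Delta\<close> equal to twice \<open>M_omega\<close>.\<close>

lemma M_omega_eq_F_A: "M_omega L \<phi> \<omega> A = F_A L \<phi> \<omega> A"
  using Q_pA[OF sobolev_L2[OF pw_facts(2)]] Q_pw[OF sobolev_L2[OF pA_facts(2)]]
    sym_form.commute[OF Q_sym_form Hm_V[OF pA_facts(2)] Hm_V[OF pw_facts(2)]]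
  unfolding M_omega_inner F_A_inner by (simp only: inner_per_commute neg_equal_iff_equal)

lemma deriv_phi0: "deriv \<phi>0 \<in> sobolev_per L m" "AE x in lborel. Lop (deriv \<phi>0) x = 0" "inner_per L (deriv \<phi>0) (deriv \<phi>0) \<noteq> 0"
proof -
  have "eigenfunction L m Lop 0 (deriv \<phi>0)" using spectral unfolding spectral_cond_def Lop_lin_op by blast
  from eigenfunction_nonzero[OF this] show "deriv \<phi>0 \<in> sobolev_per L m" "AE x in lborel. Lop (deriv \<phi>0) x = 0" "inner_per L (deriv \<phi>0) (deriv \<phi>0) \<noteq> 0"
    by auto
qed

text \<open>Moving \<open>L\<close> to the other factor removes the dependence on the choice made in \<open>inv_op\<close>.\<close>

lemma inner_inv_op:
  assumes v: "v \<in> sobolev_per L m" "AE x in lborel. Lop v x = g x"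
    and w: "w \<in> sobolev_per L m" "AE x in lborel. Lop w x = h x" and g: "g \<in> L2_per L" and h: "h \<in> L2_per L"
  shows "inner_per L (inv_op L m (lin_op L \<theta> f \<omega> \<phi>0) \<phi>0 g) h = inner_per L g w"
proof -
  let ?\<psi> = "deriv \<phi>0"
  define c where "c = inner_per L v ?\<psi> / inner_per L ?\<psi> ?\<psi>"
  \<comment> \<open>Removing the component along the kernel produces an element as required in
    \<open>inv_op\<close>, so the choice there has a witness.\<close>
  define y0 where "y0 = (\<lambda>x. v x + (- c) * ?\<psi> x)"
  have y0: "y0 \<in> sobolev_per L m" unfolding y0_def by (rule sym_form.lincomb_closed[OF sobolev_sym_form v(1) deriv_phi0(1)])
  have "inner_per L y0 ?\<psi> = 0" unfolding y0_def c_def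
    by (rule project_out[OF Hm_V[OF v(1)] Hm_V[OF deriv_phi0(1)] deriv_phi0(3)])
  moreover have "AE x in lborel. Lop y0 x = g x"
  proof (rule weak_solution_regular(2)[OF Hm_V[OF y0] g])
    fix z assume z: "z \<in> V"
    then have zL: "z \<in> L2_per L" by (rule sobolev_L2)
    have "Q y0 z = Q v z + (- c) * Q ?\<psi> z"
      unfolding y0_def by (rule sym_form.lincomb_left[OF Q_sym_form Hm_V[OF v(1)] Hm_V[OF deriv_phi0(1)] z])
    also have "Q ?\<psi> z = 0" using Q_AE[OF deriv_phi0(1) L2_const deriv_phi0(2) zL] by (simp add: inner_per_def)
    also have "Q v z = inner_per L g z" by (rule Q_AE[OF v(1) g v(2) zL])
    finally show "Q y0 z = inner_per L g z" by simp
  qed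
  ultimately have "\<exists>y. y \<in> sobolev_per L m \<and> inner_per L y ?\<psi> = 0 \<and> (AE x in lborel. lin_op L \<theta> f \<omega> \<phi>0 y x = g x)"
    using y0 unfolding Lop_lin_op by blast
  from someI_ex[OF this] obtain y where y: "y = inv_op L m (lin_op L \<theta> f \<omega> \<phi>0) \<phi>0 g" "y \<in> sobolev_per L m"
    "AE x in lborel. Lop y x = g x" unfolding inv_op_def Lop_lin_op by blast
  have "inner_per L y h = inner_per L h y" by (rule inner_per_commute)
  also have "\<dots> = Q w y" by (rule Q_AE[OF w(1) h w(2) sobolev_L2[OF y(2)], symmetric])
  also have "\<dots> = Q y w" by (rule sym_form.commute[OF Q_sym_form Hm_V[OF w(1)] Hm_V[OF y(2)]])
  also have "\<dots> = inner_per L g w" by (rule Q_AE[OF y(2) g y(3) sobolev_L2[OF w(1)]])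
  finally show ?thesis unfolding y(1) .
qed

text \<open>Linearity of \<open>Lop\<close> holds only almost everywhere, because
  \<open>mult_op\<close> is a choice; it is recovered through the weak equation.\<close>

lemma minus_pA: "(\<lambda>x. (-1) * pA x) \<in> sobolev_per L m" "AE x in lborel. Lop (\<lambda>x. (-1) * pA x) x = 1"
proof -
  show "(\<lambda>x. (-1) * pA x) \<in> sobolev_per L m" by (rule sobolev_scale[OF pA_facts(2)])
  show "AE x in lborel. Lop (\<lambda>x. (-1) * pA x) x = 1"
  proof (rule weak_solution_regular(2)[OF Hm_V[OF sobolev_scale[OF pA_facts(2)]] L2_const])
    fix z assume z: "z \<in> V"
    show "Q (\<lambda>x. (-1) * pA x) z = inner_per L (\<lambda>x. 1) z"
      unfolding sym_form.scale_left[OF Q_sym_form Hm_V[OF pA_facts(2)] z] Q_pA[OF sobolev_L2[OF z]] by simp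
  qed
qed

lemma minus_pw: "(\<lambda>x. (-1) * pw x) \<in> sobolev_per L m" "AE x in lborel. Lop (\<lambda>x. (-1) * pw x) x = \<phi>0 x"
proof -
  show "(\<lambda>x. (-1) * pw x) \<in> sobolev_per L m" by (rule sobolev_scale[OF pw_facts(2)])
  show "AE x in lborel. Lop (\<lambda>x. (-1) * pw x) x = \<phi>0 x"
  proof (rule weak_solution_regular(2)[OF Hm_V[OF sobolev_scale[OF pw_facts(2)]] phi0(5)])
    fix z assume z: "z \<in> V"
    show "Q (\<lambda>x. (-1) * pw x) z = inner_per L \<phi>0 z"
      unfolding sym_form.scale_left[OF Q_sym_form Hm_V[OF pw_facts(2)] z] Q_pw[OF sobolev_L2[OF z]] by simp
  qed
qed

text \<open>Up to kernel components the inverse images of 1 and \<phi> are \<open>- pA\<close> and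
  \<open>- pw\<close>. The kernel components disappear in the pairings, as 1 and \<phi> are in the
  range of the operator.\<close>

lemma inverse_formulas:
  defines "Linv \<equiv> inv_op L m (lin_op L \<theta> f \<omega> \<phi>0) \<phi>0"
  shows "M_A L \<phi> \<omega> A = - inner_per L (Linv (\<lambda>x. 1)) (\<lambda>x. 1)"
    "F_omega L \<phi> \<omega> A = - inner_per L (Linv \<phi>0) \<phi>0"
    "M_omega L \<phi> \<omega> A = - inner_per L (Linv \<phi>0) (\<lambda>x. 1)"
  unfolding Linv_def inner_inv_op[OF minus_pA minus_pA L2_const L2_const]
    inner_inv_op[OF minus_pw minus_pw phi0(5) phi0(5)] inner_inv_op[OF minus_pw minus_pA phi0(5) L2_const]
    M_A_inner F_omega_inner M_omega_eq_F_A F_A_inner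
  by (simp_all only: inner_per_commute[of _ "\<lambda>x. (-1) * pA x"] inner_per_commute[of _ "\<lambda>x. (-1) * pw x"] inner_per_scale_left)

theorem coercive_of_Delta:
  assumes \<Delta>: "Delta L \<phi> \<omega> A a b > 0"
  obtains c K where "c > 0" "K > 0"
    "\<And>h. h \<in> V \<Longrightarrow> inner_per L h (deriv \<phi>0) = 0 \<Longrightarrow>
       c * (sobolev_norm L (m/2) h)\<^sup>2 \<le> Q h h + K * (inner_per L (\<lambda>x. a + b * \<phi>0 x) h)\<^sup>2"
proof -
  obtain \<Lambda> \<xi> where sp: "\<Lambda> < 0" "eigenfunction L m Lop \<Lambda> \<xi>" "eigenfunction L m Lop 0 (deriv \<phi>0)"
    "\<And>l v. l \<le> 0 \<Longrightarrow> v \<in> sobolev_per L m \<Longrightarrow> (AE x in lborel. Lop v x = l * v x) \<Longrightarrow>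
       inner_per L v \<xi> = 0 \<Longrightarrow> inner_per L v (deriv \<phi>0) = 0 \<Longrightarrow> inner_per L v v = 0"
    by (rule spectral_cond_cases[OF spectral[folded Lop_lin_op]]) blast
  interpret B: sym_form V Q by (rule Q_sym_form)
  have AV: "pA \<in> V" and wV: "pw \<in> V" using pA_facts(2) pw_facts(2) Hm_V by auto
  define \<Upsilon> where "\<Upsilon> = (\<lambda>x. a * pA x + b * pw x)"
  have \<Upsilon>V: "\<Upsilon> \<in> V" unfolding \<Upsilon>_def by (intro B.add_closed B.scale_closed AV wV)
  have g: "Q \<Upsilon> w = - inner_per L (\<lambda>x. a + b * \<phi>0 x) w" if w: "w \<in> V" for w
  proof -
    have wL: "w \<in> L2_per L" using w by (rule sobolev_L2)
    have "inner_per L (\<lambda>x. a + b * \<phi>0 x) w = inner_per L (\<lambda>x. a * 1) w + inner_per L (\<lambda>x. b * \<phi>0 x) w"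
      using inner_per_add_left[OF L2_const[of a] L2_scale[OF phi0(5), of b] wL] by simp
    then show ?thesis unfolding \<Upsilon>_def inner_per_scale_left
      by (simp add: B.add_left B.scale_left B.scale_closed AV wV w Q_pA[OF wL] Q_pw[OF wL])
  qed
  have Ld: "pA \<in> L2_per L" "pw \<in> L2_per L" using AV wV sobolev_L2 by auto
  have "Q \<Upsilon> \<Upsilon> = - (a\<^sup>2 * inner_per L (\<lambda>x. 1) pA + a * b * inner_per L (\<lambda>x. 1) pw + a * b * inner_per L \<phi>0 pA + b\<^sup>2 * inner_per L \<phi>0 pw)"
    unfolding \<Upsilon>_def
    by (simp add: B.add_left B.add_right B.scale_left B.scale_right B.scale_closed B.add_closed AV wV Q_pA[OF Ld(1)] Q_pA[OF Ld(2)] Q_pw[OF Ld(1)] Q_pw[OF Ld(2)]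
        algebra_simps power2_eq_square)
  also have "\<dots> = - Delta L \<phi> \<omega> A a b"
    unfolding Delta_def M_A_inner M_omega_inner F_A_inner F_omega_inner
      inner_per_commute[of "\<lambda>x. 1"] inner_per_commute[of \<phi>0] by (simp add: algebra_simps)
  finally have neg: "Q \<Upsilon> \<Upsilon> < 0" using \<Delta> by simp
  show ?thesis
  proof (rule coercive_augmented[OF eigenfunction_nonzero[OF sp(2)] deriv_phi0 sp(1)])
    show "inner_per L v v = 0" if "l \<le> 0" "v \<in> sobolev_per L m" "AE x in lborel. Lop v x = l * v x"
      "inner_per L v \<xi> = 0" "inner_per L v (deriv \<phi>0) = 0" for l v using that by (rule sp(4))
    show "\<Upsilon> \<in> V" by fact
    show "Q \<Upsilon> \<Upsilon> < 0" by fact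
    show "Q \<Upsilon> w = - inner_per L (\<lambda>x. a + b * \<phi>0 x) w" if "w \<in> V" for w using that by (rule g)
  qed (rule that)
qed

text \<open>With \<open>x\<close> and \<open>z\<close> nonpositive, a positive
  \<open>y\<^sup>2 - z * x\<close> makes the quadratic form indefinite. For nonzero \<open>x\<close>
  the vector \<open>(y, - x)\<close> gives \<open>- x\<close> times the discriminant; for
  \<open>x = 0\<close> the form is affine in \<open>a\<close> at \<open>b = 1\<close>, and the
  witness solves for the value 1.\<close>

lemma exists_positive_Delta:
  assumes "M_A L \<phi> \<omega> A > 0 \<or> F_omega L \<phi> \<omega> A > 0 \<or> (M_omega L \<phi> \<omega> A)\<^sup>2 - F_omega L \<phi> \<omega> A * M_A L \<phi> \<omega> A > 0"
  shows "\<exists>a b. Delta L \<phi> \<omega> A a b > 0"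
proof -
  define x y z where "x = M_A L \<phi> \<omega> A" and "y = M_omega L \<phi> \<omega> A" and "z = F_omega L \<phi> \<omega> A"
  have D: "Delta L \<phi> \<omega> A a b = a\<^sup>2 * x + 2 * (a * b * y) + b\<^sup>2 * z" for a b
    unfolding Delta_def M_omega_eq_F_A[symmetric] x_def y_def z_def by simp
  consider "x > 0" | "z > 0" | "x \<le> 0" "z \<le> 0" "y\<^sup>2 - z * x > 0"
    using assms unfolding x_def y_def z_def by linarith
  then show ?thesis
  proof cases
    case 1 then show ?thesis using D[of 1 0] by force
  next
    case 2 then show ?thesis using D[of 0 1] by force
  next
    case 3
    show ?thesis
    proof (cases "x = 0")
      case True
      then have "y \<noteq> 0" using 3 by auto
      have "Delta L \<phi> \<omega> A ((1 - z) / (2 * y)) 1 = 1" unfolding D True using \<open>y \<noteq> 0\<close> by (simp add: field_simps)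
      then show ?thesis by (metis zero_less_one)
    next
      case False
      have "Delta L \<phi> \<omega> A y (- x) = (- x) * (y\<^sup>2 - z * x)" unfolding D by (simp add: power2_eq_square algebra_simps)
      also have "\<dots> > 0" using 3 False by (intro mult_pos_pos) auto
      finally show ?thesis by blast
    qed
  qed
qed

end

section \<open>Second-order expansion of the energy\<close>

text \<open>Uniqueness of second-order expansions from one side. It compares the abstract expansion
  of \<open>P\<close> with the explicit one along a ray.\<close>

lemma small_quadratic_zero:
  fixes x y C :: real
  assumes "\<delta> > 0" and b: "\<And>t. 0 < t \<Longrightarrow> t < \<delta> \<Longrightarrow> \<bar>t * x + t\<^sup>2 * y\<bar> \<le> C * t ^ 3"
  shows "x = 0" "y = 0"
proof -
  have sm: "z = 0" if z: "\<And>t. 0 < t \<Longrightarrow> t < \<delta> \<Longrightarrow> t < 1 \<Longrightarrow> \<bar>z\<bar> \<le> B * t" for z B :: real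
  proof (rule ccontr)
    assume "z \<noteq> 0"
    \<comment> \<open>The last bound in the minimum gives
      \<open>2 * (\<bar>B\<bar> + 1) * t \<le> \<bar>z\<bar>\<close>, against
      \<open>\<bar>z\<bar> \<le> B * t\<close>.\<close>
    define t where "t = min (\<delta> / 2) (min (1 / 2) (\<bar>z\<bar> / (2 * (\<bar>B\<bar> + 1))))"
    have "0 < \<bar>z\<bar> / (2 * (\<bar>B\<bar> + 1))" using \<open>z \<noteq> 0\<close> by (intro divide_pos_pos) auto
    then have t0: "0 < t" unfolding t_def using assms(1) by simp
    have "t \<le> \<delta> / 2" unfolding t_def by (rule min.cobounded1)
    moreover have "t \<le> 1 / 2" unfolding t_def by (rule order_trans[OF min.cobounded2 min.cobounded1])
    ultimately have t: "0 < t" "t < \<delta>" "t < 1" using t0 assms(1) by linarith+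
    have "t \<le> \<bar>z\<bar> / (2 * (\<bar>B\<bar> + 1))" unfolding t_def by (rule order_trans[OF min.cobounded2 min.cobounded2])
    then have 1: "2 * ((\<bar>B\<bar> + 1) * t) \<le> \<bar>z\<bar>" by (simp add: field_simps)
    have "\<bar>z\<bar> \<le> B * t" by (rule z[OF t])
    also have "\<dots> \<le> (\<bar>B\<bar> + 1) * t" using t by (intro mult_right_mono) auto
    finally show False using 1 \<open>z \<noteq> 0\<close> by simp
  qed
  have "\<bar>x\<bar> \<le> (\<bar>y\<bar> + \<bar>C\<bar>) * t" if t: "0 < t" "t < \<delta>" "t < 1" for t
  proof -
    have "t * \<bar>x\<bar> = \<bar>(t * x + t\<^sup>2 * y) - t\<^sup>2 * y\<bar>" using t by (simp add: abs_mult)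
    also have "\<dots> \<le> C * t ^ 3 + t\<^sup>2 * \<bar>y\<bar>" using b[OF t(1,2)] abs_triangle_ineq4[of "t * x + t\<^sup>2 * y" "t\<^sup>2 * y"] by (simp add: abs_mult)
    also have "C * t ^ 3 \<le> \<bar>C\<bar> * t ^ 2"
      using t power_decreasing[of 2 3 t] by (intro mult_mono) auto
    finally have "t * \<bar>x\<bar> \<le> t * ((\<bar>y\<bar> + \<bar>C\<bar>) * t)" by (simp add: power2_eq_square algebra_simps)
    then show ?thesis using t by simp
  qed
  then show x: "x = 0" by (rule sm)
  have "\<bar>y\<bar> \<le> C * t" if t: "0 < t" "t < \<delta>" "t < 1" for t
  proof -
    have "t\<^sup>2 * \<bar>y\<bar> \<le> t\<^sup>2 * (C * t)" using b[OF t(1,2)] t unfolding x by (simp add: abs_mult power2_eq_square power3_eq_cube mult_ac)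
    then show ?thesis using t by simp
  qed
  then show "y = 0" by (rule sm)
qed

text \<open>Maclaurin along the segment from \<open>u\<close> to \<open>u + h\<close> leaves the
  second derivative at an intermediate point. Its distance to the one at \<open>u\<close> is of
  first order in \<open>h\<close>, uniformly in the two directions, which yields the cubic
  error.\<close>

lemma smooth_functional_taylor:
  assumes sf: "smooth_functional V N G" and add: "\<And>u v. u \<in> V \<Longrightarrow> v \<in> V \<Longrightarrow> (\<lambda>x. u x + v x) \<in> V"
    and sc: "\<And>c u. u \<in> V \<Longrightarrow> (\<lambda>x. c * u x) \<in> V" and Nsc: "\<And>c u. N (\<lambda>x. c * u x) = \<bar>c\<bar> * N u" and N0: "\<And>u. 0 \<le> N u"
    and u: "u \<in> V"
  shows "\<exists>D1 D2 \<delta> C. \<delta> > 0 \<and> C \<ge> 0 \<and>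
    (\<forall>h\<in>V. N h < \<delta> \<longrightarrow> \<bar>G (\<lambda>x. u x + h x) - G u - D1 h - D2 h h / 2\<bar> \<le> C * N h ^ 3) \<and>
    (\<forall>h\<in>V. \<forall>k\<in>V. D1 (\<lambda>x. h x + k x) = D1 h + D1 k) \<and>
    (\<forall>c. \<forall>h\<in>V. D1 (\<lambda>x. c * h x) = c * D1 h) \<and> (\<forall>h\<in>V. \<bar>D1 h\<bar> \<le> C * N h) \<and>
    (\<forall>h\<in>V. \<forall>k\<in>V. \<forall>l\<in>V. D2 (\<lambda>x. h x + k x) l = D2 h l + D2 k l) \<and>
    (\<forall>h\<in>V. \<forall>k\<in>V. \<forall>l\<in>V. D2 l (\<lambda>x. h x + k x) = D2 l h + D2 l k) \<and>
    (\<forall>c. \<forall>h\<in>V. \<forall>k\<in>V. D2 (\<lambda>x. c * h x) k = c * D2 h k) \<and>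
    (\<forall>c. \<forall>h\<in>V. \<forall>k\<in>V. D2 k (\<lambda>x. c * h x) = c * D2 k h) \<and>
    (\<forall>h\<in>V. \<forall>k\<in>V. \<bar>D2 h k\<bar> \<le> C * (N h * N k))"
proof -
  obtain D :: "(real \<Rightarrow> real) \<Rightarrow> (real \<Rightarrow> real) list \<Rightarrow> real" where D: "\<forall>u\<in>V.
          D u [] = G u \<and>
          (\<forall>xs\<in>lists V. \<forall>ys\<in>lists V. \<forall>v\<in>V. \<forall>w\<in>V. \<forall>c.
             D u (xs @ (\<lambda>x. v x + w x) # ys) = D u (xs @ v # ys) + D u (xs @ w # ys) \<and>
             D u (xs @ (\<lambda>x. c * v x) # ys) = c * D u (xs @ v # ys)) \<and>
          (\<forall>n. \<exists>C. \<forall>vs\<in>lists V. length vs = n \<longrightarrow> \<bar>D u vs\<bar> \<le> C * prod_list (map N vs)) \<and>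
          (\<forall>n. \<forall>\<epsilon>>0. \<exists>\<delta>>0. \<forall>h\<in>V. N h < \<delta> \<longrightarrow>
             (\<forall>vs\<in>lists V. length vs = n \<longrightarrow>
                \<bar>D (\<lambda>x. u x + h x) vs - D u vs - D u (h # vs)\<bar> \<le> \<epsilon> * N h * prod_list (map N vs)))"
    using sf unfolding smooth_functional_def by (rule exE)
  note D' = bspec[OF D]
  note D0 = D'[THEN conjunct1]
    and Dm = D'[THEN conjunct2, THEN conjunct1, rule_format]
    and Db = D'[THEN conjunct2, THEN conjunct2, THEN conjunct1, THEN spec]
    and Dd = D'[THEN conjunct2, THEN conjunct2, THEN conjunct2, THEN spec, THEN spec, THEN mp]
  \<comment> \<open>The Frechet condition restricted to a line gives ordinary derivatives in
    \<open>t\<close>; homogeneity in the new direction pulls out the factor \<tau>.\<close>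
  have der: "((\<lambda>t. D (\<lambda>x. u x + t * h x) vs) has_real_derivative D (\<lambda>x. u x + t * h x) (h # vs)) (at t)"
    if h: "h \<in> V" and vs: "vs \<in> lists V" for h vs t
    unfolding DERIV_def
  proof (rule LIM_I)
    fix e :: real assume e: "e > 0"
    define p where "p = prod_list (map N vs)"
    have p: "p \<ge> 0" unfolding p_def by (rule prod_list_nonneg) (auto simp: N0)
    define M where "M = N h * p"
    have M: "M \<ge> 0" unfolding M_def using N0 p by simp
    have ut: "(\<lambda>x. u x + t * h x) \<in> V" using add[OF u sc[OF h]] .
    have "e / (M + 1) > 0" using e M by simp
    from Dd[OF ut this, of "length vs"] obtain d where d: "d > 0" "\<And>k. k \<in> V \<Longrightarrow> N k < d \<Longrightarrow>
        \<bar>D (\<lambda>x. (u x + t * h x) + k x) vs - D (\<lambda>x. u x + t * h x) vs - D (\<lambda>x. u x + t * h x) (k # vs)\<bar> \<le> e / (M + 1) * N k * p"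
      using vs unfolding p_def by blast
    have "norm ((D (\<lambda>x. u x + (t + \<tau>) * h x) vs - D (\<lambda>x. u x + t * h x) vs) / \<tau> - D (\<lambda>x. u x + t * h x) (h # vs)) < e"
      if \<tau>: "\<tau> \<noteq> 0" "norm (\<tau> - 0) < d / (N h + 1)" for \<tau>
    proof -
      let ?k = "\<lambda>x. \<tau> * h x"
      have "\<bar>\<tau>\<bar> * N h \<le> \<bar>\<tau>\<bar> * (N h + 1)" by (simp add: algebra_simps)
      also have "\<dots> < d" using \<tau>(2) N0[of h] by (simp add: pos_less_divide_eq)
      finally have "N ?k < d" unfolding Nsc .
      from d(2)[OF sc[OF h] this]
      have "\<bar>D (\<lambda>x. (u x + t * h x) + \<tau> * h x) vs - D (\<lambda>x. u x + t * h x) vs - D (\<lambda>x. u x + t * h x) (?k # vs)\<bar> \<le> e / (M + 1) * (\<bar>\<tau>\<bar> * N h) * p"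
        unfolding Nsc .
      moreover have "D (\<lambda>x. u x + t * h x) (?k # vs) = \<tau> * D (\<lambda>x. u x + t * h x) (h # vs)"
        using Dm[OF ut, of "[]" vs h h \<tau>] vs h by simp
      moreover have "(\<lambda>x. (u x + t * h x) + \<tau> * h x) = (\<lambda>x. u x + (t + \<tau>) * h x)" by (simp add: algebra_simps)
      ultimately have b: "\<bar>D (\<lambda>x. u x + (t + \<tau>) * h x) vs - D (\<lambda>x. u x + t * h x) vs - \<tau> * D (\<lambda>x. u x + t * h x) (h # vs)\<bar> \<le> \<bar>\<tau>\<bar> * (e / (M + 1) * M)"
        unfolding M_def by (simp add: mult_ac)
      have "norm ((D (\<lambda>x. u x + (t + \<tau>) * h x) vs - D (\<lambda>x. u x + t * h x) vs) / \<tau> - D (\<lambda>x. u x + t * h x) (h # vs))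
          = \<bar>D (\<lambda>x. u x + (t + \<tau>) * h x) vs - D (\<lambda>x. u x + t * h x) vs - \<tau> * D (\<lambda>x. u x + t * h x) (h # vs)\<bar> / \<bar>\<tau>\<bar>"
        using \<tau>(1) by (simp add: abs_divide[symmetric] diff_divide_distrib)
      also have "\<dots> \<le> e / (M + 1) * M" using b \<tau>(1) by (simp add: pos_divide_le_eq mult.commute)
      also have "\<dots> < e" using e M by (simp add: field_simps)
      finally show ?thesis .
    qed
    moreover have "d / (N h + 1) > 0" using d(1) N0[of h] by (simp add: add_nonneg_pos)
    ultimately show "\<exists>s>0. \<forall>\<tau>. \<tau> \<noteq> 0 \<and> norm (\<tau> - 0) < s \<longrightarrow>
       norm ((D (\<lambda>x. u x + (t + \<tau>) * h x) vs - D (\<lambda>x. u x + t * h x) vs) / \<tau> - D (\<lambda>x. u x + t * h x) (h # vs)) < e" by blast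
  qed
  \<comment> \<open>A Lipschitz bound on the second derivative is all that is wanted, so the
    condition is used with the fixed tolerance 1 and lists of length 2.\<close>
  obtain d where d: "d > 0" "\<And>h v w. h \<in> V \<Longrightarrow> N h < d \<Longrightarrow> v \<in> V \<Longrightarrow> w \<in> V \<Longrightarrow>
      \<bar>D (\<lambda>x. u x + h x) [v, w] - D u [v, w] - D u [h, v, w]\<bar> \<le> 1 * N h * (N v * N w)"
  proof -
    obtain d where d: "d > 0" "\<forall>h\<in>V. N h < d \<longrightarrow> (\<forall>vs\<in>lists V. length vs = 2 \<longrightarrow>
                \<bar>D (\<lambda>x. u x + h x) vs - D u vs - D u (h # vs)\<bar> \<le> 1 * N h * prod_list (map N vs))"
      using Dd[OF u, of 1 2] by auto
    show ?thesis
    proof (rule that[OF d(1)])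
      fix h v w assume "h \<in> V" "N h < d" "v \<in> V" "w \<in> V"
      then show "\<bar>D (\<lambda>x. u x + h x) [v, w] - D u [v, w] - D u [h, v, w]\<bar> \<le> 1 * N h * (N v * N w)"
        using bspec[OF mp[OF bspec[OF d(2)]], of h "[v, w]"] by simp
    qed
  qed
  obtain C1 where C1: "\<And>v. v \<in> V \<Longrightarrow> \<bar>D u [v]\<bar> \<le> C1 * N v"
  proof -
    obtain C where C: "\<forall>vs\<in>lists V. length vs = 1 \<longrightarrow> \<bar>D u vs\<bar> \<le> C * prod_list (map N vs)" using Db[OF u] by blast
    then have "\<bar>D u [v]\<bar> \<le> C * N v" if "v \<in> V" for v using bspec[OF C, of "[v]"] that by simp
    then show ?thesis using that by blast
  qed
  obtain C2 where C2: "\<And>v w. v \<in> V \<Longrightarrow> w \<in> V \<Longrightarrow> \<bar>D u [v, w]\<bar> \<le> C2 * (N v * N w)"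
  proof -
    obtain C where C: "\<forall>vs\<in>lists V. length vs = 2 \<longrightarrow> \<bar>D u vs\<bar> \<le> C * prod_list (map N vs)" using Db[OF u] by blast
    then have "\<bar>D u [v, w]\<bar> \<le> C * (N v * N w)" if "v \<in> V" "w \<in> V" for v w using bspec[OF C, of "[v, w]"] that by simp
    then show ?thesis using that by blast
  qed
  obtain C3 where C3: "\<And>h v w. h \<in> V \<Longrightarrow> v \<in> V \<Longrightarrow> w \<in> V \<Longrightarrow> \<bar>D u [h, v, w]\<bar> \<le> C3 * (N h * (N v * N w))"
  proof -
    obtain C where C: "\<forall>vs\<in>lists V. length vs = 3 \<longrightarrow> \<bar>D u vs\<bar> \<le> C * prod_list (map N vs)" using Db[OF u] by blast
    then have "\<bar>D u [h, v, w]\<bar> \<le> C * (N h * (N v * N w))" if "h \<in> V" "v \<in> V" "w \<in> V" for h v w using bspec[OF C, of "[h, v, w]"] that by simp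
    then show ?thesis using that by blast
  qed
  define C where "C = \<bar>C1\<bar> + \<bar>C2\<bar> + \<bar>C3\<bar> + 1"
  have C: "C \<ge> 0" "C1 \<le> C" "C2 \<le> C" "C3 + 1 \<le> C" unfolding C_def by auto
  show ?thesis
  proof (rule exI[of _ "\<lambda>h. D u [h]"], rule exI[of _ "\<lambda>h k. D u [h, k]"], rule exI[of _ d], rule exI[of _ C],
      intro conjI ballI impI allI)
    fix h assume h: "h \<in> V" "N h < d"
    define diff where "diff m t = (if m = 0 then D (\<lambda>x. u x + t * h x) [] else if m = 1 then D (\<lambda>x. u x + t * h x) [h]
        else D (\<lambda>x. u x + t * h x) [h, h])" for m :: nat and t :: real
    have "\<forall>m t. m < 2 \<and> 0 \<le> t \<and> t \<le> 1 \<longrightarrow> DERIV (diff m) t :> diff (Suc m) t"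
    proof (intro allI impI)
      fix m :: nat and t :: real assume "m < 2 \<and> 0 \<le> t \<and> t \<le> 1"
      then consider "m = 0" | "m = 1" by linarith
      then show "DERIV (diff m) t :> diff (Suc m) t"
        using der[OF h(1), of "[]" t] der[OF h(1), of "[h]" t] h(1) by cases (simp_all add: diff_def[abs_def])
    qed
    from Maclaurin[OF zero_less_one pos2 refl this] obtain t where t: "0 < t" "t < 1" "diff 0 1 = (\<Sum>m<2. (diff m 0 / fact m) * 1 ^ m) + (diff 2 t / fact 2) * 1 ^ 2"
      by blast
    have Gu: "diff 0 0 = G u" "diff 0 1 = G (\<lambda>x. u x + h x)" "diff 1 0 = D u [h]"
      unfolding diff_def using D0[OF u] D0[OF add[OF u h(1)]] by simp_all
    have Nt: "N (\<lambda>x. t * h x) \<le> N h" unfolding Nsc using t N0[of h] by (simp add: mult_le_cancel_right1 mult_left_le_one_le)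
    have t2: "\<bar>diff 2 t - D u [h, h]\<bar> \<le> (C3 + 1) * N h ^ 3"
    proof -
      have th: "(\<lambda>x. t * h x) \<in> V" by (rule sc[OF h(1)])
      have "\<bar>D (\<lambda>x. u x + t * h x) [h, h] - D u [h, h] - D u [\<lambda>x. t * h x, h, h]\<bar> \<le> 1 * N (\<lambda>x. t * h x) * (N h * N h)"
        by (rule d(2)[OF th _ h(1) h(1)]) (use Nt h(2) in simp)
      moreover have "1 * N (\<lambda>x. t * h x) * (N h * N h) \<le> 1 * N h * (N h * N h)"
        using Nt N0[of h] by (intro mult_right_mono) auto
      moreover have "\<bar>D u [\<lambda>x. t * h x, h, h]\<bar> \<le> C3 * N h ^ 3"
      proof -
        have "D u [\<lambda>x. t * h x, h, h] = t * D u [h, h, h]" using Dm[OF u, of "[]" "[h, h]" h h t] h(1) by simp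
        then have "\<bar>D u [\<lambda>x. t * h x, h, h]\<bar> = t * \<bar>D u [h, h, h]\<bar>" using t by (simp add: abs_mult)
        also have "\<dots> \<le> 1 * \<bar>D u [h, h, h]\<bar>" using t by (intro mult_right_mono) auto
        finally show ?thesis using C3[OF h(1) h(1) h(1)] by (simp add: power3_eq_cube mult_ac)
      qed
      ultimately show ?thesis unfolding diff_def by (simp add: power3_eq_cube algebra_simps)
    qed
    have "G (\<lambda>x. u x + h x) = G u + D u [h] + diff 2 t / 2"
    proof -
      have "(\<Sum>m<2. (diff m 0 / fact m) * 1 ^ m) = diff 0 0 + diff 1 0" by (simp add: numeral_2_eq_2)
      then show ?thesis using t(3) unfolding Gu by simp
    qed
    then have "G (\<lambda>x. u x + h x) - G u - D u [h] - D u [h, h] / 2 = (diff 2 t - D u [h, h]) / 2"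
      unfolding diff_divide_distrib by linarith
    then have "\<bar>G (\<lambda>x. u x + h x) - G u - D u [h] - D u [h, h] / 2\<bar> = \<bar>diff 2 t - D u [h, h]\<bar> / 2"
      by (simp only: abs_divide abs_numeral)
    also have "\<dots> \<le> \<bar>diff 2 t - D u [h, h]\<bar>" by simp
    also have "\<dots> \<le> (C3 + 1) * N h ^ 3" by (rule t2)
    also have "\<dots> \<le> C * N h ^ 3" using C N0[of h] by (intro mult_right_mono) auto
    finally show "\<bar>G (\<lambda>x. u x + h x) - G u - D u [h] - D u [h, h] / 2\<bar> \<le> C * N h ^ 3" .
  next
    fix h assume h: "h \<in> V"
    show "\<bar>D u [h]\<bar> \<le> C * N h" using C1[OF h] mult_right_mono[OF C(2) N0[of h]] by linarith
  next
    fix h k assume h: "h \<in> V" "k \<in> V"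
    have "0 \<le> N h * N k" using N0 by simp
    then show "\<bar>D u [h, k]\<bar> \<le> C * (N h * N k)" using C2[OF h] mult_right_mono[OF C(3), of "N h * N k"] by linarith
    show "D u [\<lambda>x. h x + k x] = D u [h] + D u [k]" using Dm[OF u, of "[]" "[]" h k] h by simp
  next
    fix c h k assume h: "h \<in> V" "k \<in> V"
    show "D u [\<lambda>x. c * h x, k] = c * D u [h, k]" using Dm[OF u, of "[]" "[k]" h h c] h by simp
    show "D u [k, \<lambda>x. c * h x] = c * D u [k, h]" using Dm[OF u, of "[k]" "[]" h h c] h by simp
  next
    fix c h assume h: "h \<in> V"
    show "D u [\<lambda>x. c * h x] = c * D u [h]" using Dm[OF u, of "[]" "[]" h h c] h by simp
  next
    fix h k l assume h: "h \<in> V" "k \<in> V" "l \<in> V"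
    show "D u [\<lambda>x. h x + k x, l] = D u [h, l] + D u [k, l]" using Dm[OF u, of "[]" "[l]" h k] h by simp
    show "D u [l, \<lambda>x. h x + k x] = D u [l, h] + D u [l, k]" using Dm[OF u, of "[l]" "[]" h k] h by simp
  qed (rule d(1) C(1))+
qed

section \<open>Boundedness and density in the form domain\<close>

context lin_operator
begin

text \<open>\<open>Q\<close> is indefinite, so Cauchy-Schwarz is applied to \<open>Q\<close> plus
  \<open>C\<close> times the H^(m/2) product, which is nonnegative by the diagonal bound. The factor
  3 is 2 for this sum and 1 for removing the added product.\<close>

lemma Q_bounded:
  obtains C where "C > 0" "\<And>u v. u \<in> V \<Longrightarrow> v \<in> V \<Longrightarrow> \<bar>Q u v\<bar> \<le> C * (sobolev_norm L (m/2) u * sobolev_norm L (m/2) v)"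
proof -
  obtain c C where C: "C > 0" "\<And>u. u \<in> V \<Longrightarrow> \<bar>Q u u\<bar> \<le> C * (sobolev_norm L (m/2) u)\<^sup>2" by (rule Garding) blast
  let ?N = "sobolev_norm L (m/2)" and ?S = "mform (wt (m/2))"
  have B: "sym_form V (\<lambda>u v. Q u v + C * ?S u v)" by (rule sym_form_lincomb[OF Q_sym_form sobolev_sym_form])
  have pos: "0 \<le> Q u u + C * ?S u u" if "u \<in> V" for u
    using C(2)[OF that] unfolding sobolev_norm_sq by linarith
  have up: "sqrt (Q u u + C * ?S u u) \<le> sqrt (2 * C) * ?N u" if "u \<in> V" for u
  proof -
    have "Q u u + C * ?S u u \<le> (2 * C) * (?N u)\<^sup>2" using C(2)[OF that] unfolding sobolev_norm_sq by simp
    then have "sqrt (Q u u + C * ?S u u) \<le> sqrt ((2 * C) * (?N u)\<^sup>2)" by (rule real_sqrt_le_mono)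
    then show ?thesis using sobolev_norm_nonneg[of "m/2" u] by (simp add: real_sqrt_mult)
  qed
  show ?thesis
  proof (rule that[of "3 * C"])
    fix u v assume u: "u \<in> V" and v: "v \<in> V"
    have "\<bar>Q u v + C * ?S u v\<bar> \<le> sqrt (Q u u + C * ?S u u) * sqrt (Q v v + C * ?S v v)"
      by (rule sym_form.Cauchy_Schwarz_abs[OF B u v pos])
    also have "\<dots> \<le> (sqrt (2 * C) * ?N u) * (sqrt (2 * C) * ?N v)"
      using pos u v C(1) sobolev_norm_nonneg by (intro mult_mono up) auto
    also have "\<dots> = 2 * C * (?N u * ?N v)" using C(1) by simp
    finally have 1: "\<bar>Q u v + C * ?S u v\<bar> \<le> 2 * C * (?N u * ?N v)" .
    have "\<bar>?S u v\<bar> \<le> ?N u * ?N v"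
      unfolding sobolev_norm_mform
      by (rule sym_form.Cauchy_Schwarz_abs[OF sobolev_sym_form u v]) (intro mform_nonneg less_imp_le wt_pos)
    then have "\<bar>C * ?S u v\<bar> \<le> C * (?N u * ?N v)" using C(1) by (simp add: abs_mult)
    then show "\<bar>Q u v\<bar> \<le> 3 * C * (?N u * ?N v)" using 1 by simp
  qed (use C in simp)
qed

end

context period
begin

lemma inner_bounded:
  assumes "0 \<le> s" "u \<in> sobolev_per L s" "v \<in> sobolev_per L s"
  shows "\<bar>inner_per L u v\<bar> \<le> sobolev_norm L s u * sobolev_norm L s v"
proof -
  have "\<bar>inner_per L u v\<bar> \<le> sqrt (inner_per L u u) * sqrt (inner_per L v v)"
    using assms by (intro sym_form.Cauchy_Schwarz_abs[OF inner_sym_form] inner_per_nonneg) (auto intro: sobolev_L2)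
  also have "\<dots> \<le> sobolev_norm L s u * sobolev_norm L s v"
    using inner_le_sobolev[OF assms(1,2)] inner_le_sobolev[OF assms(1,3)] sobolev_norm_nonneg
    by (intro mult_mono real_le_lsqrt) (auto intro: inner_per_nonneg)
  finally show ?thesis .
qed

lemma trig_dense:
  assumes h: "h \<in> sobolev_per L s" and e: "e > 0"
  obtains p where "continuous_on UNIV p" "periodic L p" "p \<in> sobolev_per L s" "sobolev_norm L s (\<lambda>x. h x - p x) < e"
proof -
  let ?f = "\<lambda>\<kappa>. wt s \<kappa> * (cmod (fourier_coeff L h \<kappa>))\<^sup>2"
  have f0: "0 \<le> ?f \<kappa>" for \<kappa> using wt_pos[of s \<kappa>] by simp
  have e': "e\<^sup>2 / (4 * L) > 0" using e L_pos by simp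
  obtain N where N: "\<And>A. finite A \<Longrightarrow> A \<inter> {- int N..int N} = {} \<Longrightarrow> sum ?f A < e\<^sup>2 / (4 * L)"
    using summable_on_tail[OF sobolev_summable[OF h] f0 e'] by metis
  define K where "K = {- int N..int N}"
  have K: "finite K" "\<And>\<kappa>. \<kappa> \<in> K \<longleftrightarrow> - \<kappa> \<in> K" unfolding K_def by auto
  define p where "p = trig (fourier_coeff L h) K"
  have pS: "p \<in> sobolev_per L s" unfolding p_def
    by (rule trig_sobolev[where c="fourier_coeff L h" and K=K, OF fourier_coeff_uminus K])
  have pc: "fourier_coeff L p \<kappa> = (if \<kappa> \<in> K then fourier_coeff L h \<kappa> else 0)" for \<kappa>
    unfolding p_def by (rule fourier_coeff_trig[where c="fourier_coeff L h" and K=K, OF fourier_coeff_uminus K])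
  have dc: "fourier_coeff L (\<lambda>x. h x - p x) \<kappa> = (if \<kappa> \<in> K then 0 else fourier_coeff L h \<kappa>)" for \<kappa>
    unfolding L2_coeff_diff[OF sobolev_L2[OF h] sobolev_L2[OF pS]] pc by simp
  have "(\<Sum>\<^sub>\<infinity>\<kappa>. wt s \<kappa> * (cmod (fourier_coeff L (\<lambda>x. h x - p x) \<kappa>))\<^sup>2) \<le> e\<^sup>2 / (4 * L)"
  proof (rule infsum_le_finite_sums[OF sobolev_summable[OF sobolev_diff[OF h pS]]])
    fix F :: "int set" assume F: "finite F"
    have "(\<Sum>\<kappa>\<in>F. wt s \<kappa> * (cmod (fourier_coeff L (\<lambda>x. h x - p x) \<kappa>))\<^sup>2) = sum ?f (F - K)"
      using F unfolding dc by (intro sum.mono_neutral_cong_right) auto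
    also have "\<dots> < e\<^sup>2 / (4 * L)" using F by (intro N) (auto simp: K_def)
    finally show "(\<Sum>\<kappa>\<in>F. wt s \<kappa> * (cmod (fourier_coeff L (\<lambda>x. h x - p x) \<kappa>))\<^sup>2) \<le> e\<^sup>2 / (4 * L)" by simp
  qed
  then have "(sobolev_norm L s (\<lambda>x. h x - p x))\<^sup>2 \<le> L * (e\<^sup>2 / (4 * L))"
    unfolding sobolev_norm_sq mform_self using L_pos by (intro mult_left_mono) auto
  also have "\<dots> = (e / 2)\<^sup>2" using L_pos by (simp add: power_divide)
  finally have "sobolev_norm L s (\<lambda>x. h x - p x) \<le> e / 2" by (rule power2_le_imp_le) (use e in simp)
  then have "sobolev_norm L s (\<lambda>x. h x - p x) < e" using e by simp
  then show ?thesis using that pS trig_continuous trig_periodic unfolding p_def by blast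
qed

end

locale wave_energy = wave_point +
  fixes W :: "real \<Rightarrow> real"
  assumes W_deriv: "\<And>y. (W has_real_derivative f y) (at y)"
    and P_smooth: "smooth_functional (sobolev_per L (m/2)) (sobolev_norm L (m/2)) (P_fun L \<theta> W)"
begin

abbreviation N :: "(real \<Rightarrow> real) \<Rightarrow> real" where "N \<equiv> sobolev_norm L (m/2)"

definition energy :: "(real \<Rightarrow> real) \<Rightarrow> real" where
  "energy u = P_fun L \<theta> W u + \<omega> * F_fun L u + A * M_fun L u"

lemma W_cont: "continuous_on B W"
  using W_deriv by (meson DERIV_isCont continuous_at_imp_continuous_on)

text \<open>The third derivative of \<open>W\<close> is bounded on compact sets only, so the
  constant depends on \<open>R\<close>; it is taken over \<open>{-2*R..2*R}\<close> because the
  intermediate point is \<open>y + t * k\<close>.\<close>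

lemma W_taylor:
  obtains C where "C \<ge> 0" "\<And>y k. \<bar>y\<bar> \<le> R \<Longrightarrow> \<bar>k\<bar> \<le> R \<Longrightarrow> \<bar>W (y + k) - W y - f y * k - deriv f y * k\<^sup>2 / 2\<bar> \<le> C * \<bar>k\<bar> ^ 3"
proof -
  have c: "continuous_on {-2*R..2*R} (deriv (deriv f))"
    using smooth_real_continuous_deriv[OF smooth_real_deriv(2)[OF f_smooth]] by (rule continuous_on_subset) auto
  have "compact (deriv (deriv f) ` {-2*R..2*R})" by (intro compact_continuous_image c) auto
  then obtain C where C: "\<forall>x\<in>{-2*R..2*R}. \<bar>deriv (deriv f) x\<bar> \<le> C"
    using compact_imp_bounded[of "deriv (deriv f) ` {-2*R..2*R}"] unfolding bounded_iff by auto
  show ?thesis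
  proof (rule that[of "\<bar>C\<bar>"])
    fix y k :: real assume y: "\<bar>y\<bar> \<le> R" and k: "\<bar>k\<bar> \<le> R"
    define G where "G j = (if j = 0 then W else if j = 1 then f else if j = 2 then deriv f else deriv (deriv f))" for j :: nat
    define diff where "diff j t = G j (y + t * k) * k ^ j" for j :: nat and t
    have G: "(G j has_real_derivative G (Suc j) x) (at x)" if j3: "j < 3" for j x
    proof -
      consider "j = 0" | "j = 1" | "j = 2" using j3 by linarith
      then show ?thesis
        using W_deriv[of x] smooth_real_deriv(1)[OF f_smooth, of x] smooth_real_deriv(1)[OF smooth_real_deriv(2)[OF f_smooth], of x]
        by cases (simp_all add: G_def)
    qed
    have "\<forall>j t. j < 3 \<and> 0 \<le> t \<and> t \<le> 1 \<longrightarrow> DERIV (diff j) t :> diff (Suc j) t"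
    proof (intro allI impI)
      fix j :: nat and t :: real assume j: "j < 3 \<and> 0 \<le> t \<and> t \<le> 1"
      have "((\<lambda>t. y + t * k) has_real_derivative k) (at t)" by (auto intro!: derivative_eq_intros)
      from DERIV_chain2[OF G[of j "y + t * k"] this]
      have "((\<lambda>t. G j (y + t * k)) has_real_derivative G (Suc j) (y + t * k) * k) (at t)" using j by simp
      from DERIV_cmult_right[OF this, of "k ^ j"] show "DERIV (diff j) t :> diff (Suc j) t"
        unfolding diff_def by (simp add: mult_ac)
    qed
    then obtain t where t: "0 < t" "t < 1" "diff 0 1 = (\<Sum>j<3. (diff j 0 / fact j) * 1 ^ j) + (diff 3 t / fact 3) * 1 ^ 3"
      using Maclaurin[of 1 3 diff "diff 0"] by auto
    have "W (y + k) - W y - f y * k - deriv f y * k\<^sup>2 / 2 = diff 3 t / 6"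
      using t(3) unfolding diff_def by (simp add: G_def numeral_3_eq_3 numeral_2_eq_2 fact_numeral)
    also have "\<bar>diff 3 t / 6\<bar> \<le> \<bar>C\<bar> * \<bar>k\<bar> ^ 3"
    proof -
      have "\<bar>t * k\<bar> \<le> R" using t k by (simp add: abs_mult mult_left_le_one_le order_trans[OF mult_left_le_one_le])
      then have "\<bar>deriv (deriv f) (y + t * k)\<bar> \<le> C" using y by (intro C[rule_format]) auto
      then have "\<bar>deriv (deriv f) (y + t * k)\<bar> * \<bar>k\<bar> ^ 3 \<le> \<bar>C\<bar> * \<bar>k\<bar> ^ 3" by (intro mult_right_mono) auto
      then have "\<bar>diff 3 t\<bar> \<le> \<bar>C\<bar> * \<bar>k\<bar> ^ 3" unfolding diff_def by (simp add: G_def abs_mult power_abs)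
      then show ?thesis by (simp add: abs_divide)
    qed
    finally show "\<bar>W (y + k) - W y - f y * k - deriv f y * k\<^sup>2 / 2\<bar> \<le> \<bar>C\<bar> * \<bar>k\<bar> ^ 3" .
  qed simp
qed

text \<open>For bounded \<open>p\<close> the integrand can be expanded pointwise with a uniform
  cubic error, which is out of reach for general elements of H^(m/2).\<close>

lemma P_expansion_continuous:
  assumes p: "continuous_on UNIV p" "periodic L p" "p \<in> V"
  obtains C where "\<And>t. 0 < t \<Longrightarrow> t < 1 \<Longrightarrow> \<bar>P_fun L \<theta> W (\<lambda>x. \<phi>0 x + t * p x) - P_fun L \<theta> W \<phi>0
      - t * (mform tw \<phi>0 p - inner_per L (\<lambda>x. f (\<phi>0 x)) p)
      - t\<^sup>2 * (mform tw p p - inner_per L (\<lambda>x. deriv f (\<phi>0 x) * p x) p) / 2\<bar> \<le> C * t ^ 3"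
proof -
  have phiV: "\<phi>0 \<in> V" by (rule Hm_V[OF phi0(4)])
  obtain R1 where R1: "\<And>x. \<bar>\<phi>0 x\<bar> \<le> R1" using periodic_bounded[OF phi0(3) phi0(2)] by blast
  obtain R2 where R2: "\<And>x. \<bar>p x\<bar> \<le> R2" using periodic_bounded[OF p(1,2)] by blast
  define R where "R = max R1 R2"
  obtain C where C: "C \<ge> 0" "\<And>y k. \<bar>y\<bar> \<le> R \<Longrightarrow> \<bar>k\<bar> \<le> R \<Longrightarrow> \<bar>W (y + k) - W y - f y * k - deriv f y * k\<^sup>2 / 2\<bar> \<le> C * \<bar>k\<bar> ^ 3"
    by (rule W_taylor[of R]) blast
  have tb: "\<exists>C. \<forall>\<kappa>. \<bar>tw \<kappa>\<bar> \<le> C * wt (m/2) \<kappa>" by (rule symbol_cond_bounds[OF symbol]) blast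
  then obtain Ct where Ct: "\<And>\<kappa>. \<bar>tw \<kappa>\<bar> \<le> Ct * wt (m/2) \<kappa>" by blast
  interpret T: sym_form V "mform tw" by (rule mform_sym_form[OF Ct])
  note cs = continuous_intros continuous_on_compose2[OF W_cont[of UNIV]] continuous_on_compose2[OF f_cont[of UNIV]]
     continuous_on_compose2[OF f'_cont[of UNIV]] phi0(3) continuous_on_subset[OF p(1)]
  show ?thesis
  proof (rule that[of "C * R ^ 3 * L"])
    fix t :: real assume t: "0 < t" "t < 1"
    let ?r = "\<lambda>x. W (\<phi>0 x + t * p x) - W (\<phi>0 x) - f (\<phi>0 x) * (t * p x) - deriv f (\<phi>0 x) * (t * p x)\<^sup>2 / 2"
    have i1: "set_integrable lborel {0..L} (\<lambda>x. W (\<phi>0 x + t * p x))"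
      and i2: "set_integrable lborel {0..L} (\<lambda>x. W (\<phi>0 x))"
      and i3: "set_integrable lborel {0..L} (\<lambda>x. f (\<phi>0 x) * p x)"
      and i4: "set_integrable lborel {0..L} (\<lambda>x. deriv f (\<phi>0 x) * p x * p x)"
      and i5: "set_integrable lborel {0..L} ?r"
      by (intro borel_integrable_atLeastAtMost' cs; simp)+
    have rb: "\<bar>?r x\<bar> \<le> C * R ^ 3 * t ^ 3" for x
    proof -
      have px: "\<bar>p x\<bar> \<le> R" using R2[of x] unfolding R_def by simp
      have tp: "\<bar>t * p x\<bar> = t * \<bar>p x\<bar>" using t by (simp add: abs_mult)
      also have "\<dots> \<le> 1 * \<bar>p x\<bar>" using t by (intro mult_right_mono) auto
      finally have "\<bar>t * p x\<bar> \<le> R" using px by simp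
      then have "\<bar>?r x\<bar> \<le> C * \<bar>t * p x\<bar> ^ 3" using R1[of x] by (intro C(2)) (auto simp: R_def)
      moreover have "C * \<bar>t * p x\<bar> ^ 3 \<le> C * (t * R) ^ 3" unfolding tp using t px C(1) by (intro mult_left_mono power_mono) auto
      moreover have "C * (t * R) ^ 3 = C * R ^ 3 * t ^ 3" by (simp add: power_mult_distrib)
      ultimately show ?thesis by (simp only:)
    qed
    have "\<bar>LINT x:{0..L}|lborel. ?r x\<bar> \<le> (LINT x:{0..L}|lborel. norm (?r x))"
      using set_integral_norm_bound[OF i5] by (simp only: real_norm_def)
    also have "\<dots> \<le> (LINT x:{0..L}|lborel. C * R ^ 3 * t ^ 3)"
      by (rule set_integral_mono) (use rb i5 in \<open>auto intro: set_integrable_abs borel_integrable_atLeastAtMost'\<close>)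
    also have "\<dots> = C * R ^ 3 * L * t ^ 3" using L_pos by (simp add: set_lebesgue_integral_def)
    finally have rI: "\<bar>LINT x:{0..L}|lborel. ?r x\<bar> \<le> C * R ^ 3 * L * t ^ 3" .
    have "?r x = W (\<phi>0 x + t * p x) - W (\<phi>0 x) - t * (f (\<phi>0 x) * p x) - (t\<^sup>2 / 2) * (deriv f (\<phi>0 x) * p x * p x)" for x
      by (simp add: power2_eq_square)
    then have "(LINT x:{0..L}|lborel. ?r x) = (LINT x:{0..L}|lborel. W (\<phi>0 x + t * p x)) - (LINT x:{0..L}|lborel. W (\<phi>0 x))
       - t * inner_per L (\<lambda>x. f (\<phi>0 x)) p - (t\<^sup>2 / 2) * inner_per L (\<lambda>x. deriv f (\<phi>0 x) * p x) p"
      unfolding inner_per_def using i1 i2 i3 i4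
      by (simp only: set_integral_diff set_integrable_mult_right set_integral_mult_right)
    moreover have "mult_form L \<theta> (\<lambda>x. \<phi>0 x + t * p x) = mult_form L \<theta> \<phi>0 + 2 * t * mform tw \<phi>0 p + t\<^sup>2 * mform tw p p"
      unfolding mult_form_mform by (rule T.expand[OF phiV p(3)])
    ultimately have "P_fun L \<theta> W (\<lambda>x. \<phi>0 x + t * p x) - P_fun L \<theta> W \<phi>0
      - t * (mform tw \<phi>0 p - inner_per L (\<lambda>x. f (\<phi>0 x)) p)
      - t\<^sup>2 * (mform tw p p - inner_per L (\<lambda>x. deriv f (\<phi>0 x) * p x) p) / 2 = - (LINT x:{0..L}|lborel. ?r x)"
      unfolding P_fun_def by (simp add: algebra_simps add_divide_distrib diff_divide_distrib)
    then show "\<bar>P_fun L \<theta> W (\<lambda>x. \<phi>0 x + t * p x) - P_fun L \<theta> W \<phi>0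
      - t * (mform tw \<phi>0 p - inner_per L (\<lambda>x. f (\<phi>0 x)) p)
      - t\<^sup>2 * (mform tw p p - inner_per L (\<lambda>x. deriv f (\<phi>0 x) * p x) p) / 2\<bar> \<le> C * R ^ 3 * L * t ^ 3"
      using rI by simp
  qed
qed

lemma F_fun_inner: "F_fun L u = inner_per L u u / 2"
  unfolding F_fun_def inner_per_def by (simp add: power2_eq_square)

lemma M_fun_inner: "M_fun L u = inner_per L u (\<lambda>x. 1)"
  unfolding M_fun_def inner_per_1 ..

lemma inner_1: "u \<in> L2_per L \<Longrightarrow> inner_per L (\<lambda>x. c) u = c * inner_per L u (\<lambda>x. 1)"
  using inner_per_scale_left[of c "\<lambda>x. 1" u] by (simp add: inner_per_commute)

text \<open>The derivatives of \<open>P\<close> at the wave are identified on trigonometric polynomials, where the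
  expansion can be computed pointwise, and extended by density and boundedness.\<close>

theorem energy_expansion:
  obtains \<delta> C where "\<delta> > 0" "C \<ge> 0"
    "\<And>h. h \<in> V \<Longrightarrow> N h < \<delta> \<Longrightarrow> \<bar>energy (\<lambda>x. \<phi>0 x + h x) - energy \<phi>0 - Q h h / 2\<bar> \<le> C * N h ^ 3"
proof -
  have phiV: "\<phi>0 \<in> V" by (rule Hm_V[OF phi0(4)])
  have "\<exists>D1 D2 \<delta> C. \<delta> > 0 \<and> C \<ge> 0 \<and>
    (\<forall>h\<in>V. N h < \<delta> \<longrightarrow> \<bar>P_fun L \<theta> W (\<lambda>x. \<phi>0 x + h x) - P_fun L \<theta> W \<phi>0 - D1 h - D2 h h / 2\<bar> \<le> C * N h ^ 3) \<and>
    (\<forall>h\<in>V. \<forall>k\<in>V. D1 (\<lambda>x. h x + k x) = D1 h + D1 k) \<and>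
    (\<forall>c. \<forall>h\<in>V. D1 (\<lambda>x. c * h x) = c * D1 h) \<and> (\<forall>h\<in>V. \<bar>D1 h\<bar> \<le> C * N h) \<and>
    (\<forall>h\<in>V. \<forall>k\<in>V. \<forall>l\<in>V. D2 (\<lambda>x. h x + k x) l = D2 h l + D2 k l) \<and>
    (\<forall>h\<in>V. \<forall>k\<in>V. \<forall>l\<in>V. D2 l (\<lambda>x. h x + k x) = D2 l h + D2 l k) \<and>
    (\<forall>c. \<forall>h\<in>V. \<forall>k\<in>V. D2 (\<lambda>x. c * h x) k = c * D2 h k) \<and>
    (\<forall>c. \<forall>h\<in>V. \<forall>k\<in>V. D2 k (\<lambda>x. c * h x) = c * D2 k h) \<and>
    (\<forall>h\<in>V. \<forall>k\<in>V. \<bar>D2 h k\<bar> \<le> C * (N h * N k))"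
    by (rule smooth_functional_taylor[OF P_smooth _ _ _ _ phiV])
      (erule (1) sobolev_add, erule sobolev_scale, rule sobolev_norm_scale, rule sobolev_norm_nonneg)
  then obtain D1 D2 \<delta> C where d: "\<delta> > 0" "C \<ge> 0"
    and T': "\<forall>h\<in>V. N h < \<delta> \<longrightarrow> \<bar>P_fun L \<theta> W (\<lambda>x. \<phi>0 x + h x) - P_fun L \<theta> W \<phi>0 - D1 h - D2 h h / 2\<bar> \<le> C * N h ^ 3"
    and D1': "\<forall>h\<in>V. \<forall>k\<in>V. D1 (\<lambda>x. h x + k x) = D1 h + D1 k" "\<forall>c. \<forall>h\<in>V. D1 (\<lambda>x. c * h x) = c * D1 h"
      "\<forall>h\<in>V. \<bar>D1 h\<bar> \<le> C * N h"
    and D2': "\<forall>h\<in>V. \<forall>k\<in>V. \<forall>l\<in>V. D2 (\<lambda>x. h x + k x) l = D2 h l + D2 k l"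
      "\<forall>h\<in>V. \<forall>k\<in>V. \<forall>l\<in>V. D2 l (\<lambda>x. h x + k x) = D2 l h + D2 l k"
      "\<forall>c. \<forall>h\<in>V. \<forall>k\<in>V. D2 (\<lambda>x. c * h x) k = c * D2 h k" "\<forall>c. \<forall>h\<in>V. \<forall>k\<in>V. D2 k (\<lambda>x. c * h x) = c * D2 k h"
      "\<forall>h\<in>V. \<forall>k\<in>V. \<bar>D2 h k\<bar> \<le> C * (N h * N k)"
    by (elim exE conjE) (rule that)
  note T = T'[rule_format] and D1 = D1'[rule_format] and D2 = D2'[rule_format]
  obtain CQ where CQ: "CQ > 0" "\<And>u v. u \<in> V \<Longrightarrow> v \<in> V \<Longrightarrow> \<bar>Q u v\<bar> \<le> CQ * (N u * N v)" by (rule Q_bounded) blast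
  interpret B: sym_form V Q by (rule Q_sym_form)
  interpret I: sym_form V "inner_per L" by (rule inner_V)
  have one: "(\<lambda>x. 1) \<in> V"
  proof -
    have "fourier_coeff L (\<lambda>x. 1) \<kappa> = (if \<kappa> = 0 then 1 else 0)" for \<kappa>
      using integral_E[of \<kappa>] L_pos unfolding fourier_coeff_def by simp
    then show ?thesis unfolding sobolev_iff by (auto intro!: summable_finite_support[of "{0}"] split: if_splits)
  qed
  have m2: "0 \<le> m / 2" using m_pos by simp
  \<comment> \<open>\<open>Z\<close> is the first derivative of the energy at the wave, and
    \<open>Y\<close> the difference between \<open>D2\<close> and the expected Hessian of
    \<open>P\<close>. Both are to be shown to vanish, the latter on the diagonal.\<close>
  define Z where "Z h = D1 h + \<omega> * inner_per L \<phi>0 h + A * inner_per L h (\<lambda>x. 1)" for h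
  define Y where "Y h k = D2 h k - Q h k + \<omega> * inner_per L h k" for h k
  define C1 where "C1 = C + \<bar>\<omega>\<bar> * N \<phi>0 + \<bar>A\<bar> * N (\<lambda>x. 1)"
  have Zb: "\<bar>Z h\<bar> \<le> C1 * N h" if h: "h \<in> V" for h
  proof -
    have "\<bar>\<omega> * inner_per L \<phi>0 h\<bar> \<le> \<bar>\<omega>\<bar> * (N \<phi>0 * N h)"
      unfolding abs_mult by (intro mult_left_mono inner_bounded m2 phiV h) auto
    moreover have "\<bar>A * inner_per L h (\<lambda>x. 1)\<bar> \<le> \<bar>A\<bar> * (N h * N (\<lambda>x. 1))"
      unfolding abs_mult by (intro mult_left_mono inner_bounded m2 one h) auto
    moreover have "C1 * N h = C * N h + \<bar>\<omega>\<bar> * (N \<phi>0 * N h) + \<bar>A\<bar> * (N h * N (\<lambda>x. 1))"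
      unfolding C1_def by (simp add: algebra_simps)
    ultimately show ?thesis unfolding Z_def using D1(3)[OF h] by linarith
  qed
  define C2 where "C2 = C + CQ + \<bar>\<omega>\<bar>"
  have C2: "C2 \<ge> 0" unfolding C2_def using d(2) CQ(1) by simp
  have Yb: "\<bar>Y h k\<bar> \<le> C2 * (N h * N k)" if h: "h \<in> V" and k: "k \<in> V" for h k
  proof -
    have "\<bar>\<omega> * inner_per L h k\<bar> \<le> \<bar>\<omega>\<bar> * (N h * N k)"
      unfolding abs_mult by (intro mult_left_mono inner_bounded m2 h k) auto
    then show ?thesis unfolding Y_def C2_def distrib_right using D2(5)[OF h k] CQ(2)[OF h k] by linarith
  qed
  have poly: "Z p = 0 \<and> Y p p = 0" if p: "continuous_on UNIV p" "periodic L p" "p \<in> V" for p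
  proof -
    have pL: "p \<in> L2_per L" using p(3) by (rule sobolev_L2)
    define a where "a = mform tw \<phi>0 p - inner_per L (\<lambda>x. f (\<phi>0 x)) p"
    define b where "b = mform tw p p - inner_per L (\<lambda>x. deriv f (\<phi>0 x) * p x) p"
    obtain C' where C': "\<And>t. 0 < t \<Longrightarrow> t < 1 \<Longrightarrow> \<bar>P_fun L \<theta> W (\<lambda>x. \<phi>0 x + t * p x) - P_fun L \<theta> W \<phi>0 - t * a - t\<^sup>2 * b / 2\<bar> \<le> C' * t ^ 3"
      by (rule P_expansion_continuous[OF p]) (unfold a_def b_def, blast)
    define \<delta>' where "\<delta>' = min 1 (\<delta> / (N p + 1))"
    have Np: "0 \<le> N p" by (rule sobolev_norm_nonneg)
    have \<delta>': "\<delta>' > 0" unfolding \<delta>'_def using d(1) Np by simp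
    have est: "\<bar>t * (D1 p - a) + t\<^sup>2 * ((D2 p p - b) / 2)\<bar> \<le> (C' + C * N p ^ 3) * t ^ 3" if t: "0 < t" "t < \<delta>'" for t
    proof -
      have t1: "t < 1" and "t < \<delta> / (N p + 1)" using t unfolding \<delta>'_def by auto
      then have "t * (N p + 1) < \<delta>" using Np by (simp add: pos_less_divide_eq)
      then have tN: "N (\<lambda>x. t * p x) < \<delta>" unfolding sobolev_norm_scale using t(1) by (simp add: algebra_simps)
      have "\<bar>P_fun L \<theta> W (\<lambda>x. \<phi>0 x + t * p x) - P_fun L \<theta> W \<phi>0 - t * D1 p - t * (t * D2 p p) / 2\<bar> \<le> C * (t * N p) ^ 3"
        using T[OF sobolev_scale[OF p(3), of t] tN] t(1)
        by (simp add: D1(2) D2(3) D2(4) p(3) sobolev_scale sobolev_norm_scale)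
      moreover have "C * (t * N p) ^ 3 = C * N p ^ 3 * t ^ 3" by (simp add: power_mult_distrib)
      moreover have "t * (D1 p - a) + t\<^sup>2 * ((D2 p p - b) / 2) =
          (P_fun L \<theta> W (\<lambda>x. \<phi>0 x + t * p x) - P_fun L \<theta> W \<phi>0 - t * a - t\<^sup>2 * b / 2) -
          (P_fun L \<theta> W (\<lambda>x. \<phi>0 x + t * p x) - P_fun L \<theta> W \<phi>0 - t * D1 p - t * (t * D2 p p) / 2)"
        by (simp add: power2_eq_square right_diff_distrib diff_divide_distrib)
      ultimately show ?thesis using C'[OF t(1) t1] unfolding distrib_right by linarith
    qed
    have z1: "D1 p - a = 0" and z2: "(D2 p p - b) / 2 = 0"
      using small_quadratic_zero[OF \<delta>' est] by auto
    have fL: "(\<lambda>x. f (\<phi>0 x)) \<in> L2_per L"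
      by (rule L2_continuous) (use phi0(2) in \<open>auto intro!: continuous_on_compose2[OF f_cont[of UNIV] phi0(3)] simp: periodic_def\<close>)
    have gL: "(\<lambda>x. (f (\<phi>0 x) - \<omega> * \<phi>0 x) - A) \<in> L2_per L"
      by (intro L2_diff fL L2_scale phi0(5) L2_const)
    \<comment> \<open>The wave equation enters here: it cancels the first-order terms and makes the
      wave a critical point.\<close>
    have "mform tw \<phi>0 p = inner_per L (mult_op L \<theta> \<phi>0) p" by (rule mform_mult_op[OF phi0(4) pL])
    also have "\<dots> = inner_per L (\<lambda>x. (f (\<phi>0 x) - \<omega> * \<phi>0 x) - A) p"
    proof (rule inner_per_cong_AE)
      show "AE x in lborel. mult_op L \<theta> \<phi>0 x = (f (\<phi>0 x) - \<omega> * \<phi>0 x) - A"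
        using wave[OF param] unfolding wave_eq_def by eventually_elim simp
    qed (use L2_perD(1) mult_op_exists(1)[OF phi0(4)] gL pL in auto)
    also have "\<dots> = inner_per L (\<lambda>x. f (\<phi>0 x)) p - \<omega> * inner_per L \<phi>0 p - A * inner_per L p (\<lambda>x. 1)"
      unfolding inner_per_diff_left[OF L2_diff[OF fL L2_scale[OF phi0(5)]] L2_const pL] inner_per_diff_left[OF fL L2_scale[OF phi0(5)] pL]
        inner_per_scale_left inner_1[OF pL] ..
    finally have Zp: "Z p = 0" using z1 unfolding Z_def a_def by simp
    have eq: "(\<lambda>x. pot x * p x) = (\<lambda>x. \<omega> * p x - deriv f (\<phi>0 x) * p x)" unfolding pot_def by (simp add: left_diff_distrib)
    have f'L: "(\<lambda>x. deriv f (\<phi>0 x) * p x) \<in> L2_per L"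
      by (rule L2_continuous) (use phi0(2) p in \<open>auto intro!: continuous_intros continuous_on_compose2[OF f'_cont[of UNIV] phi0(3)] simp: periodic_def\<close>)
    have "Q p p = mform tw p p + (\<omega> * inner_per L p p - inner_per L (\<lambda>x. deriv f (\<phi>0 x) * p x) p)"
      unfolding Q_def eq inner_per_diff_left[OF L2_scale[OF pL] f'L pL] inner_per_scale_left ..
    then have "Y p p = 0" using z2 unfolding Y_def b_def by simp
    then show ?thesis using Zp by simp
  qed
  have ZY: "Z h = 0 \<and> Y h h = 0" if h: "h \<in> V" for h
  proof -
    have Nh: "0 \<le> N h" by (rule sobolev_norm_nonneg)
    \<comment> \<open>Bounds by a trigonometric polynomial within distance \<open>e\<close>; the
      limit as \<open>e\<close> tends to 0 then gives both identities.\<close>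
    have app: "\<bar>Z h\<bar> \<le> C1 * e \<and> \<bar>Y h h\<bar> \<le> C2 * (2 * (N h + e) * e + e * e)" if e: "e > 0" for e
    proof -
      obtain p where p: "continuous_on UNIV p" "periodic L p" "p \<in> V" "N (\<lambda>x. h x - p x) < e"
        by (rule trig_dense[OF h e]) blast
      define k where "k = (\<lambda>x. h x - p x)"
      have kV: "k \<in> V" unfolding k_def by (rule sobolev_diff[OF h p(3)])
      have hk: "h = (\<lambda>x. p x + k x)" unfolding k_def by simp
      have Nk: "N k \<le> e" "0 \<le> N k" using p(4) sobolev_norm_nonneg unfolding k_def by auto
      have Np: "0 \<le> N p" by (rule sobolev_norm_nonneg)
      have "p = (\<lambda>x. h x + (-1) * k x)" unfolding k_def by simp
      then have "N p \<le> N h + N (\<lambda>x. (-1) * k x)" using sobolev_norm_triangle[OF h sobolev_scale[OF kV, of "-1"]] by simp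
      then have Nph: "N p \<le> N h + e" using Nk sobolev_norm_scale[of "m/2" "-1" k] by simp
      have pL: "p \<in> L2_per L" "k \<in> L2_per L" using p(3) kV sobolev_L2 by auto
      have "Z h = Z p + Z k"
        unfolding hk Z_def D1(1)[OF p(3) kV] I.add_right[OF p(3) kV phiV] I.add_left[OF p(3) kV one]
        by (simp add: algebra_simps)
      then have "Z h = Z k" using poly[OF p(1-3)] by simp
      moreover have "C1 * N k \<le> C1 * e"
        using Nk d(2) sobolev_norm_nonneg unfolding C1_def by (intro mult_left_mono) auto
      ultimately have 1: "\<bar>Z h\<bar> \<le> C1 * e" using Zb[OF kV] by linarith
      \<comment> \<open>\<open>D2\<close> is not known to be symmetric, so the two mixed terms are
        kept apart and estimated separately.\<close>
      have "Y h h = Y p p + Y p k + (Y k p + Y k k)"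
        unfolding hk Y_def D2(1)[OF p(3) kV sobolev_add[OF p(3) kV]] D2(2)[OF p(3) kV p(3)] D2(2)[OF p(3) kV kV]
          B.add_left[OF p(3) kV sobolev_add[OF p(3) kV]] B.add_right[OF p(3) kV p(3)] B.add_right[OF p(3) kV kV]
          I.add_left[OF p(3) kV sobolev_add[OF p(3) kV]] I.add_right[OF p(3) kV p(3)] I.add_right[OF p(3) kV kV]
        by (simp add: algebra_simps)
      then have "\<bar>Y h h\<bar> \<le> \<bar>Y p k\<bar> + \<bar>Y k p\<bar> + \<bar>Y k k\<bar>" using poly[OF p(1-3)] by simp
      also have "\<dots> \<le> C2 * (N p * N k) + C2 * (N k * N p) + C2 * (N k * N k)"
        using Yb[OF p(3) kV] Yb[OF kV p(3)] Yb[OF kV kV] by linarith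
      also have "\<dots> = C2 * (2 * N p * N k + N k * N k)" by (simp add: algebra_simps)
      also have "\<dots> \<le> C2 * (2 * (N h + e) * e + e * e)"
        using C2 Nk Np Nph Nh e by (intro mult_left_mono add_mono mult_mono) auto
      finally show ?thesis using 1 by simp
    qed
    have l1: "((\<lambda>e. C1 * e) \<longlongrightarrow> C1 * 0) (at_right 0)" and
      l2: "((\<lambda>e. C2 * (2 * (N h + e) * e + e * e)) \<longlongrightarrow> C2 * (2 * (N h + 0) * 0 + 0 * 0)) (at_right 0)"
      by (intro tendsto_intros)+
    have e1: "\<forall>\<^sub>F e in at_right 0. \<bar>Z h\<bar> \<le> C1 * e" and e2: "\<forall>\<^sub>F e in at_right 0. \<bar>Y h h\<bar> \<le> C2 * (2 * (N h + e) * e + e * e)"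
      using app eventually_at_right_less[of "0::real"] by (auto elim: eventually_mono)
    have "\<bar>Z h\<bar> \<le> C1 * 0" by (rule tendsto_lowerbound[OF l1 e1]) simp
    moreover have "\<bar>Y h h\<bar> \<le> C2 * (2 * (N h + 0) * 0 + 0 * 0)" by (rule tendsto_lowerbound[OF l2 e2]) simp
    ultimately show ?thesis by simp
  qed
  show ?thesis
  proof (rule that[OF d])
    fix h assume h: "h \<in> V" "N h < \<delta>"
    have "F_fun L (\<lambda>x. \<phi>0 x + h x) = F_fun L \<phi>0 + inner_per L \<phi>0 h + inner_per L h h / 2"
      unfolding F_fun_inner using I.expand[OF phiV h(1), of 1] by simp
    moreover have "M_fun L (\<lambda>x. \<phi>0 x + h x) = M_fun L \<phi>0 + inner_per L h (\<lambda>x. 1)"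
      unfolding M_fun_inner by (rule I.add_left[OF phiV h(1) one])
    moreover have "D1 h = - (\<omega> * inner_per L \<phi>0 h) - A * inner_per L h (\<lambda>x. 1)" "D2 h h = Q h h - \<omega> * inner_per L h h"
      using ZY[OF h(1)] unfolding Z_def Y_def by auto
    ultimately have "energy (\<lambda>x. \<phi>0 x + h x) - energy \<phi>0 - Q h h / 2 =
        P_fun L \<theta> W (\<lambda>x. \<phi>0 x + h x) - P_fun L \<theta> W \<phi>0 - D1 h - D2 h h / 2"
      unfolding energy_def by (simp add: algebra_simps diff_divide_distrib)
    then show "\<bar>energy (\<lambda>x. \<phi>0 x + h x) - energy \<phi>0 - Q h h / 2\<bar> \<le> C * N h ^ 3" using T[OF h] by simp
  qed
qed

end

section \<open>Translations\<close>

lemma has_real_derivative_of_quadratic_error: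
  fixes F :: "real \<Rightarrow> real"
  assumes "\<And>\<tau>. \<bar>F (r + \<tau>) - F r - \<tau> * D\<bar> \<le> C * \<tau>\<^sup>2"
  shows "(F has_real_derivative D) (at r)"
  unfolding DERIV_def
proof (rule LIM_zero_cancel, rule Lim_null_comparison)
  show "\<forall>\<^sub>F \<tau> in at 0. norm ((F (r + \<tau>) - F r) / \<tau> - D) \<le> C * \<bar>\<tau>\<bar>"
  proof (rule eventually_at_filter[THEN iffD2], rule always_eventually, intro allI impI)
    fix \<tau> :: real assume t: "\<tau> \<noteq> 0"
    have "(F (r + \<tau>) - F r) / \<tau> - D = (F (r + \<tau>) - F r - \<tau> * D) / \<tau>" using t by (simp add: diff_divide_distrib)
    then have "norm ((F (r + \<tau>) - F r) / \<tau> - D) = \<bar>F (r + \<tau>) - F r - \<tau> * D\<bar> / \<bar>\<tau>\<bar>" by (simp add: abs_divide)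
    also have "\<dots> \<le> C * \<tau>\<^sup>2 / \<bar>\<tau>\<bar>" using assms[of \<tau>] t by (intro divide_right_mono) auto
    also have "\<dots> = C * \<bar>\<tau>\<bar>" using t by (simp add: power2_eq_square abs_if)
    finally show "norm ((F (r + \<tau>) - F r) / \<tau> - D) \<le> C * \<bar>\<tau>\<bar>" .
  qed
  have "((\<lambda>\<tau>::real. C * \<bar>\<tau>\<bar>) \<longlongrightarrow> C * \<bar>0\<bar>) (at 0)" by (intro tendsto_intros)
  then show "((\<lambda>\<tau>::real. C * \<bar>\<tau>\<bar>) \<longlongrightarrow> 0) (at 0)" by simp
qed

context period
begin

section \<open>Translation invariance over a period\<close>

lemma periodic_shift: "periodic L g \<Longrightarrow> periodic L (\<lambda>x. g (x + r))"
proof -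
  assume "periodic L g"
  then have "g ((x + r) + L) = g (x + r)" for x unfolding periodic_def by blast
  then show ?thesis unfolding periodic_def by (simp add: add.assoc add.commute[of r L])
qed

text \<open>The shifted window \<open>{r..L + r}\<close> is cut at \<open>L\<close>, and the part
  beyond is moved back by one period onto \<open>{0<..r}\<close>. The half-open cut counts
  \<open>L\<close> once; what is then wrong at 0 and \<open>r\<close> is a null set.\<close>

lemma periodic_integral_shift_aux:
  fixes g :: "real \<Rightarrow> 'b::{banach, second_countable_topology}"
  assumes g: "set_integrable lborel {0..L} g" and per: "\<And>x. g (x + L) = g x" and r: "0 \<le> r" "r < L"
  shows "set_integrable lborel {0..L} (\<lambda>x. g (x + r))"
    "(LINT x:{0..L}|lborel. g (x + r)) = (LINT x:{0..L}|lborel. g x)"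
proof -
  have i1: "integrable lborel (\<lambda>x. indicat_real {r..L} x *\<^sub>R g x)"
    using set_integrable_subset[OF g, of "{r..L}"] r(1) unfolding set_integrable_def by simp
  have i2: "integrable lborel (\<lambda>x. indicat_real {0<..r} x *\<^sub>R g x)"
  proof -
    have "{0<..r} \<subseteq> {0..L}" using r(2) by auto
    then show ?thesis using set_integrable_subset[OF g, of "{0<..r}"] unfolding set_integrable_def by simp
  qed
  let ?k = "\<lambda>y. indicat_real {L<..L + r} y *\<^sub>R g y"
  have k: "?k (L + 1 * x) = indicat_real {0<..r} x *\<^sub>R g x" for x
    using per[of x] by (auto simp: indicator_def add.commute)
  have ik: "integrable lborel ?k"
    using i2 unfolding k[symmetric] by (subst (asm) lborel_integrable_real_affine_iff) auto
  have Ik: "(LINT y|lborel. ?k y) = (LINT x|lborel. indicat_real {0<..r} x *\<^sub>R g x)"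
    using lborel_integral_real_affine[of 1 ?k L] unfolding k by simp
  let ?f = "\<lambda>y. indicat_real {r..L + r} y *\<^sub>R g y"
  have f: "?f = (\<lambda>y. indicat_real {r..L} y *\<^sub>R g y + ?k y)" using r by (auto simp: indicator_def fun_eq_iff)
  have fi: "integrable lborel ?f" unfolding f by (intro Bochner_Integration.integrable_add i1 ik)
  have fr: "?f (r + 1 * x) = indicat_real {0..L} x *\<^sub>R g (x + r)" for x by (auto simp: indicator_def add.commute)
  have "integrable lborel (\<lambda>x. ?f (r + 1 * x))" using fi by (subst lborel_integrable_real_affine_iff) auto
  then show "set_integrable lborel {0..L} (\<lambda>x. g (x + r))" unfolding fr set_integrable_def .
  have "(LINT x:{0..L}|lborel. g (x + r)) = (LINT y|lborel. ?f y)"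
    using lborel_integral_real_affine[of 1 ?f r] unfolding fr set_lebesgue_integral_def by simp
  also have "\<dots> = (LINT x|lborel. indicat_real {r..L} x *\<^sub>R g x) + (LINT x|lborel. indicat_real {0<..r} x *\<^sub>R g x)"
    unfolding f Bochner_Integration.integral_add[OF i1 ik] Ik ..
  also have "\<dots> = (LINT x|lborel. indicat_real {r..L} x *\<^sub>R g x + indicat_real {0<..r} x *\<^sub>R g x)"
    by (rule Bochner_Integration.integral_add[OF i1 i2, symmetric])
  also have "\<dots> = (LINT x:{0..L}|lborel. g x)"
    unfolding set_lebesgue_integral_def
  proof (rule integral_cong_AE)
    have "AE x in lborel. x \<noteq> 0" "AE x in lborel. x \<noteq> r" by (rule AE_lborel_singleton)+
    then show "AE x in lborel. indicat_real {r..L} x *\<^sub>R g x + indicat_real {0<..r} x *\<^sub>R g x = indicat_real {0..L} x *\<^sub>R g x"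
      by eventually_elim (use r in \<open>auto simp: indicator_def\<close>)
  qed (use i1 i2 g in \<open>auto simp: set_integrable_def\<close>)
  finally show "(LINT x:{0..L}|lborel. g (x + r)) = (LINT x:{0..L}|lborel. g x)" .
qed

lemma periodic_integral_shift:
  fixes g :: "real \<Rightarrow> 'b::{banach, second_countable_topology}"
  assumes g: "set_integrable lborel {0..L} g" and per: "\<And>x. g (x + L) = g x"
  shows "set_integrable lborel {0..L} (\<lambda>x. g (x + r))"
    "(LINT x:{0..L}|lborel. g (x + r)) = (LINT x:{0..L}|lborel. g x)"
proof -
  have pn: "g (x + real n * L) = g x" for n :: nat and x
  proof (induction n arbitrary: x)
    case (Suc n)
    have "g (x + real (Suc n) * L) = g ((x + real n * L) + L)" by (simp add: algebra_simps)
    then show ?case using Suc per by simp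
  qed simp
  have pk: "g (x + of_int k * L) = g x" for k :: int and x
  proof (cases "k \<ge> 0")
    case True then show ?thesis using pn[of x "nat k"] by simp
  next
    case False then show ?thesis using pn[of "x + of_int k * L" "nat (- k)"] by simp
  qed
  obtain k where k: "r + of_int k * L \<in> {0..<L}" by (rule period_reduce)
  have eq: "g (x + r) = g (x + (r + of_int k * L))" for x
    using pk[of "x + r" k] by (simp add: add.assoc)
  show "set_integrable lborel {0..L} (\<lambda>x. g (x + r))"
    "(LINT x:{0..L}|lborel. g (x + r)) = (LINT x:{0..L}|lborel. g x)"
    unfolding eq using periodic_integral_shift_aux[OF g per, of "r + of_int k * L"] k by auto
qed

lemma L2_shift:
  assumes u: "u \<in> L2_per L" shows "(\<lambda>x. u (x + r)) \<in> L2_per L"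
proof -
  have "(\<lambda>x. u (x + r)) \<in> borel_measurable borel" using L2_perD(1)[OF u] by measurable
  moreover have "set_integrable lborel {0..L} (\<lambda>x. (u (x + r))\<^sup>2)"
    using L2_perD(2,3)[OF u] by (intro periodic_integral_shift(1)[of "\<lambda>x. (u x)\<^sup>2"]) (auto simp: periodic_def)
  ultimately show ?thesis using periodic_shift[OF L2_perD(2)[OF u]] unfolding L2_per_def by auto
qed

lemma inner_shift:
  assumes u: "u \<in> L2_per L" and v: "v \<in> L2_per L"
  shows "inner_per L (\<lambda>x. u (x + r)) (\<lambda>x. v (x + r)) = inner_per L u v"
proof -
  have "u (x + L) * v (x + L) = u x * v x" for x
    using L2_perD(2)[OF u] L2_perD(2)[OF v] unfolding periodic_def by simp
  from periodic_integral_shift(2)[OF L2_mult_integrable[OF u v] this] show ?thesis unfolding inner_per_def .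
qed

lemma cmod_fourier_coeff_shift:
  assumes u: "u \<in> L2_per L"
  shows "cmod (fourier_coeff L (\<lambda>x. u (x + r)) \<kappa>) = cmod (fourier_coeff L u \<kappa>)"
proof -
  let ?z = "cis (2 * pi * \<kappa> * r / L)"
  have "E \<kappa> x = E \<kappa> (x + r) * ?z" for x
  proof -
    have "- 2 * pi * \<kappa> * x / L = - 2 * pi * \<kappa> * (x + r) / L + 2 * pi * \<kappa> * r / L"
      using L_pos by (simp add: field_simps)
    then show ?thesis by (simp only: cis_mult)
  qed
  then have "complex_of_real (u (x + r)) * E \<kappa> x = ?z * (complex_of_real (u (x + r)) * E \<kappa> (x + r))" for x
    by (metis mult.assoc mult.commute)
  then have "(LINT x:{0..L}|lborel. complex_of_real (u (x + r)) * E \<kappa> x)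
      = ?z * (LINT x:{0..L}|lborel. complex_of_real (u (x + r)) * E \<kappa> (x + r))"
    by (simp only: set_integral_mult_right)
  also have "(LINT x:{0..L}|lborel. complex_of_real (u (x + r)) * E \<kappa> (x + r)) = (LINT x:{0..L}|lborel. complex_of_real (u x) * E \<kappa> x)"
  proof (rule periodic_integral_shift(2))
    show "set_integrable lborel {0..L} (\<lambda>x. complex_of_real (u x) * E \<kappa> x)" by (rule E_integrable[OF L2_integrable[OF u]])
    show "complex_of_real (u (x + L)) * E \<kappa> (x + L) = complex_of_real (u x) * E \<kappa> x" for x
      unfolding E_periodic using L2_perD(2)[OF u] unfolding periodic_def by simp
  qed
  finally have "fourier_coeff L (\<lambda>x. u (x + r)) \<kappa> = ?z * fourier_coeff L u \<kappa>"
    unfolding fourier_coeff_def by simp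
  then show ?thesis by (simp add: norm_mult)
qed

lemma sobolev_shift:
  assumes u: "u \<in> sobolev_per L s"
  shows "(\<lambda>x. u (x + r)) \<in> sobolev_per L s" "sobolev_norm L s (\<lambda>x. u (x + r)) = sobolev_norm L s u"
proof -
  have uL: "u \<in> L2_per L" using u by (rule sobolev_L2)
  show "(\<lambda>x. u (x + r)) \<in> sobolev_per L s" using u L2_shift[OF uL]
    unfolding sobolev_iff cmod_fourier_coeff_shift[OF uL] by auto
  show "sobolev_norm L s (\<lambda>x. u (x + r)) = sobolev_norm L s u"
    unfolding sobolev_norm_def cmod_fourier_coeff_shift[OF uL] ..
qed

text \<open>\<open>wt s\<close> is the square of \<open>wt (s/2)\<close>, so the
  arithmetic-geometric mean bounds \<open>wt (s/2)\<close> by a combination of 1 and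
  \<open>wt s\<close>. The free parameter \<open>K\<close> trades the L2 norm against the H^s
  norm.\<close>

lemma interpolation:
  assumes K: "K > 0" and u: "u \<in> sobolev_per L s" and s: "0 \<le> s"
  shows "(sobolev_norm L (s/2) u)\<^sup>2 \<le> (K * inner_per L u u + (sobolev_norm L s u)\<^sup>2 / K) / 2"
proof -
  have uL: "u \<in> L2_per L" using u by (rule sobolev_L2)
  have half: "\<bar>wt (s/2) \<kappa>\<bar> \<le> 1 * wt s \<kappa>" for \<kappa> using wt_mono[of "s/2" s \<kappa>] wt_pos[of "s/2" \<kappa>] s by simp
  have one: "\<bar>1\<bar> \<le> 1 * wt s \<kappa>" for \<kappa> using wt_ge_1[OF s, of \<kappa>] by simp
  have le: "wt (s/2) \<kappa> \<le> K / 2 * 1 + 1 / (2 * K) * wt s \<kappa>" for \<kappa>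
  proof -
    have "2 * K * wt (s/2) \<kappa> \<le> K\<^sup>2 + wt s \<kappa>" unfolding wt_half[of s] by (rule sum_squares_bound)
    then show ?thesis using K by (simp add: field_simps power2_eq_square)
  qed
  have b: "\<bar>K / 2 * 1 + 1 / (2 * K) * wt s \<kappa>\<bar> \<le> (K / 2 + 1 / (2 * K)) * wt s \<kappa>" for \<kappa>
  proof -
    have "K / 2 * 1 \<le> K / 2 * wt s \<kappa>" using one[of \<kappa>] K by (intro mult_left_mono) auto
    moreover have "0 \<le> 1 / (2 * K) * wt s \<kappa>" using K wt_pos[of s \<kappa>] by simp
    ultimately show ?thesis using K unfolding distrib_right by simp
  qed
  have "mform (wt (s/2)) u u \<le> mform (\<lambda>\<kappa>. K / 2 * 1 + 1 / (2 * K) * wt s \<kappa>) u u"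
    by (rule mform_mono[OF u half b le])
  also have "\<dots> = K / 2 * mform (\<lambda>\<kappa>. 1) u u + 1 / (2 * K) * mform (wt s) u u" by (rule mform_lincomb[OF u one wt_abs])
  finally show ?thesis unfolding sobolev_norm_sq parseval[OF uL uL] by (simp add: field_simps)
qed

end

section \<open>Orbital stability\<close>

context wave_point
begin

section \<open>Translates of the wave and distance to the orbit\<close>

lemma phi_V: "\<phi>0 \<in> V"
  by (rule Hm_V[OF phi0(4)])

lemma phi_orthogonal_deriv: "inner_per L \<phi>0 (deriv \<phi>0) = 0"
proof -
  have "((\<lambda>x. \<phi>0 x * \<phi>0 x / 2) has_real_derivative \<phi>0 x * deriv \<phi>0 x) (at x)" for x
    using DERIV_cdivide[OF DERIV_mult[OF phi0(6)[of x] phi0(6)[of x]], of 2] by simp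
  moreover have "continuous_on UNIV (\<lambda>x. \<phi>0 x * deriv \<phi>0 x)" by (intro continuous_intros phi0)
  moreover have "periodic L (\<lambda>x. \<phi>0 x * \<phi>0 x / 2)" using phi0(2) unfolding periodic_def by simp
  ultimately show ?thesis unfolding inner_per_def by (rule integral_deriv_periodic)
qed

text \<open>The second derivative is continuous and periodic, so one constant works at all points.
  The uniformity is what allows the pairing with a general L2 function to be differentiated in the
  translation parameter.\<close>

lemma phi_taylor: obtains C where "\<And>y \<tau>. \<bar>\<phi>0 (y + \<tau>) - \<phi>0 y - deriv \<phi>0 y * \<tau>\<bar> \<le> C * \<tau>\<^sup>2"
proof -
  note s1 = smooth_real_deriv(2)[OF phi0(1)]
  obtain C where C: "\<And>x. \<bar>deriv (deriv \<phi>0) x\<bar> \<le> C"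
    using periodic_bounded[OF smooth_real_continuous_deriv[OF s1] periodic_deriv[OF periodic_deriv[OF phi0(2)]]] by blast
  show ?thesis
  proof (rule that[of C])
    fix y \<tau> :: real
    define G where "G j = (if j = 0 then \<phi>0 else if j = 1 then deriv \<phi>0 else deriv (deriv \<phi>0))" for j :: nat
    define diff where "diff j t = G j (y + t * \<tau>) * \<tau> ^ j" for j :: nat and t
    have G: "(G j has_real_derivative G (Suc j) x) (at x)" if j2: "j < 2" for j x
    proof -
      consider "j = 0" | "j = 1" using j2 by linarith
      then show ?thesis using phi0(6)[of x] smooth_real_deriv(1)[OF s1, of x] by cases (simp_all add: G_def)
    qed
    have "\<forall>j t. j < 2 \<and> 0 \<le> t \<and> t \<le> 1 \<longrightarrow> DERIV (diff j) t :> diff (Suc j) t"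
    proof (intro allI impI)
      fix j :: nat and t :: real assume j: "j < 2 \<and> 0 \<le> t \<and> t \<le> 1"
      have "((\<lambda>t. y + t * \<tau>) has_real_derivative \<tau>) (at t)" by (auto intro!: derivative_eq_intros)
      from DERIV_chain2[OF G[of j "y + t * \<tau>"] this]
      have "((\<lambda>t. G j (y + t * \<tau>)) has_real_derivative G (Suc j) (y + t * \<tau>) * \<tau>) (at t)" using j by simp
      from DERIV_cmult_right[OF this, of "\<tau> ^ j"] show "DERIV (diff j) t :> diff (Suc j) t"
        unfolding diff_def by (simp add: mult_ac)
    qed
    from Maclaurin[OF zero_less_one pos2 refl this] obtain t where
      t: "diff 0 1 = (\<Sum>j<2. (diff j 0 / fact j) * 1 ^ j) + (diff 2 t / fact 2) * 1 ^ 2" by blast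
    have "(\<Sum>j<2. (diff j 0 / fact j) * 1 ^ j) = diff 0 0 + diff 1 0" by (simp add: numeral_2_eq_2)
    then have "\<phi>0 (y + \<tau>) - \<phi>0 y - deriv \<phi>0 y * \<tau> = deriv (deriv \<phi>0) (y + t * \<tau>) * \<tau>\<^sup>2 / 2"
      using t unfolding diff_def by (simp add: G_def)
    then have "\<bar>\<phi>0 (y + \<tau>) - \<phi>0 y - deriv \<phi>0 y * \<tau>\<bar> = \<bar>deriv (deriv \<phi>0) (y + t * \<tau>)\<bar> * \<tau>\<^sup>2 / 2"
      by (simp only: abs_mult abs_divide abs_power2 abs_numeral)
    also have "\<dots> \<le> \<bar>deriv (deriv \<phi>0) (y + t * \<tau>)\<bar> * \<tau>\<^sup>2" by simp
    also have "\<dots> \<le> C * \<tau>\<^sup>2" by (intro mult_right_mono C) simp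
    finally show "\<bar>\<phi>0 (y + \<tau>) - \<phi>0 y - deriv \<phi>0 y * \<tau>\<bar> \<le> C * \<tau>\<^sup>2" .
  qed
qed

text \<open>The translate closest to \<open>v\<close> in \<open>L\<^sup>2\<close> leaves a remainder orthogonal to the translated kernel.\<close>

lemma closest_translate:
  assumes v: "v \<in> L2_per L"
  obtains r where "inner_per L (\<lambda>x. v x - \<phi>0 (x + r)) (\<lambda>x. deriv \<phi>0 (x + r)) = 0"
    "\<And>r'. inner_per L (\<lambda>x. v x - \<phi>0 (x + r)) (\<lambda>x. v x - \<phi>0 (x + r)) \<le> inner_per L (\<lambda>x. v x - \<phi>0 (x + r')) (\<lambda>x. v x - \<phi>0 (x + r'))"
proof -
  interpret I: sym_form "L2_per L" "inner_per L" by (rule inner_sym_form)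
  \<comment> \<open>The squared L2 distance to the translate by \<open>r\<close> is a constant minus
    \<open>2 * J r\<close>, so the closest translate is a maximiser of \<open>J\<close>.\<close>
  define J where "J r = inner_per L v (\<lambda>x. \<phi>0 (x + r))" for r
  have pL: "(\<lambda>x. \<phi>0 (x + r)) \<in> L2_per L" for r by (rule L2_shift[OF phi0(5)])
  have dL0: "deriv \<phi>0 \<in> L2_per L" by (rule sobolev_L2[OF deriv_phi0(1)])
  have dL: "(\<lambda>x. deriv \<phi>0 (x + r)) \<in> L2_per L" for r by (rule L2_shift[OF dL0])
  obtain C where C: "\<And>y \<tau>. \<bar>\<phi>0 (y + \<tau>) - \<phi>0 y - deriv \<phi>0 y * \<tau>\<bar> \<le> C * \<tau>\<^sup>2" by (rule phi_taylor) blast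
  define B where "B = (LINT x:{0..L}|lborel. \<bar>v x\<bar>)"
  have vi: "set_integrable lborel {0..L} (\<lambda>x. \<bar>v x\<bar>)" by (rule set_integrable_abs[OF L2_integrable[OF v]])
  have est: "\<bar>J (r + \<tau>) - J r - \<tau> * inner_per L v (\<lambda>x. deriv \<phi>0 (x + r))\<bar> \<le> (C * B) * \<tau>\<^sup>2" for r \<tau>
  proof -
    let ?R = "\<lambda>x. \<phi>0 (x + (r + \<tau>)) - \<phi>0 (x + r) - \<tau> * deriv \<phi>0 (x + r)"
    have RL: "?R \<in> L2_per L" by (intro L2_diff L2_scale pL dL)
    have eq: "J (r + \<tau>) - J r - \<tau> * inner_per L v (\<lambda>x. deriv \<phi>0 (x + r)) = inner_per L v ?R"
      unfolding J_def I.diff_right[OF L2_diff[OF pL pL] L2_scale[OF dL] v] I.diff_right[OF pL pL v] I.scale_right[OF dL v] ..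
    have "\<bar>inner_per L v ?R\<bar> \<le> (LINT x:{0..L}|lborel. norm (v x * ?R x))"
      unfolding inner_per_def using set_integral_norm_bound[OF L2_mult_integrable[OF v RL]] by (simp only: real_norm_def)
    also have "\<dots> \<le> (LINT x:{0..L}|lborel. (C * \<tau>\<^sup>2) * \<bar>v x\<bar>)"
    proof (rule set_integral_mono)
      show "set_integrable lborel {0..L} (\<lambda>x. norm (v x * ?R x))"
        unfolding real_norm_def by (rule set_integrable_abs[OF L2_mult_integrable[OF v RL]])
      show "set_integrable lborel {0..L} (\<lambda>x. (C * \<tau>\<^sup>2) * \<bar>v x\<bar>)" by (rule set_integrable_mult_right[OF vi])
      fix x
      have "\<bar>?R x\<bar> \<le> C * \<tau>\<^sup>2" using C[of "x + r" \<tau>] by (simp only: add.assoc mult.commute[of \<tau>])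
      then have "\<bar>v x\<bar> * \<bar>?R x\<bar> \<le> \<bar>v x\<bar> * (C * \<tau>\<^sup>2)" by (rule mult_left_mono) simp
      then show "norm (v x * ?R x) \<le> (C * \<tau>\<^sup>2) * \<bar>v x\<bar>" unfolding real_norm_def abs_mult by (simp only: mult.commute)
    qed
    also have "\<dots> = (C * B) * \<tau>\<^sup>2" unfolding B_def by simp
    finally show ?thesis unfolding eq .
  qed
  have dJ: "(J has_real_derivative inner_per L v (\<lambda>x. deriv \<phi>0 (x + r))) (at r)" for r
    by (rule has_real_derivative_of_quadratic_error[OF est])
  have Jc: "continuous_on {0..L} J" using dJ by (meson DERIV_isCont continuous_at_imp_continuous_on)
  obtain r where r: "r \<in> {0..L}" "\<And>r'. r' \<in> {0..L} \<Longrightarrow> J r' \<le> J r"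
    using continuous_attains_sup[OF compact_Icc _ Jc] L_pos by auto
  have Jmax: "J r' \<le> J r" for r'
  proof -
    obtain k where k: "r' + of_int k * L \<in> {0..<L}" by (rule period_reduce)
    have "\<phi>0 (x + (r' + of_int k * L)) = \<phi>0 (x + r')" for x
      using periodic_of_int[OF phi0(2), of "x + r'" k] by (simp add: add.assoc)
    then have "J (r' + of_int k * L) = J r'" unfolding J_def by simp
    then show ?thesis using r(2)[of "r' + of_int k * L"] k by auto
  qed
  \<comment> \<open>By periodicity the maximum over \<open>{0..L}\<close> is global, so the
    derivative vanishes even if \<open>r\<close> is an endpoint.\<close>
  have "inner_per L v (\<lambda>x. deriv \<phi>0 (x + r)) = 0"
    by (rule DERIV_local_max[OF dJ zero_less_one]) (use Jmax in auto)
  then have "inner_per L (\<lambda>x. v x - \<phi>0 (x + r)) (\<lambda>x. deriv \<phi>0 (x + r)) = 0"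
    unfolding inner_per_diff_left[OF v pL dL] using inner_shift[OF phi0(5) dL0, of r] phi_orthogonal_deriv by simp
  moreover have "inner_per L (\<lambda>x. v x - \<phi>0 (x + r')) (\<lambda>x. v x - \<phi>0 (x + r')) = inner_per L v v - 2 * J r' + inner_per L \<phi>0 \<phi>0" for r'
    using I.expand[OF v pL[of r'], of "-1"] inner_shift[OF phi0(5) phi0(5), of r'] unfolding J_def by simp
  ultimately show ?thesis using that[of r] Jmax by simp
qed

text \<open>All translates have the same H^m norm, so interpolation turns L2 closeness into H^(m/2)
  closeness. \<open>K\<close> is large enough for the H^m contribution \<open>B\<^sup>2 / K\<close>
  to stay below \<open>e\<^sup>2\<close>, and the L2 threshold \<open>e\<^sup>2 / K\<close> does the
  same for the other term.\<close>

lemma translates_close: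
  assumes e: "e > 0"
  obtains \<eta> where "\<eta> > 0" "\<And>r r'. inner_per L (\<lambda>x. \<phi>0 (x + r) - \<phi>0 (x + r')) (\<lambda>x. \<phi>0 (x + r) - \<phi>0 (x + r')) < \<eta> \<Longrightarrow>
     sobolev_norm L (m/2) (\<lambda>x. \<phi>0 (x + r) - \<phi>0 (x + r')) < e"
proof -
  define B where "B = 2 * sobolev_norm L m \<phi>0"
  define K where "K = B\<^sup>2 / e\<^sup>2 + 1"
  have K: "K > 0" unfolding K_def by (simp add: add_nonneg_pos)
  have BK: "B\<^sup>2 / K < e\<^sup>2"
  proof -
    have "B\<^sup>2 < e\<^sup>2 * K" unfolding K_def using e by (simp add: field_simps)
    then show ?thesis using K by (simp add: pos_divide_less_eq mult.commute)
  qed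
  show ?thesis
  proof (rule that[of "e\<^sup>2 / K"])
    show "e\<^sup>2 / K > 0" using e K by simp
    fix r r'
    let ?d = "\<lambda>x. \<phi>0 (x + r) - \<phi>0 (x + r')"
    assume d: "inner_per L ?d ?d < e\<^sup>2 / K"
    have s: "(\<lambda>x. \<phi>0 (x + r)) \<in> sobolev_per L m" "sobolev_norm L m (\<lambda>x. \<phi>0 (x + r)) = sobolev_norm L m \<phi>0" for r
      by (rule sobolev_shift[OF phi0(4)])+
    have dS: "?d \<in> sobolev_per L m" by (rule sobolev_diff[OF s(1) s(1)])
    have "sobolev_norm L m ?d \<le> B"
      using sobolev_norm_triangle[OF s(1)[of r] sobolev_scale[OF s(1)[of r'], of "-1"]] sobolev_norm_scale[of m "-1" "\<lambda>x. \<phi>0 (x + r')"]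
      unfolding B_def s(2) by simp
    then have "(sobolev_norm L m ?d)\<^sup>2 \<le> B\<^sup>2" using sobolev_norm_nonneg by (intro power_mono)
    then have "(sobolev_norm L m ?d)\<^sup>2 / K \<le> B\<^sup>2 / K" using K by (intro divide_right_mono) auto
    moreover have "K * inner_per L ?d ?d < e\<^sup>2" using d K by (simp add: pos_less_divide_eq mult.commute)
    ultimately have "K * inner_per L ?d ?d + (sobolev_norm L m ?d)\<^sup>2 / K < e\<^sup>2 + e\<^sup>2" using BK by (intro add_strict_mono) auto
    then have "(K * inner_per L ?d ?d + (sobolev_norm L m ?d)\<^sup>2 / K) / 2 < (e\<^sup>2 + e\<^sup>2) / 2" by (rule divide_strict_right_mono) simp
    then have "(sobolev_norm L (m/2) ?d)\<^sup>2 < e\<^sup>2"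
      using order_le_less_trans[OF interpolation[OF K dS less_imp_le[OF m_pos]]] by simp
    then show "sobolev_norm L (m/2) ?d < e" using e by (simp add: power2_less_imp_less)
  qed
qed

lemma orbit_dist_le: "orbit_dist L m \<phi>0 v \<le> sobolev_norm L (m/2) (\<lambda>x. v x - \<phi>0 (x + r))"
  unfolding orbit_dist_def by (intro cINF_lower bdd_belowI2[of _ 0] sobolev_norm_nonneg UNIV_I)

lemma orbit_dist_less:
  assumes "orbit_dist L m \<phi>0 v < e" obtains r where "sobolev_norm L (m/2) (\<lambda>x. v x - \<phi>0 (x + r)) < e"
  using assms unfolding orbit_dist_def
  by (subst (asm) cINF_less_iff) (auto intro!: bdd_belowI2[of _ 0] sobolev_norm_nonneg)

lemma orbit_dist_nonneg: "0 \<le> orbit_dist L m \<phi>0 v"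
  unfolding orbit_dist_def by (intro cINF_greatest sobolev_norm_nonneg) auto

lemma phi_shift_V: "(\<lambda>x. \<phi>0 (x + r)) \<in> V"
  by (rule sobolev_shift(1)[OF phi_V])

lemma orbit_dist_lipschitz:
  assumes v: "v \<in> V" and w: "w \<in> V"
  shows "orbit_dist L m \<phi>0 v \<le> orbit_dist L m \<phi>0 w + sobolev_norm L (m/2) (\<lambda>x. v x - w x)"
proof (rule field_le_epsilon)
  fix e :: real assume "e > 0"
  then obtain r where r: "sobolev_norm L (m/2) (\<lambda>x. w x - \<phi>0 (x + r)) < orbit_dist L m \<phi>0 w + e"
    using orbit_dist_less[of w "orbit_dist L m \<phi>0 w + e"] by auto
  have "sobolev_norm L (m/2) (\<lambda>x. (v x - w x) + (w x - \<phi>0 (x + r))) \<le>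
      sobolev_norm L (m/2) (\<lambda>x. v x - w x) + sobolev_norm L (m/2) (\<lambda>x. w x - \<phi>0 (x + r))"
    by (intro sobolev_norm_triangle sobolev_diff v w phi_shift_V)
  then show "orbit_dist L m \<phi>0 v \<le> orbit_dist L m \<phi>0 w + sobolev_norm L (m/2) (\<lambda>x. v x - w x) + e"
    using orbit_dist_le[of v r] r by simp
qed

text \<open>The L2-closest translate and an H^(m/2)-near one are both L2-close to \<open>v\<close>,
  hence L2-close to each other; \<open>translates_close\<close> upgrades this to H^(m/2). In this
  way the orthogonality is obtained without losing closeness in the strong norm.\<close>

lemma modulation:
  assumes e: "e > 0"
  obtains \<eta> where "\<eta> > 0" "\<And>v. v \<in> V \<Longrightarrow> orbit_dist L m \<phi>0 v < \<eta> \<Longrightarrow>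
    \<exists>r. sobolev_norm L (m/2) (\<lambda>x. v x - \<phi>0 (x + r)) < e \<and> inner_per L (\<lambda>x. v x - \<phi>0 (x + r)) (\<lambda>x. deriv \<phi>0 (x + r)) = 0"
proof -
  obtain \<eta>1 where \<eta>1: "\<eta>1 > 0" "\<And>r r'. inner_per L (\<lambda>x. \<phi>0 (x + r) - \<phi>0 (x + r')) (\<lambda>x. \<phi>0 (x + r) - \<phi>0 (x + r')) < \<eta>1 \<Longrightarrow>
     sobolev_norm L (m/2) (\<lambda>x. \<phi>0 (x + r) - \<phi>0 (x + r')) < e / 2"
    by (rule translates_close[of "e/2"]) (use e in auto)
  define \<eta> where "\<eta> = min (e / 2) (sqrt \<eta>1 / 2)"
  have \<eta>: "\<eta> > 0" "\<eta> \<le> e / 2" "\<eta> \<le> sqrt \<eta>1 / 2" unfolding \<eta>_def using e \<eta>1(1) by auto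
  show ?thesis
  proof (rule that[OF \<eta>(1)])
    fix v assume v: "v \<in> V" and d: "orbit_dist L m \<phi>0 v < \<eta>"
    have vL: "v \<in> L2_per L" using v by (rule sobolev_L2)
    have m2: "0 \<le> m / 2" using m_pos by simp
    obtain r1 where r1: "sobolev_norm L (m/2) (\<lambda>x. v x - \<phi>0 (x + r1)) < \<eta>" by (rule orbit_dist_less[OF d])
    obtain r where r: "inner_per L (\<lambda>x. v x - \<phi>0 (x + r)) (\<lambda>x. deriv \<phi>0 (x + r)) = 0"
      "\<And>r'. inner_per L (\<lambda>x. v x - \<phi>0 (x + r)) (\<lambda>x. v x - \<phi>0 (x + r)) \<le> inner_per L (\<lambda>x. v x - \<phi>0 (x + r')) (\<lambda>x. v x - \<phi>0 (x + r'))"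
      by (rule closest_translate[OF vL]) blast
    let ?a = "\<lambda>x. v x - \<phi>0 (x + r1)" and ?b = "\<lambda>x. v x - \<phi>0 (x + r)" and ?c = "\<lambda>x. \<phi>0 (x + r1) - \<phi>0 (x + r)"
    have aV: "?a \<in> V" and bV: "?b \<in> V" and cV: "?c \<in> V" by (intro sobolev_diff v phi_shift_V)+
    let ?l = "\<lambda>u. sqrt (inner_per L u u)"
    have la: "?l ?a < \<eta>"
    proof -
      have "?l ?a \<le> sobolev_norm L (m/2) ?a" using inner_le_sobolev[OF m2 aV] sobolev_norm_nonneg by (intro real_le_lsqrt) auto
      then show ?thesis using r1 by simp
    qed
    have lb: "?l ?b \<le> ?l ?a" using r(2)[of r1] by simp
    have "?c = (\<lambda>x. ?b x + (-1) * ?a x)" by simp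
    then have "?l ?c \<le> ?l ?b + ?l (\<lambda>x. (-1) * ?a x)"
      using sym_form.triangle[OF inner_sym_form sobolev_L2[OF bV] L2_scale[OF sobolev_L2[OF aV], of "-1"] inner_per_nonneg] by simp
    moreover have "inner_per L (\<lambda>x. (-1) * ?a x) (\<lambda>x. (-1) * ?a x) = inner_per L ?a ?a"
      unfolding inner_per_scale_left inner_per_commute[of ?a "\<lambda>x. (-1) * ?a x"] by simp
    ultimately have "?l ?c < 2 * \<eta>" using la lb by (simp only:)
    then have "?l ?c < sqrt \<eta>1" using \<eta>(3) by linarith
    then have "sobolev_norm L (m/2) ?c < e / 2" by (intro \<eta>1(2)) (simp only: real_sqrt_less_iff)
    moreover have "sobolev_norm L (m/2) (\<lambda>x. ?a x + ?c x) \<le> sobolev_norm L (m/2) ?a + sobolev_norm L (m/2) ?c"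
      by (rule sobolev_norm_triangle[OF aV cV])
    ultimately have "sobolev_norm L (m/2) ?b < e" using r1 \<eta>(2) by simp
    then show "\<exists>r. sobolev_norm L (m/2) (\<lambda>x. v x - \<phi>0 (x + r)) < e \<and> inner_per L (\<lambda>x. v x - \<phi>0 (x + r)) (\<lambda>x. deriv \<phi>0 (x + r)) = 0"
      using r(1) by blast
  qed
qed

end

section \<open>The Lyapunov functional and the continuity argument\<close>

context wave_energy
begin

definition constraint :: "real \<Rightarrow> real \<Rightarrow> (real \<Rightarrow> real) \<Rightarrow> real" where
  "constraint a b u = a * M_fun L u + b * F_fun L u"

text \<open>The factor 2 makes the quadratic part at the wave exactly the form bounded below in
  \<open>coercive_of_Delta\<close>.\<close>

definition lyapunov :: "real \<Rightarrow> real \<Rightarrow> real \<Rightarrow> (real \<Rightarrow> real) \<Rightarrow> real" where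
  "lyapunov a b K u = 2 * (energy u - energy \<phi>0) + K * (constraint a b u - constraint a b \<phi>0)\<^sup>2"

lemma constraint_expansion:
  assumes h: "h \<in> L2_per L"
  shows "constraint a b (\<lambda>x. \<phi>0 x + h x) - constraint a b \<phi>0
    = inner_per L (\<lambda>x. a + b * \<phi>0 x) h + b / 2 * inner_per L h h"
proof -
  interpret I: sym_form "L2_per L" "inner_per L" by (rule inner_sym_form)
  have 1: "inner_per L (\<lambda>x. \<phi>0 x + h x) (\<lambda>x. \<phi>0 x + h x) = inner_per L \<phi>0 \<phi>0 + 2 * inner_per L \<phi>0 h + inner_per L h h"
    using I.expand[OF phi0(5) h, of 1] by simp
  have 2: "inner_per L (\<lambda>x. \<phi>0 x + h x) (\<lambda>x. 1) = inner_per L \<phi>0 (\<lambda>x. 1) + inner_per L h (\<lambda>x. 1)"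
    by (rule inner_per_add_left[OF phi0(5) h L2_const])
  have 3: "inner_per L (\<lambda>x. a + b * \<phi>0 x) h = a * inner_per L h (\<lambda>x. 1) + b * inner_per L \<phi>0 h"
    unfolding inner_per_add_left[OF L2_const L2_scale[OF phi0(5)] h] inner_per_scale_left inner_1[OF h] ..
  show ?thesis unfolding constraint_def M_fun_inner F_fun_inner 1 2 3 by (simp add: algebra_simps add_divide_distrib)
qed

lemma lyapunov_shift:
  assumes v: "v \<in> V" and W: "set_integrable lborel {0..L} (\<lambda>x. W (v x))"
  shows "lyapunov a b K (\<lambda>x. v (x + r)) = lyapunov a b K v"
proof -
  have vL: "v \<in> L2_per L" using v by (rule sobolev_L2)
  have per: "v (x + L) = v x" for x using L2_perD(2)[OF vL] unfolding periodic_def by blast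
  have "mult_form L \<theta> (\<lambda>x. v (x + r)) = mult_form L \<theta> v"
    unfolding mult_form_def cmod_fourier_coeff_shift[OF vL] ..
  moreover have "(LINT x:{0..L}|lborel. W (v (x + r))) = (LINT x:{0..L}|lborel. W (v x))"
    by (rule periodic_integral_shift(2)[OF W]) (simp only: per)
  moreover have "F_fun L (\<lambda>x. v (x + r)) = F_fun L v" unfolding F_fun_inner inner_shift[OF vL vL] ..
  moreover have "M_fun L (\<lambda>x. v (x + r)) = M_fun L v"
    unfolding M_fun_inner using inner_shift[OF vL L2_const[of 1]] .
  ultimately show ?thesis unfolding lyapunov_def energy_def constraint_def P_fun_def by simp
qed

lemma lyapunov_local:
  assumes \<Delta>: "Delta L \<phi> \<omega> A a b > 0"
  obtains \<epsilon> c C K where "\<epsilon> > 0" "c > 0" "C > 0"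
    "\<And>h. h \<in> V \<Longrightarrow> N h < \<epsilon> \<Longrightarrow> inner_per L h (deriv \<phi>0) = 0 \<Longrightarrow> c * (N h)\<^sup>2 \<le> lyapunov a b K (\<lambda>x. \<phi>0 x + h x)"
    "\<And>h. h \<in> V \<Longrightarrow> N h < \<epsilon> \<Longrightarrow> lyapunov a b K (\<lambda>x. \<phi>0 x + h x) \<le> C * (N h)\<^sup>2"
proof -
  let ?g = "\<lambda>x. a + b * \<phi>0 x"
  obtain c K where c: "c > 0" and K: "K > 0"
    and co: "\<And>h. h \<in> V \<Longrightarrow> inner_per L h (deriv \<phi>0) = 0 \<Longrightarrow> c * (N h)\<^sup>2 \<le> Q h h + K * (inner_per L ?g h)\<^sup>2"
    by (rule coercive_of_Delta[OF \<Delta>]) blast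
  obtain \<delta> C where \<delta>: "\<delta> > 0" and C: "C \<ge> 0"
    and ex: "\<And>h. h \<in> V \<Longrightarrow> N h < \<delta> \<Longrightarrow> \<bar>energy (\<lambda>x. \<phi>0 x + h x) - energy \<phi>0 - Q h h / 2\<bar> \<le> C * N h ^ 3"
    by (rule energy_expansion) blast
  obtain CQ where CQ: "CQ > 0" "\<And>u v. u \<in> V \<Longrightarrow> v \<in> V \<Longrightarrow> \<bar>Q u v\<bar> \<le> CQ * (N u * N v)"
    by (rule Q_bounded) blast
  define G where "G = sqrt (inner_per L ?g ?g)"
  have G: "G \<ge> 0" unfolding G_def using inner_per_nonneg by simp
  have gL: "?g \<in> L2_per L" by (intro L2_add L2_const L2_scale phi0(5))
  have m2: "0 \<le> m / 2" using m_pos by simp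
  \<comment> \<open>Collects the cubic errors: \<open>2 * C\<close> from the energy, and
    \<open>K * G * \<bar>b\<bar>\<close> from the product of the linear and the quadratic part of
    the constraint. The radius \<epsilon> lets them use up at most half of \<open>c\<close>.\<close>
  define D where "D = 2 * C + K * G * \<bar>b\<bar>"
  have D: "D \<ge> 0" unfolding D_def using C K G by simp
  define \<epsilon> where "\<epsilon> = min \<delta> (min 1 (c / (2 * (D + 1))))"
  have \<epsilon>: "\<epsilon> > 0" unfolding \<epsilon>_def using \<delta> c D by simp
  have facts: "N h \<ge> 0" "N h \<le> 1" "D * N h \<le> c / 2" "\<bar>inner_per L ?g h\<bar> \<le> G * N h" "0 \<le> inner_per L h h" "inner_per L h h \<le> (N h)\<^sup>2"
    "\<exists>e. \<bar>e\<bar> \<le> C * N h ^ 3 \<and> lyapunov a b K (\<lambda>x. \<phi>0 x + h x) = Q h h + 2 * e + K * (inner_per L ?g h + b / 2 * inner_per L h h)\<^sup>2"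
    if h: "h \<in> V" and n: "N h < \<epsilon>" for h
  proof -
    have hL: "h \<in> L2_per L" using h by (rule sobolev_L2)
    show N0: "N h \<ge> 0" by (rule sobolev_norm_nonneg)
    show "N h \<le> 1" using n unfolding \<epsilon>_def by simp
    have "N h * (2 * (D + 1)) \<le> c" using n D unfolding \<epsilon>_def by (simp add: pos_less_divide_eq)
    then show "D * N h \<le> c / 2" using N0 by (simp add: algebra_simps)
    show "0 \<le> inner_per L h h" by (rule inner_per_nonneg)
    show le: "inner_per L h h \<le> (N h)\<^sup>2" by (rule inner_le_sobolev[OF m2 h])
    have "\<bar>inner_per L ?g h\<bar> \<le> G * sqrt (inner_per L h h)" unfolding G_def
      by (rule sym_form.Cauchy_Schwarz_abs[OF inner_sym_form gL hL inner_per_nonneg])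
    also have "\<dots> \<le> G * N h" using le N0 G by (intro mult_left_mono real_le_lsqrt) auto
    finally show "\<bar>inner_per L ?g h\<bar> \<le> G * N h" .
    show "\<exists>e. \<bar>e\<bar> \<le> C * N h ^ 3 \<and> lyapunov a b K (\<lambda>x. \<phi>0 x + h x) = Q h h + 2 * e + K * (inner_per L ?g h + b / 2 * inner_per L h h)\<^sup>2"
    proof (intro exI conjI)
      show "\<bar>energy (\<lambda>x. \<phi>0 x + h x) - energy \<phi>0 - Q h h / 2\<bar> \<le> C * N h ^ 3"
        by (rule ex[OF h]) (use n in \<open>simp add: \<epsilon>_def\<close>)
      show "lyapunov a b K (\<lambda>x. \<phi>0 x + h x) = Q h h + 2 * (energy (\<lambda>x. \<phi>0 x + h x) - energy \<phi>0 - Q h h / 2)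
        + K * (inner_per L ?g h + b / 2 * inner_per L h h)\<^sup>2"
        unfolding lyapunov_def constraint_expansion[OF hL] by simp
    qed
  qed
  show ?thesis
  proof (rule that[of \<epsilon> "c / 2" "CQ + 2 * C + K * (G + \<bar>b\<bar>)\<^sup>2" K])
    show "\<epsilon> > 0" by (rule \<epsilon>)
    show "c / 2 > 0" using c by simp
    show "CQ + 2 * C + K * (G + \<bar>b\<bar>)\<^sup>2 > 0" using CQ(1) C K by (simp add: add_pos_nonneg)
    fix h assume h: "h \<in> V" and n: "N h < \<epsilon>"
    define d where "d = inner_per L ?g h"
    define i where "i = inner_per L h h"
    note F = facts[OF h n, folded d_def i_def]
    obtain e where e: "\<bar>e\<bar> \<le> C * N h ^ 3" "lyapunov a b K (\<lambda>x. \<phi>0 x + h x) = Q h h + 2 * e + K * (d + b / 2 * i)\<^sup>2"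
      using F(7) by blast
    {
      assume o: "inner_per L h (deriv \<phi>0) = 0"
      have "\<bar>d * (b * i)\<bar> = \<bar>d\<bar> * (\<bar>b\<bar> * i)" using F(5) by (simp add: abs_mult)
      also have "\<dots> \<le> (G * N h) * (\<bar>b\<bar> * (N h)\<^sup>2)"
        using F G by (intro mult_mono mult_left_mono) auto
      also have "\<dots> = G * \<bar>b\<bar> * N h ^ 3" by (simp add: power2_eq_square power3_eq_cube)
      finally have db: "- (G * \<bar>b\<bar> * N h ^ 3) \<le> d * (b * i)" by linarith
      \<comment> \<open>The last square has the right sign and is dropped, so only the mixed term
        has to be absorbed.\<close>
      have "(d + b / 2 * i)\<^sup>2 = d\<^sup>2 + d * (b * i) + (b / 2 * i)\<^sup>2" by (simp add: power2_eq_square algebra_simps)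
      then have "d\<^sup>2 - G * \<bar>b\<bar> * N h ^ 3 \<le> (d + b / 2 * i)\<^sup>2" using db zero_le_power2[of "b / 2 * i"] by linarith
      then have "K * (d\<^sup>2 - G * \<bar>b\<bar> * N h ^ 3) \<le> K * (d + b / 2 * i)\<^sup>2" using K by (intro mult_left_mono) auto
      then have "K * d\<^sup>2 - K * G * \<bar>b\<bar> * N h ^ 3 \<le> K * (d + b / 2 * i)\<^sup>2" by (simp only: right_diff_distrib mult.assoc)
      then have "c * (N h)\<^sup>2 - (2 * (C * N h ^ 3) + K * G * \<bar>b\<bar> * N h ^ 3) \<le> lyapunov a b K (\<lambda>x. \<phi>0 x + h x)"
        unfolding e(2) using co[OF h o] e(1) unfolding d_def by linarith
      moreover have "2 * (C * N h ^ 3) + K * G * \<bar>b\<bar> * N h ^ 3 = (D * N h) * (N h)\<^sup>2"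
        unfolding D_def by (simp add: power2_eq_square power3_eq_cube algebra_simps)
      moreover have "(D * N h) * (N h)\<^sup>2 \<le> (c / 2) * (N h)\<^sup>2" by (intro mult_right_mono F) simp
      moreover have "c * (N h)\<^sup>2 = (c / 2) * (N h)\<^sup>2 + (c / 2) * (N h)\<^sup>2" by simp
      ultimately show "(c / 2) * (N h)\<^sup>2 \<le> lyapunov a b K (\<lambda>x. \<phi>0 x + h x)" by linarith
    }
    have n2: "(N h)\<^sup>2 \<le> N h" using mult_left_mono[OF F(2) F(1)] by (simp add: power2_eq_square)
    have "N h ^ 3 = N h * (N h)\<^sup>2" by (simp add: power2_eq_square power3_eq_cube)
    also have "\<dots> \<le> 1 * (N h)\<^sup>2" by (intro mult_right_mono F) simp
    finally have "C * N h ^ 3 \<le> C * (N h)\<^sup>2" using C by (intro mult_left_mono) auto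
    then have e': "2 * e \<le> 2 * C * (N h)\<^sup>2" using e(1) by simp
    have q: "Q h h \<le> CQ * (N h)\<^sup>2" using CQ(2)[OF h h] by (simp add: power2_eq_square)
    have "\<bar>b / 2 * i\<bar> = \<bar>b\<bar> * (i / 2)" using F(5) by (simp add: abs_mult)
    also have "\<dots> \<le> \<bar>b\<bar> * N h" using F(1,5,6) n2 by (intro mult_left_mono) auto
    finally have "\<bar>d + b / 2 * i\<bar> \<le> (G + \<bar>b\<bar>) * N h" using F(4) by (simp add: distrib_right)
    then have "\<bar>d + b / 2 * i\<bar>\<^sup>2 \<le> ((G + \<bar>b\<bar>) * N h)\<^sup>2" by (rule power_mono) simp
    then have "K * (d + b / 2 * i)\<^sup>2 \<le> K * (G + \<bar>b\<bar>)\<^sup>2 * (N h)\<^sup>2" using K by (simp add: power_mult_distrib mult.assoc)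
    then show "lyapunov a b K (\<lambda>x. \<phi>0 x + h x) \<le> (CQ + 2 * C + K * (G + \<bar>b\<bar>)\<^sup>2) * (N h)\<^sup>2"
      unfolding e(2) using e' q by (simp only: distrib_right)
  qed
qed

text \<open>The local bounds hold at the wave itself, so the lower one is applied to
  \<open>v\<close> translated back by its modulation parameter. Invariance of the functional under
  translations uses integrability of \<open>W\<close> along \<open>v\<close>.\<close>

lemma lyapunov_orbit:
  assumes \<Delta>: "Delta L \<phi> \<omega> A a b > 0"
  obtains \<eta> c C K where "\<eta> > 0" "c > 0" "C > 0"
    "\<And>v. v \<in> V \<Longrightarrow> set_integrable lborel {0..L} (\<lambda>x. W (v x)) \<Longrightarrow> orbit_dist L m \<phi>0 v < \<eta> \<Longrightarrow>
       c * (orbit_dist L m \<phi>0 v)\<^sup>2 \<le> lyapunov a b K v"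
    "\<And>v. v \<in> V \<Longrightarrow> N (\<lambda>x. v x - \<phi>0 x) < \<eta> \<Longrightarrow> lyapunov a b K v \<le> C * (N (\<lambda>x. v x - \<phi>0 x))\<^sup>2"
proof -
  obtain \<epsilon> c C K where \<epsilon>: "\<epsilon> > 0" and c: "c > 0" and C: "C > 0"
    and lower: "\<And>h. h \<in> V \<Longrightarrow> N h < \<epsilon> \<Longrightarrow> inner_per L h (deriv \<phi>0) = 0 \<Longrightarrow> c * (N h)\<^sup>2 \<le> lyapunov a b K (\<lambda>x. \<phi>0 x + h x)"
    and upper: "\<And>h. h \<in> V \<Longrightarrow> N h < \<epsilon> \<Longrightarrow> lyapunov a b K (\<lambda>x. \<phi>0 x + h x) \<le> C * (N h)\<^sup>2"
    by (rule lyapunov_local[OF \<Delta>]) blast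
  obtain \<eta> where \<eta>: "\<eta> > 0" and mo: "\<And>v. v \<in> V \<Longrightarrow> orbit_dist L m \<phi>0 v < \<eta> \<Longrightarrow>
    \<exists>r. N (\<lambda>x. v x - \<phi>0 (x + r)) < \<epsilon> \<and> inner_per L (\<lambda>x. v x - \<phi>0 (x + r)) (\<lambda>x. deriv \<phi>0 (x + r)) = 0"
    by (rule modulation[OF \<epsilon>]) blast
  show ?thesis
  proof (rule that[of "min \<eta> \<epsilon>" c C K])
    show "min \<eta> \<epsilon> > 0" using \<eta> \<epsilon> by simp
    show "c > 0" by (rule c)
    show "C > 0" by (rule C)
    fix v assume v: "v \<in> V"
    show "lyapunov a b K v \<le> C * (N (\<lambda>x. v x - \<phi>0 x))\<^sup>2" if n: "N (\<lambda>x. v x - \<phi>0 x) < min \<eta> \<epsilon>"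
      using upper[OF sobolev_diff[OF v phi_V]] n by simp
    assume W: "set_integrable lborel {0..L} (\<lambda>x. W (v x))" and d: "orbit_dist L m \<phi>0 v < min \<eta> \<epsilon>"
    obtain r where r: "N (\<lambda>x. v x - \<phi>0 (x + r)) < \<epsilon>" "inner_per L (\<lambda>x. v x - \<phi>0 (x + r)) (\<lambda>x. deriv \<phi>0 (x + r)) = 0"
      using mo[OF v] d by auto
    let ?w = "\<lambda>x. v x - \<phi>0 (x + r)" and ?h = "\<lambda>x. v (x + - r) - \<phi>0 x"
    have wV: "?w \<in> V" by (rule sobolev_diff[OF v phi_shift_V])
    have hV: "?h \<in> V" and Nh: "N ?h = N ?w" using sobolev_shift[OF wV, of "- r"] by simp_all
    have dL: "(\<lambda>x. deriv \<phi>0 (x + r)) \<in> L2_per L" by (rule L2_shift[OF sobolev_L2[OF deriv_phi0(1)]])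
    have "inner_per L ?h (deriv \<phi>0) = 0"
      using inner_shift[OF sobolev_L2[OF wV] dL, of "- r"] r(2) by simp
    then have "c * (N ?h)\<^sup>2 \<le> lyapunov a b K (\<lambda>x. \<phi>0 x + ?h x)" using lower[OF hV] r(1) Nh by simp
    also have "\<dots> = lyapunov a b K v" using lyapunov_shift[OF v W, of a b K "- r"] by simp
    finally have 1: "c * (N ?w)\<^sup>2 \<le> lyapunov a b K v" unfolding Nh .
    have "(orbit_dist L m \<phi>0 v)\<^sup>2 \<le> (N ?w)\<^sup>2" by (intro power_mono orbit_dist_le orbit_dist_nonneg)
    then have "c * (orbit_dist L m \<phi>0 v)\<^sup>2 \<le> c * (N ?w)\<^sup>2" using c by (intro mult_left_mono) auto
    then show "c * (orbit_dist L m \<phi>0 v)\<^sup>2 \<le> lyapunov a b K v" using 1 by simp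
  qed
qed

lemma orbit_dist_continuous:
  assumes s: "m / 2 \<le> s" and u: "global_solution L \<theta> f s u0 u"
  shows "continuous_on {0..} (\<lambda>t. orbit_dist L m \<phi>0 (u t))"
  unfolding continuous_on_def
proof
  fix t :: real assume t: "t \<in> {0..}"
  have us: "u \<tau> \<in> sobolev_per L s" if "\<tau> \<ge> 0" for \<tau> using u that unfolding global_solution_def by blast
  have uV: "u \<tau> \<in> V" if "\<tau> \<ge> 0" for \<tau> by (rule sobolev_mono(1)[OF s us[OF that]])
  have lim: "((\<lambda>\<tau>. sobolev_norm L s (\<lambda>x. u \<tau> x - u t x)) \<longlongrightarrow> 0) (at t within {0..})"
    using u t unfolding global_solution_def by simp
  show "((\<lambda>t. orbit_dist L m \<phi>0 (u t)) \<longlongrightarrow> orbit_dist L m \<phi>0 (u t)) (at t within {0..})"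
  proof (rule LIM_zero_cancel, rule Lim_null_comparison[OF _ lim])
    show "\<forall>\<^sub>F \<tau> in at t within {0..}. norm (orbit_dist L m \<phi>0 (u \<tau>) - orbit_dist L m \<phi>0 (u t)) \<le> sobolev_norm L s (\<lambda>x. u \<tau> x - u t x)"
      unfolding eventually_at_filter
    proof (rule always_eventually, intro allI impI)
      fix \<tau> :: real assume "\<tau> \<in> {0..}"
      then have \<tau>: "\<tau> \<ge> 0" and t0: "t \<ge> 0" using t by auto
      have "\<bar>orbit_dist L m \<phi>0 (u \<tau>) - orbit_dist L m \<phi>0 (u t)\<bar> \<le> N (\<lambda>x. u \<tau> x - u t x)"
        using orbit_dist_lipschitz[OF uV[OF \<tau>] uV[OF t0]] orbit_dist_lipschitz[OF uV[OF t0] uV[OF \<tau>]]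
          sobolev_norm_minus_commute[of "m/2" "u \<tau>" "u t"] by linarith
      also have "\<dots> \<le> sobolev_norm L s (\<lambda>x. u \<tau> x - u t x)"
        by (rule sobolev_mono(2)[OF s sobolev_diff[OF us[OF \<tau>] us[OF t0]]])
      finally show "norm (orbit_dist L m \<phi>0 (u \<tau>) - orbit_dist L m \<phi>0 (u t)) \<le> sobolev_norm L s (\<lambda>x. u \<tau> x - u t x)"
        by simp
    qed
  qed
qed

theorem orbital_stability:
  assumes \<Delta>: "Delta L \<phi> \<omega> A a b > 0" and s: "m / 2 \<le> s"
    and fc: "functionals_cond L \<theta> f W m s" and wp: "globally_well_posed L \<theta> f s"
  shows "orbitally_stable L \<theta> f m s \<phi>0"
  unfolding orbitally_stable_def
proof (intro allI impI)
  fix \<epsilon> :: real assume \<epsilon>: "\<epsilon> > 0"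
  let ?d = "orbit_dist L m \<phi>0"
  obtain \<eta> c C K where \<eta>: "\<eta> > 0" and c: "c > 0" and C: "C > 0"
    and lower: "\<And>v. v \<in> V \<Longrightarrow> set_integrable lborel {0..L} (\<lambda>x. W (v x)) \<Longrightarrow> ?d v < \<eta> \<Longrightarrow> c * (?d v)\<^sup>2 \<le> lyapunov a b K v"
    and upper: "\<And>v. v \<in> V \<Longrightarrow> N (\<lambda>x. v x - \<phi>0 x) < \<eta> \<Longrightarrow> lyapunov a b K v \<le> C * (N (\<lambda>x. v x - \<phi>0 x))\<^sup>2"
    by (rule lyapunov_orbit[OF \<Delta>]) blast
  \<comment> \<open>The barrier level: below \<epsilon> for the conclusion, and below \<eta> so that
    the lower bound on the functional holds there.\<close>
  define l where "l = min \<epsilon> \<eta> / 2"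
  have l: "l > 0" "l < \<epsilon>" "l < \<eta>" unfolding l_def using \<epsilon> \<eta> by auto
  \<comment> \<open>Shrinks the initial ball so that
    \<open>C * (l * k)\<^sup>2 < c * l\<^sup>2\<close>: the initial value of the functional is too
    small for the solution to reach the barrier.\<close>
  define k where "k = min 1 (c / (2 * C))"
  have k: "k > 0" "k \<le> 1" "C * k \<le> c / 2" unfolding k_def using c C
    by (auto simp: min_def field_simps)
  have lk: "l * k > 0" "l * k \<le> l" using l k by (auto simp: mult_left_le)
  have small: "C * (l * k)\<^sup>2 < c * l\<^sup>2"
  proof -
    have "k * k \<le> k * 1" using k by (intro mult_left_mono) auto
    then have "C * k\<^sup>2 \<le> C * k" using C by (intro mult_left_mono) (auto simp: power2_eq_square)
    then have "C * k\<^sup>2 < c" using k(3) c by linarith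
    then have "C * k\<^sup>2 * l\<^sup>2 < c * l\<^sup>2" using l by (intro mult_strict_right_mono) auto
    then show ?thesis by (simp add: power_mult_distrib mult_ac)
  qed
  show "\<exists>\<delta>>0. \<forall>u0\<in>sobolev_per L s. N (\<lambda>x. u0 x - \<phi>0 x) < \<delta> \<longrightarrow>
      (\<exists>u. global_solution L \<theta> f s u0 u) \<and>
      (\<forall>u. global_solution L \<theta> f s u0 u \<longrightarrow> (\<forall>t\<ge>0. ?d (u t) < \<epsilon>))"
  proof (intro exI[of _ "l * k"] conjI ballI impI allI)
    show "l * k > 0" by (rule lk)
    fix u0 assume u0: "u0 \<in> sobolev_per L s" and n: "N (\<lambda>x. u0 x - \<phi>0 x) < l * k"
    show "\<exists>u. global_solution L \<theta> f s u0 u" using wp u0 unfolding globally_well_posed_def by blast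
    fix u and t :: real assume u: "global_solution L \<theta> f s u0 u" and t: "0 \<le> t"
    have u0V: "u0 \<in> V" by (rule sobolev_mono(1)[OF s u0])
    have uV: "u \<tau> \<in> V" if "\<tau> \<ge> 0" for \<tau>
      using u that unfolding global_solution_def by (blast intro: sobolev_mono(1)[OF s])
    have WI: "set_integrable lborel {0..L} (\<lambda>x. W (v x))" if "v \<in> V" for v
      using fc that unfolding functionals_cond_def by blast
    have "conserved L \<theta> f s G" if "G \<in> {P_fun L \<theta> W, F_fun L, M_fun L}" for G
      using fc that unfolding functionals_cond_def by blast
    then have eq: "G (u \<tau>) = G u0" if "G \<in> {P_fun L \<theta> W, F_fun L, M_fun L}" "\<tau> \<ge> 0" for G \<tau>
      using that u u0 unfolding conserved_def by blast
    have cons: "lyapunov a b K (u \<tau>) = lyapunov a b K u0" if "\<tau> \<ge> 0" for \<tau>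
      using eq[of "P_fun L \<theta> W" \<tau>] eq[of "F_fun L" \<tau>] eq[of "M_fun L" \<tau>] that
      unfolding lyapunov_def energy_def constraint_def by simp
    \<comment> \<open>A solution takes its initial value almost everywhere only; the norm sees just
      the Fourier coefficients, which agree.\<close>
    have init: "?d (u 0) < l"
    proof -
      have u0AE: "AE x in lborel. u 0 x = u0 x" using u unfolding global_solution_def by blast
      have "u 0 \<in> borel_measurable borel" "u0 \<in> borel_measurable borel" "\<phi>0 \<in> borel_measurable borel"
        using L2_perD(1) sobolev_L2[OF uV[of 0]] sobolev_L2[OF u0V] phi0(5) by auto
      then have m: "(\<lambda>x. u 0 x - \<phi>0 x) \<in> borel_measurable borel" "(\<lambda>x. u0 x - \<phi>0 x) \<in> borel_measurable borel"
        by (intro borel_measurable_diff; simp)+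
      have "fourier_coeff L (\<lambda>x. u 0 x - \<phi>0 x) = fourier_coeff L (\<lambda>x. u0 x - \<phi>0 x)"
        by (rule fourier_coeff_cong_AE[OF _ m]) (use u0AE in eventually_elim, simp)
      then have "N (\<lambda>x. u 0 x - \<phi>0 x) = N (\<lambda>x. u0 x - \<phi>0 x)" unfolding sobolev_norm_def by simp
      then show ?thesis using orbit_dist_le[of "u 0" 0] n lk by simp
    qed
    show "?d (u t) < \<epsilon>"
    \<comment> \<open>A solution that gets as far as \<epsilon> crosses the level \<open>l\<close>
      by the intermediate value theorem, and at that time conservation contradicts the lower
      bound.\<close>
    proof (rule ccontr)
      assume "\<not> ?d (u t) < \<epsilon>"
      then have far: "l \<le> ?d (u t)" using l by simp
      have "continuous_on {0..t} (\<lambda>t. ?d (u t))"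
        by (rule continuous_on_subset[OF orbit_dist_continuous[OF s u]]) auto
      from IVT'[of "\<lambda>t. ?d (u t)", OF less_imp_le[OF init] far t this]
      obtain \<tau> where \<tau>: "0 \<le> \<tau>" "?d (u \<tau>) = l" by blast
      have "c * l\<^sup>2 \<le> lyapunov a b K (u \<tau>)" using lower[OF uV[OF \<tau>(1)] WI[OF uV[OF \<tau>(1)]]] \<tau>(2) l by simp
      also have "\<dots> = lyapunov a b K u0" by (rule cons[OF \<tau>(1)])
      also have "\<dots> \<le> C * (N (\<lambda>x. u0 x - \<phi>0 x))\<^sup>2" using n lk l by (intro upper[OF u0V]) linarith
      also have "\<dots> \<le> C * (l * k)\<^sup>2" using n C sobolev_norm_nonneg by (intro mult_left_mono power_mono) auto
      finally show False using small by simp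
    qed
  qed
qed

end

theorem theorem4p4:
  fixes L m s \<omega> A :: real
    and \<theta> f W :: "real \<Rightarrow> real"
    and \<phi> :: "real \<times> real \<Rightarrow> real \<Rightarrow> real"
    and S :: "(real \<times> real) set"
  defines "\<phi>0 \<equiv> \<phi> (\<omega>, A)"
    and "Lin \<equiv> lin_op L \<theta> f \<omega> (\<phi> (\<omega>, A))"
    and "Linv \<equiv> inv_op L m (lin_op L \<theta> f \<omega> (\<phi> (\<omega>, A))) (\<phi> (\<omega>, A))"
  assumes L_pos: "L > 0"
    and f_smooth: "smooth_on UNIV f"
    and W_prim: "\<And>y. (W has_real_derivative f y) (at y)"
    and symbol: "symbol_cond \<theta> m"
    and s_ge: "s \<ge> m/2"
    and functionals: "functionals_cond L \<theta> f W m s"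
    and well_posed: "globally_well_posed L \<theta> f s"
    and H3_open: "open S"
    and H3_surface: "smooth_surface L S \<phi>"
    and H3_wave: "\<And>w a. (w, a) \<in> S \<Longrightarrow> wave_eq L \<theta> f w a (\<phi> (w, a))"
    and H3_spectral: "\<And>w a. (w, a) \<in> S \<Longrightarrow>
           spectral_cond L m (lin_op L \<theta> f w (\<phi> (w, a))) (\<phi> (w, a))"
    and param: "(\<omega>, A) \<in> S"
    and H1: "\<exists>c1>0. \<exists>c2>0. \<forall>v\<in>smooth_per L.
           inner_per L (Lin v) v \<ge> c1 * (sobolev_norm L (m/2) v)\<^sup>2 - c2 * (sobolev_norm L 0 v)\<^sup>2"
  shows "((\<exists>a b. Delta L \<phi> \<omega> A a b > 0) \<longrightarrow> orbitally_stable L \<theta> f m s \<phi>0)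
    \<and> M_A L \<phi> \<omega> A = - inner_per L (Linv (\<lambda>x. 1)) (\<lambda>x. 1)
    \<and> F_omega L \<phi> \<omega> A = - inner_per L (Linv \<phi>0) \<phi>0
    \<and> (M_omega L \<phi> \<omega> A)\<^sup>2 - F_omega L \<phi> \<omega> A * M_A L \<phi> \<omega> A
        = (inner_per L (Linv \<phi>0) (\<lambda>x. 1))\<^sup>2
          - inner_per L (Linv \<phi>0) \<phi>0 * inner_per L (Linv (\<lambda>x. 1)) (\<lambda>x. 1)
    \<and> (M_A L \<phi> \<omega> A > 0 \<or> F_omega L \<phi> \<omega> A > 0
        \<or> (M_omega L \<phi> \<omega> A)\<^sup>2 - F_omega L \<phi> \<omega> A * M_A L \<phi> \<omega> A > 0
        \<longrightarrow> orbitally_stable L \<theta> f m s \<phi>0)"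
proof -
  \<comment> \<open>The spectral hypothesis is used here at all parameters, to place every wave of
    the surface in the operator domain; this is what makes the wave equation differentiable along
    the surface.\<close>
  have "deriv (\<phi> p) \<in> sobolev_per L m" if "p \<in> S" for p
    using H3_spectral[of "fst p" "snd p"] that
    unfolding spectral_cond_def eigenfunction_def eigenspace_def by auto
  then interpret wave_energy L \<theta> m f S \<phi> \<omega> A W
    using L_pos symbol f_smooth H3_open H3_surface H3_wave param H3_spectral[OF param] W_prim functionals
    by unfold_locales (auto simp: functionals_cond_def)
  have stable: "orbitally_stable L \<theta> f m s \<phi>0" if "\<exists>a b. Delta L \<phi> \<omega> A a b > 0"
    using that orbital_stability[OF _ s_ge functionals well_posed] unfolding \<phi>0_def by blast
  note inv = inverse_formulas[folded \<phi>0_def Linv_def]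
  show ?thesis
  proof (intro conjI impI)
    show "M_A L \<phi> \<omega> A = - inner_per L (Linv (\<lambda>x. 1)) (\<lambda>x. 1)" "F_omega L \<phi> \<omega> A = - inner_per L (Linv \<phi>0) \<phi>0"
      by (rule inv)+
    show "(M_omega L \<phi> \<omega> A)\<^sup>2 - F_omega L \<phi> \<omega> A * M_A L \<phi> \<omega> A
        = (inner_per L (Linv \<phi>0) (\<lambda>x. 1))\<^sup>2
          - inner_per L (Linv \<phi>0) \<phi>0 * inner_per L (Linv (\<lambda>x. 1)) (\<lambda>x. 1)"
      unfolding inv by simp
  qed (use stable exists_positive_Delta in blast)+
qed

end
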